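(* Let $\rho\in(-1,1)$ and let $c_1,c_2$ be two given real constants. i) If $a\in(\rho,1]$, then for any $x\in(0,\infty)$ and $0\le L_2\le L_1\le1$ $$\lim_{u\to\infty}\mathbb{P}\left\{u^2(1-\tau_{L_1}(u))\ge x\,\middle|\,\tau_{L_2}(u)\le1\right\}=\Gamma(L_1,L_2)\,e^{-x\frac{1-2a\rho+a^2}{2-2\rho^2}},\qquad \Gamma(L_1,L_2)=\frac{K_{a,\rho}(L_1)}{K_{a,\rho}(L_2)} .$$ ii) If $a\le\rho$, then for any $x\in(0,\infty)$ and $0\le L_2\le L_1\le1$ $$\lim_{u\to\infty}\mathbb{P}\left\{u^2(1-\tau_{L_1}(u))\ge x\,\middle|\,\tau_{L_2}(u)\le1\right\}=\Gamma(L_1,L_2)\,e^{-\frac{x}{2}},\qquad \Gamma(L_1,L_2)=\frac{K(L_1)}{K(L_2)} .$$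
   Context: Let $B_1,B_2$ be two independent standard Brownian motions and, for $\rho\in(-1,1)$, let $(W_1(t),W_2(t))$, $t\ge0$, be jointly Gaussian with the same law as $(B_1(t),\ \rho B_1(t)+\sqrt{1-\rho^2}\,B_2(t))$, $t\ge 0$. For real $c_1,c_2$, $u>0$ and real $a\le 1$, the risk processes are $R_1(t)=u+c_1t-W_1(t)$ and $R_2(t)=au+c_2t-W_2(t)$, $t\ge0$. $\mathbb{I}(\cdot)$ denotes the indicator function. The cumulative Parisian ruin time (with scaling function $u^2$) is $$\tau_L(u)=\inf\left\{T>0:\ \int_0^T\mathbb{I}(R_1(t)<0,\ R_2(t)<0)\,dt>L/u^2\right\}.$$ With $\lambda_1=\dfrac{1-a\rho}{1-\rho^2}$ and $\lambda_2=\dfrac{a-\rho}{1-\rho^2}$, define $$K_{a,\rho}(L)=\lambda_1\lambda_2\int_{\mathbb{R}^2}\mathbb{P}\left\{\int_0^\infty\mathbb{I}(W_1(t)-t>x,\ W_2(t)-at>y)\,dt>L\right\}e^{\lambda_1x+\lambda_2y}\,dx\,dy,$$ $$K(L)=\int_{\mathbb{R}}e^x\,\mathbb{P}\left\{\int_0^\infty\mathbb{I}(W_1(t)-t>x)\,dt>L\right\}dx .$$ *)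

theory Defs
  imports "HOL-Probability.Probability"
begin

text \<open>A process is indexed by all reals, but only times \<open>t \<ge> 0\<close> are constrained or used.
  Paths are continuous for every sample point (not just almost every one), so that the events
  below are measurable without completing \<open>M\<close>.\<close>

definition continuous_process :: "'a measure \<Rightarrow> (real \<Rightarrow> 'a \<Rightarrow> real) \<Rightarrow> bool" where
  "continuous_process M X \<longleftrightarrow>
     (\<forall>t\<ge>0. X t \<in> borel_measurable M) \<and>
     (\<forall>\<omega>\<in>space M. continuous_on {0..} (\<lambda>t. X t \<omega>))"

text \<open>The second parameter of \<^const>\<open>normal_density\<close> is the standard deviation.\<close>

definition standard_brownian_motion :: "'a measure \<Rightarrow> (real \<Rightarrow> 'a \<Rightarrow> real) \<Rightarrow> bool" where
  "standard_brownian_motion M B \<longleftrightarrow>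
     prob_space M \<and> continuous_process M B \<and>
     (AE \<omega> in M. B 0 \<omega> = 0) \<and>
     (\<forall>s t. 0 \<le> s \<and> s < t \<longrightarrow>
        distributed M lborel (\<lambda>\<omega>. B t \<omega> - B s \<omega>) (normal_density 0 (sqrt (t - s)))) \<and>
     (\<forall>(n::nat) t. 0 \<le> t 0 \<and> (\<forall>i<n. t i < t (Suc i)) \<longrightarrow>
        prob_space.indep_vars M (\<lambda>_. borel) (\<lambda>i \<omega>. B (t (Suc i)) \<omega> - B (t i) \<omega>) {..<n})"

definition path_map :: "(real \<Rightarrow> 'a \<Rightarrow> 'b) \<Rightarrow> 'a \<Rightarrow> real \<Rightarrow> 'b" where
  "path_map X \<omega> = (\<lambda>t\<in>{0..}. X t \<omega>)"

definition process_law ::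
    "'a measure \<Rightarrow> (real \<Rightarrow> 'a \<Rightarrow> 'b::topological_space) \<Rightarrow> (real \<Rightarrow> 'b) measure" where
  "process_law M X = distr M (PiM {0..} (\<lambda>_. borel)) (path_map X)"

definition independent_processes ::
    "'a measure \<Rightarrow> (real \<Rightarrow> 'a \<Rightarrow> real) \<Rightarrow> (real \<Rightarrow> 'a \<Rightarrow> real) \<Rightarrow> bool" where
  "independent_processes M X Y \<longleftrightarrow>
     prob_space.indep_var M (PiM {0..} (\<lambda>_. borel)) (path_map X)
                            (PiM {0..} (\<lambda>_. borel)) (path_map Y)"

definition risk_process :: "real \<Rightarrow> real \<Rightarrow> (real \<Rightarrow> 'a \<Rightarrow> real) \<Rightarrow> real \<Rightarrow> 'a \<Rightarrow> real" where
  "risk_process v c W t \<omega> = v + c * t - W t \<omega>"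

text \<open>The value is \<^term>\<open>\<infinity> :: ereal\<close> if the accumulated time never exceeds \<open>L / u\<^sup>2\<close>.\<close>

definition parisian_ruin_time ::
    "real \<Rightarrow> real \<Rightarrow> real \<Rightarrow> (real \<Rightarrow> 'a \<Rightarrow> real) \<Rightarrow> (real \<Rightarrow> 'a \<Rightarrow> real)
      \<Rightarrow> real \<Rightarrow> real \<Rightarrow> 'a \<Rightarrow> ereal" where
  "parisian_ruin_time a c1 c2 W1 W2 L u \<omega> =
     Inf (ereal ` {T. T > 0 \<and>
       (\<integral>\<^sup>+ t\<in>{0..T}. indicator {s. risk_process u c1 W1 s \<omega> < 0 \<and>
                                  risk_process (a * u) c2 W2 s \<omega> < 0} t \<partial>lborel)
         > ennreal (L / u\<^sup>2)})"

definition lambda1 :: "real \<Rightarrow> real \<Rightarrow> real" where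
  "lambda1 a \<rho> = (1 - a * \<rho>) / (1 - \<rho>\<^sup>2)"

definition lambda2 :: "real \<Rightarrow> real \<Rightarrow> real" where
  "lambda2 a \<rho> = (a - \<rho>) / (1 - \<rho>\<^sup>2)"

text \<open>The pair \<open>W1, W2\<close> on \<open>M\<close> is a parameter of the two constants, which depend only on
  its law.\<close>

definition K_biv ::
    "'a measure \<Rightarrow> (real \<Rightarrow> 'a \<Rightarrow> real) \<Rightarrow> (real \<Rightarrow> 'a \<Rightarrow> real) \<Rightarrow> real \<Rightarrow> real \<Rightarrow> real \<Rightarrow> real" where
  "K_biv M W1 W2 a \<rho> L =
     lambda1 a \<rho> * lambda2 a \<rho> *
     (LINT (x, y)|(lborel :: (real \<times> real) measure).
        \<P>(\<omega> in M. (\<integral>\<^sup>+ t\<in>{0..}. indicator {s. W1 s \<omega> - s > x \<and> W2 s \<omega> - a * s > y} t \<partial>lborel)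
                    > ennreal L)
        * exp (lambda1 a \<rho> * x + lambda2 a \<rho> * y))"

definition K_uni :: "'a measure \<Rightarrow> (real \<Rightarrow> 'a \<Rightarrow> real) \<Rightarrow> real \<Rightarrow> real" where
  "K_uni M W1 L =
     (LINT x|lborel.
        exp x *
        \<P>(\<omega> in M. (\<integral>\<^sup>+ t\<in>{0..}. indicator {s. W1 s \<omega> - s > x} t \<partial>lborel) > ennreal L))"

end

theory Submission
  imports Defs "HOL-Real_Asymp.Real_Asymp"
begin

text \<open>
  Both ruin events are extremely unlikely for large \<open>u\<close>, and the point of the proof is that they have
  the same exponential order, so that the conditional probability converges to the quotient of their
  constants.

  Brownian scaling (\<open>ruin_scaling\<close>) turns the horizon 1 into \<open>u\<^sup>2\<close> and the barriers into levels of
  order \<open>u\<^sup>2\<close>, while occupation times become of order one. Ruin by the time \<open>1 - y / u\<^sup>2\<close> means that the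
  scaled pair spends more than \<open>L\<close> units of time above both barriers before \<open>u\<^sup>2 - y\<close>. The most likely
  way is to arrive at the last moment: by Gaussian density estimates the probability of being above
  both barriers \<open>B\<close> units before \<open>u\<^sup>2\<close> is of order \<open>g u * exp (- q * B / 2)\<close>, where \<open>q\<close> is the squared
  distance of the ruin set from the origin in independent coordinates, and early ruin is excluded by
  an exponential maximal inequality (\<open>maximal_inequality\<close>). Hence only a bounded stretch of scaled
  time before the horizon matters (\<open>ruin_asymptotics\<close>).

  On such a stretch of length \<open>A\<close> the Markov property (\<open>restart\<close>) writes the probability as the
  integral, over the overshoots at the beginning of the stretch, of a Gaussian density times the
  occupation probability of a fresh Brownian pair. Divided by \<open>g u\<close> the density converges to an
  exponential function of the overshoots. The drifts over the stretch are of order \<open>1 / u\<close> and are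
  absorbed by shifting the overshoots in either direction. The resulting integral is brought into the
  form of the Parisian constant with cut-off \<open>A\<close> by time reversal and an exponential change of measure
  (\<open>reversal_tilt\<close>, \<open>tilt_identity\<close>); then \<open>A\<close> tends to infinity by monotone convergence. Ruin by the
  time \<open>1 - y / u\<^sup>2\<close> thus has probability asymptotic to \<open>g u * c * exp (- q * y / 2) * K L\<close>
  (\<open>quadrant_limit\<close>), and the quotient of the cases \<open>(L1, x)\<close> and \<open>(L2, 0)\<close> is the claim
  (\<open>parisian_ratio_limit\<close>).

  For \<open>a \<le> \<rho>\<close> the first barrier alone determines the cost, so \<open>q = 1\<close>. The second constraint then only
  contributes a factor that does not depend on \<open>L\<close> and cancels in the quotient
  (\<open>half_plane_limit\<close>).

  Identities in law for occupation times never need a measure on path space: occupation times of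
  continuous paths are limits of functions of finitely many path values (\<open>occ_prob_limit\<close>), so it
  suffices to compare independent Gaussian increments on grids (\<open>occ_prob_cong\<close>, \<open>grid_law_eq\<close>).
\<close>

section \<open>Occupation times of continuous processes\<close>

definition occ :: "real \<Rightarrow> (real \<Rightarrow> real) \<Rightarrow> ennreal" where
  "occ A z = emeasure lborel {t \<in> {0..A}. 0 < z t}"

text \<open>Only nonnegative times matter in the end; continuity on the whole line makes the class closed under
shifting and reversing time.\<close>

definition cont_proc :: "'a measure \<Rightarrow> (real \<Rightarrow> 'a \<Rightarrow> real) \<Rightarrow> bool" where
  "cont_proc M Z \<longleftrightarrow>
     (\<forall>t. Z t \<in> borel_measurable M) \<and> (\<forall>\<omega>\<in>space M. continuous_on UNIV (\<lambda>t. Z t \<omega>))"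

lemma occ_nn_integral:
  assumes [measurable]: "z \<in> borel_measurable borel"
  shows "occ A z = (\<integral>\<^sup>+ t. indicator {0..A} t * indicator {0<..} (z t) \<partial>lborel)"
proof -
  have "occ A z = (\<integral>\<^sup>+ t. indicator {t \<in> {0..A}. 0 < z t} t \<partial>lborel)"
    unfolding occ_def by (subst nn_integral_indicator) auto
  also have "\<dots> = (\<integral>\<^sup>+ t. indicator {0..A} t * indicator {0<..} (z t) \<partial>lborel)"
    by (intro nn_integral_cong) (auto simp: indicator_def)
  finally show ?thesis .
qed

lemma cont_proc_joint_measurable:
  assumes "cont_proc M Z"
  shows "(\<lambda>p. Z (fst p) (snd p)) \<in> borel_measurable (borel \<Otimes>\<^sub>M M)"
proof (rule borel_measurable_LIMSEQ_real)
  fix p :: "real \<times> 'a" assume "p \<in> space (borel \<Otimes>\<^sub>M M)"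
  then have "snd p \<in> space M" by (auto simp: space_pair_measure)
  with assms have c: "isCont (\<lambda>t. Z t (snd p)) (fst p)"
    by (auto simp: cont_proc_def continuous_on_eq_continuous_at)
  have "(\<lambda>n. of_int \<lfloor>real (Suc n) * fst p\<rfloor> / real (Suc n)) \<longlonglongrightarrow> fst p"
    by real_asymp
  from isCont_tendsto_compose[OF c this]
  show "(\<lambda>n. Z (of_int \<lfloor>real (Suc n) * fst p\<rfloor> / real (Suc n)) (snd p)) \<longlonglongrightarrow> Z (fst p) (snd p)" .
next
  fix n :: nat
  have [measurable]: "Z t \<in> borel_measurable M" for t
    using assms by (auto simp: cont_proc_def)
  show "(\<lambda>p. Z (of_int \<lfloor>real (Suc n) * fst p\<rfloor> / real (Suc n)) (snd p)) \<in> borel_measurable (borel \<Otimes>\<^sub>M M)"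
    by (rule measurable_compose_countable[where f="\<lambda>i p. Z (of_int i / real (Suc n)) (snd p)"])
      measurable
qed

lemma cont_proc_measurable:
  assumes "cont_proc M Z" "f \<in> borel_measurable N" "g \<in> measurable N M"
  shows "(\<lambda>x. Z (f x) (g x)) \<in> borel_measurable N"
  using measurable_compose[OF measurable_Pair[OF assms(2,3)] cont_proc_joint_measurable[OF assms(1)]]
  by simp

lemma cont_proc_path_measurable:
  assumes "cont_proc M Z" "\<omega> \<in> space M"
  shows "(\<lambda>t. Z t \<omega>) \<in> borel_measurable borel"
  using assms by (auto simp: cont_proc_def intro: borel_measurable_continuous_onI)

lemma occ_measurable:
  assumes "cont_proc M Z"
  shows "(\<lambda>\<omega>. occ A (\<lambda>t. Z t \<omega>)) \<in> borel_measurable M"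
proof -
  note [measurable] = cont_proc_measurable[OF assms]
  have "(\<lambda>\<omega>. \<integral>\<^sup>+ t. indicator {0..A} t * indicator {0<..} (Z t \<omega>) \<partial>lborel) \<in> borel_measurable M"
    by measurable
  then show ?thesis
    by (rule measurable_cong[THEN iffD2, rotated])
      (rule occ_nn_integral[OF cont_proc_path_measurable[OF assms]])
qed

text \<open>Sampling the integrand at the last grid point before \<open>t\<close> makes the integral a function of finitely
many values of the path; this is how laws on grids reach occupation times.\<close>

lemma integral_grid_sum:
  fixes h :: "real \<Rightarrow> real"
  assumes A: "0 < A" and n: "0 < n"
  shows "(LINT t|lborel. indicator {0..A} t * h (A * of_int \<lfloor>real n * t / A\<rfloor> / real n)) =
    (\<Sum>i\<le>n. measure lborel {t \<in> {0..A}. \<lfloor>real n * t / A\<rfloor> = int i} * h (A * real i / real n))"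
proof -
  let ?E = "\<lambda>i. {t \<in> {0..A}. \<lfloor>real n * t / A\<rfloor> = int i}"
  have E[measurable]: "?E i \<in> sets lborel" for i by measurable
  have fin: "emeasure lborel (?E i) < \<infinity>" for i
    by (rule le_less_trans[OF emeasure_mono[of _ "{0..A}"]]) (use A in auto)
  have "indicator {0..A} t * h (A * of_int \<lfloor>real n * t / A\<rfloor> / real n) =
      (\<Sum>i\<le>n. indicator (?E i) t * h (A * real i / real n))" for t
  proof (cases "t \<in> {0..A}")
    case True
    define k where "k = nat \<lfloor>real n * t / A\<rfloor>"
    have "0 \<le> real n * t / A" "real n * t / A \<le> real n"
      using True A n by (auto simp: field_simps)
    then have k: "int k = \<lfloor>real n * t / A\<rfloor>" "k \<le> n"
      unfolding k_def by (auto simp: le_nat_iff nat_le_iff floor_le_iff)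
    have "(\<Sum>i\<le>n. indicator (?E i) t * h (A * real i / real n)) =
       (\<Sum>i\<le>n. if i = k then h (A * real i / real n) else 0)"
      using True k by (intro sum.cong) (auto simp: indicator_def)
    also have "\<dots> = h (A * real k / real n)" using k by simp
    finally show ?thesis using True by (simp flip: k(1))
  qed (auto simp: indicator_def)
  then have "(LINT t|lborel. indicator {0..A} t * h (A * of_int \<lfloor>real n * t / A\<rfloor> / real n)) =
     (LINT t|lborel. (\<Sum>i\<le>n. indicator (?E i) t * h (A * real i / real n)))" by simp
  also have "\<dots> = (\<Sum>i\<le>n. (LINT t|lborel. indicator (?E i) t * h (A * real i / real n)))"
    using fin by (intro Bochner_Integration.integral_sum integrable_mult_left integrable_real_indicator) auto
  also have "\<dots> = (\<Sum>i\<le>n. measure lborel (?E i) * h (A * real i / real n))"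
    by (intro sum.cong) simp_all
  finally show ?thesis .
qed

text \<open>A continuous approximation from below of the indicator of the positive half line.\<close>

definition ramp :: "nat \<Rightarrow> real \<Rightarrow> real" where
  "ramp m z = min 1 (max 0 (real m * z))"

lemma ramp_nonpos: "z \<le> 0 \<Longrightarrow> ramp m z = 0"
  unfolding ramp_def using mult_nonneg_nonpos[of "real m" z] by linarith

text \<open>The event that the occupation time exceeds \<open>L\<close> involves two discontinuous steps, the indicator of
positive values and the comparison with \<open>L\<close>. Both are replaced by the ramp. For a fixed ramp the
Riemann sums converge along every continuous path, and as the ramp steepens the truncated times
increase to the occupation time from below, which is what the strict inequality needs. Bounded
convergence carries both limits under the expectation.\<close>

lemma occ_prob_limit:
  fixes P :: "'a measure" and Z :: "real \<Rightarrow> 'a \<Rightarrow> real"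
  assumes P: "prob_space P" and Z: "cont_proc P Z" and A: "0 < A" and L: "0 \<le> L"
  defines "J \<equiv> \<lambda>m \<omega>. LINT t|lborel. indicator {0..A} t * ramp m (Z t \<omega>)"
  defines "R \<equiv> \<lambda>m n \<omega>. \<Sum>i\<le>Suc n. measure lborel {t \<in> {0..A}. \<lfloor>real (Suc n) * t / A\<rfloor> = int i} *
                 ramp m (Z (A * real i / real (Suc n)) \<omega>)"
  shows "(\<lambda>n. LINT \<omega>|P. ramp m (R m n \<omega> - L)) \<longlonglongrightarrow> (LINT \<omega>|P. ramp m (J m \<omega> - L))" (is ?A)
    and "(\<lambda>m. LINT \<omega>|P. ramp m (J m \<omega> - L)) \<longlonglongrightarrow>
           measure P {\<omega> \<in> space P. occ A (\<lambda>t. Z t \<omega>) > ennreal L}" (is ?B)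
proof -
  interpret P: prob_space P by fact
  have ramp01: "0 \<le> ramp m z" "ramp m z \<le> 1" for m z unfolding ramp_def by auto
  have rampcont: "isCont (ramp m) z" for m z
    unfolding ramp_def by (intro continuous_intros)
  have [measurable]: "ramp m \<in> borel_measurable borel" for m
    by (intro borel_measurable_continuous_onI) (auto simp: continuous_on_eq_continuous_at rampcont)
  note [measurable] = cont_proc_measurable[OF Z]
  have Zt[measurable]: "Z t \<in> borel_measurable P" for t using Z by (auto simp: cont_proc_def)
  have path[measurable]: "(\<lambda>t. Z t \<omega>) \<in> borel_measurable borel" if "\<omega> \<in> space P" for \<omega>
    by (rule cont_proc_path_measurable[OF Z that])
  have cont: "isCont (\<lambda>t. Z t \<omega>) t" if "\<omega> \<in> space P" for \<omega> t
    using Z that by (auto simp: cont_proc_def continuous_on_eq_continuous_at)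
  have [measurable]: "J m \<in> borel_measurable P" for m unfolding J_def by measurable
  have [measurable]: "R m n \<in> borel_measurable P" for m n unfolding R_def by measurable
  have dom: "integrable lborel (indicator {0..A} :: real \<Rightarrow> real)"
    by (rule integrable_real_indicator) (use A in auto)
  have RJ: "(\<lambda>n. R m n \<omega>) \<longlonglongrightarrow> J m \<omega>" if w: "\<omega> \<in> space P" for m \<omega>
  proof -
    have eq: "R m n \<omega> = (LINT t|lborel. indicator {0..A} t *
        ramp m (Z (A * of_int \<lfloor>real (Suc n) * t / A\<rfloor> / real (Suc n)) \<omega>))" for n
      unfolding R_def by (subst integral_grid_sum[OF A]) simp_all
    note [measurable] = path[OF w]
    show ?thesis unfolding eq J_def
    proof (rule integral_dominated_convergence[OF _ _ dom])
      show "AE t in lborel. (\<lambda>n. indicator {0..A} t *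
         ramp m (Z (A * of_int \<lfloor>real (Suc n) * t / A\<rfloor> / real (Suc n)) \<omega>)) \<longlonglongrightarrow> indicator {0..A} t * ramp m (Z t \<omega>)"
      proof (intro AE_I2 tendsto_intros isCont_tendsto_compose[OF rampcont] isCont_tendsto_compose[OF cont[OF w]])
        fix t
        show "(\<lambda>n. A * of_int \<lfloor>real (Suc n) * t / A\<rfloor> / real (Suc n)) \<longlonglongrightarrow> t"
          using A by real_asymp
      qed
      show "AE t in lborel. norm (indicator {0..A} t *
         ramp m (Z (A * of_int \<lfloor>real (Suc n) * t / A\<rfloor> / real (Suc n)) \<omega>)) \<le> indicator {0..A} t" for n
        using ramp01 by (intro AE_I2) (auto simp: indicator_def)
    qed measurable
  qed
  show ?A
  proof (rule integral_dominated_convergence[where w="\<lambda>_. 1"])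
    show "AE \<omega> in P. (\<lambda>n. ramp m (R m n \<omega> - L)) \<longlonglongrightarrow> ramp m (J m \<omega> - L)"
      by (intro AE_I2 isCont_tendsto_compose[OF rampcont] tendsto_intros RJ)
    show "AE \<omega> in P. norm (ramp m (R m n \<omega> - L)) \<le> 1" for n
      using ramp01 by (intro AE_I2) auto
  qed auto
  let ?S = "{\<omega> \<in> space P. occ A (\<lambda>t. Z t \<omega>) > ennreal L}"
  note occ_measurable[OF Z, measurable]
  have S[measurable]: "?S \<in> sets P" by measurable
  have lim: "(\<lambda>m. ramp m (J m \<omega> - L)) \<longlonglongrightarrow> indicator ?S \<omega>" if w: "\<omega> \<in> space P" for \<omega>
  proof -
    let ?E = "{t \<in> {0..A}. 0 < Z t \<omega>}"
    define l where "l = measure lborel ?E"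
    note [measurable] = path[OF w]
    have fin: "emeasure lborel ?E < \<infinity>"
      by (rule le_less_trans[OF emeasure_mono[of _ "{0..A}"]]) (use A in auto)
    have occl: "occ A (\<lambda>t. Z t \<omega>) = ennreal l"
      unfolding occ_def l_def by (rule emeasure_eq_ennreal_measure) (use fin in auto)
    have "integrable lborel (indicator ?E :: real \<Rightarrow> real)"
      using fin by (intro integrable_real_indicator) auto
    have li: "l = (LINT t|lborel. indicator ?E t)" unfolding l_def by simp
    have Jl: "(\<lambda>m. J m \<omega>) \<longlonglongrightarrow> l" unfolding li J_def
    proof (rule integral_dominated_convergence[OF _ _ dom])
      show "AE t in lborel. (\<lambda>m. indicator {0..A} t * ramp m (Z t \<omega>)) \<longlonglongrightarrow> indicator ?E t"
      proof (intro AE_I2)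
        fix t
        have "(\<lambda>m. ramp m (Z t \<omega>)) \<longlonglongrightarrow> (if 0 < Z t \<omega> then 1 else 0)"
        proof (cases "0 < Z t \<omega>")
          case True
          have "\<forall>\<^sub>F m in sequentially. real m * Z t \<omega> \<ge> 1" using True by real_asymp
          then have "\<forall>\<^sub>F m in sequentially. ramp m (Z t \<omega>) = 1"
            by eventually_elim (auto simp: ramp_def)
          then show ?thesis using True by (simp add: tendsto_eventually)
        next
          case False
          then have "ramp m (Z t \<omega>) = 0" for m by (simp add: ramp_nonpos)
          then show ?thesis using False by simp
        qed
        then have "(\<lambda>m. indicator {0..A} t * ramp m (Z t \<omega>)) \<longlonglongrightarrow> indicator {0..A} t * (if 0 < Z t \<omega> then 1 else 0)"
          by (rule tendsto_mult_left)
        also have "indicator {0..A} t * (if 0 < Z t \<omega> then 1 else 0 :: real) = indicator ?E t"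
          by (auto simp: indicator_def)
        finally show "(\<lambda>m. indicator {0..A} t * ramp m (Z t \<omega>)) \<longlonglongrightarrow> indicator ?E t" .
      qed
      show "AE t in lborel. norm (indicator {0..A} t * ramp m (Z t \<omega>)) \<le> indicator {0..A} t" for m
        using ramp01 by (intro AE_I2) (auto simp: indicator_def)
    qed measurable
    show ?thesis
    proof (cases "l > L")
      case True
      have "eventually (\<lambda>m. J m \<omega> - L > (l - L) / 2) sequentially"
        using order_tendstoD(1)[OF tendsto_diff[OF Jl tendsto_const[of L]], of "(l-L)/2"] True by auto
      moreover have "eventually (\<lambda>m. real m * ((l - L) / 2) \<ge> 1) sequentially"
        using True by real_asymp
      ultimately have "eventually (\<lambda>m. ramp m (J m \<omega> - L) = 1) sequentially"
      proof eventually_elim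
        case (elim m)
        have "real m * ((l - L) / 2) \<le> real m * (J m \<omega> - L)" using elim(1) by (intro mult_left_mono) auto
        then show ?case using elim by (auto simp: ramp_def)
      qed
      moreover have "\<omega> \<in> ?S" using True occl w L by (auto simp: ennreal_less_iff)
      ultimately show ?thesis by (simp add: tendsto_eventually)
    next
      case False
      have Jle: "J m \<omega> \<le> l" for m unfolding li J_def
      proof (rule integral_mono)
        show "integrable lborel (\<lambda>t. indicator {0..A} t * ramp m (Z t \<omega>))"
          by (rule Bochner_Integration.integrable_bound[OF dom]) (use ramp01 in \<open>auto simp: indicator_def\<close>)
        show "integrable lborel (indicator ?E :: real \<Rightarrow> real)" by fact
        show "indicator {0..A} t * ramp m (Z t \<omega>) \<le> indicator ?E t" for t
          using ramp01[of m "Z t \<omega>"] by (auto simp: indicator_def ramp_nonpos)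
      qed
      have "ramp m (J m \<omega> - L) = 0" for m
        by (rule ramp_nonpos) (use Jle[of m] False in linarith)
      moreover have "\<omega> \<notin> ?S" using False occl L by (auto simp: not_less intro: ennreal_leI)
      ultimately show ?thesis by simp
    qed
  qed
  have "(\<lambda>m. LINT \<omega>|P. ramp m (J m \<omega> - L)) \<longlonglongrightarrow> (LINT \<omega>|P. indicator ?S \<omega>)"
  proof (rule integral_dominated_convergence[where w="\<lambda>_. 1"])
    show "AE \<omega> in P. (\<lambda>m. ramp m (J m \<omega> - L)) \<longlonglongrightarrow> indicator ?S \<omega>"
      by (intro AE_I2 lim)
    show "AE \<omega> in P. norm (ramp m (J m \<omega> - L)) \<le> 1" for m
      using ramp01 by (intro AE_I2) auto
  qed auto
  then show ?B by simp
qed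

text \<open>Uniqueness of the two limits in \<open>occ_prob_limit\<close>: only the laws of the process on equidistant
grids enter the approximating expectations.\<close>

lemma occ_prob_cong:
  fixes P :: "'a measure" and Q :: "'b measure"
  assumes P: "prob_space P" and Q: "prob_space Q" and Z: "cont_proc P Z" and Z': "cont_proc Q Z'"
    and A: "0 < A" and L: "0 \<le> L"
    and grid: "\<And>n::nat. 0 < n \<Longrightarrow>
      distr P (PiM {..n} (\<lambda>_. borel)) (\<lambda>\<omega>. \<lambda>i\<in>{..n}. Z (A * real i / real n) \<omega>) =
      distr Q (PiM {..n} (\<lambda>_. borel)) (\<lambda>\<omega>. \<lambda>i\<in>{..n}. Z' (A * real i / real n) \<omega>)"
  shows "emeasure P {\<omega> \<in> space P. occ A (\<lambda>t. Z t \<omega>) > ennreal L} =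
         emeasure Q {\<omega> \<in> space Q. occ A (\<lambda>t. Z' t \<omega>) > ennreal L}"
proof -
  interpret P: prob_space P by fact
  interpret Q: prob_space Q by fact
  define \<Phi> where "\<Phi> \<equiv> \<lambda>m n (v::nat \<Rightarrow> real). ramp m ((\<Sum>i\<le>Suc n. measure lborel {t \<in> {0..A}. \<lfloor>real (Suc n) * t / A\<rfloor> = int i} *
                 ramp m (v i)) - L)"
  have Zt[measurable]: "Z t \<in> borel_measurable P" "Z' t \<in> borel_measurable Q" for t
    using Z Z' by (auto simp: cont_proc_def)
  have [measurable]: "ramp m \<in> borel_measurable borel" for m unfolding ramp_def by measurable
  have meas: "\<Phi> m n \<in> borel_measurable (PiM {..Suc n} (\<lambda>_. borel))" for m n
    unfolding \<Phi>_def by measurable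
  have eq: "(LINT \<omega>|P. \<Phi> m n (\<lambda>i. Z (A * real i / real (Suc n)) \<omega>)) =
            (LINT \<omega>|Q. \<Phi> m n (\<lambda>i. Z' (A * real i / real (Suc n)) \<omega>))" for m n
  proof -
    have "(LINT \<omega>|P. \<Phi> m n (\<lambda>i. Z (A * real i / real (Suc n)) \<omega>)) =
       (LINT \<omega>|P. \<Phi> m n (\<lambda>i\<in>{..Suc n}. Z (A * real i / real (Suc n)) \<omega>))"
      unfolding \<Phi>_def by simp
    also have "\<dots> = (LINT v|distr P (PiM {..Suc n} (\<lambda>_. borel)) (\<lambda>\<omega>. \<lambda>i\<in>{..Suc n}. Z (A * real i / real (Suc n)) \<omega>). \<Phi> m n v)"
      by (rule integral_distr[symmetric, OF _ meas]) measurable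
    also have "\<dots> = (LINT v|distr Q (PiM {..Suc n} (\<lambda>_. borel)) (\<lambda>\<omega>. \<lambda>i\<in>{..Suc n}. Z' (A * real i / real (Suc n)) \<omega>). \<Phi> m n v)"
      by (subst grid) simp_all
    also have "\<dots> = (LINT \<omega>|Q. \<Phi> m n (\<lambda>i\<in>{..Suc n}. Z' (A * real i / real (Suc n)) \<omega>))"
      by (rule integral_distr[OF _ meas]) measurable
    also have "\<dots> = (LINT \<omega>|Q. \<Phi> m n (\<lambda>i. Z' (A * real i / real (Suc n)) \<omega>))"
      unfolding \<Phi>_def by simp
    finally show ?thesis .
  qed
  note lP = occ_prob_limit[OF P Z A L]
  note lQ = occ_prob_limit[OF Q Z' A L]
  define EP where "EP m = (LINT \<omega>|P. ramp m ((LINT t|lborel. indicator {0..A} t * ramp m (Z t \<omega>)) - L))" for m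
  define EQ where "EQ m = (LINT \<omega>|Q. ramp m ((LINT t|lborel. indicator {0..A} t * ramp m (Z' t \<omega>)) - L))" for m
  have "EP m = EQ m" for m
  proof (rule LIMSEQ_unique)
    show "(\<lambda>n. LINT \<omega>|P. \<Phi> m n (\<lambda>i. Z (A * real i / real (Suc n)) \<omega>)) \<longlonglongrightarrow> EP m"
      unfolding \<Phi>_def EP_def by (rule lP(1))
    show "(\<lambda>n. LINT \<omega>|P. \<Phi> m n (\<lambda>i. Z (A * real i / real (Suc n)) \<omega>)) \<longlonglongrightarrow> EQ m"
      unfolding eq unfolding \<Phi>_def EQ_def by (rule lQ(1))
  qed
  then have "EP = EQ" by (rule ext)
  with lP(2) lQ(2) have "measure P {\<omega> \<in> space P. occ A (\<lambda>t. Z t \<omega>) > ennreal L} =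
      measure Q {\<omega> \<in> space Q. occ A (\<lambda>t. Z' t \<omega>) > ennreal L}"
    unfolding EP_def[symmetric] EQ_def[symmetric] by (metis LIMSEQ_unique)
  then show ?thesis by (simp add: P.emeasure_eq_measure Q.emeasure_eq_measure)
qed

section \<open>Gaussian measures\<close>

definition gauss :: "real \<Rightarrow> real measure" where
  "gauss v = density lborel (\<lambda>x. ennreal (normal_density 0 (sqrt v) x))"

definition gauss2 :: "real \<Rightarrow> (real \<times> real) measure" where
  "gauss2 v = gauss v \<Otimes>\<^sub>M gauss v"

lemma sets_gauss[measurable_cong, simp]: "sets (gauss v) = sets borel"
  by (simp add: gauss_def)

lemma space_gauss[simp]: "space (gauss v) = UNIV"
  by (simp add: gauss_def)

lemma sets_gauss2[measurable_cong]: "sets (gauss2 v) = sets (borel \<Otimes>\<^sub>M borel)"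
  by (auto simp: gauss2_def intro: sets_pair_measure_cong)

lemma space_gauss2[simp]: "space (gauss2 v) = UNIV"
  by (simp add: gauss2_def space_pair_measure)

lemma prob_space_gauss: "0 < v \<Longrightarrow> prob_space (gauss v)"
  unfolding gauss_def by (rule prob_space_normal_density) simp

lemma prob_space_gauss2: "0 < v \<Longrightarrow> prob_space (gauss2 v)"
  unfolding gauss2_def by (intro prob_space_pair prob_space_gauss)

lemma nn_integral_gauss:
  assumes [measurable]: "g \<in> borel_measurable borel"
  shows "(\<integral>\<^sup>+ x. g x \<partial>gauss v) = (\<integral>\<^sup>+ x. ennreal (normal_density 0 (sqrt v) x) * g x \<partial>lborel)"
  unfolding gauss_def by (rule nn_integral_density) auto

lemma nn_integral_gauss2:
  assumes v: "0 < v" and g[measurable]: "g \<in> borel_measurable (borel \<Otimes>\<^sub>M borel)"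
  shows "(\<integral>\<^sup>+ p. g p \<partial>gauss2 v) =
    (\<integral>\<^sup>+ x. \<integral>\<^sup>+ y. ennreal (normal_density 0 (sqrt v) x * normal_density 0 (sqrt v) y) * g (x, y) \<partial>lborel \<partial>lborel)"
proof -
  interpret prob_space "gauss v" by (rule prob_space_gauss[OF v])
  have [measurable]: "g \<in> borel_measurable (gauss v \<Otimes>\<^sub>M gauss v)"
    using g by (simp cong: measurable_cong_sets add: sets_pair_measure_cong[of "gauss v" borel "gauss v" borel])
  have "(\<integral>\<^sup>+ p. g p \<partial>gauss2 v) = (\<integral>\<^sup>+ x. \<integral>\<^sup>+ y. g (x, y) \<partial>gauss v \<partial>gauss v)"
    unfolding gauss2_def by (rule nn_integral_fst[symmetric]) measurable
  also have "\<dots> = (\<integral>\<^sup>+ x. ennreal (normal_density 0 (sqrt v) x) *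
      (\<integral>\<^sup>+ y. ennreal (normal_density 0 (sqrt v) y) * g (x, y) \<partial>lborel) \<partial>lborel)"
    by (simp add: nn_integral_gauss)
  also have "\<dots> = (\<integral>\<^sup>+ x. \<integral>\<^sup>+ y. ennreal (normal_density 0 (sqrt v) x * normal_density 0 (sqrt v) y) * g (x, y) \<partial>lborel \<partial>lborel)"
    by (intro nn_integral_cong, subst nn_integral_cmult[symmetric]) (auto simp: ennreal_mult mult.assoc)
  finally show ?thesis .
qed

lemma distr_gauss_scale:
  assumes v: "0 < v" and c: "0 < c"
  shows "distr (gauss v) borel (\<lambda>x. c * x) = gauss (c\<^sup>2 * v)"
proof -
  interpret prob_space "gauss v" by (rule prob_space_gauss[OF v])
  have "distributed (gauss v) lborel (\<lambda>x. x) (\<lambda>x. ennreal (normal_density 0 (sqrt v) x))"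
    unfolding distributed_def by (auto simp: gauss_def distr_id2)
  from normal_density_affine[OF this, of c 0] v c
  have "distributed (gauss v) lborel (\<lambda>x. c * x) (\<lambda>x. ennreal (normal_density 0 (c * sqrt v) x))"
    by simp
  then have "distr (gauss v) lborel (\<lambda>x. c * x) = gauss (c\<^sup>2 * v)"
    using c by (simp add: distributed_def gauss_def real_sqrt_mult)
  then show ?thesis by (metis distr_cong sets_lborel)
qed

lemma distr_gauss2_scale:
  assumes v: "0 < v" and c: "0 < c"
  shows "distr (gauss2 v) (borel \<Otimes>\<^sub>M borel) (\<lambda>p. (c * fst p, c * snd p)) = gauss2 (c\<^sup>2 * v)"
proof -
  interpret p: prob_space "gauss (c\<^sup>2 * v)" using v c by (intro prob_space_gauss) auto
  have "gauss2 (c\<^sup>2 * v) = distr (gauss v) borel (\<lambda>x. c * x) \<Otimes>\<^sub>M distr (gauss v) borel (\<lambda>x. c * x)"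
    by (simp add: gauss2_def distr_gauss_scale[OF assms])
  also have "\<dots> = distr (gauss v \<Otimes>\<^sub>M gauss v) (borel \<Otimes>\<^sub>M borel) (\<lambda>(x, y). (c * x, c * y))"
    by (rule pair_measure_distr) (auto simp: distr_gauss_scale[OF assms] p.sigma_finite_measure_axioms)
  finally show ?thesis by (simp add: gauss2_def case_prod_beta')
qed

text \<open>Girsanov for a single step. Exponential tilting with slope \<open>m\<close> moves the mean of the normal law to
\<open>m * v\<close>, and that law is symmetric about its mean; so a tilted step \<open>x\<close> is distributed like
\<open>m * v - x\<close>. The reflected form is the one that fits time reversal.\<close>

lemma gauss_tilt_reflect:
  assumes v: "0 < v" and [measurable]: "g \<in> borel_measurable borel"
  shows "(\<integral>\<^sup>+ x. ennreal (normal_density 0 (sqrt v) x * exp (m * x - m\<^sup>2 * v / 2)) * g x \<partial>lborel) =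
    (\<integral>\<^sup>+ x. ennreal (normal_density 0 (sqrt v) x) * g (m * v - x) \<partial>lborel)"
proof -
  have *: "normal_density 0 (sqrt v) (m * v - x) * exp (m * (m * v - x) - m\<^sup>2 * v / 2) =
        normal_density 0 (sqrt v) x" for x
    using v by (simp add: normal_density_def mult_exp_exp field_simps power2_eq_square)
  show ?thesis
    by (subst nn_integral_real_affine[where c="-1" and t="m * v"]) (simp_all add: *)
qed

lemma gauss2_tilt_reflect:
  assumes v: "0 < v" and g[measurable]: "g \<in> borel_measurable (borel \<Otimes>\<^sub>M borel)"
  shows "(\<integral>\<^sup>+ p. ennreal (exp (m1 * fst p + m2 * snd p - (m1\<^sup>2 + m2\<^sup>2) * v / 2)) * g p \<partial>gauss2 v) =
    (\<integral>\<^sup>+ p. g (m1 * v - fst p, m2 * v - snd p) \<partial>gauss2 v)"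
proof -
  let ?\<phi> = "normal_density 0 (sqrt v)"
  have "(\<integral>\<^sup>+ p. ennreal (exp (m1 * fst p + m2 * snd p - (m1\<^sup>2 + m2\<^sup>2) * v / 2)) * g p \<partial>gauss2 v) =
     (\<integral>\<^sup>+ x. \<integral>\<^sup>+ y. ennreal (?\<phi> x * ?\<phi> y) * (ennreal (exp (m1 * x + m2 * y - (m1\<^sup>2 + m2\<^sup>2) * v / 2)) * g (x, y)) \<partial>lborel \<partial>lborel)"
    by (subst nn_integral_gauss2[OF v]) simp_all
  also have "\<dots> = (\<integral>\<^sup>+ x. ennreal (?\<phi> x * exp (m1 * x - m1\<^sup>2 * v / 2)) *
     (\<integral>\<^sup>+ y. ennreal (?\<phi> y * exp (m2 * y - m2\<^sup>2 * v / 2)) * g (x, y) \<partial>lborel) \<partial>lborel)"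
  proof (intro nn_integral_cong, subst nn_integral_cmult[symmetric], simp, intro nn_integral_cong)
    fix x y
    have *: "(?\<phi> x * ?\<phi> y) * exp (m1 * x + m2 * y - (m1\<^sup>2 + m2\<^sup>2) * v / 2) =
      (?\<phi> x * exp (m1 * x - m1\<^sup>2 * v / 2)) * (?\<phi> y * exp (m2 * y - m2\<^sup>2 * v / 2))"
      by (simp add: mult_exp_exp algebra_simps add_divide_distrib)
    have assoc: "ennreal a * (ennreal b * c) = ennreal (a * b) * c" if "0 \<le> a" "0 \<le> b" for a b c
      using that by (simp add: ennreal_mult mult.assoc)
    show "ennreal (?\<phi> x * ?\<phi> y) * (ennreal (exp (m1 * x + m2 * y - (m1\<^sup>2 + m2\<^sup>2) * v / 2)) * g (x, y)) =
      ennreal (?\<phi> x * exp (m1 * x - m1\<^sup>2 * v / 2)) * (ennreal (?\<phi> y * exp (m2 * y - m2\<^sup>2 * v / 2)) * g (x, y))"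
      by (simp only: assoc normal_density_nonneg exp_ge_zero mult_nonneg_nonneg *)
  qed
  also have "\<dots> = (\<integral>\<^sup>+ x. ennreal (?\<phi> x) * (\<integral>\<^sup>+ y. ennreal (?\<phi> y) * g (m1 * v - x, m2 * v - y) \<partial>lborel) \<partial>lborel)"
    by (simp add: gauss_tilt_reflect[OF v])
  also have "\<dots> = (\<integral>\<^sup>+ x. \<integral>\<^sup>+ y. ennreal (?\<phi> x * ?\<phi> y) * g (m1 * v - x, m2 * v - y) \<partial>lborel \<partial>lborel)"
    by (intro nn_integral_cong, subst nn_integral_cmult[symmetric]) (auto simp: ennreal_mult mult.assoc)
  also have "\<dots> = (\<integral>\<^sup>+ p. g (m1 * v - fst p, m2 * v - snd p) \<partial>gauss2 v)"
    by (subst nn_integral_gauss2[OF v]) simp_all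
  finally show ?thesis .
qed

lemma nn_integral_gauss_exp:
  assumes v: "0 < v"
  shows "(\<integral>\<^sup>+ p. ennreal (exp (m1 * fst p + m2 * snd p - (m1\<^sup>2 + m2\<^sup>2) * v / 2)) \<partial>gauss2 v) = 1"
proof -
  interpret prob_space "gauss2 v" by (rule prob_space_gauss2[OF v])
  show ?thesis using gauss2_tilt_reflect[OF v, of "\<lambda>_. 1" m1 m2] by (simp add: emeasure_space_1[simplified])
qed

lemma box_vimage: "(\<lambda>\<omega>. \<lambda>j\<in>{..<k::nat}. D j \<omega>) -` Pi\<^sub>E {..<k} B \<inter> S = {\<omega> \<in> S. \<forall>j<k. D j \<omega> \<in> B j}"
  by (auto simp: PiE_def Pi_def)

text \<open>Equality on boxes determines the joint law of finitely many increments, and grid values are a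
measurable function \<open>h\<close> of the increments. Every identity in law for paths used below is reduced in
this way to a product formula for independent increments.\<close>

lemma grid_law_eq:
  fixes P :: "'a measure" and Q :: "'b measure" and D :: "nat \<Rightarrow> 'a \<Rightarrow> 'c"
  assumes P: "prob_space P" and Q: "prob_space Q"
    and D[measurable]: "\<And>j. j < k \<Longrightarrow> D j \<in> measurable P S" and D'[measurable]: "\<And>j. j < k \<Longrightarrow> D' j \<in> measurable Q S"
    and box: "\<And>B. (\<And>j. j < k \<Longrightarrow> B j \<in> sets S) \<Longrightarrow>
       emeasure P {\<omega> \<in> space P. \<forall>j<k. D j \<omega> \<in> B j} = emeasure Q {\<omega> \<in> space Q. \<forall>j<k. D' j \<omega> \<in> B j}"
    and h: "\<And>i. i \<in> I \<Longrightarrow> h i \<in> borel_measurable (PiM {..<k} (\<lambda>_. S))"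
    and Z: "\<And>i \<omega>. i \<in> I \<Longrightarrow> \<omega> \<in> space P \<Longrightarrow> Z i \<omega> = h i (\<lambda>j\<in>{..<k}. D j \<omega>)"
    and Z': "\<And>i \<omega>. i \<in> I \<Longrightarrow> \<omega> \<in> space Q \<Longrightarrow> Z' i \<omega> = h i (\<lambda>j\<in>{..<k}. D' j \<omega>)"
  shows "distr P (PiM I (\<lambda>_. borel)) (\<lambda>\<omega>. \<lambda>i\<in>I. Z i \<omega>) = distr Q (PiM I (\<lambda>_. borel :: real measure)) (\<lambda>\<omega>. \<lambda>i\<in>I. Z' i \<omega>)"
proof -
  interpret P: prob_space P by fact
  interpret Q: prob_space Q by fact
  let ?M = "PiM {..<k} (\<lambda>_. S)"
  have mD[measurable]: "(\<lambda>\<omega>. \<lambda>j\<in>{..<k}. D j \<omega>) \<in> measurable P ?M" "(\<lambda>\<omega>. \<lambda>j\<in>{..<k}. D' j \<omega>) \<in> measurable Q ?M"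
    by (auto intro!: measurable_restrict)
  interpret PD: prob_space "distr P ?M (\<lambda>\<omega>. \<lambda>j\<in>{..<k}. D j \<omega>)" by (rule P.prob_space_distr) fact
  have eq: "distr P ?M (\<lambda>\<omega>. \<lambda>j\<in>{..<k}. D j \<omega>) = distr Q ?M (\<lambda>\<omega>. \<lambda>j\<in>{..<k}. D' j \<omega>)"
  proof (rule measure_eqI_PiM_finite[where I="{..<k}" and M="\<lambda>_. S" and A="\<lambda>_. space ?M"])
    fix B assume B: "\<And>i. i \<in> {..<k} \<Longrightarrow> B i \<in> sets S"
    have m: "Pi\<^sub>E {..<k} B \<in> sets ?M" using B by (intro sets_PiM_I_finite) auto
    have "emeasure (distr P ?M (\<lambda>\<omega>. \<lambda>j\<in>{..<k}. D j \<omega>)) (Pi\<^sub>E {..<k} B) = emeasure P {\<omega> \<in> space P. \<forall>j<k. D j \<omega> \<in> B j}"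
      by (simp only: emeasure_distr[OF mD(1) m] box_vimage)
    also have "\<dots> = emeasure Q {\<omega> \<in> space Q. \<forall>j<k. D' j \<omega> \<in> B j}" using B by (intro box) auto
    also have "\<dots> = emeasure (distr Q ?M (\<lambda>\<omega>. \<lambda>j\<in>{..<k}. D' j \<omega>)) (Pi\<^sub>E {..<k} B)"
      by (simp only: emeasure_distr[OF mD(2) m] box_vimage)
    finally show "emeasure (distr P ?M (\<lambda>\<omega>. \<lambda>j\<in>{..<k}. D j \<omega>)) (Pi\<^sub>E {..<k} B) =
        emeasure (distr Q ?M (\<lambda>\<omega>. \<lambda>j\<in>{..<k}. D' j \<omega>)) (Pi\<^sub>E {..<k} B)" .
  next
    show "range (\<lambda>_::nat. space ?M) \<subseteq> prod_algebra {..<k} (\<lambda>_. S)"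
      by (auto simp: space_PiM intro!: prod_algebraI_finite)
    show "emeasure (distr P ?M (\<lambda>\<omega>. \<lambda>j\<in>{..<k}. D j \<omega>)) (space ?M) \<noteq> \<infinity>" for i :: nat
      using PD.emeasure_finite by simp
  qed auto
  let ?H = "\<lambda>d. \<lambda>i\<in>I. h i d"
  have mH: "?H \<in> measurable ?M (PiM I (\<lambda>_. borel))" using h by (intro measurable_restrict) auto
  have "distr P (PiM I (\<lambda>_. borel)) (\<lambda>\<omega>. \<lambda>i\<in>I. Z i \<omega>) = distr P (PiM I (\<lambda>_. borel)) (?H \<circ> (\<lambda>\<omega>. \<lambda>j\<in>{..<k}. D j \<omega>))"
    by (rule distr_cong) (use Z in auto)
  also have "\<dots> = distr (distr P ?M (\<lambda>\<omega>. \<lambda>j\<in>{..<k}. D j \<omega>)) (PiM I (\<lambda>_. borel)) ?H"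
    by (rule distr_distr[symmetric, OF mH mD(1)])
  also have "\<dots> = distr (distr Q ?M (\<lambda>\<omega>. \<lambda>j\<in>{..<k}. D' j \<omega>)) (PiM I (\<lambda>_. borel)) ?H" by (simp add: eq)
  also have "\<dots> = distr Q (PiM I (\<lambda>_. borel)) (?H \<circ> (\<lambda>\<omega>. \<lambda>j\<in>{..<k}. D' j \<omega>))"
    by (rule distr_distr[OF mH mD(2)])
  also have "\<dots> = distr Q (PiM I (\<lambda>_. borel)) (\<lambda>\<omega>. \<lambda>i\<in>I. Z' i \<omega>)"
    by (rule distr_cong) (use Z' in auto)
  finally show ?thesis .
qed

section \<open>Pairs of independent Brownian motions\<close>

locale brownian_pair = prob_space M for M :: "'a measure" +
  fixes X Y :: "real \<Rightarrow> 'a \<Rightarrow> real"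
  assumes X_proc: "cont_proc M X" and Y_proc: "cont_proc M Y"
    and X_0: "\<And>\<omega>. \<omega> \<in> space M \<Longrightarrow> X 0 \<omega> = 0" and Y_0: "\<And>\<omega>. \<omega> \<in> space M \<Longrightarrow> Y 0 \<omega> = 0"
    and incr_law: "\<And>s t. 0 \<le> s \<Longrightarrow> s < t \<Longrightarrow>
      distr M (borel \<Otimes>\<^sub>M borel) (\<lambda>\<omega>. (X t \<omega> - X s \<omega>, Y t \<omega> - Y s \<omega>)) = gauss2 (t - s)"
    and incr_indep: "\<And>(n::nat) t. 0 \<le> t 0 \<Longrightarrow> (\<And>i. i < n \<Longrightarrow> t i < t (Suc i)) \<Longrightarrow>
      indep_vars (\<lambda>_. borel \<Otimes>\<^sub>M borel)
        (\<lambda>i \<omega>. (X (t (Suc i)) \<omega> - X (t i) \<omega>, Y (t (Suc i)) \<omega> - Y (t i) \<omega>)) {..<n}"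
begin

lemmas X_measurable[measurable (raw)] = cont_proc_measurable[OF X_proc]
lemmas Y_measurable[measurable (raw)] = cont_proc_measurable[OF Y_proc]

lemma incr_PiM:
  fixes t :: "nat \<Rightarrow> real"
  assumes t: "0 \<le> t 0" "\<And>i. i < n \<Longrightarrow> t i < t (Suc i)" and n: "0 < n"
  shows "distr M (PiM {..<n} (\<lambda>_. borel \<Otimes>\<^sub>M borel))
      (\<lambda>\<omega>. \<lambda>i\<in>{..<n}. (X (t (Suc i)) \<omega> - X (t i) \<omega>, Y (t (Suc i)) \<omega> - Y (t i) \<omega>)) =
    PiM {..<n} (\<lambda>i. gauss2 (t (Suc i) - t i))"
proof -
  have pos: "0 \<le> t i" if "i < Suc n" for i
    using that t by (induction i) (auto intro: less_imp_le order_trans)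
  have "distr M (PiM {..<n} (\<lambda>_. borel \<Otimes>\<^sub>M borel))
      (\<lambda>\<omega>. \<lambda>i\<in>{..<n}. (X (t (Suc i)) \<omega> - X (t i) \<omega>, Y (t (Suc i)) \<omega> - Y (t i) \<omega>)) =
    PiM {..<n} (\<lambda>i. distr M (borel \<Otimes>\<^sub>M borel) (\<lambda>\<omega>. (X (t (Suc i)) \<omega> - X (t i) \<omega>, Y (t (Suc i)) \<omega> - Y (t i) \<omega>)))"
    using incr_indep[of t n] t n
    by (subst (asm) indep_vars_iff_distr_eq_PiM) auto
  also have "\<dots> = PiM {..<n} (\<lambda>i. gauss2 (t (Suc i) - t i))"
    using pos t by (intro PiM_cong refl incr_law) auto
  finally show ?thesis .
qed

lemma incr_nn_integral:
  fixes t :: "nat \<Rightarrow> real"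
  assumes t: "0 \<le> t 0" "\<And>i. i < n \<Longrightarrow> t i < t (Suc i)" and n: "0 < n"
    and g[measurable]: "\<And>i. i < n \<Longrightarrow> g i \<in> borel_measurable (borel \<Otimes>\<^sub>M borel)"
  shows "(\<integral>\<^sup>+ \<omega>. (\<Prod>i<n. g i (X (t (Suc i)) \<omega> - X (t i) \<omega>, Y (t (Suc i)) \<omega> - Y (t i) \<omega>)) \<partial>M) =
     (\<Prod>i<n. \<integral>\<^sup>+ p. g i p \<partial>gauss2 (t (Suc i) - t i))"
proof -
  interpret pp: product_sigma_finite "\<lambda>i. gauss2 (if i < n then t (Suc i) - t i else 1)"
    using t by (intro product_sigma_finite.intro prob_space_imp_sigma_finite prob_space_gauss2) auto
  have gm: "g i \<in> borel_measurable (gauss2 v)" if "i < n" for i v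
    using g[OF that] by (simp cong: measurable_cong_sets add: sets_gauss2)
  have "(\<integral>\<^sup>+ \<omega>. (\<Prod>i<n. g i (X (t (Suc i)) \<omega> - X (t i) \<omega>, Y (t (Suc i)) \<omega> - Y (t i) \<omega>)) \<partial>M) =
    (\<integral>\<^sup>+ \<omega>. (\<Prod>i<n. g i ((\<lambda>i\<in>{..<n}. (X (t (Suc i)) \<omega> - X (t i) \<omega>, Y (t (Suc i)) \<omega> - Y (t i) \<omega>)) i)) \<partial>M)"
    by simp
  also have "\<dots> = (\<integral>\<^sup>+ d. (\<Prod>i<n. g i (d i)) \<partial>distr M (PiM {..<n} (\<lambda>_. borel \<Otimes>\<^sub>M borel))
      (\<lambda>\<omega>. \<lambda>i\<in>{..<n}. (X (t (Suc i)) \<omega> - X (t i) \<omega>, Y (t (Suc i)) \<omega> - Y (t i) \<omega>)))"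
    by (subst nn_integral_distr) (auto intro!: borel_measurable_prod measurable_compose[OF _ g])
  also have "\<dots> = (\<integral>\<^sup>+ d. (\<Prod>i<n. g i (d i)) \<partial>PiM {..<n} (\<lambda>i. gauss2 (if i < n then t (Suc i) - t i else 1)))"
  proof -
    have "PiM {..<n} (\<lambda>i. gauss2 (t (Suc i) - t i)) = PiM {..<n} (\<lambda>i. gauss2 (if i < n then t (Suc i) - t i else 1))"
      by (intro PiM_cong) auto
    then show ?thesis by (subst incr_PiM[OF t n]) simp_all
  qed
  also have "\<dots> = (\<Prod>i<n. \<integral>\<^sup>+ p. g i p \<partial>gauss2 (if i < n then t (Suc i) - t i else 1))"
    by (rule pp.product_nn_integral_prod) (auto intro: gm)
  also have "\<dots> = (\<Prod>i<n. \<integral>\<^sup>+ p. g i p \<partial>gauss2 (t (Suc i) - t i))"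
    by (rule prod.cong) auto
  finally show ?thesis .
qed

lemma incr_box:
  fixes t :: "nat \<Rightarrow> real"
  assumes t: "0 \<le> t 0" "\<And>i. i < n \<Longrightarrow> t i < t (Suc i)" and n: "0 < n"
    and B[measurable]: "\<And>i. i < n \<Longrightarrow> B i \<in> sets (borel \<Otimes>\<^sub>M borel)"
  shows "emeasure M {\<omega> \<in> space M. \<forall>i<n. (X (t (Suc i)) \<omega> - X (t i) \<omega>, Y (t (Suc i)) \<omega> - Y (t i) \<omega>) \<in> B i} =
     (\<Prod>i<n. emeasure (gauss2 (t (Suc i) - t i)) (B i))"
proof -
  let ?D = "\<lambda>i \<omega>. (X (t (Suc i)) \<omega> - X (t i) \<omega>, Y (t (Suc i)) \<omega> - Y (t i) \<omega>)"
  have "(\<integral>\<^sup>+ \<omega>. (\<Prod>i<n. indicator (B i) (?D i \<omega>)) \<partial>M) = (\<Prod>i<n. \<integral>\<^sup>+ p. indicator (B i) p \<partial>gauss2 (t (Suc i) - t i))"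
    by (rule incr_nn_integral[OF t n]) auto
  also have "\<dots> = (\<Prod>i<n. emeasure (gauss2 (t (Suc i) - t i)) (B i))"
    by (intro prod.cong) (auto simp: sets_gauss2 nn_integral_indicator)
  finally have *: "(\<integral>\<^sup>+ \<omega>. (\<Prod>i<n. indicator (B i) (?D i \<omega>)) \<partial>M) = (\<Prod>i<n. emeasure (gauss2 (t (Suc i) - t i)) (B i))" .
  have m: "{\<omega> \<in> space M. \<forall>i<n. ?D i \<omega> \<in> B i} \<in> sets M"
  proof -
    have "{\<omega> \<in> space M. \<forall>i\<in>{..<n}. ?D i \<omega> \<in> B i} \<in> sets M"
      by (intro sets.sets_Collect_finite_All) auto
    then show ?thesis by (simp add: Ball_def)
  qed
  have "emeasure M {\<omega> \<in> space M. \<forall>i<n. ?D i \<omega> \<in> B i} = (\<integral>\<^sup>+ \<omega>. indicator {\<omega> \<in> space M. \<forall>i<n. ?D i \<omega> \<in> B i} \<omega> \<partial>M)"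
    using m by simp
  also have "\<dots> = (\<integral>\<^sup>+ \<omega>. (\<Prod>i<n. indicator (B i) (?D i \<omega>)) \<partial>M)"
  proof (intro nn_integral_cong)
    fix \<omega> assume w: "\<omega> \<in> space M"
    show "indicator {\<omega> \<in> space M. \<forall>i<n. ?D i \<omega> \<in> B i} \<omega> = (\<Prod>i<n. indicator (B i) (?D i \<omega>) :: ennreal)"
    proof (cases "\<forall>i<n. ?D i \<omega> \<in> B i")
      case True then show ?thesis using w by simp
    next
      case False
      then obtain i where "i < n" "?D i \<omega> \<notin> B i" by auto
      then have "(\<Prod>i<n. indicator (B i) (?D i \<omega>) :: ennreal) = 0" by (intro prod_zero bexI[of _ i]) simp_all
      then show ?thesis using False by (simp add: indicator_def)
    qed
  qed
  finally show ?thesis using * by simp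
qed

end

section \<open>Occupation probabilities and the Markov property\<close>

definition occ_prob :: "'a measure \<Rightarrow> real \<Rightarrow> real \<Rightarrow> (real \<Rightarrow> 'a \<Rightarrow> real) \<Rightarrow> ennreal" where
  "occ_prob M A L Z = emeasure M {\<omega> \<in> space M. occ A (\<lambda>t. Z t \<omega>) > ennreal L}"

lemma continuous3_measurable:
  fixes f :: "real \<Rightarrow> real \<Rightarrow> real \<Rightarrow> real"
  assumes f: "continuous_on UNIV (\<lambda>(t, x, y). f t x y)"
    and [measurable]: "a \<in> borel_measurable N" "b \<in> borel_measurable N" "c \<in> borel_measurable N"
  shows "(\<lambda>x. f (a x) (b x) (c x)) \<in> borel_measurable N"
proof -
  have "(\<lambda>x. (a x, b x, c x)) \<in> borel_measurable N" by measurable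
  from measurable_compose[OF this borel_measurable_continuous_onI[OF f]] show ?thesis by simp
qed

lemma cont_proc_comp:
  fixes f :: "real \<Rightarrow> real \<Rightarrow> real \<Rightarrow> real"
  assumes X: "cont_proc M X" and Y: "cont_proc M Y" and f: "continuous_on UNIV (\<lambda>(t, x, y). f t x y)"
  shows "cont_proc M (\<lambda>t \<omega>. f t (X t \<omega>) (Y t \<omega>))"
  unfolding cont_proc_def
proof (intro conjI allI ballI)
  show "(\<lambda>\<omega>. f t (X t \<omega>) (Y t \<omega>)) \<in> borel_measurable M" for t
    using X Y by (intro continuous3_measurable[OF f]) (auto simp: cont_proc_def)
  fix \<omega> assume "\<omega> \<in> space M"
  then have "continuous_on UNIV (\<lambda>t. (t, X t \<omega>, Y t \<omega>))"
    using X Y by (intro continuous_intros) (auto simp: cont_proc_def)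
  from continuous_on_compose2[OF f this] show "continuous_on UNIV (\<lambda>t. f t (X t \<omega>) (Y t \<omega>))"
    by simp
qed

lemma cont_proc_reindex:
  assumes "cont_proc M X" "continuous_on UNIV g"
  shows "cont_proc M (\<lambda>t. X (g t))"
  using assms unfolding cont_proc_def by (auto intro: continuous_on_compose2[where t=UNIV])

lemma cont_proc_minus:
  assumes "cont_proc M X" "cont_proc M Y"
  shows "cont_proc M (\<lambda>t \<omega>. X t \<omega> - Y t \<omega>)"
  using assms unfolding cont_proc_def by (auto intro!: continuous_intros borel_measurable_diff)

lemma cont_proc_add:
  assumes "cont_proc M X" "cont_proc M Y"
  shows "cont_proc M (\<lambda>t \<omega>. X t \<omega> + Y t \<omega>)"
  using assms unfolding cont_proc_def by (auto intro!: continuous_intros borel_measurable_add)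

lemma cont_proc_const: "g \<in> borel_measurable M \<Longrightarrow> cont_proc M (\<lambda>t. g)"
  by (auto simp: cont_proc_def)

lemma cont_proc_det: "continuous_on UNIV g \<Longrightarrow> cont_proc M (\<lambda>t \<omega>. g t)"
  by (auto simp: cont_proc_def)

lemma cont_proc_snd: "cont_proc M X \<Longrightarrow> cont_proc (P \<Otimes>\<^sub>M M) (\<lambda>t p. X t (snd p))"
  by (auto simp: cont_proc_def space_pair_measure intro: measurable_compose[OF measurable_snd])

lemma cont_proc_sets_cong: "sets M = sets N \<Longrightarrow> cont_proc M X = cont_proc N X"
  by (auto simp: cont_proc_def cong: measurable_cong_sets dest: sets_eq_imp_space_eq)

lemma occ_shift:
  assumes [measurable]: "z \<in> borel_measurable borel"
  shows "emeasure lborel {t \<in> {s..s + A}. 0 < z t} = occ A (\<lambda>r. z (s + r))"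
proof -
  have "emeasure lborel {t \<in> {s..s + A}. 0 < z t} = (\<integral>\<^sup>+ t. indicator {t \<in> {s..s + A}. 0 < z t} t \<partial>lborel)"
    by (subst nn_integral_indicator) auto
  also have "\<dots> = (\<integral>\<^sup>+ r. indicator {t \<in> {s..s + A}. 0 < z t} (s + 1 * r) \<partial>lborel)"
    by (subst nn_integral_real_affine[where c=1 and t=s]) auto
  also have "\<dots> = (\<integral>\<^sup>+ r. indicator {0..A} r * indicator {0<..} (z (s + r)) \<partial>lborel)"
    by (intro nn_integral_cong) (auto simp: indicator_def)
  also have "\<dots> = occ A (\<lambda>r. z (s + r))" by (subst occ_nn_integral) auto
  finally show ?thesis .
qed

lemma occ_reverse:
  assumes [measurable]: "z \<in> borel_measurable borel"
  shows "occ A z = occ A (\<lambda>r. z (A - r))"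
proof -
  have "occ A z = (\<integral>\<^sup>+ r. indicator {0..A} (A + (-1) * r) * indicator {0<..} (z (A + (-1) * r)) \<partial>lborel)"
    by (subst occ_nn_integral, simp, subst nn_integral_real_affine[where c="-1" and t=A]) auto
  also have "\<dots> = (\<integral>\<^sup>+ r. indicator {0..A} r * indicator {0<..} (z (A - r)) \<partial>lborel)"
    by (intro nn_integral_cong) (auto simp: indicator_def)
  also have "\<dots> = occ A (\<lambda>r. z (A - r))" by (subst occ_nn_integral) auto
  finally show ?thesis .
qed

text \<open>Occupation probabilities are a property of the law of the Brownian pair, so they can be moved
between probability spaces and between different constructions of the pair.\<close>

lemma brownian_pair_occ_prob_cong:
  assumes B: "brownian_pair M X Y" and B': "brownian_pair N X' Y'"
    and A: "0 < A" and L: "0 \<le> L" and f: "continuous_on UNIV (\<lambda>(t, x, y). f t x y)"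
  shows "occ_prob M A L (\<lambda>t \<omega>. f t (X t \<omega>) (Y t \<omega>)) = occ_prob N A L (\<lambda>t \<omega>. f t (X' t \<omega>) (Y' t \<omega>))"
proof -
  interpret B: brownian_pair M X Y by fact
  interpret B': brownian_pair N X' Y' by fact
  show ?thesis unfolding occ_prob_def
  proof (rule occ_prob_cong)
    fix n :: nat assume n: "0 < n"
    let ?t = "\<lambda>i. A * real i / real n"
    have t: "0 \<le> ?t 0" "\<And>i. i < n \<Longrightarrow> ?t i < ?t (Suc i)" using A n by (auto intro!: divide_strict_right_mono)
    let ?h = "\<lambda>i d. f (?t i) (\<Sum>j<i. fst (d j)) (\<Sum>j<i. snd (d j :: real \<times> real))"
    show "distr M (PiM {..n} (\<lambda>_. borel)) (\<lambda>\<omega>. \<lambda>i\<in>{..n}. f (?t i) (X (?t i) \<omega>) (Y (?t i) \<omega>)) =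
       distr N (PiM {..n} (\<lambda>_. borel)) (\<lambda>\<omega>. \<lambda>i\<in>{..n}. f (?t i) (X' (?t i) \<omega>) (Y' (?t i) \<omega>))"
    proof (rule grid_law_eq[where k=n and S="borel \<Otimes>\<^sub>M borel" and h="?h"
          and D="\<lambda>j \<omega>. (X (?t (Suc j)) \<omega> - X (?t j) \<omega>, Y (?t (Suc j)) \<omega> - Y (?t j) \<omega>)"
          and D'="\<lambda>j \<omega>. (X' (?t (Suc j)) \<omega> - X' (?t j) \<omega>, Y' (?t (Suc j)) \<omega> - Y' (?t j) \<omega>)"])
      fix Bx assume Bx: "\<And>j. j < n \<Longrightarrow> Bx j \<in> sets (borel \<Otimes>\<^sub>M borel :: (real \<times> real) measure)"
      show "emeasure M {\<omega> \<in> space M. \<forall>j<n. (X (?t (Suc j)) \<omega> - X (?t j) \<omega>, Y (?t (Suc j)) \<omega> - Y (?t j) \<omega>) \<in> Bx j} =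
         emeasure N {\<omega> \<in> space N. \<forall>j<n. (X' (?t (Suc j)) \<omega> - X' (?t j) \<omega>, Y' (?t (Suc j)) \<omega> - Y' (?t j) \<omega>) \<in> Bx j}"
        by (rule trans[OF B.incr_box[where t="?t", OF t n Bx] B'.incr_box[where t="?t", OF t n Bx, symmetric]])
    next
      fix i assume "i \<in> {..n}"
      then show "?h i \<in> borel_measurable (PiM {..<n} (\<lambda>_. borel \<Otimes>\<^sub>M borel))"
        by (intro continuous3_measurable[OF f] borel_measurable_sum) (auto intro!: measurable_compose[OF measurable_component_singleton])
    next
      fix i \<omega> assume i: "i \<in> {..n}" and w: "\<omega> \<in> space M"
      have "(\<Sum>j<i. fst ((\<lambda>j\<in>{..<n}. (X (?t (Suc j)) \<omega> - X (?t j) \<omega>, Y (?t (Suc j)) \<omega> - Y (?t j) \<omega>)) j)) =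
          (\<Sum>j<i. X (?t (Suc j)) \<omega> - X (?t j) \<omega>)" using i by (intro sum.cong) auto
      moreover have "(\<Sum>j<i. snd ((\<lambda>j\<in>{..<n}. (X (?t (Suc j)) \<omega> - X (?t j) \<omega>, Y (?t (Suc j)) \<omega> - Y (?t j) \<omega>)) j)) =
          (\<Sum>j<i. Y (?t (Suc j)) \<omega> - Y (?t j) \<omega>)" using i by (intro sum.cong) auto
      ultimately show "f (?t i) (X (?t i) \<omega>) (Y (?t i) \<omega>) = ?h i (\<lambda>j\<in>{..<n}. (X (?t (Suc j)) \<omega> - X (?t j) \<omega>, Y (?t (Suc j)) \<omega> - Y (?t j) \<omega>))"
        using w sum_lessThan_telescope[of "\<lambda>j. X (?t j) \<omega>" "i"] sum_lessThan_telescope[of "\<lambda>j. Y (?t j) \<omega>" "i"]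
        by (simp only:) (simp add: B.X_0 B.Y_0)
    next
      fix i \<omega> assume i: "i \<in> {..n}" and w: "\<omega> \<in> space N"
      have "(\<Sum>j<i. fst ((\<lambda>j\<in>{..<n}. (X' (?t (Suc j)) \<omega> - X' (?t j) \<omega>, Y' (?t (Suc j)) \<omega> - Y' (?t j) \<omega>)) j)) =
          (\<Sum>j<i. X' (?t (Suc j)) \<omega> - X' (?t j) \<omega>)" using i by (intro sum.cong) auto
      moreover have "(\<Sum>j<i. snd ((\<lambda>j\<in>{..<n}. (X' (?t (Suc j)) \<omega> - X' (?t j) \<omega>, Y' (?t (Suc j)) \<omega> - Y' (?t j) \<omega>)) j)) =
          (\<Sum>j<i. Y' (?t (Suc j)) \<omega> - Y' (?t j) \<omega>)" using i by (intro sum.cong) auto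
      ultimately show "f (?t i) (X' (?t i) \<omega>) (Y' (?t i) \<omega>) = ?h i (\<lambda>j\<in>{..<n}. (X' (?t (Suc j)) \<omega> - X' (?t j) \<omega>, Y' (?t (Suc j)) \<omega> - Y' (?t j) \<omega>))"
        using w sum_lessThan_telescope[of "\<lambda>j. X' (?t j) \<omega>" "i"] sum_lessThan_telescope[of "\<lambda>j. Y' (?t j) \<omega>" "i"]
        by (simp only:) (simp add: B'.X_0 B'.Y_0)
    qed (use B.prob_space_axioms B'.prob_space_axioms in auto)
  qed (use A L B.prob_space_axioms B'.prob_space_axioms cont_proc_comp[OF B.X_proc B.Y_proc f] cont_proc_comp[OF B'.X_proc B'.Y_proc f] in auto)
qed

context brownian_pair
begin

lemma scaled:
  assumes c: "0 < c"
  shows "brownian_pair M (\<lambda>t \<omega>. c * X (t / c\<^sup>2) \<omega>) (\<lambda>t \<omega>. c * Y (t / c\<^sup>2) \<omega>)"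
proof -
  have scale: "cont_proc M Z \<Longrightarrow> cont_proc M (\<lambda>t. Z (t / c\<^sup>2))" for Z
    using c by (auto intro!: cont_proc_reindex continuous_intros)
  show ?thesis
  proof (unfold_locales, goal_cases)
    case 1 show ?case
      by (rule cont_proc_comp[OF scale[OF X_proc] scale[OF X_proc], where f="\<lambda>t x y. c * x"])
        (auto simp: case_prod_beta' intro!: continuous_intros)
  next
    case 2 show ?case
      by (rule cont_proc_comp[OF scale[OF Y_proc] scale[OF Y_proc], where f="\<lambda>t x y. c * x"])
        (auto simp: case_prod_beta' intro!: continuous_intros)
  next
    case (5 s t)
    have st: "0 \<le> s / c\<^sup>2" "s / c\<^sup>2 < t / c\<^sup>2" using 5 c by (auto intro!: divide_strict_right_mono)
    have "distr M (borel \<Otimes>\<^sub>M borel) (\<lambda>\<omega>. (c * X (t / c\<^sup>2) \<omega> - c * X (s / c\<^sup>2) \<omega>, c * Y (t / c\<^sup>2) \<omega> - c * Y (s / c\<^sup>2) \<omega>)) =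
      distr (distr M (borel \<Otimes>\<^sub>M borel) (\<lambda>\<omega>. (X (t / c\<^sup>2) \<omega> - X (s / c\<^sup>2) \<omega>, Y (t / c\<^sup>2) \<omega> - Y (s / c\<^sup>2) \<omega>)))
        (borel \<Otimes>\<^sub>M borel) (\<lambda>p. (c * fst p, c * snd p))"
      by (subst distr_distr) (auto simp: o_def right_diff_distrib)
    also have "\<dots> = gauss2 (c\<^sup>2 * (t / c\<^sup>2 - s / c\<^sup>2))"
      by (subst incr_law[OF st], subst distr_gauss2_scale) (use st c in auto)
    also have "c\<^sup>2 * (t / c\<^sup>2 - s / c\<^sup>2) = t - s" using c by (simp add: field_simps)
    finally show ?case .
  next
    case (6 n t)
    have "indep_vars (\<lambda>_. borel \<Otimes>\<^sub>M borel)
      (\<lambda>i \<omega>. (X (t (Suc i) / c\<^sup>2) \<omega> - X (t i / c\<^sup>2) \<omega>, Y (t (Suc i) / c\<^sup>2) \<omega> - Y (t i / c\<^sup>2) \<omega>)) {..<n}"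
      using 6 c by (intro incr_indep[of "\<lambda>i. t i / c\<^sup>2"]) (auto intro!: divide_strict_right_mono)
    from indep_vars_compose2[OF this, of "\<lambda>_ p. (c * fst p, c * snd p)" "\<lambda>_. borel \<Otimes>\<^sub>M borel"]
    show ?case by (simp add: right_diff_distrib)
  qed (simp_all add: X_0 Y_0)
qed

lemma incr_box_sets:
  assumes B[measurable]: "\<And>i. i < n \<Longrightarrow> B i \<in> sets (borel \<Otimes>\<^sub>M borel)"
  shows "{\<omega> \<in> space M. \<forall>i<n::nat. (X (a i) \<omega> - X (b i) \<omega>, Y (a i) \<omega> - Y (b i) \<omega>) \<in> B i} \<in> sets M"
proof -
  have "{\<omega> \<in> space M. \<forall>i\<in>{..<n}. (X (a i) \<omega> - X (b i) \<omega>, Y (a i) \<omega> - Y (b i) \<omega>) \<in> B i} \<in> sets M"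
    by (intro sets.sets_Collect_finite_All) auto
  then show ?thesis by (simp add: Ball_def)
qed

text \<open>The Markov property at the deterministic time \<open>\<tau>\<close>, in the form needed here: after \<open>\<tau>\<close> the pair runs
like a fresh one started at an independent Gaussian point. On a grid, the position at \<open>\<tau>\<close> is simply
one more increment in front of the others.\<close>

lemma restart:
  assumes \<tau>: "0 < \<tau>" and A: "0 < A" and L: "0 \<le> L" and f: "continuous_on UNIV (\<lambda>(t, x, y). f t x y)"
  shows "occ_prob M A L (\<lambda>r \<omega>. f r (X (\<tau> + r) \<omega>) (Y (\<tau> + r) \<omega>)) =
    (\<integral>\<^sup>+ x. \<integral>\<^sup>+ y. ennreal (normal_density 0 (sqrt \<tau>) x * normal_density 0 (sqrt \<tau>) y) *
       occ_prob M A L (\<lambda>r \<omega>. f r (x + X r \<omega>) (y + Y r \<omega>)) \<partial>lborel \<partial>lborel)"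
proof -
  let ?Q = "gauss2 \<tau> \<Otimes>\<^sub>M M"
  interpret g: prob_space "gauss2 \<tau>" by (rule prob_space_gauss2[OF \<tau>])
  interpret Q: pair_prob_space "gauss2 \<tau>" M ..
  let ?Z = "\<lambda>r p. f r (fst (fst p) + X r (snd p)) (snd (fst p) + Y r (snd p))"
  have sQ: "sets ?Q = sets ((borel \<Otimes>\<^sub>M borel) \<Otimes>\<^sub>M M)" by (intro sets_pair_measure_cong sets_gauss2 refl)
  have m1: "(\<lambda>p. fst (fst p)) \<in> borel_measurable ?Q" and m2: "(\<lambda>p. snd (fst p)) \<in> borel_measurable ?Q"
    by (simp_all cong: measurable_cong_sets add: sQ)
  have Zc: "cont_proc ?Q ?Z"
    by (rule cont_proc_comp[OF cont_proc_add[OF cont_proc_const[OF m1] cont_proc_snd[OF X_proc]]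
          cont_proc_add[OF cont_proc_const[OF m2] cont_proc_snd[OF Y_proc]] f])
  have "continuous_on UNIV (\<lambda>r. \<tau> + r)" by (intro continuous_intros)
  note Pc = cont_proc_comp[OF cont_proc_reindex[OF X_proc this] cont_proc_reindex[OF Y_proc this] f]
  have "occ_prob M A L (\<lambda>r \<omega>. f r (X (\<tau> + r) \<omega>) (Y (\<tau> + r) \<omega>)) = occ_prob ?Q A L ?Z"
    unfolding occ_prob_def
  proof (rule occ_prob_cong[OF prob_space_axioms Q.prob_space_axioms Pc Zc A L])
    fix n :: nat assume n: "0 < n"
    let ?s = "\<lambda>i. A * real i / real n"
    \<comment> \<open>The grid with the point 0 in front: its first increment is the position at \<open>\<tau>\<close>.\<close>
    define t where "t = (\<lambda>i. case i of 0 \<Rightarrow> 0 | Suc i \<Rightarrow> \<tau> + ?s i)"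
    have t0[simp]: "t 0 = 0" and tS[simp]: "t (Suc i) = \<tau> + ?s i" for i by (auto simp: t_def)
    have s: "0 \<le> ?s 0" "\<And>i. i < n \<Longrightarrow> ?s i < ?s (Suc i)" using A n by (auto intro!: divide_strict_right_mono)
    have t: "0 \<le> t 0" "\<And>i. i < Suc n \<Longrightarrow> t i < t (Suc i)"
      using s \<tau> by (auto simp: t_def split: nat.split)
    let ?D = "\<lambda>j \<omega>. (X (t (Suc j)) \<omega> - X (t j) \<omega>, Y (t (Suc j)) \<omega> - Y (t j) \<omega>)"
    let ?E = "\<lambda>j \<omega>. (X (?s (Suc j)) \<omega> - X (?s j) \<omega>, Y (?s (Suc j)) \<omega> - Y (?s j) \<omega>)"
    let ?D' = "\<lambda>j p. case j of 0 \<Rightarrow> fst p | Suc j \<Rightarrow> ?E j (snd p)"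
    let ?h = "\<lambda>i d. f (?s i) (\<Sum>j<Suc i. fst (d j)) (\<Sum>j<Suc i. snd (d j :: real \<times> real))"
    have D'm: "?D' j \<in> measurable ?Q (borel \<Otimes>\<^sub>M borel)" for j
    proof (cases j)
      case 0 then show ?thesis by (simp cong: measurable_cong_sets add: sQ)
    next
      case (Suc i)
      have "?E i \<in> measurable M (borel \<Otimes>\<^sub>M borel)" by measurable
      from measurable_compose[OF measurable_snd this, of "gauss2 \<tau>"] show ?thesis using Suc by simp
    qed
    show "distr M (PiM {..n} (\<lambda>_. borel)) (\<lambda>\<omega>. \<lambda>i\<in>{..n}. f (?s i) (X (\<tau> + ?s i) \<omega>) (Y (\<tau> + ?s i) \<omega>)) =
       distr ?Q (PiM {..n} (\<lambda>_. borel)) (\<lambda>p. \<lambda>i\<in>{..n}. ?Z (?s i) p)"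
    proof (rule grid_law_eq[where k="Suc n" and S="borel \<Otimes>\<^sub>M borel" and h="?h" and D="?D" and D'="?D'"])
      fix B assume B: "\<And>j. j < Suc n \<Longrightarrow> B j \<in> sets (borel \<Otimes>\<^sub>M borel :: (real \<times> real) measure)"
      have B0: "B 0 \<in> sets (gauss2 \<tau>)" using B[of 0] by (simp add: sets_gauss2)
      have BS: "B (Suc j) \<in> sets (borel \<Otimes>\<^sub>M borel)" if "j < n" for j using B[of "Suc j"] that by simp
      have Em: "{\<omega> \<in> space M. \<forall>j<n. ?E j \<omega> \<in> B (Suc j)} \<in> sets M"
        by (rule incr_box_sets[where a="\<lambda>j. ?s (Suc j)" and b="?s", OF BS])
      have "emeasure M {\<omega> \<in> space M. \<forall>j<Suc n. ?D j \<omega> \<in> B j} = (\<Prod>j<Suc n. emeasure (gauss2 (t (Suc j) - t j)) (B j))"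
        using incr_box[where t=t and n="Suc n" and B=B, OF t zero_less_Suc B] .
      also have "\<dots> = emeasure (gauss2 \<tau>) (B 0) * (\<Prod>j<n. emeasure (gauss2 (?s (Suc j) - ?s j)) (B (Suc j)))"
        by (subst prod.lessThan_Suc_shift) simp
      also have "(\<Prod>j<n. emeasure (gauss2 (?s (Suc j) - ?s j)) (B (Suc j))) = emeasure M {\<omega> \<in> space M. \<forall>j<n. ?E j \<omega> \<in> B (Suc j)}"
        using incr_box[where t="?s" and n=n and B="\<lambda>j. B (Suc j)", OF s n BS, symmetric] .
      also have "emeasure (gauss2 \<tau>) (B 0) * emeasure M {\<omega> \<in> space M. \<forall>j<n. ?E j \<omega> \<in> B (Suc j)} =
         emeasure ?Q (B 0 \<times> {\<omega> \<in> space M. \<forall>j<n. ?E j \<omega> \<in> B (Suc j)})"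
        by (rule emeasure_pair_measure_Times[symmetric, OF B0 Em])
      also have "B 0 \<times> {\<omega> \<in> space M. \<forall>j<n. ?E j \<omega> \<in> B (Suc j)} = {p \<in> space ?Q. \<forall>j<Suc n. ?D' j p \<in> B j}"
        by (simp add: space_pair_measure All_less_Suc2 set_eq_iff) blast
      finally show "emeasure M {\<omega> \<in> space M. \<forall>j<Suc n. ?D j \<omega> \<in> B j} = emeasure ?Q {p \<in> space ?Q. \<forall>j<Suc n. ?D' j p \<in> B j}" .
    next
      fix i assume "i \<in> {..n}"
      then show "?h i \<in> borel_measurable (PiM {..<Suc n} (\<lambda>_. borel \<Otimes>\<^sub>M borel))"
        by (intro continuous3_measurable[OF f] borel_measurable_sum) (auto intro!: measurable_compose[OF measurable_component_singleton])
    next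
      fix i \<omega> assume i: "i \<in> {..n}" and w: "\<omega> \<in> space M"
      have "(\<Sum>j<Suc i. fst ((\<lambda>j\<in>{..<Suc n}. ?D j \<omega>) j)) = (\<Sum>j<Suc i. X (t (Suc j)) \<omega> - X (t j) \<omega>)"
        using i by (intro sum.cong) auto
      moreover have "(\<Sum>j<Suc i. snd ((\<lambda>j\<in>{..<Suc n}. ?D j \<omega>) j)) = (\<Sum>j<Suc i. Y (t (Suc j)) \<omega> - Y (t j) \<omega>)"
        using i by (intro sum.cong) auto
      ultimately show "f (?s i) (X (\<tau> + ?s i) \<omega>) (Y (\<tau> + ?s i) \<omega>) = ?h i (\<lambda>j\<in>{..<Suc n}. ?D j \<omega>)"
        using w sum_lessThan_telescope[of "\<lambda>j. X (t j) \<omega>" "Suc i"] sum_lessThan_telescope[of "\<lambda>j. Y (t j) \<omega>" "Suc i"]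
        by (simp only:) (simp add: X_0 Y_0)
    next
      fix i p assume i: "i \<in> {..n}" and "p \<in> space ?Q"
      then have w: "snd p \<in> space M" by (auto simp: space_pair_measure)
      have "(\<Sum>j<Suc i. fst ((\<lambda>j\<in>{..<Suc n}. ?D' j p) j)) = fst (fst p) + (\<Sum>j<i. X (?s (Suc j)) (snd p) - X (?s j) (snd p))"
        using i by (subst sum.lessThan_Suc_shift) (auto intro!: sum.cong)
      moreover have "(\<Sum>j<Suc i. snd ((\<lambda>j\<in>{..<Suc n}. ?D' j p) j)) = snd (fst p) + (\<Sum>j<i. Y (?s (Suc j)) (snd p) - Y (?s j) (snd p))"
        using i by (subst sum.lessThan_Suc_shift) (auto intro!: sum.cong)
      ultimately show "?Z (?s i) p = ?h i (\<lambda>j\<in>{..<Suc n}. ?D' j p)"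
        using w sum_lessThan_telescope[of "\<lambda>j. X (?s j) (snd p)" "i"] sum_lessThan_telescope[of "\<lambda>j. Y (?s j) (snd p)" "i"]
        by (simp only:) (simp add: X_0 Y_0)
    qed (use D'm prob_space_axioms Q.prob_space_axioms in auto)
  qed
  also have "\<dots> = (\<integral>\<^sup>+ p. occ_prob M A L (\<lambda>r \<omega>. f r (fst p + X r \<omega>) (snd p + Y r \<omega>)) \<partial>gauss2 \<tau>)"
  proof -
    have m: "{p \<in> space ?Q. ennreal L < occ A (\<lambda>t. ?Z t p)} \<in> sets ?Q"
      using occ_measurable[OF Zc] by measurable
    show ?thesis unfolding occ_prob_def
      by (subst emeasure_pair_measure_alt[OF m]) (intro nn_integral_cong arg_cong[where f="emeasure M"], auto simp: space_pair_measure)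
  qed
  also have "\<dots> = (\<integral>\<^sup>+ x. \<integral>\<^sup>+ y. ennreal (normal_density 0 (sqrt \<tau>) x * normal_density 0 (sqrt \<tau>) y) *
       occ_prob M A L (\<lambda>r \<omega>. f r (x + X r \<omega>) (y + Y r \<omega>)) \<partial>lborel \<partial>lborel)"
  proof -
    let ?Q' = "(borel \<Otimes>\<^sub>M borel) \<Otimes>\<^sub>M M"
    have "{p \<in> space ?Q. ennreal L < occ A (\<lambda>t. ?Z t p)} \<in> sets ?Q"
      using occ_measurable[OF Zc] by measurable
    then have m: "{p \<in> space ?Q'. ennreal L < occ A (\<lambda>t. ?Z t p)} \<in> sets ?Q'"
      unfolding sQ sets_eq_imp_space_eq[OF sQ] .
    have "(\<lambda>p. emeasure M (Pair p -` {p \<in> space ?Q'. ennreal L < occ A (\<lambda>t. ?Z t p)})) \<in> borel_measurable (borel \<Otimes>\<^sub>M borel)"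
      by (rule measurable_emeasure_Pair[OF m])
    also have "(\<lambda>p. emeasure M (Pair p -` {p \<in> space ?Q'. ennreal L < occ A (\<lambda>t. ?Z t p)})) =
        (\<lambda>p. occ_prob M A L (\<lambda>r \<omega>. f r (fst p + X r \<omega>) (snd p + Y r \<omega>)))"
      unfolding occ_prob_def by (intro ext arg_cong[where f="emeasure M"]) (auto simp: space_pair_measure)
    finally have "(\<lambda>p. occ_prob M A L (\<lambda>r \<omega>. f r (fst p + X r \<omega>) (snd p + Y r \<omega>))) \<in> borel_measurable (borel \<Otimes>\<^sub>M borel)" .
    then show ?thesis by (subst nn_integral_gauss2[OF \<tau>]) auto
  qed
  finally show ?thesis .
qed

end

section \<open>Time reversal, change of measure and the maximal inequality\<close>

lemma prod_indicator_all:
  "(\<Prod>i<n::nat. indicator (B i) (x i) :: ennreal) = indicator {y. \<forall>i<n. y i \<in> B i} x"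
proof (cases "\<forall>i<n. x i \<in> B i")
  case False
  then obtain i where i: "i < n" "x i \<notin> B i" by auto
  then have "(\<Prod>i<n. indicator (B i) (x i) :: ennreal) = 0" by (intro prod_zero bexI[of _ i]) simp_all
  then show ?thesis using False by simp
qed simp

lemma borel_measurable_indicator_Int:
  assumes "A \<inter> space M \<in> sets M"
  shows "(indicator A :: 'a \<Rightarrow> ennreal) \<in> borel_measurable M"
proof -
  have "(indicator (A \<inter> space M) :: 'a \<Rightarrow> ennreal) \<in> borel_measurable M" using assms by simp
  then show ?thesis
    by (rule measurable_cong[THEN iffD2, rotated]) (simp add: indicator_def)
qed

lemma (in prob_space) indep_var_nn_integral_mult:
  fixes F :: "_ \<Rightarrow> ennreal"
  assumes I: "indep_var S U T V" and F: "F \<in> borel_measurable S" and H: "H \<in> borel_measurable T"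
  shows "(\<integral>\<^sup>+ \<omega>. F (U \<omega>) * H (V \<omega>) \<partial>M) = (\<integral>\<^sup>+ \<omega>. F (U \<omega>) \<partial>M) * (\<integral>\<^sup>+ \<omega>. H (V \<omega>) \<partial>M)"
proof -
  have "indep_var borel (F \<circ> U) borel (H \<circ> V)" by (rule indep_var_compose[OF I F H])
  then have "indep_vars (\<lambda>_. borel) (case_bool (F \<circ> U) (H \<circ> V)) UNIV"
    unfolding indep_var_def by (rule indep_vars_cong[THEN iffD1, rotated -1]) (auto split: bool.split)
  from indep_vars_nn_integral[OF _ this] show ?thesis by (simp add: UNIV_bool mult.commute o_def)
qed

context brownian_pair
begin

text \<open>Girsanov's theorem combined with time reversal. Under the exponential tilt every grid increment
becomes its drift minus itself (\<open>gauss2_tilt_reflect\<close>). Looking at the path backwards from time \<open>A\<close>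
only permutes the increments, which have equal laws on an equidistant grid.\<close>

lemma reversal_tilt:
  assumes A: "0 < A" and L: "0 \<le> L" and f: "continuous_on UNIV (\<lambda>(t, x, y). f t x y)"
  shows "(\<integral>\<^sup>+ \<omega>. ennreal (exp (m1 * X A \<omega> + m2 * Y A \<omega> - (m1\<^sup>2 + m2\<^sup>2) * A / 2)) *
      indicator {\<omega> \<in> space M. occ A (\<lambda>r. f r (X A \<omega> - X (A - r) \<omega>) (Y A \<omega> - Y (A - r) \<omega>)) > ennreal L} \<omega> \<partial>M) =
    occ_prob M A L (\<lambda>r \<omega>. f r (m1 * r - X r \<omega>) (m2 * r - Y r \<omega>))"
proof -
  let ?w = "\<lambda>\<omega>. ennreal (exp (m1 * X A \<omega> + m2 * Y A \<omega> - (m1\<^sup>2 + m2\<^sup>2) * A / 2))"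
  let ?P = "density M ?w"
  let ?Z = "\<lambda>r \<omega>. f r (X A \<omega> - X (A - r) \<omega>) (Y A \<omega> - Y (A - r) \<omega>)"
  let ?Z' = "\<lambda>r \<omega>. f r (m1 * r - X r \<omega>) (m2 * r - Y r \<omega>)"
  have wm[measurable]: "?w \<in> borel_measurable M" by measurable
  have P: "prob_space ?P"
  proof
    have "emeasure ?P (space ?P) = (\<integral>\<^sup>+ \<omega>. ?w \<omega> \<partial>M)"
      by (subst emeasure_density) (auto intro!: nn_integral_cong)
    also have "\<dots> = (\<integral>\<^sup>+ \<omega>. (\<lambda>p. ennreal (exp (m1 * fst p + m2 * snd p - (m1\<^sup>2 + m2\<^sup>2) * (A - 0) / 2)))
          (X A \<omega> - X 0 \<omega>, Y A \<omega> - Y 0 \<omega>) \<partial>M)"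
      by (intro nn_integral_cong) (simp add: X_0 Y_0)
    also have "\<dots> = (\<integral>\<^sup>+ p. ennreal (exp (m1 * fst p + m2 * snd p - (m1\<^sup>2 + m2\<^sup>2) * (A - 0) / 2)) \<partial>gauss2 (A - 0))"
      by (subst incr_law[symmetric, of 0 A]) (use A in \<open>auto simp: nn_integral_distr\<close>)
    also have "\<dots> = 1" by (rule nn_integral_gauss_exp) (use A in simp)
    finally show "emeasure ?P (space ?P) = 1" .
  qed
  have cr: "continuous_on UNIV (\<lambda>r. A - r)" by (intro continuous_intros)
  have Zc: "cont_proc M ?Z"
    by (intro cont_proc_comp[OF _ _ f] cont_proc_minus cont_proc_const cont_proc_reindex[OF X_proc cr] cont_proc_reindex[OF Y_proc cr])
      measurable
  then have ZcP: "cont_proc ?P ?Z" by (subst cont_proc_sets_cong[where N=M]) simp_all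
  have Z'c: "cont_proc M ?Z'"
    by (intro cont_proc_comp[OF _ _ f] cont_proc_minus cont_proc_det X_proc Y_proc continuous_intros)
  have "occ_prob ?P A L ?Z = occ_prob M A L ?Z'"
    unfolding occ_prob_def
  proof (rule occ_prob_cong[OF P prob_space_axioms ZcP Z'c A L])
    fix n :: nat assume n: "0 < n"
    define t where "t = (\<lambda>i. A * real i / real n)"
    have t: "0 \<le> t 0" "\<And>i. i < n \<Longrightarrow> t i < t (Suc i)"
      using A n by (auto intro!: divide_strict_right_mono simp: t_def)
    have dt: "t (Suc i) - t i = A / real n" for i by (simp add: t_def add_divide_distrib distrib_left)
    have tn: "t n = A" and t0: "t 0 = 0" using n by (auto simp: t_def)
    let ?D = "\<lambda>j \<omega>. (X (t (Suc j)) \<omega> - X (t j) \<omega>, Y (t (Suc j)) \<omega> - Y (t j) \<omega>)"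
    let ?D' = "\<lambda>j \<omega>. (m1 * (A / real n) - fst (?D j \<omega>), m2 * (A / real n) - snd (?D j \<omega>))"
    let ?h = "\<lambda>i d. f (t i) (\<Sum>j<i. fst (d j)) (\<Sum>j<i. snd (d j :: real \<times> real))"
    have "distr ?P (PiM {..n} (\<lambda>_. borel)) (\<lambda>\<omega>. \<lambda>i\<in>{..n}. ?Z (t i) \<omega>) =
       distr M (PiM {..n} (\<lambda>_. borel)) (\<lambda>\<omega>. \<lambda>i\<in>{..n}. ?Z' (t i) \<omega>)"
    proof (rule grid_law_eq[where k=n and S="borel \<Otimes>\<^sub>M borel" and h="?h" and D="\<lambda>j. ?D (n - Suc j)" and D'="?D'"])
      fix B assume B[measurable]: "\<And>j. j < n \<Longrightarrow> B j \<in> sets (borel \<Otimes>\<^sub>M borel :: (real \<times> real) measure)"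
      \<comment> \<open>Reversing time permutes the boxes instead of the increments.\<close>
      let ?C = "\<lambda>i. B (n - Suc i)"
      have C[measurable]: "?C i \<in> sets (borel \<Otimes>\<^sub>M borel)" if "i < n" for i using n by (intro B) simp
      let ?e = "\<lambda>i p. exp (m1 * fst p + m2 * snd p - (m1\<^sup>2 + m2\<^sup>2) * (t (Suc i) - t i) / 2)"
      have wprod: "?w \<omega> = (\<Prod>i<n. ennreal (?e i (?D i \<omega>)))" if "\<omega> \<in> space M" for \<omega>
      proof -
        have "m1 * X A \<omega> + m2 * Y A \<omega> - (m1\<^sup>2 + m2\<^sup>2) * A / 2 =
           m1 * (\<Sum>i<n. X (t (Suc i)) \<omega> - X (t i) \<omega>) + m2 * (\<Sum>i<n. Y (t (Suc i)) \<omega> - Y (t i) \<omega>) - (m1\<^sup>2 + m2\<^sup>2) / 2 * (\<Sum>i<n. t (Suc i) - t i)"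
          using that sum_lessThan_telescope[of "\<lambda>j. X (t j) \<omega>" n] sum_lessThan_telescope[of "\<lambda>j. Y (t j) \<omega>" n] sum_lessThan_telescope[of t n]
          by (simp only: tn t0 X_0 Y_0) simp
        also have "\<dots> = (\<Sum>i<n. m1 * fst (?D i \<omega>) + m2 * snd (?D i \<omega>) - (m1\<^sup>2 + m2\<^sup>2) * (t (Suc i) - t i) / 2)"
          by (simp add: sum_distrib_left sum.distrib sum_subtractf sum_divide_distrib right_diff_distrib diff_divide_distrib)
        finally show ?thesis by (simp add: exp_sum prod_ennreal)
      qed
      have "{\<omega> \<in> space M. \<forall>j<n. ?D (n - Suc j) \<omega> \<in> B j} = {\<omega> \<in> space M. \<forall>i<n. ?D i \<omega> \<in> ?C i}"
      proof (intro Collect_cong conj_cong refl iffI allI impI)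
        fix \<omega> i assume *: "\<forall>j<n. ?D (n - Suc j) \<omega> \<in> B j" and i: "i < n"
        from *[rule_format, of "n - Suc i"] i show "?D i \<omega> \<in> ?C i" by (simp add: Suc_diff_Suc)
      next
        fix \<omega> i assume *: "\<forall>i<n. ?D i \<omega> \<in> ?C i" and i: "i < n"
        from *[rule_format, of "n - Suc i"] i show "?D (n - Suc i) \<omega> \<in> B i" by (simp add: Suc_diff_Suc)
      qed
      then have "emeasure ?P {\<omega> \<in> space ?P. \<forall>j<n. ?D (n - Suc j) \<omega> \<in> B j} = emeasure ?P {\<omega> \<in> space M. \<forall>i<n. ?D i \<omega> \<in> ?C i}"
        by (simp only: space_density)
      also have "\<dots> = (\<integral>\<^sup>+ \<omega>. ?w \<omega> * indicator {\<omega> \<in> space M. \<forall>i<n. ?D i \<omega> \<in> ?C i} \<omega> \<partial>M)"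
        by (rule emeasure_density[OF wm incr_box_sets[where a="\<lambda>j. t (Suc j)" and b=t, OF C]])
      also have "\<dots> = (\<integral>\<^sup>+ \<omega>. (\<Prod>i<n. ennreal (?e i (?D i \<omega>)) * indicator (?C i) (?D i \<omega>)) \<partial>M)"
      proof (intro nn_integral_cong)
        fix \<omega> assume w: "\<omega> \<in> space M"
        have "indicator {\<omega> \<in> space M. \<forall>i<n. ?D i \<omega> \<in> ?C i} \<omega> = (\<Prod>i<n. indicator (?C i) (?D i \<omega>) :: ennreal)"
          unfolding prod_indicator_all using w by (simp add: indicator_def)
        then show "?w \<omega> * indicator {\<omega> \<in> space M. \<forall>i<n. ?D i \<omega> \<in> ?C i} \<omega> = (\<Prod>i<n. ennreal (?e i (?D i \<omega>)) * indicator (?C i) (?D i \<omega>))"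
          using wprod[OF w] by (simp only: prod.distrib)
      qed
      also have "\<dots> = (\<Prod>i<n. \<integral>\<^sup>+ p. ennreal (?e i p) * indicator (?C i) p \<partial>gauss2 (t (Suc i) - t i))"
        by (rule incr_nn_integral[where t=t and g="\<lambda>i p. ennreal (?e i p) * indicator (?C i) p", OF t n]) measurable
      also have "\<dots> = (\<Prod>i<n. \<integral>\<^sup>+ p. indicator (B (n - Suc i)) (m1 * (A / real n) - fst p, m2 * (A / real n) - snd p) \<partial>gauss2 (A / real n))"
        unfolding dt using A n by (intro prod.cong refl gauss2_tilt_reflect) auto
      also have "\<dots> = (\<Prod>i<n. \<integral>\<^sup>+ p. indicator (B i) (m1 * (A / real n) - fst p, m2 * (A / real n) - snd p) \<partial>gauss2 (A / real n))"
        by (rule prod.nat_diff_reindex)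
      also have "\<dots> = (\<integral>\<^sup>+ \<omega>. (\<Prod>i<n. indicator (B i) (m1 * (A / real n) - fst (?D i \<omega>), m2 * (A / real n) - snd (?D i \<omega>))) \<partial>M)"
        using incr_nn_integral[where t=t and g="\<lambda>i p. indicator (B i) (m1 * (A / real n) - fst p, m2 * (A / real n) - snd p)", OF t n, unfolded dt, symmetric]
        by measurable
      also have "\<dots> = (\<integral>\<^sup>+ \<omega>. indicator {\<omega> \<in> space M. \<forall>i<n. ?D' i \<omega> \<in> B i} \<omega> \<partial>M)"
        unfolding prod_indicator_all by (intro nn_integral_cong) (simp add: indicator_def)
      also have "\<dots> = emeasure M {\<omega> \<in> space M. \<forall>i<n. ?D' i \<omega> \<in> B i}"
      proof (rule nn_integral_indicator)
        have "{\<omega> \<in> space M. \<forall>i\<in>{..<n}. ?D' i \<omega> \<in> B i} \<in> sets M"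
          by (intro sets.sets_Collect_finite_All) auto
        then show "{\<omega> \<in> space M. \<forall>i<n. ?D' i \<omega> \<in> B i} \<in> sets M" by (simp add: Ball_def)
      qed
      finally show "emeasure ?P {\<omega> \<in> space ?P. \<forall>j<n. ?D (n - Suc j) \<omega> \<in> B j} = emeasure M {\<omega> \<in> space M. \<forall>j<n. ?D' j \<omega> \<in> B j}" .
    next
      fix i assume "i \<in> {..n}"
      then show "?h i \<in> borel_measurable (PiM {..<n} (\<lambda>_. borel \<Otimes>\<^sub>M borel))"
        by (intro continuous3_measurable[OF f] borel_measurable_sum) (auto intro!: measurable_compose[OF measurable_component_singleton])
    next
      fix i \<omega> assume i: "i \<in> {..n}" and "\<omega> \<in> space ?P"
      have ti: "t (n - i) = A - t i" using i n by (simp add: t_def of_nat_diff field_simps)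
      have rev: "(\<Sum>j<i. W (t (Suc (n - Suc j))) - W (t (n - Suc j))) = W A - W (A - t i)" for W :: "real \<Rightarrow> real"
      proof -
        have "(\<Sum>j<i. W (t (Suc (n - Suc j))) - W (t (n - Suc j))) = (\<Sum>j<i. (- W (t (n - Suc j))) - (- W (t (n - j))))"
          using i by (intro sum.cong) (auto simp: Suc_diff_Suc)
        also have "\<dots> = - W (t (n - i)) - (- W (t (n - 0)))"
          by (rule sum_lessThan_telescope[of "\<lambda>j. - W (t (n - j))" i])
        finally show ?thesis by (simp add: ti tn)
      qed
      have "(\<Sum>j<i. fst ((\<lambda>j\<in>{..<n}. ?D (n - Suc j) \<omega>) j)) = (\<Sum>j<i. X (t (Suc (n - Suc j))) \<omega> - X (t (n - Suc j)) \<omega>)"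
        using i by (intro sum.cong) auto
      moreover have "(\<Sum>j<i. snd ((\<lambda>j\<in>{..<n}. ?D (n - Suc j) \<omega>) j)) = (\<Sum>j<i. Y (t (Suc (n - Suc j))) \<omega> - Y (t (n - Suc j)) \<omega>)"
        using i by (intro sum.cong) auto
      ultimately show "?Z (t i) \<omega> = ?h i (\<lambda>j\<in>{..<n}. ?D (n - Suc j) \<omega>)"
        using rev[of "\<lambda>t. X t \<omega>"] rev[of "\<lambda>t. Y t \<omega>"] by (simp only:)
    next
      fix i \<omega> assume i: "i \<in> {..n}" and w: "\<omega> \<in> space M"
      have fwd: "(\<Sum>j<i. m * (A / real n) - (W (t (Suc j)) - W (t j))) = m * t i - W (t i)" if "W 0 = 0" for W :: "real \<Rightarrow> real" and m
      proof -
        have "(\<Sum>j<i. m * (A / real n) - (W (t (Suc j)) - W (t j))) = (\<Sum>j<i. (m * t (Suc j) - W (t (Suc j))) - (m * t j - W (t j)))"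
        proof (intro sum.cong refl)
          fix j
          have "m * (A / real n) = m * t (Suc j) - m * t j" by (simp only: dt[of j, symmetric] right_diff_distrib)
          then show "m * (A / real n) - (W (t (Suc j)) - W (t j)) = (m * t (Suc j) - W (t (Suc j))) - (m * t j - W (t j))" by simp
        qed
        also have "\<dots> = (m * t i - W (t i)) - (m * t 0 - W (t 0))"
          by (rule sum_lessThan_telescope[of "\<lambda>j. m * t j - W (t j)" i])
        finally show ?thesis using that by (simp add: t0)
      qed
      have "(\<Sum>j<i. fst ((\<lambda>j\<in>{..<n}. ?D' j \<omega>) j)) = (\<Sum>j<i. m1 * (A / real n) - (X (t (Suc j)) \<omega> - X (t j) \<omega>))"
        using i by (intro sum.cong) auto
      moreover have "(\<Sum>j<i. snd ((\<lambda>j\<in>{..<n}. ?D' j \<omega>) j)) = (\<Sum>j<i. m2 * (A / real n) - (Y (t (Suc j)) \<omega> - Y (t j) \<omega>))"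
        using i by (intro sum.cong) auto
      ultimately show "?Z' (t i) \<omega> = ?h i (\<lambda>j\<in>{..<n}. ?D' j \<omega>)"
        using fwd[of "\<lambda>t. X t \<omega>" m1, OF X_0[OF w]] fwd[of "\<lambda>t. Y t \<omega>" m2, OF Y_0[OF w]] by (simp only:)
    qed (use P prob_space_axioms in auto)
    then show "distr ?P (PiM {..n} (\<lambda>_. borel)) (\<lambda>\<omega>. \<lambda>i\<in>{..n}. ?Z (A * real i / real n) \<omega>) =
       distr M (PiM {..n} (\<lambda>_. borel)) (\<lambda>\<omega>. \<lambda>i\<in>{..n}. ?Z' (A * real i / real n) \<omega>)"
      unfolding t_def .
  qed
  moreover have "occ_prob ?P A L ?Z = (\<integral>\<^sup>+ \<omega>. ?w \<omega> * indicator {\<omega> \<in> space M. occ A (\<lambda>t. ?Z t \<omega>) > ennreal L} \<omega> \<partial>M)"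
  proof -
    have "{\<omega> \<in> space M. occ A (\<lambda>t. ?Z t \<omega>) > ennreal L} \<in> sets M" using occ_measurable[OF Zc] by measurable
    then show ?thesis unfolding occ_prob_def by (simp add: emeasure_density)
  qed
  ultimately show ?thesis by simp
qed

text \<open>The exponential martingale \<open>exp (T t - \<gamma> * t)\<close> does not change its mean over one grid step, also
when restricted to an event that depends on the past only.\<close>

lemma exp_martingale_step:
  fixes al be v :: real
  defines "\<gamma> \<equiv> (al\<^sup>2 + be\<^sup>2) / 2"
  defines "T \<equiv> \<lambda>t \<omega>. al * X t \<omega> + be * Y t \<omega>"
  assumes t: "t 0 = (0::real)" "\<And>i. i < Suc j \<Longrightarrow> t i < t (Suc i)"
  shows "(\<integral>\<^sup>+ \<omega>. ennreal (exp (T (t (Suc j)) \<omega> - \<gamma> * t (Suc j))) * indicator {\<omega>. \<forall>i\<le>j. T (t i) \<omega> \<le> v} \<omega> \<partial>M) =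
    (\<integral>\<^sup>+ \<omega>. ennreal (exp (T (t j) \<omega> - \<gamma> * t j)) * indicator {\<omega>. \<forall>i\<le>j. T (t i) \<omega> \<le> v} \<omega> \<partial>M)"
proof -
  let ?D = "\<lambda>j \<omega>. (X (t (Suc j)) \<omega> - X (t j) \<omega>, Y (t (Suc j)) \<omega> - Y (t j) \<omega>)"
  let ?S = "\<lambda>i d. al * (\<Sum>k<i. fst (d k)) + be * (\<Sum>k<i. snd (d k :: real \<times> real))"
  let ?F = "\<lambda>d. ennreal (exp (?S j d - \<gamma> * t j)) * indicator {d. \<forall>i\<in>{..j}. ?S i d \<le> v} d"
  let ?H = "\<lambda>d. ennreal (exp (al * fst (d j) + be * snd (d j :: real \<times> real) - \<gamma> * (t (Suc j) - t j)))"
  let ?U = "\<lambda>\<omega>. \<lambda>i\<in>{..<j}. ?D i \<omega>" and ?V = "\<lambda>\<omega>. \<lambda>i\<in>{j}. ?D i \<omega>"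
  have "0 \<le> t k" if "k \<le> j" for k
    using that
  proof (induction k)
    case (Suc k)
    then have "0 \<le> t k" "t k < t (Suc k)" using t(2)[of k] by simp_all
    then show ?case by simp
  qed (simp add: t(1))
  then have tn: "0 \<le> t j" by simp
  have I: "indep_vars (\<lambda>_. borel \<Otimes>\<^sub>M borel) ?D {..<Suc j}"
    using t by (intro incr_indep[of t "Suc j"]) simp_all
  have UV: "indep_var (PiM {..<j} (\<lambda>_. borel \<Otimes>\<^sub>M borel)) ?U (PiM {j} (\<lambda>_. borel \<Otimes>\<^sub>M borel)) ?V"
    by (rule indep_var_restrict[OF I]) auto
  have Sm[measurable]: "?S i \<in> borel_measurable (PiM {..<j} (\<lambda>_. borel \<Otimes>\<^sub>M borel))" if "i \<le> j" for i
    using that by (intro borel_measurable_add borel_measurable_times borel_measurable_const borel_measurable_sum)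
      (auto intro!: measurable_compose[OF measurable_component_singleton])
  have Fm: "?F \<in> borel_measurable (PiM {..<j} (\<lambda>_. borel \<Otimes>\<^sub>M borel))"
  proof (intro borel_measurable_times_ennreal)
    show "(\<lambda>d. ennreal (exp (?S j d - \<gamma> * t j))) \<in> borel_measurable (PiM {..<j} (\<lambda>_. borel \<Otimes>\<^sub>M borel))"
      using Sm[of j] by measurable
    have "{d \<in> space (PiM {..<j} (\<lambda>_. borel \<Otimes>\<^sub>M borel :: (real \<times> real) measure)). \<forall>i\<in>{..j}. ?S i d \<le> v} \<in> sets (PiM {..<j} (\<lambda>_. borel \<Otimes>\<^sub>M borel))"
      by (intro sets.sets_Collect_finite_All borel_measurable_le Sm) auto
    then show "(indicator {d. \<forall>i\<in>{..j}. ?S i d \<le> v} :: _ \<Rightarrow> ennreal) \<in> borel_measurable (PiM {..<j} (\<lambda>_. borel \<Otimes>\<^sub>M borel))"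
      by (intro borel_measurable_indicator_Int) (simp add: Int_def conj_commute)
  qed
  have Hm: "?H \<in> borel_measurable (PiM {j} (\<lambda>_. borel \<Otimes>\<^sub>M borel))"
    by measurable
  have Sx: "?S i (?U \<omega>) = T (t i) \<omega>" if "i \<le> j" "\<omega> \<in> space M" for i \<omega>
  proof -
    have "(\<Sum>k<i. fst (?U \<omega> k)) = (\<Sum>k<i. X (t (Suc k)) \<omega> - X (t k) \<omega>)"
      using that by (intro sum.cong) auto
    also have "\<dots> = X (t i) \<omega> - X (t 0) \<omega>" by (rule sum_lessThan_telescope[of "\<lambda>j. X (t j) \<omega>" i])
    finally have x: "(\<Sum>k<i. fst (?U \<omega> k)) = X (t i) \<omega>" unfolding t(1) X_0[OF that(2)] by simp
    have "(\<Sum>k<i. snd (?U \<omega> k)) = (\<Sum>k<i. Y (t (Suc k)) \<omega> - Y (t k) \<omega>)"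
      using that by (intro sum.cong) auto
    also have "\<dots> = Y (t i) \<omega> - Y (t 0) \<omega>" by (rule sum_lessThan_telescope[of "\<lambda>j. Y (t j) \<omega>" i])
    finally have y: "(\<Sum>k<i. snd (?U \<omega> k)) = Y (t i) \<omega>" unfolding t(1) Y_0[OF that(2)] by simp
    have "?S i (?U \<omega>) = al * X (t i) \<omega> + be * Y (t i) \<omega>"
      by (rule arg_cong2[OF x y, of "\<lambda>a b. al * a + be * b"])
    then show ?thesis by (simp only: T_def)
  qed
  have FU: "?F (?U \<omega>) = ennreal (exp (T (t j) \<omega> - \<gamma> * t j)) * indicator {\<omega>. \<forall>i\<le>j. T (t i) \<omega> \<le> v} \<omega>"
    if "\<omega> \<in> space M" for \<omega>
  proof -
    have "(\<forall>i\<in>{..j}. ?S i (?U \<omega>) \<le> v) \<longleftrightarrow> (\<forall>i\<le>j. T (t i) \<omega> \<le> v)"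
    proof (intro iffI ballI allI impI)
      fix i assume h: "\<forall>i\<in>{..j}. ?S i (?U \<omega>) \<le> v" and i: "i \<le> j"
      have "?S i (?U \<omega>) \<le> v" by (rule bspec[OF h atMost_iff[THEN iffD2, OF i]])
      then show "T (t i) \<omega> \<le> v" unfolding Sx[OF i that] .
    next
      fix i assume h: "\<forall>i\<le>j. T (t i) \<omega> \<le> v" and "i \<in> {..j}"
      then have i: "i \<le> j" by simp
      show "?S i (?U \<omega>) \<le> v" unfolding Sx[OF i that] using h i by blast
    qed
    then have "indicator {d. \<forall>i\<in>{..j}. ?S i d \<le> v} (?U \<omega>) = (indicator {\<omega>. \<forall>i\<le>j. T (t i) \<omega> \<le> v} \<omega> :: ennreal)"
      by (simp only: indicator_def mem_Collect_eq)
    then show ?thesis unfolding Sx[OF order_refl that] by (rule arg_cong)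
  qed
  have HV: "(\<integral>\<^sup>+ \<omega>. ?H (?V \<omega>) \<partial>M) = 1"
  proof -
    have "(\<integral>\<^sup>+ \<omega>. ?H (?V \<omega>) \<partial>M) = (\<integral>\<^sup>+ \<omega>. (\<lambda>p. ennreal (exp (al * fst p + be * snd p - (al\<^sup>2 + be\<^sup>2) * (t (Suc j) - t j) / 2))) (?D j \<omega>) \<partial>M)"
      by (simp add: \<gamma>_def)
    also have "\<dots> = (\<integral>\<^sup>+ p. ennreal (exp (al * fst p + be * snd p - (al\<^sup>2 + be\<^sup>2) * (t (Suc j) - t j) / 2)) \<partial>gauss2 (t (Suc j) - t j))"
      by (subst incr_law[OF tn t(2)[OF lessI], symmetric], subst nn_integral_distr) auto
    also have "\<dots> = 1" by (rule nn_integral_gauss_exp) (use t in auto)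
    finally show ?thesis .
  qed
  have "(\<integral>\<^sup>+ \<omega>. ennreal (exp (T (t (Suc j)) \<omega> - \<gamma> * t (Suc j))) * indicator {\<omega>. \<forall>i\<le>j. T (t i) \<omega> \<le> v} \<omega> \<partial>M) =
     (\<integral>\<^sup>+ \<omega>. ?F (?U \<omega>) * ?H (?V \<omega>) \<partial>M)"
  proof (intro nn_integral_cong)
    fix \<omega> assume w: "\<omega> \<in> space M"
    have "exp (T (t (Suc j)) \<omega> - \<gamma> * t (Suc j)) = exp (T (t j) \<omega> - \<gamma> * t j) *
      exp (al * fst (?D j \<omega>) + be * snd (?D j \<omega>) - \<gamma> * (t (Suc j) - t j))"
      unfolding T_def by (simp add: mult_exp_exp algebra_simps)
    then have "ennreal (exp (T (t (Suc j)) \<omega> - \<gamma> * t (Suc j))) = ennreal (exp (T (t j) \<omega> - \<gamma> * t j)) * ?H (?V \<omega>)"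
      by (simp add: ennreal_mult)
    from this show "ennreal (exp (T (t (Suc j)) \<omega> - \<gamma> * t (Suc j))) * indicator {\<omega>. \<forall>i\<le>j. T (t i) \<omega> \<le> v} \<omega> =
       ?F (?U \<omega>) * ?H (?V \<omega>)"
      unfolding FU[OF w] by (simp only: mult_ac)
  qed
  also have "\<dots> = (\<integral>\<^sup>+ \<omega>. ?F (?U \<omega>) \<partial>M) * (\<integral>\<^sup>+ \<omega>. ?H (?V \<omega>) \<partial>M)"
    by (rule indep_var_nn_integral_mult[OF UV Fm Hm])
  also have "\<dots> = (\<integral>\<^sup>+ \<omega>. ?F (?U \<omega>) \<partial>M)" unfolding HV by simp
  also have "\<dots> = (\<integral>\<^sup>+ \<omega>. ennreal (exp (T (t j) \<omega> - \<gamma> * t j)) * indicator {\<omega>. \<forall>i\<le>j. T (t i) \<omega> \<le> v} \<omega> \<partial>M)"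
    by (intro nn_integral_cong FU)
  finally show ?thesis .
qed

text \<open>Doob's argument by induction over the grid: on paths that have not yet crossed the level \<open>v\<close> keep the
exponential martingale, on paths that have crossed keep the constant \<open>c = exp (v - \<gamma> * A)\<close>. At the
first crossing the martingale is at least \<open>c\<close>, so the total never exceeds its initial value 1.\<close>

lemma maximal_grid:
  fixes al be v A :: real and N :: nat
  assumes A: "0 < A" and N: "0 < N"
  defines "\<gamma> \<equiv> (al\<^sup>2 + be\<^sup>2) / 2"
  defines "S \<equiv> {\<omega> \<in> space M. \<exists>j\<le>N. v < al * X (A * real j / real N) \<omega> + be * Y (A * real j / real N) \<omega>}"
  shows "S \<in> sets M" and "emeasure M S \<le> ennreal (exp (\<gamma> * A - v))"
proof -
  define t where "t = (\<lambda>i. A * real i / real N)"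
  have t: "t 0 = 0" "\<And>i. t i < t (Suc i)" and tA: "\<And>i. i \<le> N \<Longrightarrow> t i \<le> A"
    using A N by (auto intro!: divide_strict_right_mono simp: t_def field_simps)
  define T where "T = (\<lambda>t \<omega>. al * X t \<omega> + be * Y t \<omega>)"
  define G where "G = (\<lambda>j. {\<omega>. \<forall>i\<le>j. T (t i) \<omega> \<le> v})"
  define E where "E = (\<lambda>j \<omega>. ennreal (exp (T (t j) \<omega> - \<gamma> * t j)))"
  define c where "c = ennreal (exp (v - \<gamma> * A))"
  have Tm[measurable]: "T s \<in> borel_measurable M" for s unfolding T_def by measurable
  have Gs: "G j \<inter> space M \<in> sets M" for j
  proof -
    have "{\<omega> \<in> space M. \<forall>i\<in>{..j}. T (t i) \<omega> \<le> v} \<in> sets M"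
      by (intro sets.sets_Collect_finite_All) auto
    also have "{\<omega> \<in> space M. \<forall>i\<in>{..j}. T (t i) \<omega> \<le> v} = G j \<inter> space M" by (auto simp: G_def)
    finally show ?thesis .
  qed
  have Gm[measurable]: "(indicator (G j) :: 'a \<Rightarrow> ennreal) \<in> borel_measurable M" "(indicator (- G j) :: 'a \<Rightarrow> ennreal) \<in> borel_measurable M" for j
  proof -
    show "(indicator (G j) :: 'a \<Rightarrow> ennreal) \<in> borel_measurable M" by (intro borel_measurable_indicator_Int Gs)
    have "- G j \<inter> space M = space M - (G j \<inter> space M)" by auto
    then show "(indicator (- G j) :: 'a \<Rightarrow> ennreal) \<in> borel_measurable M" using Gs[of j] by (intro borel_measurable_indicator_Int) auto
  qed
  have Em[measurable]: "E j \<in> borel_measurable M" for j unfolding E_def by measurable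
  have \<gamma>0: "0 \<le> \<gamma>" by (simp add: \<gamma>_def)
  have step: "(\<integral>\<^sup>+ \<omega>. E (Suc j) \<omega> * indicator (G j) \<omega> \<partial>M) = (\<integral>\<^sup>+ \<omega>. E j \<omega> * indicator (G j) \<omega> \<partial>M)" for j
    using exp_martingale_step[of t j al be v, OF t(1) t(2)] unfolding E_def G_def T_def \<gamma>_def .
  have main: "(\<integral>\<^sup>+ \<omega>. E j \<omega> * indicator (G j) \<omega> + c * indicator (- G j) \<omega> \<partial>M) \<le> 1" if "j \<le> N" for j
    using that
  proof (induction j)
    case 0
    have "E 0 \<omega> * indicator (G 0) \<omega> + c * indicator (- G 0) \<omega> \<le> 1" if "\<omega> \<in> space M" for \<omega>
    proof (cases "0 \<le> v")
      case True
      then show ?thesis using that by (simp add: E_def G_def T_def t(1) X_0 Y_0)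
    next
      case False
      then have "c \<le> 1" unfolding c_def using \<gamma>0 A by (simp add: ennreal_le_1) (smt (verit) mult_nonneg_nonneg)
      then show ?thesis using that False by (simp add: E_def G_def T_def t(1) X_0 Y_0)
    qed
    then have "(\<integral>\<^sup>+ \<omega>. E 0 \<omega> * indicator (G 0) \<omega> + c * indicator (- G 0) \<omega> \<partial>M) \<le> (\<integral>\<^sup>+ \<omega>. 1 \<partial>M)"
      by (intro nn_integral_mono)
    then show ?case by (simp add: emeasure_space_1)
  next
    case (Suc j)
    have "E (Suc j) \<omega> * indicator (G (Suc j)) \<omega> + c * indicator (- G (Suc j)) \<omega> \<le>
       E (Suc j) \<omega> * indicator (G j) \<omega> + c * indicator (- G j) \<omega>" for \<omega>
    proof (cases "\<omega> \<in> G (Suc j)")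
      case True
      then have "\<omega> \<in> G j" by (auto simp: G_def)
      then show ?thesis using True by simp
    next
      case False
      show ?thesis
      proof (cases "\<omega> \<in> G j")
        case True
        with False have "v < T (t (Suc j)) \<omega>" unfolding G_def by (auto simp: le_Suc_eq not_le)
        moreover have "\<gamma> * t (Suc j) \<le> \<gamma> * A" using tA[OF Suc.prems] \<gamma>0 by (rule mult_left_mono)
        ultimately have "c \<le> E (Suc j) \<omega>" unfolding c_def E_def by (intro ennreal_leI) simp
        then show ?thesis using True False by simp
      next
        case F: False
        then show ?thesis using False by simp
      qed
    qed
    then have "(\<integral>\<^sup>+ \<omega>. E (Suc j) \<omega> * indicator (G (Suc j)) \<omega> + c * indicator (- G (Suc j)) \<omega> \<partial>M) \<le>
       (\<integral>\<^sup>+ \<omega>. E (Suc j) \<omega> * indicator (G j) \<omega> + c * indicator (- G j) \<omega> \<partial>M)"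
      by (intro nn_integral_mono)
    also have "\<dots> = (\<integral>\<^sup>+ \<omega>. E (Suc j) \<omega> * indicator (G j) \<omega> \<partial>M) + (\<integral>\<^sup>+ \<omega>. c * indicator (- G j) \<omega> \<partial>M)"
      by (rule nn_integral_add) measurable
    also have "\<dots> = (\<integral>\<^sup>+ \<omega>. E j \<omega> * indicator (G j) \<omega> \<partial>M) + (\<integral>\<^sup>+ \<omega>. c * indicator (- G j) \<omega> \<partial>M)"
      by (simp only: step)
    also have "\<dots> = (\<integral>\<^sup>+ \<omega>. E j \<omega> * indicator (G j) \<omega> + c * indicator (- G j) \<omega> \<partial>M)"
      by (rule nn_integral_add[symmetric]) measurable
    also have "\<dots> \<le> 1" using Suc by simp
    finally show ?case .
  qed
  have SG: "S = space M - (G N \<inter> space M)" unfolding S_def G_def T_def t_def by (auto simp: not_le)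
  then show S: "S \<in> sets M" using Gs by auto
  have "c * emeasure M S = (\<integral>\<^sup>+ \<omega>. c * indicator S \<omega> \<partial>M)" using S by (simp add: nn_integral_cmult)
  also have "\<dots> \<le> (\<integral>\<^sup>+ \<omega>. E N \<omega> * indicator (G N) \<omega> + c * indicator (- G N) \<omega> \<partial>M)"
    by (intro nn_integral_mono) (auto simp: SG indicator_def)
  also have "\<dots> \<le> 1" by (rule main) simp
  finally have "ennreal (exp (\<gamma> * A - v)) * (c * emeasure M S) \<le> ennreal (exp (\<gamma> * A - v)) * 1"
    by (rule mult_left_mono) simp
  moreover have "ennreal (exp (\<gamma> * A - v)) * c = 1"
    unfolding c_def by (subst ennreal_mult[symmetric]) (auto simp: mult_exp_exp)
  ultimately show "emeasure M S \<le> ennreal (exp (\<gamma> * A - v))"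
    by (simp add: mult.assoc[symmetric])
qed

lemma maximal_inequality:
  fixes al be v A :: real
  assumes A: "0 < A"
  defines "\<gamma> \<equiv> (al\<^sup>2 + be\<^sup>2) / 2"
  defines "S \<equiv> {\<omega> \<in> space M. \<exists>t. 0 \<le> t \<and> t \<le> A \<and> v < al * X t \<omega> + be * Y t \<omega>}"
  shows "S \<in> sets M" and "emeasure M S \<le> ennreal (exp (\<gamma> * A - v))"
proof -
  \<comment> \<open>Dyadic grids increase, so the grid events do as well; continuity of the paths gives all times.\<close>
  define R where "R = (\<lambda>n::nat. {\<omega> \<in> space M. \<exists>j\<le>2^n. v < al * X (A * real j / real (2^n)) \<omega> + be * Y (A * real j / real (2^n)) \<omega>})"
  have Rm: "R n \<in> sets M" for n unfolding R_def by (rule maximal_grid(1)[OF A]) simp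
  have Rb: "emeasure M (R n) \<le> ennreal (exp (\<gamma> * A - v))" for n
    unfolding R_def \<gamma>_def by (rule maximal_grid(2)[OF A]) simp
  have inc: "incseq R"
  proof (rule incseq_SucI, rule subsetI)
    fix n \<omega> assume "\<omega> \<in> R n"
    then obtain j where "\<omega> \<in> space M" "j \<le> 2^n" "v < al * X (A * real j / real (2^n)) \<omega> + be * Y (A * real j / real (2^n)) \<omega>"
      by (auto simp: R_def)
    moreover have "A * real (2 * j) / real (2 ^ Suc n) = A * real j / real (2^n)" by simp
    ultimately show "\<omega> \<in> R (Suc n)" unfolding R_def by (auto intro!: exI[of _ "2 * j"])
  qed
  have SR: "S = (\<Union>n. R n)"
  proof (intro set_eqI iffI)
    fix \<omega> assume "\<omega> \<in> S"
    then obtain t where w: "\<omega> \<in> space M" and t: "0 \<le> t" "t \<le> A" and v: "v < al * X t \<omega> + be * Y t \<omega>"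
      by (auto simp: S_def)
    define s where "s = (\<lambda>n::nat. A * of_int \<lfloor>2 ^ n * t / A\<rfloor> / 2 ^ n)"
    have c: "isCont (\<lambda>t. X t \<omega>) t" "isCont (\<lambda>t. Y t \<omega>) t"
      using X_proc Y_proc w by (auto simp: cont_proc_def continuous_on_eq_continuous_at)
    have st: "s \<longlonglongrightarrow> t" unfolding s_def using A by real_asymp
    have "(\<lambda>n. al * X (s n) \<omega> + be * Y (s n) \<omega>) \<longlonglongrightarrow> al * X t \<omega> + be * Y t \<omega>"
      by (intro tendsto_intros isCont_tendsto_compose[OF c(1) st] isCont_tendsto_compose[OF c(2) st])
    from order_tendstoD(1)[OF this v] obtain n where n: "v < al * X (s n) \<omega> + be * Y (s n) \<omega>"
      by (auto simp: eventually_sequentially)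
    define j where "j = nat \<lfloor>2 ^ n * t / A\<rfloor>"
    have "0 \<le> 2 ^ n * t / A" "2 ^ n * t / A \<le> 2 ^ n" using t A by (auto simp: field_simps)
    then have ji: "of_int \<lfloor>2 ^ n * t / A\<rfloor> = real j"
      unfolding j_def by simp
    have "real j \<le> 2 ^ n" using of_int_floor_le[of "2 ^ n * t / A"] \<open>2 ^ n * t / A \<le> 2 ^ n\<close> unfolding ji by linarith
    then have "j \<le> 2 ^ n" by (metis of_nat_le_iff of_nat_numeral of_nat_power)
    then have "\<omega> \<in> R n" using n w unfolding R_def s_def ji by (auto intro!: exI[of _ j])
    then show "\<omega> \<in> (\<Union>n. R n)" by auto
  next
    fix \<omega> assume "\<omega> \<in> (\<Union>n. R n)"
    then obtain n j where "\<omega> \<in> space M" "j \<le> 2^n" "v < al * X (A * real j / real (2^n)) \<omega> + be * Y (A * real j / real (2^n)) \<omega>"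
      by (auto simp: R_def)
    moreover have "A * real j / real (2^n) \<le> A"
    proof -
      have "real j \<le> real (2^n)" using \<open>j \<le> 2^n\<close> by (simp only: of_nat_le_iff)
      then show ?thesis using A by (simp add: field_simps)
    qed
    ultimately show "\<omega> \<in> S" using A unfolding S_def by (auto intro!: exI[of _ "A * real j / real (2^n)"])
  qed
  show "S \<in> sets M" unfolding SR using Rm by auto
  have "emeasure M S = (SUP n. emeasure M (R n))"
    unfolding SR using Rm inc by (intro SUP_emeasure_incseq[symmetric]) auto
  also have "\<dots> \<le> ennreal (exp (\<gamma> * A - v))" by (intro SUP_least Rb)
  finally show "emeasure M S \<le> ennreal (exp (\<gamma> * A - v))" .
qed

end

section \<open>Asymptotics of Gaussian densities\<close>

text \<open>Density, at the scaled time \<open>u\<^sup>2 - B\<close>, of a Brownian motion at distance \<open>z\<close> beyond the barrier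
\<open>k * u\<^sup>2 + d * t / u\<close>.\<close>

definition dens :: "real \<Rightarrow> real \<Rightarrow> real \<Rightarrow> real \<Rightarrow> real \<Rightarrow> real" where
  "dens k d B u z = normal_density 0 (sqrt (u\<^sup>2 - B)) (k * u\<^sup>2 + d * (u\<^sup>2 - B) / u + z)"

text \<open>The value \<open>dens k d 0 u 0\<close> for positive \<open>u\<close>, written out: the common exponential order of all these densities.\<close>

definition rate :: "real \<Rightarrow> real \<Rightarrow> real \<Rightarrow> real" where
  "rate k d u = exp (- (k\<^sup>2 * u\<^sup>2 / 2 + k * d * u + d\<^sup>2 / 2)) / (sqrt (2 * pi) * u)"

lemma rate_pos: "0 < u \<Longrightarrow> 0 < rate k d u"
  by (simp add: rate_def)

lemma dens_nonneg: "0 \<le> dens k d B u z"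
  by (simp add: dens_def)

lemma dens_measurable[measurable]: "(\<lambda>z. dens k d B u z) \<in> borel_measurable borel"
  unfolding dens_def by measurable

lemma dens_over_rate:
  assumes u: "0 < u" and v: "B < u\<^sup>2"
  shows "dens k d B u z / rate k d u = u / sqrt (u\<^sup>2 - B) *
    exp (- (k\<^sup>2 * B / 2) - k\<^sup>2 * B\<^sup>2 * (1 / (2 * (u\<^sup>2 - B))) + d\<^sup>2 * B / 2 * (1 / u\<^sup>2)
         - z\<^sup>2 * (1 / (2 * (u\<^sup>2 - B))) - k * z * (u\<^sup>2 / (u\<^sup>2 - B)) - d * z * (1 / u))"
proof -
  define w where "w = u\<^sup>2 - B"
  have w: "0 < w" and B: "B = u\<^sup>2 - w" using v by (auto simp: w_def)
  have e: "- ((k * u\<^sup>2 + d * w / u + z)\<^sup>2 / (2 * w)) + (k\<^sup>2 * u\<^sup>2 / 2 + k * d * u + d\<^sup>2 / 2) =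
     - (k\<^sup>2 * B / 2) - k\<^sup>2 * B\<^sup>2 * (1 / (2 * w)) + d\<^sup>2 * B / 2 * (1 / u\<^sup>2)
         - z\<^sup>2 * (1 / (2 * w)) - k * z * (u\<^sup>2 / w) - d * z * (1 / u)"
    unfolding B using u w by (simp add: field_simps power2_eq_square)
  have "dens k d B u z / rate k d u = u / sqrt w *
      (exp (- ((k * u\<^sup>2 + d * w / u + z)\<^sup>2 / (2 * w))) * exp (k\<^sup>2 * u\<^sup>2 / 2 + k * d * u + d\<^sup>2 / 2))"
    using u w unfolding dens_def rate_def normal_density_def w_def[symmetric]
    by (simp add: real_sqrt_mult exp_minus field_simps)
  also have "\<dots> = u / sqrt w * exp (- ((k * u\<^sup>2 + d * w / u + z)\<^sup>2 / (2 * w)) + (k\<^sup>2 * u\<^sup>2 / 2 + k * d * u + d\<^sup>2 / 2))"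
    by (simp only: exp_add)
  also have "\<dots> = u / sqrt w * exp (- (k\<^sup>2 * B / 2) - k\<^sup>2 * B\<^sup>2 * (1 / (2 * w)) + d\<^sup>2 * B / 2 * (1 / u\<^sup>2)
         - z\<^sup>2 * (1 / (2 * w)) - k * z * (u\<^sup>2 / w) - d * z * (1 / u))"
    by (simp only: e)
  finally show ?thesis unfolding w_def .
qed

text \<open>In \<open>dens_over_rate\<close> every term except \<open>k\<^sup>2 * B / 2\<close> and \<open>k * z\<close> carries a factor that vanishes as
\<open>u \<rightarrow> \<infinity>\<close>. The shift \<open>e / u\<close> disappears in the limit, which is why drifts of size \<open>r / u\<close> may be
traded for shifts of the starting point.\<close>

lemma dens_over_rate_limit:
  "((\<lambda>u. dens k d B u (z + e / u) / rate k d u) \<longlongrightarrow> exp (- (k\<^sup>2 * B / 2) - k * z)) at_top"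
proof -
  have ev: "eventually (\<lambda>u::real. 0 < u \<and> B < u\<^sup>2) at_top" 
  proof (intro eventually_conj eventually_gt_at_top)
    show "eventually (\<lambda>u::real. B < u\<^sup>2) at_top" by real_asymp
  qed
  have t1: "((\<lambda>u::real. 1 / (2 * (u\<^sup>2 - B))) \<longlongrightarrow> 0) at_top" by real_asymp
  have t2: "((\<lambda>u::real. 1 / u\<^sup>2) \<longlongrightarrow> 0) at_top" by real_asymp
  have t3: "((\<lambda>u::real. 1 / u) \<longlongrightarrow> 0) at_top" by real_asymp
  have t4: "((\<lambda>u::real. u\<^sup>2 / (u\<^sup>2 - B)) \<longlongrightarrow> 1) at_top" by real_asymp
  have t5: "((\<lambda>u::real. u / sqrt (u\<^sup>2 - B)) \<longlongrightarrow> 1) at_top" by real_asymp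
  have t6: "((\<lambda>u::real. z + e * (1 / u)) \<longlongrightarrow> z + e * 0) at_top" by (intro tendsto_intros t3)
  have "((\<lambda>u. u / sqrt (u\<^sup>2 - B) *
    exp (- (k\<^sup>2 * B / 2) - k\<^sup>2 * B\<^sup>2 * (1 / (2 * (u\<^sup>2 - B))) + d\<^sup>2 * B / 2 * (1 / u\<^sup>2)
         - (z + e * (1 / u))\<^sup>2 * (1 / (2 * (u\<^sup>2 - B))) - k * (z + e * (1 / u)) * (u\<^sup>2 / (u\<^sup>2 - B)) - d * (z + e * (1 / u)) * (1 / u)))
     \<longlongrightarrow> 1 * exp (- (k\<^sup>2 * B / 2) - k\<^sup>2 * B\<^sup>2 * 0 + d\<^sup>2 * B / 2 * 0
         - (z + e * 0)\<^sup>2 * 0 - k * (z + e * 0) * 1 - d * (z + e * 0) * 0)) at_top"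
    by (intro tendsto_mult tendsto_exp tendsto_add tendsto_diff tendsto_power tendsto_const t1 t2 t3 t4 t5)
  then have "((\<lambda>u. u / sqrt (u\<^sup>2 - B) *
    exp (- (k\<^sup>2 * B / 2) - k\<^sup>2 * B\<^sup>2 * (1 / (2 * (u\<^sup>2 - B))) + d\<^sup>2 * B / 2 * (1 / u\<^sup>2)
         - (z + e / u)\<^sup>2 * (1 / (2 * (u\<^sup>2 - B))) - k * (z + e / u) * (u\<^sup>2 / (u\<^sup>2 - B)) - d * (z + e / u) * (1 / u)))
     \<longlongrightarrow> exp (- (k\<^sup>2 * B / 2) - k * z)) at_top" by simp
  then show ?thesis
    by (rule tendsto_cong[THEN iffD2, rotated]) (use ev in eventually_elim, rule dens_over_rate, auto)
qed

text \<open>Uniform in \<open>B\<close> over the second half of the time interval. The exponent is controlled by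
\<open>(u\<^sup>2 + B) * (u\<^sup>2 - B) \<le> u\<^sup>4\<close> and by dropping a square; the prefactor costs at most 2.\<close>

lemma dens_bound:
  assumes u: "0 < u" and v: "u\<^sup>2 / 2 \<le> u\<^sup>2 - B"
  shows "dens k d B u z \<le> rate k d u * (2 * exp (d\<^sup>2 / 2) * exp (- (k\<^sup>2 * B / 2)) * exp (- (u\<^sup>2 / (u\<^sup>2 - B) * (k * z))))"
proof -
  define w where "w = u\<^sup>2 - B"
  have u2: "0 < u\<^sup>2" using u by simp
  have v': "u\<^sup>2 / 2 \<le> w" and B: "B = u\<^sup>2 - w" using v by (simp_all add: w_def)
  have w: "0 < w" and uw: "u\<^sup>2 \<le> 2 * w" using v' u2 by linarith+
  have sq: "(a + (a - b)) * b \<le> a * a" for a b :: real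
    using zero_le_power2[of "a - b"] by (simp add: power2_eq_square algebra_simps)
  have "(u\<^sup>2 + B) * w \<le> u\<^sup>2 * u\<^sup>2" using sq[of "u\<^sup>2" w] by (simp only: B)
  then have "u\<^sup>2 + B \<le> u\<^sup>2 * u\<^sup>2 / w" using w by (simp add: field_simps)
  then have "k\<^sup>2 / 2 * (u\<^sup>2 + B) \<le> k\<^sup>2 / 2 * (u\<^sup>2 * u\<^sup>2 / w)" by (rule mult_left_mono) simp
  moreover have "(k * u\<^sup>2 + d * w / u + z)\<^sup>2 / (2 * w) = k\<^sup>2 / 2 * (u\<^sup>2 * u\<^sup>2 / w) + k * d * u + u\<^sup>2 / w * (k * z) + (d * w / u + z)\<^sup>2 / (2 * w)"
    using u w by (simp add: field_simps power2_eq_square)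
  moreover have "0 \<le> (d * w / u + z)\<^sup>2 / (2 * w)" using w by simp
  moreover have "k\<^sup>2 / 2 * (u\<^sup>2 + B) = k\<^sup>2 * u\<^sup>2 / 2 + k\<^sup>2 * B / 2"
    by (simp only: distrib_left times_divide_eq_left)
  ultimately have e: "- ((k * u\<^sup>2 + d * w / u + z)\<^sup>2 / (2 * w)) \<le>
      - (k\<^sup>2 * u\<^sup>2 / 2 + k * d * u + d\<^sup>2 / 2) + (d\<^sup>2 / 2 + - (k\<^sup>2 * B / 2) + - (u\<^sup>2 / w * (k * z)))"
    by linarith
  have "(2 * sqrt w)\<^sup>2 = 4 * w" using w by (simp add: power_mult_distrib)
  then have "u\<^sup>2 \<le> (2 * sqrt w)\<^sup>2" using uw w by linarith
  then have su: "u \<le> 2 * sqrt w" by (rule power2_le_imp_le) (use w in simp)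
  have "dens k d B u z = 1 / sqrt (2 * pi * w) * exp (- ((k * u\<^sup>2 + d * w / u + z)\<^sup>2 / (2 * w)))"
    using w unfolding dens_def normal_density_def w_def[symmetric] by simp
  also have "\<dots> \<le> 2 / (sqrt (2 * pi) * u) * exp (- (k\<^sup>2 * u\<^sup>2 / 2 + k * d * u + d\<^sup>2 / 2) + (d\<^sup>2 / 2 + - (k\<^sup>2 * B / 2) + - (u\<^sup>2 / w * (k * z))))"
  proof (rule mult_mono)
    show "1 / sqrt (2 * pi * w) \<le> 2 / (sqrt (2 * pi) * u)"
      using su u w by (simp add: real_sqrt_mult field_simps)
  qed (use e u in auto)
  also have "\<dots> = rate k d u * (2 * exp (d\<^sup>2 / 2) * exp (- (k\<^sup>2 * B / 2)) * exp (- (u\<^sup>2 / w * (k * z))))"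
    unfolding rate_def by (simp only: exp_add) simp
  finally show ?thesis unfolding w_def .
qed

lemma time_ratio_bounds:
  fixes u B :: real
  assumes u: "0 < u" and v: "u\<^sup>2 / 2 \<le> u\<^sup>2 - B" and B: "- u\<^sup>2 \<le> B"
  shows "1 / 2 \<le> u\<^sup>2 / (u\<^sup>2 - B)" "u\<^sup>2 / (u\<^sup>2 - B) \<le> 2"
proof -
  have "0 < u\<^sup>2" using u by simp
  then have "0 < u\<^sup>2 - B" using v by linarith
  then show "1 / 2 \<le> u\<^sup>2 / (u\<^sup>2 - B)" "u\<^sup>2 / (u\<^sup>2 - B) \<le> 2"
    using v B by (auto simp: field_simps)
qed

text \<open>Removes the factor \<open>u\<^sup>2 / (u\<^sup>2 - B)\<close>, which lies between 1/2 and 2, from the exponent in \<open>dens_bound\<close>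
and so yields a dominating function that does not depend on \<open>u\<close>.\<close>

lemma exp_between:
  fixes s v :: real
  assumes "1 / 2 \<le> s" "s \<le> 2"
  shows "exp (- (s * v)) \<le> exp (- (v / 2)) + exp (- (2 * v))"
proof (cases "0 \<le> v")
  case True
  then have "1 / 2 * v \<le> s * v" using assms by (intro mult_right_mono) auto
  then have "exp (- (s * v)) \<le> exp (- (v / 2))" by simp
  then show ?thesis by (smt (verit) exp_gt_zero)
next
  case False
  then have "2 * v \<le> s * v" using assms by (intro mult_right_mono_neg) auto
  then have "exp (- (s * v)) \<le> exp (- (2 * v))" by simp
  then show ?thesis by (smt (verit) exp_gt_zero)
qed

section \<open>Integrability and passage to the limit\<close>

lemma nn_integral_exponential:
  assumes "0 < l"
  shows "(\<integral>\<^sup>+ x. ennreal (exponential_density l x) \<partial>lborel) = 1"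
proof -
  interpret prob_space "density lborel (exponential_density l)"
    by (rule prob_space_exponential_density[OF assms])
  have "emeasure (density lborel (\<lambda>x. ennreal (exponential_density l x))) UNIV = 1"
    using emeasure_space_1 by simp
  then show ?thesis by (subst (asm) emeasure_density) (auto simp: exponential_density_def)
qed

lemma nn_integral_two_sided_exponential:
  fixes al th :: real
  assumes a: "0 < al" "al < th"
  shows "(\<integral>\<^sup>+ z. ennreal (exp (- (al * z) + th * min z 0)) \<partial>lborel) < \<infinity>"
proof -
  let ?b = "th - al"
  have m[measurable]: "(\<lambda>x. exponential_density l x) \<in> borel_measurable borel" for l
    unfolding exponential_density_def by measurable
  have "ennreal (exp (- (al * z) + th * min z 0)) \<le>
     ennreal (1 / al) * ennreal (exponential_density al z) + ennreal (1 / ?b) * ennreal (exponential_density ?b (0 + (-1) * z))" for z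
  proof -
    have n: "0 \<le> exponential_density l x" if "0 < l" for l x using that by (simp add: exponential_density_def)
    have "exp (- (al * z) + th * min z 0) \<le> 1 / al * exponential_density al z + 1 / ?b * exponential_density ?b (0 + (-1) * z)"
    proof (cases "0 \<le> z")
      case True
      have "0 \<le> 1 / ?b * exponential_density ?b (0 + (-1) * z)" using n[of ?b] a by simp
      moreover have "exp (- (al * z) + th * min z 0) = 1 / al * exponential_density al z"
        using True a by (simp add: exponential_density_def mult.commute)
      ultimately show ?thesis by linarith
    next
      case False
      have "0 \<le> 1 / al * exponential_density al z" using n[of al] a by simp
      moreover have "- (al * z) + th * min z 0 = z * ?b" using False by (simp add: algebra_simps)
      then have "exp (- (al * z) + th * min z 0) = 1 / ?b * exponential_density ?b (0 + (-1) * z)"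
        using False a by (simp add: exponential_density_def)
      ultimately show ?thesis by linarith
    qed
    then have "ennreal (exp (- (al * z) + th * min z 0)) \<le> ennreal (1 / al * exponential_density al z + 1 / ?b * exponential_density ?b (0 + (-1) * z))"
      by (rule ennreal_leI)
    also have "\<dots> = ennreal (1 / al) * ennreal (exponential_density al z) + ennreal (1 / ?b) * ennreal (exponential_density ?b (0 + (-1) * z))"
      using a n by (simp only: ennreal_plus[symmetric] ennreal_mult[symmetric] mult_nonneg_nonneg divide_nonneg_pos zero_le_one diff_gt_0_iff_gt less_imp_le)
    finally show ?thesis .
  qed
  then have "(\<integral>\<^sup>+ z. ennreal (exp (- (al * z) + th * min z 0)) \<partial>lborel) \<le>
    (\<integral>\<^sup>+ z. ennreal (1 / al) * ennreal (exponential_density al z) + ennreal (1 / ?b) * ennreal (exponential_density ?b (0 + (-1) * z)) \<partial>lborel)"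
    by (intro nn_integral_mono)
  also have "\<dots> = ennreal (1 / al) * (\<integral>\<^sup>+ z. ennreal (exponential_density al z) \<partial>lborel) +
      ennreal (1 / ?b) * (\<integral>\<^sup>+ z. ennreal (exponential_density ?b (0 + (-1) * z)) \<partial>lborel)"
    by (subst nn_integral_add) (auto simp: nn_integral_cmult)
  also have "(\<integral>\<^sup>+ z. ennreal (exponential_density ?b (0 + (-1) * z)) \<partial>lborel) = (\<integral>\<^sup>+ z. ennreal (exponential_density ?b z) \<partial>lborel)"
    by (subst (2) nn_integral_real_affine[where c="-1" and t=0]) auto
  finally have "(\<integral>\<^sup>+ z. ennreal (exp (- (al * z) + th * min z 0)) \<partial>lborel) \<le> ennreal (1 / al) + ennreal (1 / ?b)"
    using a by (simp add: nn_integral_exponential)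
  also have "\<dots> < \<infinity>" by simp
  finally show ?thesis .
qed

lemma nn_integral_dominated_at_top:
  fixes s :: "real \<Rightarrow> 'a \<Rightarrow> real"
  assumes "f \<in> borel_measurable M" "\<And>t. s t \<in> borel_measurable M" and w: "w \<in> borel_measurable M"
    and wf: "(\<integral>\<^sup>+ x. ennreal (w x) \<partial>M) < \<infinity>"
    and lim: "AE x in M. ((\<lambda>t. s t x) \<longlongrightarrow> f x) at_top"
    and bound: "\<forall>\<^sub>F t in at_top. AE x in M. s t x \<le> w x"
    and nn: "\<And>t x. 0 \<le> s t x" and wn: "\<And>x. 0 \<le> w x" and fn: "\<And>x. 0 \<le> f x"
  shows "((\<lambda>t. \<integral>\<^sup>+ x. ennreal (s t x) \<partial>M) \<longlongrightarrow> (\<integral>\<^sup>+ x. ennreal (f x) \<partial>M)) at_top"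
proof -
  have wi: "integrable M w" using w wf wn by (intro integrableI_bounded) (auto simp: abs_of_nonneg)
  have b': "\<forall>\<^sub>F t in at_top. AE x in M. norm (s t x) \<le> w x"
    using bound by eventually_elim (use nn in \<open>auto simp: abs_of_nonneg\<close>)
  have fi: "integrable M f"
    by (rule integrable_dominated_convergence_at_top[OF assms(1,2) wi lim b'])
  have "((\<lambda>t. integral\<^sup>L M (s t)) \<longlongrightarrow> integral\<^sup>L M f) at_top"
    by (rule integral_dominated_convergence_at_top[OF assms(1,2) wi lim b'])
  then have "((\<lambda>t. ennreal (integral\<^sup>L M (s t))) \<longlongrightarrow> ennreal (integral\<^sup>L M f)) at_top"
    by (rule tendsto_ennrealI)
  moreover have "ennreal (integral\<^sup>L M f) = (\<integral>\<^sup>+ x. ennreal (f x) \<partial>M)"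
    using fi fn by (intro nn_integral_eq_integral[symmetric]) auto
  moreover have "\<forall>\<^sub>F t in at_top. ennreal (integral\<^sup>L M (s t)) = (\<integral>\<^sup>+ x. ennreal (s t x) \<partial>M)"
    using b'
  proof eventually_elim
    case (elim t)
    have "integrable M (s t)" by (rule Bochner_Integration.integrable_bound[OF wi]) (use elim assms wn in \<open>auto simp: abs_of_nonneg\<close>)
    then show ?case using nn by (intro nn_integral_eq_integral[symmetric]) auto
  qed
  ultimately show ?thesis by (simp add: tendsto_cong)
qed

text \<open>The truncated quantities \<open>loc m\<close> have limits for each fixed \<open>m\<close>, and the truncation error is
uniformly small relative to \<open>g\<close>; so the limits in \<open>u\<close> and \<open>m\<close> may be taken one after the other.\<close>

lemma localization_limit:
  fixes p g e :: "real \<Rightarrow> real" and loc :: "nat \<Rightarrow> real \<Rightarrow> real" and Ks :: "nat \<Rightarrow> real"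
  assumes g: "\<forall>\<^sub>F u in at_top. 0 < g u"
    and lower: "\<And>m. \<forall>\<^sub>F u in at_top. loc m u \<le> p u"
    and upper: "\<And>m. \<forall>\<^sub>F u in at_top. p u \<le> loc m u + g u * (C * r ^ m) + e u"
    and r: "0 \<le> r" "r < 1"
    and e: "((\<lambda>u. e u / g u) \<longlongrightarrow> 0) at_top"
    and loc: "\<And>m. ((\<lambda>u. loc m u / g u) \<longlongrightarrow> Ks m) at_top"
    and K: "Ks \<longlonglongrightarrow> K"
  shows "((\<lambda>u. p u / g u) \<longlongrightarrow> K) at_top"
proof (rule tendstoI)
  fix \<epsilon> :: real assume "0 < \<epsilon>"
  then have \<epsilon>: "0 < \<epsilon> / 4" by simp
  have "(\<lambda>m. C * r ^ m) \<longlonglongrightarrow> C * 0"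
    by (intro tendsto_intros LIMSEQ_power_zero) (use r in auto)
  from order_tendstoD(2)[OF this, of "\<epsilon> / 4"] \<epsilon>
  have "\<forall>\<^sub>F m in sequentially. C * r ^ m < \<epsilon> / 4" by simp
  moreover have "\<forall>\<^sub>F m in sequentially. dist (Ks m) K < \<epsilon> / 4" using tendstoD[OF K \<epsilon>] .
  ultimately have "\<forall>\<^sub>F m in sequentially. C * r ^ m < \<epsilon> / 4 \<and> dist (Ks m) K < \<epsilon> / 4" by (rule eventually_conj)
  then obtain m where m: "C * r ^ m < \<epsilon> / 4" "dist (Ks m) K < \<epsilon> / 4"
    by (auto simp: eventually_sequentially)
  show "\<forall>\<^sub>F u in at_top. dist (p u / g u) K < \<epsilon>"
    using g lower[of m] upper[of m] tendstoD[OF e \<epsilon>] tendstoD[OF loc[of m] \<epsilon>]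
  proof eventually_elim
    case (elim u)
    have "loc m u / g u \<le> p u / g u" using elim by (intro divide_right_mono) auto
    moreover have "p u / g u \<le> (loc m u + g u * (C * r ^ m) + e u) / g u" using elim by (intro divide_right_mono) auto
    moreover have "(loc m u + g u * (C * r ^ m) + e u) / g u = loc m u / g u + C * r ^ m + e u / g u"
      using elim(1) by (simp add: add_divide_distrib)
    ultimately show ?case using elim(4,5) m unfolding dist_real_def by linarith
  qed
qed

lemma exp_quadratic_limit:
  fixes q b c :: real
  assumes "0 < q"
  shows "((\<lambda>u. exp (- (q * u\<^sup>2) + b * u + c) * u ^ n) \<longlongrightarrow> 0) at_top"
  using assms by real_asymp

section \<open>Decomposition of the time interval\<close>

lemma cont_proc_min:
  assumes "cont_proc M X" "cont_proc M Y"
  shows "cont_proc M (\<lambda>t \<omega>. min (X t \<omega>) (Y t \<omega>))"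
  using assms unfolding cont_proc_def by (auto intro!: continuous_on_min borel_measurable_min)

lemma cont_proc_cmult:
  assumes "cont_proc M X"
  shows "cont_proc M (\<lambda>t \<omega>. c * X t \<omega>)"
  using assms unfolding cont_proc_def by (auto intro!: continuous_on_mult borel_measurable_times)

lemma occ_mono:
  assumes z': "z' \<in> borel_measurable borel"
    and le: "\<And>t. 0 \<le> t \<Longrightarrow> t \<le> A \<Longrightarrow> 0 < z t \<Longrightarrow> 0 < z' t"
  shows "occ A z \<le> occ A z'"
  unfolding occ_def by (rule emeasure_mono) (use z' le in auto)

lemma occ_set_measurable:
  assumes "cont_proc M Z"
  shows "{\<omega> \<in> space M. ennreal L < occ A (\<lambda>t. Z t \<omega>)} \<in> sets M"
  using occ_measurable[OF assms, of A] by measurable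

lemma occ_prob_mono:
  assumes Z': "cont_proc M Z'"
    and le: "\<And>t \<omega>. \<omega> \<in> space M \<Longrightarrow> 0 \<le> t \<Longrightarrow> t \<le> A \<Longrightarrow> 0 < Z t \<omega> \<Longrightarrow> 0 < Z' t \<omega>"
  shows "occ_prob M A L Z \<le> occ_prob M A L Z'"
  unfolding occ_prob_def
proof (rule emeasure_mono[OF _ occ_set_measurable[OF Z']], rule subsetI)
  fix \<omega> assume "\<omega> \<in> {\<omega> \<in> space M. ennreal L < occ A (\<lambda>t. Z t \<omega>)}"
  then have w: "\<omega> \<in> space M" and "ennreal L < occ A (\<lambda>t. Z t \<omega>)" by auto
  moreover have "occ A (\<lambda>t. Z t \<omega>) \<le> occ A (\<lambda>t. Z' t \<omega>)"
    by (rule occ_mono[OF cont_proc_path_measurable[OF Z' w] le[OF w]])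
  ultimately show "\<omega> \<in> {\<omega> \<in> space M. ennreal L < occ A (\<lambda>t. Z' t \<omega>)}" by auto
qed

lemma occ_prob_cong_sign:
  assumes "\<And>t \<omega>. \<omega> \<in> space M \<Longrightarrow> 0 \<le> t \<Longrightarrow> t \<le> A \<Longrightarrow> 0 < Z t \<omega> \<longleftrightarrow> 0 < Z' t \<omega>"
  shows "occ_prob M A L Z = occ_prob M A L Z'"
proof -
  have "{\<omega> \<in> space M. ennreal L < occ A (\<lambda>t. Z t \<omega>)} = {\<omega> \<in> space M. ennreal L < occ A (\<lambda>t. Z' t \<omega>)}"
  proof (intro Collect_cong conj_cong refl)
    fix \<omega> assume w: "\<omega> \<in> space M"
    have "{t \<in> {0..A}. 0 < Z t \<omega>} = {t \<in> {0..A}. 0 < Z' t \<omega>}"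
    proof (intro Collect_cong conj_cong refl)
      fix t assume "t \<in> {0..A}"
      then have "0 \<le> t" "t \<le> A" by simp_all
      then show "0 < Z t \<omega> \<longleftrightarrow> 0 < Z' t \<omega>" by (rule assms[OF w])
    qed
    then show "(ennreal L < occ A (\<lambda>t. Z t \<omega>)) = (ennreal L < occ A (\<lambda>t. Z' t \<omega>))" unfolding occ_def by (simp only:)
  qed
  then show ?thesis unfolding occ_prob_def by (simp only:)
qed

lemma (in prob_space) occ_prob_le_1: "occ_prob M A L Z \<le> 1"
  unfolding occ_prob_def by (rule emeasure_le_1)

lemma occ_pos_imp_ex:
  assumes "ennreal L < occ A z"
  shows "\<exists>t. 0 \<le> t \<and> t \<le> A \<and> 0 < z t"
proof (rule ccontr)
  assume "\<not> ?thesis"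
  then have e: "{t \<in> {0..A}. 0 < z t} = {}" by auto
  have "occ A z = 0" unfolding occ_def e by simp
  then show False using assms by simp
qed

lemma occ_prob_measurable:
  assumes "cont_proc (N \<Otimes>\<^sub>M M) (\<lambda>t p. Z (fst p) t (snd p))" and M: "prob_space M"
  shows "(\<lambda>p. occ_prob M A L (Z p)) \<in> borel_measurable N"
proof -
  interpret prob_space M by fact
  have m: "{p \<in> space (N \<Otimes>\<^sub>M M). ennreal L < occ A (\<lambda>t. Z (fst p) t (snd p))} \<in> sets (N \<Otimes>\<^sub>M M)"
    by (rule occ_set_measurable[OF assms(1)])
  have "(\<lambda>p. emeasure M (Pair p -` {p \<in> space (N \<Otimes>\<^sub>M M). ennreal L < occ A (\<lambda>t. Z (fst p) t (snd p))})) \<in> borel_measurable N"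
    by (rule measurable_emeasure_Pair[OF m])
  then show ?thesis
    unfolding occ_prob_def
    by (rule measurable_cong[THEN iffD2, rotated])
      (rule arg_cong[where f="emeasure M"], auto simp: space_pair_measure)
qed

lemma occ_prob_lower:
  assumes Z: "cont_proc M Z" and H: "real m \<le> H"
  shows "occ_prob M (real m) L (\<lambda>r. Z (H - real m + r)) \<le> occ_prob M H L Z"
  unfolding occ_prob_def
proof (rule emeasure_mono[OF _ occ_set_measurable[OF Z]], rule subsetI)
  fix \<omega> assume "\<omega> \<in> {\<omega> \<in> space M. ennreal L < occ (real m) (\<lambda>r. Z (H - real m + r) \<omega>)}"
  then have w: "\<omega> \<in> space M" and l: "ennreal L < occ (real m) (\<lambda>r. Z (H - real m + r) \<omega>)" by auto
  note [measurable] = cont_proc_path_measurable[OF Z w]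
  have "occ (real m) (\<lambda>r. Z (H - real m + r) \<omega>) = emeasure lborel {t \<in> {H - real m..H - real m + real m}. 0 < Z t \<omega>}"
    by (rule occ_shift[symmetric]) measurable
  also have "\<dots> \<le> occ H (\<lambda>t. Z t \<omega>)" unfolding occ_def by (rule emeasure_mono) (use H in auto)
  finally show "\<omega> \<in> {\<omega> \<in> space M. ennreal L < occ H (\<lambda>t. Z t \<omega>)}" using w l by auto
qed

text \<open>If the time spent above zero before \<open>H\<close> exceeds \<open>L\<close>, then either the last \<open>m\<close> units of time account
for it, or some positive time is spent in one of the preceding unit blocks or before \<open>B\<close>.\<close>

lemma occ_prob_decompose:
  assumes Z: "cont_proc M Z" and mK: "m \<le> K" and HK: "H - real K \<le> B"
  shows "occ_prob M H L Z \<le> occ_prob M (real m) L (\<lambda>r. Z (H - real m + r)) +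
    (\<Sum>k=m..<K. occ_prob M 1 0 (\<lambda>r. Z (H - real (Suc k) + r))) + occ_prob M B 0 Z"
proof -
  have shift: "cont_proc M (\<lambda>r. Z (s + r))" for s
    by (rule cont_proc_reindex[OF Z]) (intro continuous_intros)
  let ?S0 = "{\<omega> \<in> space M. ennreal L < occ (real m) (\<lambda>r. Z (H - real m + r) \<omega>)}"
  let ?Sk = "\<lambda>k. {\<omega> \<in> space M. ennreal 0 < occ 1 (\<lambda>r. Z (H - real (Suc k) + r) \<omega>)}"
  let ?SB = "{\<omega> \<in> space M. ennreal 0 < occ B (\<lambda>r. Z r \<omega>)}"
  have m0: "?S0 \<in> sets M" and mk: "?Sk k \<in> sets M" and mB: "?SB \<in> sets M" for k
    by (rule occ_set_measurable[OF shift] occ_set_measurable[OF Z])+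
  have "{\<omega> \<in> space M. ennreal L < occ H (\<lambda>t. Z t \<omega>)} \<subseteq> (?S0 \<union> (\<Union>k\<in>{m..<K}. ?Sk k)) \<union> ?SB"
  proof (rule subsetI, rule ccontr)
    fix \<omega> assume "\<omega> \<in> {\<omega> \<in> space M. ennreal L < occ H (\<lambda>t. Z t \<omega>)}" and n: "\<omega> \<notin> (?S0 \<union> (\<Union>k\<in>{m..<K}. ?Sk k)) \<union> ?SB"
    then have w: "\<omega> \<in> space M" and l: "ennreal L < occ H (\<lambda>t. Z t \<omega>)" by auto
    note [measurable] = cont_proc_path_measurable[OF Z w]
    have n0: "occ (real m) (\<lambda>r. Z (H - real m + r) \<omega>) \<le> ennreal L" using n w by (auto simp: not_less)
    have nk: "occ 1 (\<lambda>r. Z (H - real (Suc k) + r) \<omega>) = 0" if "k \<in> {m..<K}" for k using n w that by auto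
    have nB: "occ B (\<lambda>r. Z r \<omega>) = 0" using n w by auto
    let ?E0 = "{t \<in> {H - real m..H - real m + real m}. 0 < Z t \<omega>}"
    let ?Ek = "\<lambda>k. {t \<in> {H - real (Suc k)..H - real (Suc k) + 1}. 0 < Z t \<omega>}"
    let ?EB = "{t \<in> {0..B}. 0 < Z t \<omega>}"
    have sub: "{t \<in> {0..H}. 0 < Z t \<omega>} \<subseteq> (?E0 \<union> (\<Union>k\<in>{m..<K}. ?Ek k)) \<union> ?EB"
    proof (rule subsetI)
      fix t assume t: "t \<in> {t \<in> {0..H}. 0 < Z t \<omega>}"
      show "t \<in> (?E0 \<union> (\<Union>k\<in>{m..<K}. ?Ek k)) \<union> ?EB"
      proof (cases "t \<le> B \<or> H - real m \<le> t")
        case False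
        define k where "k = nat \<lfloor>H - t\<rfloor>"
        have 0: "0 \<le> H - t" using t by auto
        then have k: "real k \<le> H - t" "H - t < real k + 1" unfolding k_def by (auto simp: of_nat_nat)
        have "real m < real k + 1" "real k < real K" using k False HK by auto
        then have "k \<in> {m..<K}" by auto
        moreover have "t \<in> ?Ek k" using t k by auto
        ultimately show ?thesis by blast
      qed (use t in auto)
    qed
    have "occ H (\<lambda>t. Z t \<omega>) \<le> emeasure lborel ((?E0 \<union> (\<Union>k\<in>{m..<K}. ?Ek k)) \<union> ?EB)"
      unfolding occ_def by (rule emeasure_mono[OF sub]) measurable
    also have "\<dots> \<le> emeasure lborel (?E0 \<union> (\<Union>k\<in>{m..<K}. ?Ek k)) + emeasure lborel ?EB"
      by (rule emeasure_subadditive) measurable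
    also have "\<dots> \<le> (emeasure lborel ?E0 + emeasure lborel (\<Union>k\<in>{m..<K}. ?Ek k)) + emeasure lborel ?EB"
      by (intro add_right_mono emeasure_subadditive) measurable
    also have "\<dots> \<le> (emeasure lborel ?E0 + (\<Sum>k\<in>{m..<K}. emeasure lborel (?Ek k))) + emeasure lborel ?EB"
      by (intro add_right_mono add_left_mono emeasure_subadditive_finite) auto
    also have "(\<Sum>k\<in>{m..<K}. emeasure lborel (?Ek k)) = 0"
    proof (rule sum.neutral, rule ballI)
      fix k assume "k \<in> {m..<K}"
      then show "emeasure lborel (?Ek k) = 0" using nk occ_shift[of "\<lambda>t. Z t \<omega>" "H - real (Suc k)" 1] by simp
    qed
    also have "emeasure lborel ?EB = 0" using nB unfolding occ_def .
    also have "emeasure lborel ?E0 = occ (real m) (\<lambda>r. Z (H - real m + r) \<omega>)" by (rule occ_shift) measurable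
    finally show False using n0 l by simp
  qed
  then have "occ_prob M H L Z \<le> emeasure M ((?S0 \<union> (\<Union>k\<in>{m..<K}. ?Sk k)) \<union> ?SB)"
    unfolding occ_prob_def by (rule emeasure_mono) (use m0 mk mB in auto)
  also have "\<dots> \<le> emeasure M (?S0 \<union> (\<Union>k\<in>{m..<K}. ?Sk k)) + emeasure M ?SB"
    by (rule emeasure_subadditive) (use m0 mk mB in auto)
  also have "\<dots> \<le> (emeasure M ?S0 + emeasure M (\<Union>k\<in>{m..<K}. ?Sk k)) + emeasure M ?SB"
    by (intro add_right_mono emeasure_subadditive) (use m0 mk mB in auto)
  also have "\<dots> \<le> (emeasure M ?S0 + (\<Sum>k\<in>{m..<K}. emeasure M (?Sk k))) + emeasure M ?SB"
    by (intro add_right_mono add_left_mono emeasure_subadditive_finite) (use mk in auto)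
  finally show ?thesis unfolding occ_prob_def by simp
qed

lemma occ_SUP:
  assumes z: "z \<in> borel_measurable borel"
  shows "(SUP m. occ (real m) z) = emeasure lborel {t \<in> {0..}. 0 < z t}"
proof -
  have "(SUP m. occ (real m) z) = emeasure lborel (\<Union>m. {t \<in> {0..real m}. 0 < z t})"
    unfolding occ_def using z by (intro SUP_emeasure_incseq) (auto simp: incseq_def)
  also have "(\<Union>m. {t \<in> {0..real m}. 0 < z t}) = {t \<in> {0..}. 0 < z t}"
    by (auto intro: real_arch_simple)
  finally show ?thesis .
qed

lemma occ_prob_incseq:
  assumes Z: "cont_proc M Z"
  shows "incseq (\<lambda>m. occ_prob M (real m) L Z)"
proof (rule incseq_SucI)
  fix m
  show "occ_prob M (real m) L Z \<le> occ_prob M (real (Suc m)) L Z"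
    unfolding occ_prob_def
  proof (rule emeasure_mono[OF _ occ_set_measurable[OF Z]], rule subsetI)
    fix \<omega> assume "\<omega> \<in> {\<omega> \<in> space M. ennreal L < occ (real m) (\<lambda>t. Z t \<omega>)}"
    then have w: "\<omega> \<in> space M" and l: "ennreal L < occ (real m) (\<lambda>t. Z t \<omega>)" by auto
    note [measurable] = cont_proc_path_measurable[OF Z w]
    have "occ (real m) (\<lambda>t. Z t \<omega>) \<le> occ (real (Suc m)) (\<lambda>t. Z t \<omega>)"
      unfolding occ_def by (rule emeasure_mono) auto
    then show "\<omega> \<in> {\<omega> \<in> space M. ennreal L < occ (real (Suc m)) (\<lambda>t. Z t \<omega>)}" using w l by auto
  qed
qed

lemma occ_prob_SUP:
  assumes Z: "cont_proc M Z"
  shows "(SUP m. occ_prob M (real m) L Z) = emeasure M {\<omega> \<in> space M. ennreal L < emeasure lborel {t \<in> {0..}. 0 < Z t \<omega>}}"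
proof -
  let ?S = "\<lambda>m. {\<omega> \<in> space M. ennreal L < occ (real m) (\<lambda>t. Z t \<omega>)}"
  have inc: "incseq ?S"
  proof (rule incseq_SucI, rule subsetI)
    fix m \<omega> assume "\<omega> \<in> ?S m"
    then have w: "\<omega> \<in> space M" and l: "ennreal L < occ (real m) (\<lambda>t. Z t \<omega>)" by auto
    note [measurable] = cont_proc_path_measurable[OF Z w]
    have "occ (real m) (\<lambda>t. Z t \<omega>) \<le> occ (real (Suc m)) (\<lambda>t. Z t \<omega>)"
      unfolding occ_def by (rule emeasure_mono) auto
    then show "\<omega> \<in> ?S (Suc m)" using w l by auto
  qed
  have "(SUP m. occ_prob M (real m) L Z) = emeasure M (\<Union>m. ?S m)"
    unfolding occ_prob_def using occ_set_measurable[OF Z] inc by (intro SUP_emeasure_incseq) auto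
  also have "(\<Union>m. ?S m) = {\<omega> \<in> space M. ennreal L < emeasure lborel {t \<in> {0..}. 0 < Z t \<omega>}}"
  proof (rule set_eqI)
    fix \<omega>
    show "\<omega> \<in> (\<Union>m. ?S m) \<longleftrightarrow> \<omega> \<in> {\<omega> \<in> space M. ennreal L < emeasure lborel {t \<in> {0..}. 0 < Z t \<omega>}}"
    proof (cases "\<omega> \<in> space M")
      case True
      have "ennreal L < emeasure lborel {t \<in> {0..}. 0 < Z t \<omega>} \<longleftrightarrow> (\<exists>m. ennreal L < occ (real m) (\<lambda>t. Z t \<omega>))"
        unfolding occ_SUP[OF cont_proc_path_measurable[OF Z True], symmetric] by (simp add: less_SUP_iff)
      then show ?thesis using True by blast
    qed blast
  qed
  finally show ?thesis .
qed

context brownian_pair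
begin

text \<open>Chernoff bound: any positive occupation time forces a linear combination of the pair above the
level \<open>v\<close> at some moment.\<close>

lemma occ_prob_tail:
  assumes A: "0 < A"
    and ev: "\<And>t \<omega>. \<omega> \<in> space M \<Longrightarrow> 0 \<le> t \<Longrightarrow> t \<le> A \<Longrightarrow> 0 < Z t \<omega> \<Longrightarrow> v < al * X t \<omega> + be * Y t \<omega>"
  shows "occ_prob M A L Z \<le> ennreal (exp ((al\<^sup>2 + be\<^sup>2) / 2 * A - v))"
proof -
  let ?S = "{\<omega> \<in> space M. \<exists>t. 0 \<le> t \<and> t \<le> A \<and> v < al * X t \<omega> + be * Y t \<omega>}"
  have "occ_prob M A L Z \<le> emeasure M ?S"
    unfolding occ_prob_def
  proof (rule emeasure_mono[OF _ maximal_inequality(1)[OF A]], rule subsetI)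
    fix \<omega> assume "\<omega> \<in> {\<omega> \<in> space M. ennreal L < occ A (\<lambda>t. Z t \<omega>)}"
    then have w: "\<omega> \<in> space M" and l: "ennreal L < occ A (\<lambda>t. Z t \<omega>)" by auto
    from occ_pos_imp_ex[OF l] obtain t where "0 \<le> t" "t \<le> A" "0 < Z t \<omega>" by auto
    with ev[OF w] w show "\<omega> \<in> ?S" by auto
  qed
  also have "\<dots> \<le> ennreal (exp ((al\<^sup>2 + be\<^sup>2) / 2 * A - v))" by (rule maximal_inequality(2)[OF A])
  finally show ?thesis .
qed

end

lemma cont_proc_compose:
  assumes "cont_proc M X" "h \<in> measurable N M"
  shows "cont_proc N (\<lambda>t x. X t (h x))"
  using assms measurable_space[OF assms(2)] unfolding cont_proc_def by (auto intro: measurable_compose)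

lemma occ_prob_nn_integral:
  assumes "cont_proc M Z"
  shows "occ_prob M A L Z = (\<integral>\<^sup>+ \<omega>. indicator {ennreal L<..} (occ A (\<lambda>t. Z t \<omega>)) \<partial>M)"
proof -
  have "occ_prob M A L Z = (\<integral>\<^sup>+ \<omega>. indicator {\<omega> \<in> space M. ennreal L < occ A (\<lambda>t. Z t \<omega>)} \<omega> \<partial>M)"
    unfolding occ_prob_def by (rule nn_integral_indicator[symmetric, OF occ_set_measurable[OF assms]])
  also have "\<dots> = (\<integral>\<^sup>+ \<omega>. indicator {ennreal L<..} (occ A (\<lambda>t. Z t \<omega>)) \<partial>M)"
    by (intro nn_integral_cong) (simp add: indicator_def)
  finally show ?thesis .
qed

section \<open>Correlated pairs near the final time\<close>

locale corr_pair = brownian_pair +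
  fixes \<rho> \<sigma> :: real
  assumes sigma_pos: "0 < \<sigma>" and unit: "\<rho>\<^sup>2 + \<sigma>\<^sup>2 = 1"
begin

definition W :: "real \<Rightarrow> 'a \<Rightarrow> real" where
  "W t \<omega> = \<rho> * X t \<omega> + \<sigma> * Y t \<omega>"

lemma W_proc: "cont_proc M W"
  unfolding W_def by (intro cont_proc_add cont_proc_cmult X_proc Y_proc)

lemmas W_measurable[measurable (raw)] = cont_proc_measurable[OF W_proc]

lemma rho_le_1: "\<rho> \<le> 1"
proof -
  have "\<rho>\<^sup>2 \<le> 1\<^sup>2" using unit sigma_pos by (simp add: power2_eq_square) (smt (verit) mult_pos_pos)
  then show ?thesis by (rule power2_le_imp_le) simp
qed

lemma quadrant_proc:
  assumes "f \<in> borel_measurable N" "g \<in> borel_measurable N" "h \<in> measurable N M"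
  shows "cont_proc N (\<lambda>r x. min (f x + X r (h x)) (g x + W r (h x)))"
  by (intro cont_proc_min cont_proc_add cont_proc_const assms cont_proc_compose[OF X_proc] cont_proc_compose[OF W_proc])

lemma quadrant_occ_measurable[measurable (raw)]:
  assumes "f \<in> borel_measurable N" "g \<in> borel_measurable N" "h \<in> measurable N M"
  shows "(\<lambda>x. occ A (\<lambda>r. min (f x + X r (h x)) (g x + W r (h x)))) \<in> borel_measurable N"
  by (rule occ_measurable[OF quadrant_proc[OF assms]])

text \<open>The probability that the pair started at \<open>(z1, z2)\<close> spends more than \<open>L\<close> time units in the positive
quadrant before \<open>A\<close>.\<close>

definition quadrant_prob :: "real \<Rightarrow> real \<Rightarrow> real \<Rightarrow> real \<Rightarrow> ennreal" where
  "quadrant_prob A L z1 z2 = occ_prob M A L (\<lambda>r \<omega>. min (z1 + X r \<omega>) (z2 + W r \<omega>))"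

lemma quadrant_prob_nn_integral: "quadrant_prob A L z1 z2 = (\<integral>\<^sup>+ \<omega>. indicator {ennreal L<..} (occ A (\<lambda>r. min (z1 + X r \<omega>) (z2 + W r \<omega>))) \<partial>M)"
  unfolding quadrant_prob_def by (rule occ_prob_nn_integral[OF quadrant_proc]) auto

lemma quadrant_prob_measurable[measurable (raw)]:
  assumes [measurable]: "f \<in> borel_measurable N" "g \<in> borel_measurable N"
  shows "(\<lambda>x. quadrant_prob A L (f x) (g x)) \<in> borel_measurable N"
  unfolding quadrant_prob_nn_integral by measurable

lemma quadrant_prob_le_1: "quadrant_prob A L z1 z2 \<le> 1"
  unfolding quadrant_prob_def by (rule occ_prob_le_1)

text \<open>Exponential decay of arbitrary rate in the negative directions, from the Chernoff bound with a tilt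
in those coordinates that are negative. It compensates the exponential growth of the limiting
density there.\<close>

lemma quadrant_prob_bound:
  assumes A: "0 < A" and th: "0 \<le> th"
  shows "quadrant_prob A L z1 z2 \<le> ennreal (exp (2 * th\<^sup>2 * A + th * min z1 0 + th * min z2 0))"
proof -
  \<comment> \<open>Tilt only those coordinates whose starting value is negative.\<close>
  define t1 where "t1 = (if z1 < 0 then th else 0)"
  define t2 where "t2 = (if z2 < 0 then th else 0)"
  have t: "0 \<le> t1" "0 \<le> t2" "t1 \<le> th" "t2 \<le> th" using th by (auto simp: t1_def t2_def)
  have tz: "t1 * z1 + t2 * z2 = th * min z1 0 + th * min z2 0" by (auto simp: t1_def t2_def)
  show ?thesis
  proof (cases "t1 = 0 \<and> t2 = 0")
    case True
    then have "th * min z1 0 + th * min z2 0 = 0" using tz by simp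
    moreover have "0 \<le> 2 * th\<^sup>2 * A" using A by simp
    ultimately have "0 \<le> 2 * th\<^sup>2 * A + th * min z1 0 + th * min z2 0" by linarith
    then have "ennreal 1 \<le> ennreal (exp (2 * th\<^sup>2 * A + th * min z1 0 + th * min z2 0))"
      by (intro ennreal_leI) (simp only: one_le_exp_iff)
    then show ?thesis using quadrant_prob_le_1[of A L z1 z2] unfolding ennreal_1 by (rule order_trans[rotated])
  next
    case False
    have "quadrant_prob A L z1 z2 \<le> ennreal (exp (((t1 + \<rho> * t2)\<^sup>2 + (\<sigma> * t2)\<^sup>2) / 2 * A - (- (t1 * z1 + t2 * z2))))"
      unfolding quadrant_prob_def
    proof (rule occ_prob_tail[OF A])
      fix t \<omega> assume "0 < min (z1 + X t \<omega>) (z2 + W t \<omega>)"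
      then have p: "0 < z1 + X t \<omega>" "0 < z2 + W t \<omega>" by auto
      have "0 < t1 * (z1 + X t \<omega>) + t2 * (z2 + W t \<omega>)"
      proof (cases "t1 = 0")
        case True
        then have "0 < t2" using False t by auto
        then show ?thesis using True p by simp
      next
        case F: False
        then have "0 < t1 * (z1 + X t \<omega>)" using t p by simp
        moreover have "0 \<le> t2 * (z2 + W t \<omega>)" using t p by simp
        ultimately show ?thesis by linarith
      qed
      then show "- (t1 * z1 + t2 * z2) < (t1 + \<rho> * t2) * X t \<omega> + \<sigma> * t2 * Y t \<omega>"
        unfolding W_def by (simp add: algebra_simps)
    qed
    also have "\<dots> \<le> ennreal (exp (2 * th\<^sup>2 * A + th * min z1 0 + th * min z2 0))"
    proof (intro ennreal_leI, subst exp_le_cancel_iff)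
      have "\<rho> * (t1 * t2) \<le> 1 * (t1 * t2)" using rho_le_1 t by (intro mult_right_mono) auto
      moreover have "t1 * t2 \<le> th * th" "t1 * t1 \<le> th * th" "t2 * t2 \<le> th * th" using t th by (auto intro!: mult_mono)
      ultimately have "t1 * t1 + 2 * (\<rho> * (t1 * t2)) + t2 * t2 \<le> 4 * (th * th)" by linarith
      moreover have "(t1 + \<rho> * t2)\<^sup>2 + (\<sigma> * t2)\<^sup>2 = t1 * t1 + 2 * (\<rho> * (t1 * t2)) + (\<rho>\<^sup>2 + \<sigma>\<^sup>2) * (t2 * t2)"
        by (simp add: power2_eq_square algebra_simps)
      ultimately have "((t1 + \<rho> * t2)\<^sup>2 + (\<sigma> * t2)\<^sup>2) / 2 \<le> 2 * th\<^sup>2"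
        unfolding unit power2_eq_square[of th] by simp
      then have "((t1 + \<rho> * t2)\<^sup>2 + (\<sigma> * t2)\<^sup>2) / 2 * A \<le> 2 * th\<^sup>2 * A" using A by (intro mult_right_mono) auto
      then show "((t1 + \<rho> * t2)\<^sup>2 + (\<sigma> * t2)\<^sup>2) / 2 * A - (- (t1 * z1 + t2 * z2)) \<le> 2 * th\<^sup>2 * A + th * min z1 0 + th * min z2 0"
        using tz by linarith
    qed
    finally show ?thesis .
  qed
qed

lemma quadrant_prob_shift_sandwich:
  assumes u: "0 < u" and C: "\<bar>c1\<bar> * A \<le> C" "\<bar>c2\<bar> * A \<le> C"
  shows "occ_prob M A L (\<lambda>r \<omega>. min (z1 + X r \<omega> - c1 * r / u) (z2 + W r \<omega> - c2 * r / u)) \<le> quadrant_prob A L (z1 + C / u) (z2 + C / u)"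
    and "quadrant_prob A L (z1 + (- C) / u) (z2 + (- C) / u) \<le> occ_prob M A L (\<lambda>r \<omega>. min (z1 + X r \<omega> - c1 * r / u) (z2 + W r \<omega> - c2 * r / u))"
proof -
  have b: "c * r / u \<le> C / u" "- (C / u) \<le> c * r / u" if "0 \<le> r" "r \<le> A" "\<bar>c\<bar> * A \<le> C" for c r
  proof -
    have "\<bar>c\<bar> * r \<le> C" using that by (meson abs_ge_zero mult_left_mono order_trans)
    then have "c * r \<le> C" "- C \<le> c * r"
      using abs_mult[of c r] that by (auto simp: abs_le_iff)
    then have "c * r / u \<le> C / u" "(- C) / u \<le> c * r / u"
      using divide_right_mono[of "c * r" C u] divide_right_mono[of "- C" "c * r" u] u by (simp_all only: less_imp_le)
    then show "c * r / u \<le> C / u" "- (C / u) \<le> c * r / u" by simp_all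
  qed
  have d: "cont_proc M (\<lambda>r \<omega>. min (z1 + X r \<omega> - c1 * r / u) (z2 + W r \<omega> - c2 * r / u))"
    by (intro cont_proc_min cont_proc_minus cont_proc_add cont_proc_const cont_proc_det X_proc W_proc)
      (use u in \<open>auto intro!: continuous_intros\<close>)
  show "occ_prob M A L (\<lambda>r \<omega>. min (z1 + X r \<omega> - c1 * r / u) (z2 + W r \<omega> - c2 * r / u)) \<le> quadrant_prob A L (z1 + C / u) (z2 + C / u)"
    unfolding quadrant_prob_def
  proof (rule occ_prob_mono[OF quadrant_proc])
    fix r \<omega> assume r: "0 \<le> r" "r \<le> A" and "0 < min (z1 + X r \<omega> - c1 * r / u) (z2 + W r \<omega> - c2 * r / u)"
    then show "0 < min (z1 + C / u + X r \<omega>) (z2 + C / u + W r \<omega>)"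
      using b[OF r C(1)] b[OF r C(2)] unfolding min_less_iff_conj by - (intro conjI, linarith, linarith)
  qed auto
  show "quadrant_prob A L (z1 + (- C) / u) (z2 + (- C) / u) \<le> occ_prob M A L (\<lambda>r \<omega>. min (z1 + X r \<omega> - c1 * r / u) (z2 + W r \<omega> - c2 * r / u))"
    unfolding quadrant_prob_def
  proof (rule occ_prob_mono[OF d])
    fix r \<omega> assume r: "0 \<le> r" "r \<le> A" and "0 < min (z1 + (- C) / u + X r \<omega>) (z2 + (- C) / u + W r \<omega>)"
    then show "0 < min (z1 + X r \<omega> - c1 * r / u) (z2 + W r \<omega> - c2 * r / u)"
      using b[OF r C(1)] b[OF r C(2)] unfolding min_less_iff_conj by - (intro conjI, linarith, linarith)
  qed
qed

text \<open>The Markov property at the scaled time \<open>u\<^sup>2 - B\<close>. The position is expressed by its overshoots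
\<open>(z1, z2)\<close> over the two barriers. In the independent coordinates \<open>(X, Y)\<close> the overshoots are \<open>z1\<close> over
a barrier with slope 1 and \<open>(z2 - \<rho> * z1) / \<sigma>\<close> over a barrier with slope \<open>k\<close>.\<close>

lemma local_formula:
  fixes c1 c2 a B u A L :: real
  assumes u: "0 < u" and B: "B < u\<^sup>2" and A: "0 < A" and L: "0 \<le> L"
  defines "k \<equiv> (a - \<rho>) / \<sigma>" and "d \<equiv> (c2 - \<rho> * c1) / \<sigma>"
  shows "occ_prob M A L (\<lambda>r \<omega>. min (X (u\<^sup>2 - B + r) \<omega> - u\<^sup>2 - c1 * (u\<^sup>2 - B + r) / u)
            (W (u\<^sup>2 - B + r) \<omega> - a * u\<^sup>2 - c2 * (u\<^sup>2 - B + r) / u)) =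
    ennreal (1 / \<sigma>) * (\<integral>\<^sup>+ z1. \<integral>\<^sup>+ z2. ennreal (dens 1 c1 B u z1 * dens k d B u ((z2 - \<rho> * z1) / \<sigma>)) *
      occ_prob M A L (\<lambda>r \<omega>. min (z1 + X r \<omega> - c1 * r / u) (z2 + W r \<omega> - c2 * r / u)) \<partial>lborel \<partial>lborel)"
proof -
  define \<tau> where "\<tau> = u\<^sup>2 - B"
  have \<tau>: "0 < \<tau>" using B by (simp add: \<tau>_def)
  define f where "f = (\<lambda>r x y. min (x - u\<^sup>2 - c1 * (\<tau> + r) / u) (\<rho> * x + \<sigma> * y - a * u\<^sup>2 - c2 * (\<tau> + r) / u))"
  have fc: "continuous_on UNIV (\<lambda>(r, x, y). f r x y)"
    unfolding f_def case_prod_beta' using u by (intro continuous_intros) auto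
  let ?P = "\<lambda>x y. occ_prob M A L (\<lambda>r \<omega>. f r (x + X r \<omega>) (y + Y r \<omega>))"
  let ?\<phi> = "normal_density 0 (sqrt \<tau>)"
  have Pm[measurable (raw)]: "(\<lambda>p. ?P (F p) (H p)) \<in> borel_measurable N"
    if [measurable]: "F \<in> borel_measurable N" "H \<in> borel_measurable N" for F H :: "'c \<Rightarrow> real" and N
  proof (rule occ_prob_measurable[OF _ prob_space_axioms])
    show "cont_proc (N \<Otimes>\<^sub>M M) (\<lambda>t p. f t (F (fst p) + X t (snd p)) (H (fst p) + Y t (snd p)))"
      by (rule cont_proc_comp[OF cont_proc_add[OF cont_proc_const cont_proc_snd[OF X_proc]]
          cont_proc_add[OF cont_proc_const cont_proc_snd[OF Y_proc]] fc]) measurable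
  qed
  let ?t = "\<lambda>z1. k * u\<^sup>2 + d * \<tau> / u - \<rho> * z1 / \<sigma>"
  have "occ_prob M A L (\<lambda>r \<omega>. min (X (\<tau> + r) \<omega> - u\<^sup>2 - c1 * (\<tau> + r) / u) (W (\<tau> + r) \<omega> - a * u\<^sup>2 - c2 * (\<tau> + r) / u)) =
      (\<integral>\<^sup>+ x. \<integral>\<^sup>+ y. ennreal (?\<phi> x * ?\<phi> y) * ?P x y \<partial>lborel \<partial>lborel)"
    using restart[OF \<tau> A L fc] unfolding f_def W_def .
  also have "\<dots> = (\<integral>\<^sup>+ z1. \<integral>\<^sup>+ y. ennreal (?\<phi> (u\<^sup>2 + c1 * \<tau> / u + 1 * z1) * ?\<phi> y) * ?P (u\<^sup>2 + c1 * \<tau> / u + 1 * z1) y \<partial>lborel \<partial>lborel)"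
    by (subst nn_integral_real_affine[where c=1 and t="u\<^sup>2 + c1 * \<tau> / u"]) simp_all
  also have "\<dots> = (\<integral>\<^sup>+ z1. ennreal (1 / \<sigma>) * (\<integral>\<^sup>+ z2. ennreal (?\<phi> (u\<^sup>2 + c1 * \<tau> / u + 1 * z1) * ?\<phi> (?t z1 + 1 / \<sigma> * z2)) *
       ?P (u\<^sup>2 + c1 * \<tau> / u + 1 * z1) (?t z1 + 1 / \<sigma> * z2) \<partial>lborel) \<partial>lborel)"
  proof (rule nn_integral_cong)
    fix z1
    have "(\<lambda>y. ennreal (?\<phi> (u\<^sup>2 + c1 * \<tau> / u + 1 * z1) * ?\<phi> y) * ?P (u\<^sup>2 + c1 * \<tau> / u + 1 * z1) y) \<in> borel_measurable borel"
      by measurable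
    from nn_integral_real_affine[OF this, of "1 / \<sigma>" "?t z1"] sigma_pos
    show "(\<integral>\<^sup>+ y. ennreal (?\<phi> (u\<^sup>2 + c1 * \<tau> / u + 1 * z1) * ?\<phi> y) * ?P (u\<^sup>2 + c1 * \<tau> / u + 1 * z1) y \<partial>lborel) =
      ennreal (1 / \<sigma>) * (\<integral>\<^sup>+ z2. ennreal (?\<phi> (u\<^sup>2 + c1 * \<tau> / u + 1 * z1) * ?\<phi> (?t z1 + 1 / \<sigma> * z2)) *
       ?P (u\<^sup>2 + c1 * \<tau> / u + 1 * z1) (?t z1 + 1 / \<sigma> * z2) \<partial>lborel)" by simp
  qed
  also have "\<dots> = ennreal (1 / \<sigma>) * (\<integral>\<^sup>+ z1. \<integral>\<^sup>+ z2. ennreal (?\<phi> (u\<^sup>2 + c1 * \<tau> / u + 1 * z1) * ?\<phi> (?t z1 + 1 / \<sigma> * z2)) *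
       ?P (u\<^sup>2 + c1 * \<tau> / u + 1 * z1) (?t z1 + 1 / \<sigma> * z2) \<partial>lborel \<partial>lborel)"
    by (rule nn_integral_cmult) measurable
  also have "\<dots> = ennreal (1 / \<sigma>) * (\<integral>\<^sup>+ z1. \<integral>\<^sup>+ z2. ennreal (dens 1 c1 B u z1 * dens k d B u ((z2 - \<rho> * z1) / \<sigma>)) *
      occ_prob M A L (\<lambda>r \<omega>. min (z1 + X r \<omega> - c1 * r / u) (z2 + W r \<omega> - c2 * r / u)) \<partial>lborel \<partial>lborel)"
  proof (rule arg_cong[where f="\<lambda>x. ennreal (1 / \<sigma>) * x"], intro nn_integral_cong)
    fix z1 z2
    have e1: "?\<phi> (u\<^sup>2 + c1 * \<tau> / u + 1 * z1) = dens 1 c1 B u z1" by (simp add: dens_def \<tau>_def)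
    have "?t z1 + 1 / \<sigma> * z2 = k * u\<^sup>2 + d * \<tau> / u + (z2 - \<rho> * z1) / \<sigma>" using sigma_pos by (simp add: field_simps)
    then have e2: "?\<phi> (?t z1 + 1 / \<sigma> * z2) = dens k d B u ((z2 - \<rho> * z1) / \<sigma>)"
      unfolding dens_def \<tau>_def[symmetric] by (simp only:)
    have "f r (u\<^sup>2 + c1 * \<tau> / u + 1 * z1 + X r \<omega>) (?t z1 + 1 / \<sigma> * z2 + Y r \<omega>) =
      min (z1 + X r \<omega> - c1 * r / u) (z2 + W r \<omega> - c2 * r / u)" for r \<omega>
    proof -
      have "u\<^sup>2 + c1 * \<tau> / u + 1 * z1 + X r \<omega> - u\<^sup>2 - c1 * (\<tau> + r) / u = z1 + X r \<omega> - c1 * r / u"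
        using u by (simp add: field_simps)
      moreover have "\<sigma> * (?t z1 + 1 / \<sigma> * z2 + Y r \<omega>) = (a - \<rho>) * u\<^sup>2 + (c2 - \<rho> * c1) * \<tau> / u - \<rho> * z1 + z2 + \<sigma> * Y r \<omega>"
        unfolding k_def d_def using sigma_pos u by (simp add: field_simps)
      from this have "\<rho> * (u\<^sup>2 + c1 * \<tau> / u + 1 * z1 + X r \<omega>) + \<sigma> * (?t z1 + 1 / \<sigma> * z2 + Y r \<omega>) - a * u\<^sup>2 - c2 * (\<tau> + r) / u
          = z2 + W r \<omega> - c2 * r / u"
        unfolding W_def by (simp only:) (simp add: algebra_simps add_divide_distrib diff_divide_distrib)
      ultimately show ?thesis unfolding f_def by (simp only:)
    qed
    then show "ennreal (?\<phi> (u\<^sup>2 + c1 * \<tau> / u + 1 * z1) * ?\<phi> (?t z1 + 1 / \<sigma> * z2)) * ?P (u\<^sup>2 + c1 * \<tau> / u + 1 * z1) (?t z1 + 1 / \<sigma> * z2) =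
       ennreal (dens 1 c1 B u z1 * dens k d B u ((z2 - \<rho> * z1) / \<sigma>)) * occ_prob M A L (\<lambda>r \<omega>. min (z1 + X r \<omega> - c1 * r / u) (z2 + W r \<omega> - c2 * r / u))"
      unfolding e1 e2 by (simp only:)
  qed
  finally show ?thesis unfolding \<tau>_def .
qed

text \<open>Turns the limit of \<open>local_formula\<close> into the Parisian constant with horizon \<open>A\<close>. Moving the
starting point to the end point of the path (a shift by \<open>(X A, W A)\<close> in \<open>(z1, z2)\<close>) produces the
weight \<open>exp (X A + k * Y A)\<close>; the path is then seen backwards from its end, and \<open>reversal_tilt\<close>
replaces weight and reversal by a drift. The factor \<open>exp ((1 + k\<^sup>2) * A / 2)\<close> is the normalisation of
the tilt.\<close>

lemma tilt_identity:
  fixes k A L :: real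
  assumes A: "0 < A" and L: "0 \<le> L"
  defines "V \<equiv> \<lambda>z1 z2. z1 + k * ((z2 - \<rho> * z1) / \<sigma>)"
  shows "(\<integral>\<^sup>+ z1. \<integral>\<^sup>+ z2. ennreal (exp (- V z1 z2)) * quadrant_prob A L z1 z2 \<partial>lborel \<partial>lborel) =
    ennreal (exp ((1 + k\<^sup>2) * A / 2)) * (\<integral>\<^sup>+ z1. \<integral>\<^sup>+ z2. ennreal (exp (V z1 z2)) *
      occ_prob M A L (\<lambda>r \<omega>. min (X r \<omega> - r - z1) (W r \<omega> - (\<rho> + \<sigma> * k) * r - z2)) \<partial>lborel \<partial>lborel)"
proof -
  interpret pm: pair_sigma_finite lborel M ..
  have V[measurable (raw)]: "(\<lambda>x. V (f x) (g x)) \<in> borel_measurable N" if [measurable]: "f \<in> borel_measurable N" "g \<in> borel_measurable N" for f g :: "'c \<Rightarrow> real" and N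
    unfolding V_def by measurable
  let ?I = "\<lambda>z1 z2 \<omega>. indicator {ennreal L<..} (occ A (\<lambda>r. min (z1 + X r \<omega>) (z2 + W r \<omega>))) :: ennreal"
  let ?J = "\<lambda>z1 z2 \<omega>. ?I (- X A \<omega> + 1 * z1) (- W A \<omega> + 1 * z2) \<omega>"
  have "(\<integral>\<^sup>+ z1. \<integral>\<^sup>+ z2. ennreal (exp (- V z1 z2)) * quadrant_prob A L z1 z2 \<partial>lborel \<partial>lborel) =
     (\<integral>\<^sup>+ z1. \<integral>\<^sup>+ z2. \<integral>\<^sup>+ \<omega>. ennreal (exp (- V z1 z2)) * ?I z1 z2 \<omega> \<partial>M \<partial>lborel \<partial>lborel)"
    unfolding quadrant_prob_nn_integral by (intro nn_integral_cong nn_integral_cmult[symmetric]) measurable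
  also have "\<dots> = (\<integral>\<^sup>+ z1. \<integral>\<^sup>+ \<omega>. \<integral>\<^sup>+ z2. ennreal (exp (- V z1 z2)) * ?I z1 z2 \<omega> \<partial>lborel \<partial>M \<partial>lborel)"
    by (intro nn_integral_cong pm.Fubini'[symmetric]) measurable
  also have "\<dots> = (\<integral>\<^sup>+ \<omega>. \<integral>\<^sup>+ z1. \<integral>\<^sup>+ z2. ennreal (exp (- V z1 z2)) * ?I z1 z2 \<omega> \<partial>lborel \<partial>lborel \<partial>M)"
    by (intro pm.Fubini'[symmetric]) measurable
  also have "\<dots> = (\<integral>\<^sup>+ \<omega>. \<integral>\<^sup>+ z1. \<integral>\<^sup>+ z2. ennreal (exp (- V z1 z2)) * (ennreal (exp (X A \<omega> + k * Y A \<omega>)) * ?J z1 z2 \<omega>) \<partial>lborel \<partial>lborel \<partial>M)"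
  proof (rule nn_integral_cong)
    fix \<omega> assume w[measurable]: "\<omega> \<in> space M"
    have "(\<integral>\<^sup>+ z1. \<integral>\<^sup>+ z2. ennreal (exp (- V z1 z2)) * ?I z1 z2 \<omega> \<partial>lborel \<partial>lborel) =
       (\<integral>\<^sup>+ z1. \<integral>\<^sup>+ z2. ennreal (exp (- V (- X A \<omega> + 1 * z1) z2)) * ?I (- X A \<omega> + 1 * z1) z2 \<omega> \<partial>lborel \<partial>lborel)"
      by (subst nn_integral_real_affine[where c=1 and t="- X A \<omega>"]) (simp_all, measurable)
    also have "\<dots> = (\<integral>\<^sup>+ z1. \<integral>\<^sup>+ z2. ennreal (exp (- V (- X A \<omega> + 1 * z1) (- W A \<omega> + 1 * z2))) * ?J z1 z2 \<omega> \<partial>lborel \<partial>lborel)"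
    proof (rule nn_integral_cong)
      fix z1
      have "(\<lambda>z2. ennreal (exp (- V (- X A \<omega> + 1 * z1) z2)) * ?I (- X A \<omega> + 1 * z1) z2 \<omega>) \<in> borel_measurable borel" by measurable
      from nn_integral_real_affine[OF this, of 1 "- W A \<omega>"]
      show "(\<integral>\<^sup>+ z2. ennreal (exp (- V (- X A \<omega> + 1 * z1) z2)) * ?I (- X A \<omega> + 1 * z1) z2 \<omega> \<partial>lborel) =
        (\<integral>\<^sup>+ z2. ennreal (exp (- V (- X A \<omega> + 1 * z1) (- W A \<omega> + 1 * z2))) * ?J z1 z2 \<omega> \<partial>lborel)" by simp
    qed
    also have "\<dots> = (\<integral>\<^sup>+ z1. \<integral>\<^sup>+ z2. ennreal (exp (- V z1 z2)) * (ennreal (exp (X A \<omega> + k * Y A \<omega>)) * ?J z1 z2 \<omega>) \<partial>lborel \<partial>lborel)"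
    proof (intro nn_integral_cong)
      fix z1 z2
      have "- V (- X A \<omega> + 1 * z1) (- W A \<omega> + 1 * z2) = - V z1 z2 + (X A \<omega> + k * Y A \<omega>)"
        unfolding V_def W_def using sigma_pos by (simp add: field_simps)
      then have "ennreal (exp (- V (- X A \<omega> + 1 * z1) (- W A \<omega> + 1 * z2))) = ennreal (exp (- V z1 z2)) * ennreal (exp (X A \<omega> + k * Y A \<omega>))"
        by (simp only: exp_add[of "- V z1 z2" "X A \<omega> + k * Y A \<omega>"] ennreal_mult exp_ge_zero)
      then show "ennreal (exp (- V (- X A \<omega> + 1 * z1) (- W A \<omega> + 1 * z2))) * ?J z1 z2 \<omega> =
        ennreal (exp (- V z1 z2)) * (ennreal (exp (X A \<omega> + k * Y A \<omega>)) * ?J z1 z2 \<omega>)"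
        by (simp only: mult.assoc)
    qed
    finally show "(\<integral>\<^sup>+ z1. \<integral>\<^sup>+ z2. ennreal (exp (- V z1 z2)) * ?I z1 z2 \<omega> \<partial>lborel \<partial>lborel) =
       (\<integral>\<^sup>+ z1. \<integral>\<^sup>+ z2. ennreal (exp (- V z1 z2)) * (ennreal (exp (X A \<omega> + k * Y A \<omega>)) * ?J z1 z2 \<omega>) \<partial>lborel \<partial>lborel)" .
  qed
  also have "\<dots> = (\<integral>\<^sup>+ z1. \<integral>\<^sup>+ \<omega>. \<integral>\<^sup>+ z2. ennreal (exp (- V z1 z2)) * (ennreal (exp (X A \<omega> + k * Y A \<omega>)) * ?J z1 z2 \<omega>) \<partial>lborel \<partial>M \<partial>lborel)"
    by (intro pm.Fubini') measurable
  also have "\<dots> = (\<integral>\<^sup>+ z1. \<integral>\<^sup>+ z2. \<integral>\<^sup>+ \<omega>. ennreal (exp (- V z1 z2)) * (ennreal (exp (X A \<omega> + k * Y A \<omega>)) * ?J z1 z2 \<omega>) \<partial>M \<partial>lborel \<partial>lborel)"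
    by (intro nn_integral_cong pm.Fubini') measurable
  also have "\<dots> = (\<integral>\<^sup>+ z1. \<integral>\<^sup>+ z2. ennreal (exp (- V z1 z2)) * (\<integral>\<^sup>+ \<omega>. ennreal (exp (X A \<omega> + k * Y A \<omega>)) * ?J z1 z2 \<omega> \<partial>M) \<partial>lborel \<partial>lborel)"
    by (intro nn_integral_cong nn_integral_cmult) measurable
  also have "\<dots> = (\<integral>\<^sup>+ z1. \<integral>\<^sup>+ z2. ennreal (exp ((1 + k\<^sup>2) * A / 2)) * (ennreal (exp (- V z1 z2)) *
      occ_prob M A L (\<lambda>r \<omega>. min (X r \<omega> - r - (- z1)) (W r \<omega> - (\<rho> + \<sigma> * k) * r - (- z2)))) \<partial>lborel \<partial>lborel)"
  proof (intro nn_integral_cong)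
    fix z1 z2
    define f where "f = (\<lambda>r::real. \<lambda>x y. min (z1 - x) (z2 - \<rho> * x - \<sigma> * y))"
    have fc: "continuous_on UNIV (\<lambda>(r, x, y). f r x y)"
      unfolding f_def case_prod_beta' by (intro continuous_intros)
    let ?Z = "\<lambda>r \<omega>. f r (X A \<omega> - X (A - r) \<omega>) (Y A \<omega> - Y (A - r) \<omega>)"
    have "(\<integral>\<^sup>+ \<omega>. ennreal (exp (X A \<omega> + k * Y A \<omega>)) * ?J z1 z2 \<omega> \<partial>M) =
      (\<integral>\<^sup>+ \<omega>. ennreal (exp ((1 + k\<^sup>2) * A / 2)) * (ennreal (exp (1 * X A \<omega> + k * Y A \<omega> - (1\<^sup>2 + k\<^sup>2) * A / 2)) *
         indicator {\<omega> \<in> space M. occ A (\<lambda>r. ?Z r \<omega>) > ennreal L} \<omega>) \<partial>M)"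
    proof (intro nn_integral_cong)
      fix \<omega> assume w[measurable]: "\<omega> \<in> space M"
      have "occ A (\<lambda>r. min (- X A \<omega> + 1 * z1 + X r \<omega>) (- W A \<omega> + 1 * z2 + W r \<omega>)) =
         occ A (\<lambda>r. min (- X A \<omega> + 1 * z1 + X (A - r) \<omega>) (- W A \<omega> + 1 * z2 + W (A - r) \<omega>))"
        by (rule occ_reverse) measurable
      also have "\<dots> = occ A (\<lambda>r. ?Z r \<omega>)"
        unfolding f_def W_def by (rule arg_cong[where f="occ A"]) (simp add: algebra_simps)
      finally have "?J z1 z2 \<omega> = indicator {\<omega> \<in> space M. occ A (\<lambda>r. ?Z r \<omega>) > ennreal L} \<omega>"
        using w by (simp add: indicator_def)
      moreover have "ennreal (exp (X A \<omega> + k * Y A \<omega>)) = ennreal (exp ((1 + k\<^sup>2) * A / 2)) * ennreal (exp (1 * X A \<omega> + k * Y A \<omega> - (1\<^sup>2 + k\<^sup>2) * A / 2))"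
        by (simp add: ennreal_mult[symmetric] mult_exp_exp)
      ultimately show "ennreal (exp (X A \<omega> + k * Y A \<omega>)) * ?J z1 z2 \<omega> =
          ennreal (exp ((1 + k\<^sup>2) * A / 2)) * (ennreal (exp (1 * X A \<omega> + k * Y A \<omega> - (1\<^sup>2 + k\<^sup>2) * A / 2)) *
         indicator {\<omega> \<in> space M. occ A (\<lambda>r. ?Z r \<omega>) > ennreal L} \<omega>)"
        by (simp only: mult.assoc)
    qed
    also have "\<dots> = ennreal (exp ((1 + k\<^sup>2) * A / 2)) * (\<integral>\<^sup>+ \<omega>. ennreal (exp (1 * X A \<omega> + k * Y A \<omega> - (1\<^sup>2 + k\<^sup>2) * A / 2)) *
         indicator {\<omega> \<in> space M. occ A (\<lambda>r. ?Z r \<omega>) > ennreal L} \<omega> \<partial>M)"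
    proof (rule nn_integral_cmult)
      have cr: "continuous_on UNIV (\<lambda>r. A - r)" by (intro continuous_intros)
      have "cont_proc M ?Z"
        by (intro cont_proc_comp[OF _ _ fc] cont_proc_minus cont_proc_const cont_proc_reindex[OF X_proc cr] cont_proc_reindex[OF Y_proc cr])
          measurable
      note ind = borel_measurable_indicator[OF occ_set_measurable[OF this, of L A]]
      have "(\<lambda>\<omega>. ennreal (exp (1 * X A \<omega> + k * Y A \<omega> - (1\<^sup>2 + k\<^sup>2) * A / 2))) \<in> borel_measurable M"
        by measurable
      from borel_measurable_times_ennreal[OF this ind]
      show "(\<lambda>\<omega>. ennreal (exp (1 * X A \<omega> + k * Y A \<omega> - (1\<^sup>2 + k\<^sup>2) * A / 2)) *
         indicator {\<omega> \<in> space M. occ A (\<lambda>r. ?Z r \<omega>) > ennreal L} \<omega>) \<in> borel_measurable M" .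
    qed
    also have "\<dots> = ennreal (exp ((1 + k\<^sup>2) * A / 2)) * occ_prob M A L (\<lambda>r \<omega>. f r (1 * r - X r \<omega>) (k * r - Y r \<omega>))"
      unfolding reversal_tilt[OF A L fc] ..
    also have "(\<lambda>r \<omega>. f r (1 * r - X r \<omega>) (k * r - Y r \<omega>)) = (\<lambda>r \<omega>. min (X r \<omega> - r - (- z1)) (W r \<omega> - (\<rho> + \<sigma> * k) * r - (- z2)))"
      unfolding f_def W_def by (simp add: algebra_simps)
    finally show "ennreal (exp (- V z1 z2)) * (\<integral>\<^sup>+ \<omega>. ennreal (exp (X A \<omega> + k * Y A \<omega>)) * ?J z1 z2 \<omega> \<partial>M) =
       ennreal (exp ((1 + k\<^sup>2) * A / 2)) * (ennreal (exp (- V z1 z2)) *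
      occ_prob M A L (\<lambda>r \<omega>. min (X r \<omega> - r - (- z1)) (W r \<omega> - (\<rho> + \<sigma> * k) * r - (- z2))))"
      by (simp only: mult.left_commute)
  qed
  finally have main: "(\<integral>\<^sup>+ z1. \<integral>\<^sup>+ z2. ennreal (exp (- V z1 z2)) * quadrant_prob A L z1 z2 \<partial>lborel \<partial>lborel) =
    (\<integral>\<^sup>+ z1. \<integral>\<^sup>+ z2. ennreal (exp ((1 + k\<^sup>2) * A / 2)) * (ennreal (exp (- V z1 z2)) *
      occ_prob M A L (\<lambda>r \<omega>. min (X r \<omega> - r - (- z1)) (W r \<omega> - (\<rho> + \<sigma> * k) * r - (- z2)))) \<partial>lborel \<partial>lborel)" .
  let ?R = "\<lambda>z1 z2. occ_prob M A L (\<lambda>r \<omega>. min (X r \<omega> - r - z1) (W r \<omega> - (\<rho> + \<sigma> * k) * r - z2))"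
  have Rm[measurable (raw)]: "(\<lambda>p. ?R (F p) (H p)) \<in> borel_measurable N"
    if [measurable]: "F \<in> borel_measurable N" "H \<in> borel_measurable N" for F H :: "'c \<Rightarrow> real" and N
    by (intro occ_prob_measurable[OF _ prob_space_axioms] cont_proc_min cont_proc_minus cont_proc_const cont_proc_det
        cont_proc_snd[OF X_proc] cont_proc_snd[OF W_proc] continuous_intros) measurable
  have "(\<integral>\<^sup>+ z1. \<integral>\<^sup>+ z2. ennreal (exp (V z1 z2)) * ?R z1 z2 \<partial>lborel \<partial>lborel) =
     (\<integral>\<^sup>+ z1. \<integral>\<^sup>+ z2. ennreal (exp (V (0 + (-1) * z1) z2)) * ?R (0 + (-1) * z1) z2 \<partial>lborel \<partial>lborel)"
    by (subst nn_integral_real_affine[where c="-1" and t=0]) (simp_all, measurable)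
  also have "\<dots> = (\<integral>\<^sup>+ z1. \<integral>\<^sup>+ z2. ennreal (exp (V (0 + (-1) * z1) (0 + (-1) * z2))) * ?R (0 + (-1) * z1) (0 + (-1) * z2) \<partial>lborel \<partial>lborel)"
  proof (rule nn_integral_cong)
    fix z1
    have "(\<lambda>z2. ennreal (exp (V (0 + (-1) * z1) z2)) * ?R (0 + (-1) * z1) z2) \<in> borel_measurable borel" by measurable
    from nn_integral_real_affine[OF this, of "-1" 0]
    show "(\<integral>\<^sup>+ z2. ennreal (exp (V (0 + (-1) * z1) z2)) * ?R (0 + (-1) * z1) z2 \<partial>lborel) =
      (\<integral>\<^sup>+ z2. ennreal (exp (V (0 + (-1) * z1) (0 + (-1) * z2))) * ?R (0 + (-1) * z1) (0 + (-1) * z2) \<partial>lborel)" by simp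
  qed
  also have "\<dots> = (\<integral>\<^sup>+ z1. \<integral>\<^sup>+ z2. ennreal (exp (- V z1 z2)) * ?R (- z1) (- z2) \<partial>lborel \<partial>lborel)"
  proof (intro nn_integral_cong)
    fix z1 z2
    have "V (0 + (-1) * z1) (0 + (-1) * z2) = - V z1 z2" unfolding V_def using sigma_pos by (simp add: field_simps)
    then show "ennreal (exp (V (0 + (-1) * z1) (0 + (-1) * z2))) * ?R (0 + (-1) * z1) (0 + (-1) * z2) =
      ennreal (exp (- V z1 z2)) * ?R (- z1) (- z2)" by simp
  qed
  finally have "ennreal (exp ((1 + k\<^sup>2) * A / 2)) * (\<integral>\<^sup>+ z1. \<integral>\<^sup>+ z2. ennreal (exp (V z1 z2)) * ?R z1 z2 \<partial>lborel \<partial>lborel) =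
     ennreal (exp ((1 + k\<^sup>2) * A / 2)) * (\<integral>\<^sup>+ z1. \<integral>\<^sup>+ z2. ennreal (exp (- V z1 z2)) * ?R (- z1) (- z2) \<partial>lborel \<partial>lborel)"
    by (simp only:)
  also have "\<dots> = (\<integral>\<^sup>+ z1. ennreal (exp ((1 + k\<^sup>2) * A / 2)) * (\<integral>\<^sup>+ z2. ennreal (exp (- V z1 z2)) * ?R (- z1) (- z2) \<partial>lborel) \<partial>lborel)"
    by (rule nn_integral_cmult[symmetric]) measurable
  also have "\<dots> = (\<integral>\<^sup>+ z1. \<integral>\<^sup>+ z2. ennreal (exp ((1 + k\<^sup>2) * A / 2)) * (ennreal (exp (- V z1 z2)) * ?R (- z1) (- z2)) \<partial>lborel \<partial>lborel)"
    by (intro nn_integral_cong nn_integral_cmult[symmetric]) measurable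
  finally show ?thesis using main by (simp only:)
qed

end

section \<open>From local limits to the probability of ruin\<close>

lemma SUP_Suc_incseq:
  fixes f :: "nat \<Rightarrow> ennreal"
  assumes "incseq f"
  shows "(SUP m. f (Suc m)) = (SUP m. f m)"
proof (rule antisym)
  show "(SUP m. f (Suc m)) \<le> (SUP m. f m)" by (intro SUP_least SUP_upper) auto
  show "(SUP m. f m) \<le> (SUP m. f (Suc m))"
    using incseq_SucD[OF assms] by (intro SUP_mono) blast
qed

lemma tendsto_enn2real_finite:
  assumes "(f \<longlongrightarrow> l) F" "l < \<infinity>"
  shows "((\<lambda>x. enn2real (f x)) \<longlongrightarrow> enn2real l) F"
  using assms by (intro tendsto_enn2real) (simp_all add: ennreal_enn2real)

lemma geometric_tail_bound:
  fixes r :: real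
  assumes r: "0 \<le> r" "r < 1"
  shows "(\<Sum>k=m..<K. r ^ k) \<le> r ^ m / (1 - r)"
proof (cases "m \<le> K")
  case True
  have "(\<Sum>k=m..<K. r ^ k) * (1 - r) = (\<Sum>k=m..<K. (- (r ^ Suc k)) - (- (r ^ k)))"
    by (subst sum_distrib_right) (simp add: algebra_simps)
  also have "\<dots> = (- (r ^ K)) - (- (r ^ m))" by (rule sum_Suc_diff'[OF True])
  also have "\<dots> \<le> r ^ m" using r by simp
  finally show ?thesis using r by (simp add: field_simps)
qed (use r in simp)

lemma occ_prob_null: "occ_prob M 0 L Z = 0"
proof -
  have "occ 0 z = 0" for z
  proof -
    have "emeasure lborel {t \<in> {0..0}. 0 < z t} \<le> emeasure lborel {0::real}"
      by (rule emeasure_mono) auto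
    then show ?thesis unfolding occ_def by simp
  qed
  then show ?thesis unfolding occ_prob_def by simp
qed

text \<open>Ruin happens at the end. The interval up to \<open>u\<^sup>2 - x\<close> is cut into the last \<open>m\<close> units, where the exact
limit is known, the preceding unit blocks back to roughly \<open>3/4 * u\<^sup>2\<close>, whose probabilities decay
geometrically relative to \<open>g\<close>, and the early part, which is negligible. The block bound also shows
that the limits for growing \<open>m\<close> stay bounded.\<close>

lemma (in prob_space) ruin_asymptotics:
  fixes Z :: "real \<Rightarrow> real \<Rightarrow> 'a \<Rightarrow> real" and g e :: "real \<Rightarrow> real" and Lm :: "nat \<Rightarrow> ennreal"
  assumes Z: "\<And>u. 0 < u \<Longrightarrow> cont_proc M (Z u)"
    and g: "\<And>u. 0 < u \<Longrightarrow> 0 < g u"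
    and q: "0 < q" and C: "0 \<le> C"
    and block: "\<And>u B. 1 \<le> u \<Longrightarrow> u\<^sup>2 / 2 \<le> u\<^sup>2 - B \<Longrightarrow> - u\<^sup>2 \<le> B \<Longrightarrow>
      occ_prob M 1 0 (\<lambda>r. Z u (u\<^sup>2 - B + r)) \<le> ennreal (g u * (C * exp (- (q * B / 2))))"
    and early: "\<And>u. 1 \<le> u \<Longrightarrow> occ_prob M (3 / 4 * u\<^sup>2) 0 (Z u) \<le> ennreal (e u)"
    and e0: "\<And>u. 0 \<le> e u" and e: "((\<lambda>u. e u / g u) \<longlongrightarrow> 0) at_top"
    and loc: "\<And>m::nat. ((\<lambda>u. occ_prob M (real (Suc m)) L (\<lambda>r. Z u (u\<^sup>2 - x - real (Suc m) + r)) * ennreal (1 / g u)) \<longlongrightarrow> Lm m) at_top"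
    and inc: "incseq Lm"
  shows "(SUP m. Lm m) < \<infinity>"
    and "((\<lambda>u. enn2real (occ_prob M (u\<^sup>2 - x) L (Z u)) / g u) \<longlongrightarrow> enn2real (SUP m. Lm m)) at_top"
proof -
  define r where "r = exp (- (q / 2))"
  have r: "0 \<le> r" "r < 1" using q by (auto simp: r_def)
  define C' where "C' = C * exp (- (q * (x + 1) / 2)) / (1 - r)"
  have C': "0 \<le> C'" using C r by (simp add: C'_def)
  have fin: "occ_prob M A L Z \<noteq> \<infinity>" for A L and Z :: "real \<Rightarrow> 'a \<Rightarrow> real"
    using occ_prob_le_1[of A L Z] by (metis ennreal_one_neq_top infinity_ennreal_def neq_top_trans)
  have blocks: "(\<Sum>k=m..<K. occ_prob M 1 0 (\<lambda>s. Z u (u\<^sup>2 - x - real (Suc k) + s))) \<le> ennreal (g u * (C' * r ^ m))"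
    if u: "1 \<le> u" and K: "x + real K \<le> u\<^sup>2 / 2" "- u\<^sup>2 \<le> x" for m K u
  proof -
    have "(\<Sum>k=m..<K. occ_prob M 1 0 (\<lambda>s. Z u (u\<^sup>2 - x - real (Suc k) + s))) \<le>
      (\<Sum>k=m..<K. ennreal (g u * (C * exp (- (q * (x + 1) / 2)) * r ^ k)))"
    proof (rule sum_mono)
      fix k assume "k \<in> {m..<K}"
      then have "real (Suc k) \<le> real K" by (simp only: of_nat_le_iff) simp
      then have "u\<^sup>2 / 2 \<le> u\<^sup>2 - (x + real (Suc k))" "- u\<^sup>2 \<le> x + real (Suc k)" using K by linarith+
      from block[OF u this]
      have "occ_prob M 1 0 (\<lambda>s. Z u (u\<^sup>2 - x - real (Suc k) + s)) \<le> ennreal (g u * (C * exp (- (q * (x + real (Suc k)) / 2))))"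
        by (simp add: algebra_simps)
      also have "exp (- (q * (x + real (Suc k)) / 2)) = exp (- (q * (x + 1) / 2)) * r ^ k"
        unfolding r_def exp_of_nat_mult[symmetric] exp_add[symmetric] by (simp add: field_simps)
      finally show "occ_prob M 1 0 (\<lambda>s. Z u (u\<^sup>2 - x - real (Suc k) + s)) \<le> ennreal (g u * (C * exp (- (q * (x + 1) / 2)) * r ^ k))"
        by (simp add: mult.assoc)
    qed
    also have "\<dots> = ennreal (\<Sum>k=m..<K. g u * (C * exp (- (q * (x + 1) / 2)) * r ^ k))"
      using C r g[of u] u by (intro sum_ennreal) auto
    also have "\<dots> \<le> ennreal (g u * (C' * r ^ m))"
    proof (rule ennreal_leI)
      have "(\<Sum>k=m..<K. g u * (C * exp (- (q * (x + 1) / 2)) * r ^ k)) = g u * (C * exp (- (q * (x + 1) / 2))) * (\<Sum>k=m..<K. r ^ k)"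
        by (simp add: sum_distrib_left mult.assoc)
      also have "\<dots> \<le> g u * (C * exp (- (q * (x + 1) / 2))) * (r ^ m / (1 - r))"
        using C g[of u] u by (intro mult_left_mono geometric_tail_bound r) auto
      also have "\<dots> = g u * (C' * r ^ m)" by (simp add: C'_def)
      finally show "(\<Sum>k=m..<K. g u * (C * exp (- (q * (x + 1) / 2)) * r ^ k)) \<le> g u * (C' * r ^ m)" .
    qed
    finally show ?thesis .
  qed
  have aux: "4 * (y + n) \<le> b \<Longrightarrow> 0 \<le> n \<Longrightarrow> 0 \<le> b / 4 - y" for y n b :: real by (simp add: field_simps)
  have aux2: "4 * (y + n) \<le> b \<Longrightarrow> n \<le> b / 4 - y" for y n b :: real by (simp add: field_simps)
  have big: "\<forall>\<^sub>F u in at_top. c \<le> u\<^sup>2" for c :: real by real_asymp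
  have Lm_le: "Lm m \<le> ennreal C'" for m
  proof (rule tendsto_upperbound[OF loc])
    show "\<forall>\<^sub>F u in at_top. occ_prob M (real (Suc m)) L (\<lambda>r. Z u (u\<^sup>2 - x - real (Suc m) + r)) * ennreal (1 / g u) \<le> ennreal C'"
      using eventually_ge_at_top[of 1] big[of "2 * (x + real (Suc m))"] big[of "- x"]
    proof eventually_elim
      case (elim u)
      then have u: "1 \<le> u" "0 < u" by auto
      let ?Z = "\<lambda>s. Z u (u\<^sup>2 - x - real (Suc m) + s)"
      have Zc: "cont_proc M ?Z" by (rule cont_proc_reindex[OF Z[OF u(2)]]) (intro continuous_intros)
      have "occ_prob M (real (Suc m)) L ?Z \<le> occ_prob M (real 0) L (\<lambda>s. ?Z (real (Suc m) - real 0 + s)) +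
         (\<Sum>k=0..<Suc m. occ_prob M 1 0 (\<lambda>s. ?Z (real (Suc m) - real (Suc k) + s))) + occ_prob M 0 0 ?Z"
        by (rule occ_prob_decompose[OF Zc]) simp_all
      also have "\<dots> = (\<Sum>k=0..<Suc m. occ_prob M 1 0 (\<lambda>s. Z u (u\<^sup>2 - x - real (Suc k) + s)))"
        by (simp add: occ_prob_null algebra_simps)
      also have "\<dots> \<le> ennreal (g u * (C' * r ^ 0))"
        by (rule blocks) (use elim in auto)
      finally have "occ_prob M (real (Suc m)) L ?Z * ennreal (1 / g u) \<le> ennreal (g u * C') * ennreal (1 / g u)"
        by (intro mult_right_mono) auto
      also have "\<dots> = ennreal C'" using g[OF u(2)] C' by (simp flip: ennreal_mult)
      finally show ?case .
    qed
  qed simp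
  then have "(SUP m. Lm m) \<le> ennreal C'" by (intro SUP_least)
  then show S: "(SUP m. Lm m) < \<infinity>" by (rule le_less_trans) simp
  have Lfin: "Lm m < \<infinity>" for m using Lm_le[of m] by (rule le_less_trans) simp
  show "((\<lambda>u. enn2real (occ_prob M (u\<^sup>2 - x) L (Z u)) / g u) \<longlongrightarrow> enn2real (SUP m. Lm m)) at_top"
  proof (rule localization_limit[where C=C' and r=r and e=e and
        loc="\<lambda>m u. enn2real (occ_prob M (real (Suc m)) L (\<lambda>s. Z u (u\<^sup>2 - x - real (Suc m) + s)))" and Ks="\<lambda>m. enn2real (Lm m)"])
    show "\<forall>\<^sub>F u in at_top. 0 < g u" using eventually_gt_at_top[of 0] by eventually_elim (rule g)
    show "\<forall>\<^sub>F u in at_top. enn2real (occ_prob M (real (Suc m)) L (\<lambda>s. Z u (u\<^sup>2 - x - real (Suc m) + s))) \<le> enn2real (occ_prob M (u\<^sup>2 - x) L (Z u))" for m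
      using eventually_gt_at_top[of 0] big[of "x + real (Suc m)"]
    proof eventually_elim
      case (elim u)
      then have "occ_prob M (real (Suc m)) L (\<lambda>s. Z u (u\<^sup>2 - x - real (Suc m) + s)) \<le> occ_prob M (u\<^sup>2 - x) L (Z u)"
        by (intro occ_prob_lower Z) auto
      then show ?case using fin by (intro enn2real_mono) (auto simp: less_top)
    qed
    show "\<forall>\<^sub>F u in at_top. enn2real (occ_prob M (u\<^sup>2 - x) L (Z u)) \<le>
       enn2real (occ_prob M (real (Suc m)) L (\<lambda>s. Z u (u\<^sup>2 - x - real (Suc m) + s))) + g u * (C' * r ^ m) + e u" for m
      using eventually_ge_at_top[of 2] big[of "4 * (x + real (Suc m))"] big[of "- x"]
    proof eventually_elim
      case (elim u)
      then have u: "1 \<le> u" "0 < u" "2 \<le> u" by auto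
      have u4: "4 \<le> u\<^sup>2" using power_mono[OF u(3), of 2] by simp
      \<comment> \<open>With this many blocks the remaining part ends before \<open>3/4 * u\<^sup>2\<close>, and all blocks lie in the second half.\<close>
      define K where "K = nat \<lceil>u\<^sup>2 / 4 - x\<rceil>"
      have pos: "0 \<le> u\<^sup>2 / 4 - x" using aux[OF elim(2)] by simp
      have K1: "u\<^sup>2 / 4 - x \<le> real K" unfolding K_def by (rule real_nat_ceiling_ge)
      have K2: "real K \<le> u\<^sup>2 / 4 - x + 1" unfolding K_def using pos by (simp add: of_nat_nat)
      have mK: "Suc m \<le> K"
      proof -
        have "real (Suc m) \<le> real K" using K1 aux2[OF elim(2)] by linarith
        then show ?thesis by (simp only: of_nat_le_iff)
      qed
      have "occ_prob M (u\<^sup>2 - x) L (Z u) \<le> occ_prob M (real (Suc m)) L (\<lambda>s. Z u (u\<^sup>2 - x - real (Suc m) + s)) +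
        (\<Sum>k=Suc m..<K. occ_prob M 1 0 (\<lambda>s. Z u (u\<^sup>2 - x - real (Suc k) + s))) + occ_prob M (3 / 4 * u\<^sup>2) 0 (Z u)"
        by (rule occ_prob_decompose[OF Z[OF u(2)] mK]) (use K1 in linarith)
      also have "\<dots> \<le> occ_prob M (real (Suc m)) L (\<lambda>s. Z u (u\<^sup>2 - x - real (Suc m) + s)) + ennreal (g u * (C' * r ^ Suc m)) + ennreal (e u)"
      proof (intro add_mono order_refl early[OF u(1)] blocks[OF u(1)])
        show "x + real K \<le> u\<^sup>2 / 2" using K2 u4 by linarith
        show "- u\<^sup>2 \<le> x" using elim by linarith
      qed
      also have "\<dots> \<le> occ_prob M (real (Suc m)) L (\<lambda>s. Z u (u\<^sup>2 - x - real (Suc m) + s)) + ennreal (g u * (C' * r ^ m)) + ennreal (e u)"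
        using C' r g[OF u(2)] by (intro add_mono order_refl ennreal_leI mult_left_mono) (auto intro: mult_left_le_one_le)
      also have "\<dots> = ennreal (enn2real (occ_prob M (real (Suc m)) L (\<lambda>s. Z u (u\<^sup>2 - x - real (Suc m) + s))) + g u * (C' * r ^ m) + e u)"
        using C' r g[OF u(2)] e0 fin by (simp add: ennreal_enn2real_if[symmetric] less_top)
      finally show ?case
        using C' r g[OF u(2)] e0 by (intro enn2real_leI) auto
    qed
    show "((\<lambda>u. enn2real (occ_prob M (real (Suc m)) L (\<lambda>s. Z u (u\<^sup>2 - x - real (Suc m) + s))) / g u) \<longlongrightarrow> enn2real (Lm m)) at_top" for m
    proof -
      have "((\<lambda>u. enn2real (occ_prob M (real (Suc m)) L (\<lambda>r. Z u (u\<^sup>2 - x - real (Suc m) + r)) * ennreal (1 / g u))) \<longlongrightarrow> enn2real (Lm m)) at_top"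
        by (rule tendsto_enn2real_finite[OF loc Lfin])
      then show ?thesis
        by (rule Lim_transform_eventually)
          (use eventually_gt_at_top[of "0::real"] in eventually_elim, use g in \<open>auto simp: enn2real_mult less_imp_le\<close>)
    qed
    have "Lm \<longlonglongrightarrow> (SUP m. Lm m)" by (rule LIMSEQ_SUP[OF inc])
    then show "(\<lambda>m. enn2real (Lm m)) \<longlonglongrightarrow> enn2real (SUP m. Lm m)"
      by (rule tendsto_enn2real_finite[OF _ S])
  qed (use r e in auto)
qed

text \<open>Used for the positivity of the limiting constants: a path is bounded on \<open>{0..A}\<close>, so lifting it
far enough makes it positive throughout.\<close>

lemma (in prob_space) occ_prob_shift_pos:
  assumes Z: "cont_proc M Z" and L: "0 \<le> L" "L < A"
  shows "\<exists>n::nat. 0 < occ_prob M A L (\<lambda>r \<omega>. Z r \<omega> + real n)"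
proof (rule ccontr)
  assume "\<not> ?thesis"
  then have z: "occ_prob M A L (\<lambda>r \<omega>. Z r \<omega> + real n) = 0" for n by (auto simp: not_less)
  have Zn: "cont_proc M (\<lambda>r \<omega>. Z r \<omega> + real n)" for n
    by (intro cont_proc_add Z cont_proc_const) auto
  let ?S = "\<lambda>n. {\<omega> \<in> space M. ennreal L < occ A (\<lambda>r. Z r \<omega> + real n)}"
  have "(\<Union>n. ?S n) = space M"
  proof (intro equalityI subsetI)
    fix \<omega> assume w: "\<omega> \<in> space M"
    have "continuous_on {0..A} (\<lambda>t. Z t \<omega>)" using Z w by (auto simp: cont_proc_def intro: continuous_on_subset)
    then have "compact ((\<lambda>t. Z t \<omega>) ` {0..A})" by (intro compact_continuous_image) auto
    then obtain b where b: "\<And>t. t \<in> {0..A} \<Longrightarrow> \<bar>Z t \<omega>\<bar> \<le> b"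
      using compact_imp_bounded[of "(\<lambda>t. Z t \<omega>) ` {0..A}"] unfolding bounded_iff real_norm_def by blast
    obtain n :: nat where n: "b < real n" using reals_Archimedean2 by blast
    have "{t \<in> {0..A}. 0 < Z t \<omega> + real n} = {0..A}"
    proof (intro equalityI subsetI)
      fix t assume t: "t \<in> {0..A}"
      then show "t \<in> {t \<in> {0..A}. 0 < Z t \<omega> + real n}" using b[OF t] n by auto
    qed auto
    then have "occ A (\<lambda>r. Z r \<omega> + real n) = ennreal A" unfolding occ_def using L by simp
    then have "\<omega> \<in> ?S n" using w L by (simp add: ennreal_less_iff)
    then show "\<omega> \<in> (\<Union>n. ?S n)" by blast
  qed auto
  moreover have "emeasure M (\<Union>n. ?S n) = 0"
    using z occ_set_measurable[OF Zn] unfolding occ_prob_def by (intro emeasure_UN_eq_0) auto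
  ultimately show False using emeasure_space_1 by simp
qed

section \<open>Scaled ruin events\<close>

locale ruin_pair = corr_pair +
  fixes a c1 c2 :: real
begin

text \<open>The ruin condition after Brownian scaling of time by \<open>u\<^sup>2\<close> and of space by \<open>u\<close>: positive exactly
when both (scaled) risk processes are negative. The horizon 1 becomes \<open>u\<^sup>2\<close>.\<close>

definition Z :: "real \<Rightarrow> real \<Rightarrow> 'a \<Rightarrow> real" where
  "Z u s \<omega> = min (X s \<omega> - u\<^sup>2 - c1 * s / u) (W s \<omega> - a * u\<^sup>2 - c2 * s / u)"

lemma Z_proc: "0 < u \<Longrightarrow> cont_proc M (Z u)"
  unfolding Z_def by (intro cont_proc_min cont_proc_minus cont_proc_const cont_proc_det X_proc W_proc)
    (auto intro!: continuous_intros)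

end

section \<open>Two active barriers\<close>

text \<open>For \<open>a > \<rho>\<close> reaching the first barrier typically leaves the second one unreached, so both barriers
contribute to the cost. The hypothesis \<open>a * \<rho> < 1\<close> is the corresponding statement with the barriers
exchanged. In terms of the exponents it says that \<open>l1\<close> and \<open>l2\<close> are both positive.\<close>

locale quadrant_ruin = ruin_pair +
  assumes a_gt: "\<rho> < a" and a_rho: "a * \<rho> < 1"
begin

text \<open>In the independent coordinates \<open>(X, Y)\<close> the corner of the ruin quadrant is \<open>u\<^sup>2 * (1, k)\<close> up to lower
order terms, with \<open>d\<close> the drift of its second coordinate. Hence \<open>q\<close> is the squared Euclidean
norm of \<open>(1, k)\<close>, and \<open>q / 2\<close> is the exponential cost per unit of scaled time; \<open>l1\<close> and \<open>l2\<close> give the cost \<open>V\<close> of additional overshoots.\<close>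

definition k :: real where "k = (a - \<rho>) / \<sigma>"
definition d :: real where "d = (c2 - \<rho> * c1) / \<sigma>"
definition l1 :: real where "l1 = (1 - a * \<rho>) / \<sigma>\<^sup>2"
definition l2 :: real where "l2 = (a - \<rho>) / \<sigma>\<^sup>2"
definition V :: "real \<Rightarrow> real \<Rightarrow> real" where "V z1 z2 = l1 * z1 + l2 * z2"
definition q :: real where "q = 1 + k\<^sup>2"
definition g :: "real \<Rightarrow> real" where "g u = rate 1 c1 u * rate k d u"

lemma l_pos: "0 < l1" "0 < l2" using a_gt a_rho sigma_pos by (auto simp: l1_def l2_def)
lemma q_pos: "0 < q" by (simp add: q_def add_pos_nonneg)
lemma a_eq: "a = \<rho> + \<sigma> * k" using sigma_pos by (simp add: k_def)

lemma V_eq: "z1 + k * ((z2 - \<rho> * z1) / \<sigma>) = V z1 z2"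
proof -
  have "(z1 + k * ((z2 - \<rho> * z1) / \<sigma>)) * \<sigma>\<^sup>2 = z1 * (\<rho>\<^sup>2 + \<sigma>\<^sup>2) - z1 * \<rho>\<^sup>2 + (a - \<rho>) * (z2 - \<rho> * z1)"
    unfolding k_def using sigma_pos by (simp add: field_simps power2_eq_square)
  also have "\<dots> = V z1 z2 * \<sigma>\<^sup>2"
    unfolding unit V_def l1_def l2_def using sigma_pos by (simp add: field_simps power2_eq_square)
  finally show ?thesis using sigma_pos by simp
qed

lemma g_pos: "0 < u \<Longrightarrow> 0 < g u"
  by (simp add: g_def rate_pos)

lemma g_nonneg: "0 \<le> g u"
  by (auto simp: g_def rate_def zero_le_mult_iff zero_le_divide_iff)

text \<open>Density of the overshoots, evaluated after a shift by \<open>e / u\<close> of both. With \<open>e\<close> of either sign it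
produces upper and lower bounds in which the drift over the remaining time no longer appears.\<close>

definition entry_density :: "real \<Rightarrow> real \<Rightarrow> real \<Rightarrow> real \<Rightarrow> real \<Rightarrow> real" where
  "entry_density e B u z1 z2 = dens 1 c1 B u (z1 + e / u) * dens k d B u ((z2 + e / u - \<rho> * (z1 + e / u)) / \<sigma>)"

lemma entry_density_nonneg: "0 \<le> entry_density e B u z1 z2"
  by (simp add: entry_density_def dens_nonneg)

lemma entry_density_measurable[measurable (raw)]:
  assumes [measurable]: "f \<in> borel_measurable N" "h \<in> borel_measurable N"
  shows "(\<lambda>x. entry_density e B u (f x) (h x)) \<in> borel_measurable N"
  unfolding entry_density_def dens_def by measurable

definition local_integral :: "real \<Rightarrow> real \<Rightarrow> real \<Rightarrow> real \<Rightarrow> real \<Rightarrow> ennreal" where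
  "local_integral e B u A L = (\<integral>\<^sup>+ z1. \<integral>\<^sup>+ z2. ennreal (entry_density e B u z1 z2) * quadrant_prob A L z1 z2 \<partial>lborel \<partial>lborel)"

lemma local_integral_shift:
  "(\<integral>\<^sup>+ z1. \<integral>\<^sup>+ z2. ennreal (dens 1 c1 B u z1 * dens k d B u ((z2 - \<rho> * z1) / \<sigma>)) * quadrant_prob A L (z1 + (- e) / u) (z2 + (- e) / u) \<partial>lborel \<partial>lborel) = local_integral e B u A L"
proof -
  let ?F = "\<lambda>z1 z2. ennreal (dens 1 c1 B u z1 * dens k d B u ((z2 - \<rho> * z1) / \<sigma>)) * quadrant_prob A L (z1 + (- e) / u) (z2 + (- e) / u)"
  have [measurable (raw)]: "(\<lambda>x. dens k' d' B u (f x)) \<in> borel_measurable N" if [measurable]: "f \<in> borel_measurable N" for k' d' and f :: "'c \<Rightarrow> real" and N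
    unfolding dens_def by measurable
  have "(\<integral>\<^sup>+ z1. \<integral>\<^sup>+ z2. ?F z1 z2 \<partial>lborel \<partial>lborel) = (\<integral>\<^sup>+ z1. \<integral>\<^sup>+ z2. ?F (e / u + 1 * z1) z2 \<partial>lborel \<partial>lborel)"
    by (subst nn_integral_real_affine[where c=1 and t="e / u"]) (simp_all, measurable)
  also have "\<dots> = (\<integral>\<^sup>+ z1. \<integral>\<^sup>+ z2. ?F (e / u + 1 * z1) (e / u + 1 * z2) \<partial>lborel \<partial>lborel)"
  proof (rule nn_integral_cong)
    fix z1
    have "(\<lambda>z2. ?F (e / u + 1 * z1) z2) \<in> borel_measurable borel" by measurable
    from nn_integral_real_affine[OF this, of 1 "e / u"]
    show "(\<integral>\<^sup>+ z2. ?F (e / u + 1 * z1) z2 \<partial>lborel) = (\<integral>\<^sup>+ z2. ?F (e / u + 1 * z1) (e / u + 1 * z2) \<partial>lborel)" by simp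
  qed
  also have "\<dots> = local_integral e B u A L"
    unfolding local_integral_def entry_density_def by (intro nn_integral_cong) (simp add: add.commute)
  finally show ?thesis .
qed

lemma local_sandwich:
  assumes u: "0 < u" and B: "B < u\<^sup>2" and A: "0 < A" and L: "0 \<le> L"
  defines "C \<equiv> (\<bar>c1\<bar> + \<bar>c2\<bar>) * A"
  shows "occ_prob M A L (\<lambda>r. Z u (u\<^sup>2 - B + r)) \<le> ennreal (1 / \<sigma>) * local_integral (- C) B u A L"
    and "ennreal (1 / \<sigma>) * local_integral C B u A L \<le> occ_prob M A L (\<lambda>r. Z u (u\<^sup>2 - B + r))"
proof -
  have C: "\<bar>c1\<bar> * A \<le> C" "\<bar>c2\<bar> * A \<le> C" using A unfolding C_def by (auto intro!: mult_right_mono)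
  note loc = local_formula[OF u B A L, of c1 a c2, folded k_def d_def, folded Z_def]
  show "occ_prob M A L (\<lambda>r. Z u (u\<^sup>2 - B + r)) \<le> ennreal (1 / \<sigma>) * local_integral (- C) B u A L"
    unfolding loc local_integral_shift[symmetric] minus_minus
    by (intro mult_left_mono nn_integral_mono quadrant_prob_shift_sandwich(1)[OF u C]) auto
  show "ennreal (1 / \<sigma>) * local_integral C B u A L \<le> occ_prob M A L (\<lambda>r. Z u (u\<^sup>2 - B + r))"
    unfolding loc local_integral_shift[symmetric]
    by (intro mult_left_mono nn_integral_mono quadrant_prob_shift_sandwich(2)[OF u C]) auto
qed

text \<open>The factor 4 comes from the two density bounds, the last factor from the shift \<open>e / u\<close>.\<close>

definition density_const :: "real \<Rightarrow> real" where
  "density_const e = 4 * exp (c1\<^sup>2 / 2) * exp (d\<^sup>2 / 2) * exp (2 * (\<bar>e\<bar> * (l1 + l2)))"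

lemma entry_density_bound:
  assumes u: "1 \<le> u" and v: "u\<^sup>2 / 2 \<le> u\<^sup>2 - B" and B: "- u\<^sup>2 \<le> B"
  shows "entry_density e B u z1 z2 \<le> g u * (density_const e * exp (- (q * B / 2)) * (exp (- (V z1 z2 / 2)) + exp (- (2 * V z1 z2))))"
proof -
  define s where "s = u\<^sup>2 / (u\<^sup>2 - B)"
  have u0: "0 < u" using u by simp
  have s: "1 / 2 \<le> s" "s \<le> 2" using time_ratio_bounds[OF u0 v B] by (auto simp: s_def)
  let ?x = "z1 + e / u" and ?y = "(z2 + e / u - \<rho> * (z1 + e / u)) / \<sigma>"
  have "entry_density e B u z1 z2 \<le> (rate 1 c1 u * (2 * exp (c1\<^sup>2 / 2) * exp (- (1\<^sup>2 * B / 2)) * exp (- (s * (1 * ?x))))) *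
     (rate k d u * (2 * exp (d\<^sup>2 / 2) * exp (- (k\<^sup>2 * B / 2)) * exp (- (s * (k * ?y)))))"
    unfolding entry_density_def s_def using u0 rate_pos[OF u0]
    by (intro mult_mono dens_bound[OF u0 v] dens_nonneg) (auto simp: less_imp_le)
  also have "\<dots> = g u * (4 * exp (c1\<^sup>2 / 2) * exp (d\<^sup>2 / 2) * (exp (- (1\<^sup>2 * B / 2)) * exp (- (k\<^sup>2 * B / 2))) * (exp (- (s * (1 * ?x))) * exp (- (s * (k * ?y)))))"
    unfolding g_def by (simp add: mult_ac)
  also have "exp (- (1\<^sup>2 * B / 2)) * exp (- (k\<^sup>2 * B / 2)) = exp (- (q * B / 2))"
    unfolding q_def mult_exp_exp by (simp add: algebra_simps add_divide_distrib)
  also have "exp (- (s * (1 * ?x))) * exp (- (s * (k * ?y))) = exp (- (s * V z1 z2)) * exp (- (s * (e / u * (l1 + l2))))"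
  proof -
    have "1 * ?x + k * ?y = V (z1 + e / u) (z2 + e / u)" using V_eq[of "z1 + e / u" "z2 + e / u"] by simp
    also have "\<dots> = V z1 z2 + e / u * (l1 + l2)" unfolding V_def by (simp add: algebra_simps)
    finally have "s * (1 * ?x) + s * (k * ?y) = s * V z1 z2 + s * (e / u * (l1 + l2))" by (simp only: distrib_left[symmetric])
    then have "- (s * (1 * ?x)) + - (s * (k * ?y)) = - (s * V z1 z2) + - (s * (e / u * (l1 + l2)))" by linarith
    then show ?thesis by (simp only: mult_exp_exp)
  qed
  also have "g u * (4 * exp (c1\<^sup>2 / 2) * exp (d\<^sup>2 / 2) * exp (- (q * B / 2)) * (exp (- (s * V z1 z2)) * exp (- (s * (e / u * (l1 + l2)))))) \<le>
     g u * (4 * exp (c1\<^sup>2 / 2) * exp (d\<^sup>2 / 2) * exp (- (q * B / 2)) * ((exp (- (V z1 z2 / 2)) + exp (- (2 * V z1 z2))) * exp (2 * (\<bar>e\<bar> * (l1 + l2)))))"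
  proof (intro mult_left_mono mult_mono exp_between[OF s])
    have "\<bar>e\<bar> / u \<le> \<bar>e\<bar> / 1" by (rule divide_left_mono) (use u in auto)
    moreover have "- (e / u) \<le> \<bar>e\<bar> / u" using u0 divide_right_mono[of "- e" "\<bar>e\<bar>" u] by simp
    ultimately have "- (e / u) \<le> \<bar>e\<bar>" by simp
    then have "- (e / u) * (l1 + l2) \<le> \<bar>e\<bar> * (l1 + l2)"
      by (rule mult_right_mono) (use l_pos in simp)
    then have "s * (- (e / u) * (l1 + l2)) \<le> s * (\<bar>e\<bar> * (l1 + l2))" using s by (intro mult_left_mono) auto
    also have "\<dots> \<le> 2 * (\<bar>e\<bar> * (l1 + l2))" using s l_pos by (intro mult_right_mono) auto
    finally have "- (s * (e / u * (l1 + l2))) \<le> 2 * (\<bar>e\<bar> * (l1 + l2))"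
      by (simp only: mult_minus_left mult_minus_right)
    then show "exp (- (s * (e / u * (l1 + l2)))) \<le> exp (2 * (\<bar>e\<bar> * (l1 + l2)))" by simp
  qed (auto simp: g_nonneg add_nonneg_nonneg)
  also have "\<dots> = g u * (density_const e * exp (- (q * B / 2)) * (exp (- (V z1 z2 / 2)) + exp (- (2 * V z1 z2))))"
    unfolding density_const_def by (simp add: mult_ac)
  finally show ?thesis .
qed

text \<open>Any number above \<open>2 * l1\<close> and \<open>2 * l2\<close> would do: it has to beat the growth of \<open>exp (- (2 * V z1 z2))\<close>
at minus infinity.\<close>

definition tilt :: real where "tilt = 2 * (l1 + l2) + 1"
definition weight :: "real \<Rightarrow> real \<Rightarrow> real" where
  "weight z1 z2 = (exp (- (V z1 z2 / 2)) + exp (- (2 * V z1 z2))) * exp (tilt * min z1 0 + tilt * min z2 0)"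

lemma weight_nonneg: "0 \<le> weight z1 z2"
  by (auto simp: weight_def intro!: mult_nonneg_nonneg add_nonneg_nonneg)

lemma weight_measurable[measurable (raw)]:
  assumes [measurable]: "f \<in> borel_measurable N" "h \<in> borel_measurable N"
  shows "(\<lambda>x. weight (f x) (h x)) \<in> borel_measurable N"
  unfolding weight_def V_def by measurable

lemma V_measurable[measurable (raw)]:
  assumes [measurable]: "f \<in> borel_measurable N" "h \<in> borel_measurable N"
  shows "(\<lambda>x. V (f x) (h x)) \<in> borel_measurable N"
  unfolding V_def by measurable

lemma weight_integral: "(\<integral>\<^sup>+ z1. \<integral>\<^sup>+ z2. ennreal (weight z1 z2) \<partial>lborel \<partial>lborel) < \<infinity>"
proof -
  let ?E = "\<lambda>al z. ennreal (exp (- (al * z) + tilt * min z 0))"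
  have fin: "(\<integral>\<^sup>+ z. ?E (s * l1) z \<partial>lborel) < \<infinity>" "(\<integral>\<^sup>+ z. ?E (s * l2) z \<partial>lborel) < \<infinity>" if "0 < s" "s \<le> 2" for s
  proof -
    have "s * l1 \<le> 2 * l1" "s * l2 \<le> 2 * l2" using that l_pos by (auto intro!: mult_right_mono)
    then have p: "s * l1 < tilt" "s * l2 < tilt" using l_pos unfolding tilt_def distrib_left by linarith+
    have p': "0 < s * l1" "0 < s * l2" using that l_pos by simp_all
    show "(\<integral>\<^sup>+ z. ?E (s * l1) z \<partial>lborel) < \<infinity>" "(\<integral>\<^sup>+ z. ?E (s * l2) z \<partial>lborel) < \<infinity>"
      by (rule nn_integral_two_sided_exponential[OF p'(1) p(1)], rule nn_integral_two_sided_exponential[OF p'(2) p(2)])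
  qed
  have split: "ennreal (weight z1 z2) = ?E (1 / 2 * l1) z1 * ?E (1 / 2 * l2) z2 + ?E (2 * l1) z1 * ?E (2 * l2) z2" for z1 z2
  proof -
    have "weight z1 z2 = exp (- (1 / 2 * l1 * z1) + tilt * min z1 0) * exp (- (1 / 2 * l2 * z2) + tilt * min z2 0) +
       exp (- (2 * l1 * z1) + tilt * min z1 0) * exp (- (2 * l2 * z2) + tilt * min z2 0)"
      unfolding weight_def V_def distrib_right mult_exp_exp by (simp add: algebra_simps add_divide_distrib)
    then show ?thesis by (simp add: ennreal_mult)
  qed
  have "(\<integral>\<^sup>+ z1. \<integral>\<^sup>+ z2. ennreal (weight z1 z2) \<partial>lborel \<partial>lborel) =
     (\<integral>\<^sup>+ z1. ?E (1 / 2 * l1) z1 * (\<integral>\<^sup>+ z2. ?E (1 / 2 * l2) z2 \<partial>lborel) + ?E (2 * l1) z1 * (\<integral>\<^sup>+ z2. ?E (2 * l2) z2 \<partial>lborel) \<partial>lborel)"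
    unfolding split by (simp add: nn_integral_add nn_integral_cmult)
  also have "\<dots> = (\<integral>\<^sup>+ z. ?E (1 / 2 * l1) z \<partial>lborel) * (\<integral>\<^sup>+ z2. ?E (1 / 2 * l2) z2 \<partial>lborel) +
      (\<integral>\<^sup>+ z. ?E (2 * l1) z \<partial>lborel) * (\<integral>\<^sup>+ z2. ?E (2 * l2) z2 \<partial>lborel)"
    by (simp add: nn_integral_add nn_integral_multc)
  also have "\<dots> < \<infinity>"
    using fin[of "1 / 2"] fin[of 2] by (simp add: ennreal_mult_less_top)
  finally show ?thesis .
qed

lemma tilt_nonneg: "0 \<le> tilt" using l_pos by (simp add: tilt_def)

lemma quadrant_prob_weight_bound:
  assumes A: "0 < A"
  shows "ennreal (exp (- (V z1 z2 / 2)) + exp (- (2 * V z1 z2))) * quadrant_prob A L z1 z2 \<le> ennreal (exp (2 * tilt\<^sup>2 * A) * weight z1 z2)"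
proof -
  have "ennreal (exp (- (V z1 z2 / 2)) + exp (- (2 * V z1 z2))) * quadrant_prob A L z1 z2 \<le>
     ennreal (exp (- (V z1 z2 / 2)) + exp (- (2 * V z1 z2))) * ennreal (exp (2 * tilt\<^sup>2 * A + tilt * min z1 0 + tilt * min z2 0))"
    by (intro mult_left_mono quadrant_prob_bound[OF A tilt_nonneg]) auto
  also have "\<dots> = ennreal ((exp (- (V z1 z2 / 2)) + exp (- (2 * V z1 z2))) * exp (2 * tilt\<^sup>2 * A + tilt * min z1 0 + tilt * min z2 0))"
    by (rule ennreal_mult[symmetric]) (auto intro!: add_nonneg_nonneg)
  also have "(exp (- (V z1 z2 / 2)) + exp (- (2 * V z1 z2))) * exp (2 * tilt\<^sup>2 * A + tilt * min z1 0 + tilt * min z2 0) = exp (2 * tilt\<^sup>2 * A) * weight z1 z2"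
    unfolding weight_def by (simp add: exp_add mult_ac)
  finally show ?thesis .
qed

definition block_const :: real where
  "block_const = 1 / \<sigma> * (density_const (- ((\<bar>c1\<bar> + \<bar>c2\<bar>) * 1)) * exp (2 * tilt\<^sup>2 * 1)) * enn2real (\<integral>\<^sup>+ z1. \<integral>\<^sup>+ z2. ennreal (weight z1 z2) \<partial>lborel \<partial>lborel)"

lemma block_bound:
  assumes u: "1 \<le> u" and v: "u\<^sup>2 / 2 \<le> u\<^sup>2 - B" and B: "- u\<^sup>2 \<le> B"
  shows "occ_prob M 1 0 (\<lambda>r. Z u (u\<^sup>2 - B + r)) \<le> ennreal (g u * (block_const * exp (- (q * B / 2))))"
proof -
  let ?e = "- ((\<bar>c1\<bar> + \<bar>c2\<bar>) * 1)" and ?w = "\<integral>\<^sup>+ z1. \<integral>\<^sup>+ z2. ennreal (weight z1 z2) \<partial>lborel \<partial>lborel"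
  have u0: "0 < u" and Bu: "B < u\<^sup>2" using u v by (auto, smt (verit) divide_pos_pos zero_less_power)
  have const_nonneg: "0 \<le> density_const e" for e by (simp add: density_const_def)
  have "local_integral ?e B u 1 0 \<le> (\<integral>\<^sup>+ z1. \<integral>\<^sup>+ z2. ennreal (g u * (density_const ?e * exp (- (q * B / 2))) * exp (2 * tilt\<^sup>2 * 1)) * ennreal (weight z1 z2) \<partial>lborel \<partial>lborel)"
    unfolding local_integral_def
  proof (intro nn_integral_mono)
    fix z1 z2
    have "ennreal (entry_density ?e B u z1 z2) * quadrant_prob 1 0 z1 z2 \<le>
       ennreal (g u * (density_const ?e * exp (- (q * B / 2)) * (exp (- (V z1 z2 / 2)) + exp (- (2 * V z1 z2))))) * quadrant_prob 1 0 z1 z2"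
      by (intro mult_right_mono ennreal_leI entry_density_bound[OF u v B]) auto
    also have "\<dots> = ennreal (g u * (density_const ?e * exp (- (q * B / 2)))) * (ennreal (exp (- (V z1 z2 / 2)) + exp (- (2 * V z1 z2))) * quadrant_prob 1 0 z1 z2)"
    proof -
      have "0 \<le> exp (- (V z1 z2 / 2)) + exp (- (2 * V z1 z2))" "0 \<le> g u * (density_const ?e * exp (- (q * B / 2)))"
        using g_nonneg const_nonneg by (auto intro: add_nonneg_nonneg)
      then show ?thesis by (simp only: mult.assoc[symmetric] ennreal_mult[symmetric])
    qed
    also have "\<dots> \<le> ennreal (g u * (density_const ?e * exp (- (q * B / 2)))) * ennreal (exp (2 * tilt\<^sup>2 * 1) * weight z1 z2)"
      by (intro mult_left_mono quadrant_prob_weight_bound) auto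
    also have "\<dots> = ennreal (g u * (density_const ?e * exp (- (q * B / 2))) * exp (2 * tilt\<^sup>2 * 1)) * ennreal (weight z1 z2)"
      using g_nonneg const_nonneg weight_nonneg by (simp add: mult.assoc ennreal_mult[symmetric])
    finally show "ennreal (entry_density ?e B u z1 z2) * quadrant_prob 1 0 z1 z2 \<le> \<dots>" .
  qed
  also have "\<dots> = ennreal (g u * (density_const ?e * exp (- (q * B / 2))) * exp (2 * tilt\<^sup>2 * 1)) * ?w"
    by (simp add: nn_integral_cmult)
  finally have integral_bound: "local_integral ?e B u 1 0 \<le> ennreal (g u * (density_const ?e * exp (- (q * B / 2))) * exp (2 * tilt\<^sup>2 * 1)) * ?w" .
  have "occ_prob M 1 0 (\<lambda>r. Z u (u\<^sup>2 - B + r)) \<le> ennreal (1 / \<sigma>) * local_integral ?e B u 1 0"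
    by (rule local_sandwich(1)[OF u0 Bu]) auto
  also have "\<dots> \<le> ennreal (1 / \<sigma>) * (ennreal (g u * (density_const ?e * exp (- (q * B / 2))) * exp (2 * tilt\<^sup>2 * 1)) * ?w)"
    by (intro mult_left_mono integral_bound) auto
  also have "?w = ennreal (enn2real ?w)" using weight_integral by (simp add: less_top)
  also have "ennreal (1 / \<sigma>) * (ennreal (g u * (density_const ?e * exp (- (q * B / 2))) * exp (2 * tilt\<^sup>2 * 1)) * ennreal (enn2real ?w)) =
     ennreal (1 / \<sigma> * ((g u * (density_const ?e * exp (- (q * B / 2))) * exp (2 * tilt\<^sup>2 * 1)) * enn2real ?w))"
    using g_nonneg const_nonneg sigma_pos by (simp add: ennreal_mult[symmetric])
  also have "1 / \<sigma> * ((g u * (density_const ?e * exp (- (q * B / 2))) * exp (2 * tilt\<^sup>2 * 1)) * enn2real ?w) = g u * (block_const * exp (- (q * B / 2)))"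
    unfolding block_const_def by (simp add: mult_ac)
  finally show ?thesis .
qed

lemma block_const_nonneg: "0 \<le> block_const"
  using sigma_pos by (simp add: block_const_def density_const_def)

text \<open>The Chernoff bound at time \<open>3/4 * u\<^sup>2\<close> along the direction \<open>(1, k)\<close>. The factor 4/3 is the optimal
tilt; it gives the exponent \<open>- 2/3 * q * u\<^sup>2\<close>, strictly below the exponent \<open>- q / 2 * u\<^sup>2\<close> of \<open>g\<close>.\<close>

definition early_rate :: "real \<Rightarrow> real" where
  "early_rate u = exp (2 / 3 * q * u\<^sup>2 - 4 / 3 * (q * u\<^sup>2 - (l1 * \<bar>c1\<bar> + l2 * \<bar>c2\<bar>) * u))"

lemma early_bound:
  assumes u: "1 \<le> u"
  shows "occ_prob M (3 / 4 * u\<^sup>2) 0 (Z u) \<le> ennreal (early_rate u)"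
proof -
  have u0: "0 < u" using u by simp
  have "occ_prob M (3 / 4 * u\<^sup>2) 0 (Z u) \<le> ennreal (exp (((4 / 3)\<^sup>2 + (4 / 3 * k)\<^sup>2) / 2 * (3 / 4 * u\<^sup>2) - 4 / 3 * (q * u\<^sup>2 - (l1 * \<bar>c1\<bar> + l2 * \<bar>c2\<bar>) * u)))"
  proof (rule occ_prob_tail)
    show "0 < 3 / 4 * u\<^sup>2" using u0 by simp
    fix t \<omega> assume t: "0 \<le> t" "t \<le> 3 / 4 * u\<^sup>2" and "0 < Z u t \<omega>"
    then have p: "u\<^sup>2 + c1 * t / u < X t \<omega>" "a * u\<^sup>2 + c2 * t / u < W t \<omega>" by (auto simp: Z_def)
    have lb: "- (\<bar>c\<bar> * u) \<le> c * t / u" for c :: real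
    proof -
      have "t \<le> u * u" using t(2) zero_le_power2[of u] unfolding power2_eq_square by linarith
      then have "t / u \<le> u" using u0 by (simp add: field_simps)
      moreover have "0 \<le> t / u" using t u0 by simp
      ultimately have "\<bar>c * (t / u)\<bar> \<le> \<bar>c\<bar> * u" by (simp add: abs_mult mult_left_mono del: times_divide_eq_right)
      then have "- (c * (t / u)) \<le> \<bar>c\<bar> * u" by linarith
      then have "- (\<bar>c\<bar> * u) \<le> c * (t / u)" by linarith
      then show ?thesis by simp
    qed
    have "l1 * (u\<^sup>2 - \<bar>c1\<bar> * u) + l2 * (a * u\<^sup>2 - \<bar>c2\<bar> * u) < l1 * X t \<omega> + l2 * W t \<omega>"
      using p lb[of c1] lb[of c2] l_pos by (intro add_strict_mono mult_strict_left_mono) auto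
    also have "l1 * X t \<omega> + l2 * W t \<omega> = X t \<omega> + k * Y t \<omega>"
      using V_eq[of "X t \<omega>" "W t \<omega>"] sigma_pos unfolding V_def W_def by simp
    also have "l1 * (u\<^sup>2 - \<bar>c1\<bar> * u) + l2 * (a * u\<^sup>2 - \<bar>c2\<bar> * u) = (l1 * 1 + l2 * a) * u\<^sup>2 - (l1 * \<bar>c1\<bar> + l2 * \<bar>c2\<bar>) * u"
      by (simp add: algebra_simps)
    also have "l1 * 1 + l2 * a = q"
      using V_eq[of 1 a] sigma_pos unfolding V_def q_def power2_eq_square by (simp add: k_def)
    finally show "4 / 3 * (q * u\<^sup>2 - (l1 * \<bar>c1\<bar> + l2 * \<bar>c2\<bar>) * u) < 4 / 3 * X t \<omega> + 4 / 3 * k * Y t \<omega>"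
      by (simp add: algebra_simps)
  qed
  also have "((4 / 3)\<^sup>2 + (4 / 3 * k)\<^sup>2) / 2 * (3 / 4 * u\<^sup>2) = 2 / 3 * q * u\<^sup>2"
    unfolding q_def by (simp add: power2_eq_square field_simps)
  finally show ?thesis unfolding early_rate_def .
qed

lemma early_limit: "((\<lambda>u. early_rate u / g u) \<longlongrightarrow> 0) at_top"
proof -
  let ?b = "4 / 3 * (l1 * \<bar>c1\<bar> + l2 * \<bar>c2\<bar>) + c1 + k * d" and ?c = "c1\<^sup>2 / 2 + d\<^sup>2 / 2"
  have "((\<lambda>u. 2 * pi * (exp (- (q / 6 * u\<^sup>2) + ?b * u + ?c) * u ^ 2)) \<longlongrightarrow> 2 * pi * 0) at_top"
    by (intro tendsto_mult tendsto_const exp_quadratic_limit) (use q_pos in simp)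
  moreover have "\<forall>\<^sub>F u in at_top. 2 * pi * (exp (- (q / 6 * u\<^sup>2) + ?b * u + ?c) * u ^ 2) = early_rate u / g u"
    using eventually_gt_at_top[of 0]
  proof eventually_elim
    case (elim u)
    have e: "- (q / 6 * u\<^sup>2) + ?b * u + ?c = (2 / 3 * q * u\<^sup>2 - 4 / 3 * (q * u\<^sup>2 - (l1 * \<bar>c1\<bar> + l2 * \<bar>c2\<bar>) * u)) +
        ((1\<^sup>2 * u\<^sup>2 / 2 + 1 * c1 * u + c1\<^sup>2 / 2) + (k\<^sup>2 * u\<^sup>2 / 2 + k * d * u + d\<^sup>2 / 2))"
      unfolding q_def by (simp add: field_simps)
    have "1 / g u = 2 * pi * u ^ 2 * (exp (1\<^sup>2 * u\<^sup>2 / 2 + 1 * c1 * u + c1\<^sup>2 / 2) * exp (k\<^sup>2 * u\<^sup>2 / 2 + k * d * u + d\<^sup>2 / 2))"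
      using elim unfolding g_def rate_def exp_minus by (simp add: field_simps power2_eq_square)
    then have "early_rate u / g u = early_rate u * (2 * pi * u ^ 2 * (exp (1\<^sup>2 * u\<^sup>2 / 2 + 1 * c1 * u + c1\<^sup>2 / 2) * exp (k\<^sup>2 * u\<^sup>2 / 2 + k * d * u + d\<^sup>2 / 2)))"
      by (metis divide_inverse inverse_eq_divide)
    also have "\<dots> = 2 * pi * (exp (- (q / 6 * u\<^sup>2) + ?b * u + ?c) * u ^ 2)"
      unfolding early_rate_def e exp_add by (simp only: mult_ac)
    finally show ?case by simp
  qed
  ultimately show ?thesis by (simp add: tendsto_cong)
qed

text \<open>Dominated convergence. Pointwise limits come from \<open>dens_over_rate_limit\<close>; the dominating function
combines the growth of the density bound with the decay of \<open>quadrant_prob\<close>.\<close>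

lemma local_integral_limit:
  assumes A: "0 < A"
  shows "((\<lambda>u. local_integral e B u A L * ennreal (1 / g u)) \<longlongrightarrow>
    (\<integral>\<^sup>+ z1. \<integral>\<^sup>+ z2. ennreal (exp (- (q * B / 2)) * exp (- V z1 z2)) * quadrant_prob A L z1 z2 \<partial>lborel \<partial>lborel)) at_top"
proof -
  let ?P = "lborel \<Otimes>\<^sub>M lborel :: (real \<times> real) measure"
  let ?G = "\<lambda>p. enn2real (quadrant_prob A L (fst p) (snd p))"
  define s where "s = (\<lambda>u p. entry_density e B u (fst p) (snd p) / g u * ?G p)"
  define f where "f = (\<lambda>p. exp (- (q * B / 2)) * exp (- V (fst p) (snd p)) * ?G p)"
  define w where "w = (\<lambda>p. density_const e * exp (- (q * B / 2)) * exp (2 * tilt\<^sup>2 * A) * weight (fst p) (snd p))"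
  have Gfin: "quadrant_prob A L z1 z2 = ennreal (enn2real (quadrant_prob A L z1 z2))" for z1 z2
    using quadrant_prob_le_1[of A L z1 z2] by (metis ennreal_enn2real ennreal_one_less_top le_less_trans)
  have sm[measurable]: "s u \<in> borel_measurable ?P" for u unfolding s_def by measurable
  have fm[measurable]: "f \<in> borel_measurable ?P" unfolding f_def by measurable
  have wm[measurable]: "w \<in> borel_measurable ?P" unfolding w_def by measurable
  have const_nonneg: "0 \<le> density_const e" by (simp add: density_const_def)
  have s_int: "(\<integral>\<^sup>+ p. ennreal (s u p) \<partial>?P) = local_integral e B u A L * ennreal (1 / g u)" if u: "0 < u" for u
  proof -
    have "(\<integral>\<^sup>+ p. ennreal (s u p) \<partial>?P) = (\<integral>\<^sup>+ z1. \<integral>\<^sup>+ z2. ennreal (s u (z1, z2)) \<partial>lborel \<partial>lborel)"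
      by (rule lborel.nn_integral_fst[symmetric]) measurable
    also have "\<dots> = (\<integral>\<^sup>+ z1. \<integral>\<^sup>+ z2. (ennreal (entry_density e B u z1 z2) * quadrant_prob A L z1 z2) * ennreal (1 / g u) \<partial>lborel \<partial>lborel)"
    proof (intro nn_integral_cong)
      fix z1 z2
      have "ennreal (s u (z1, z2)) = ennreal (entry_density e B u z1 z2 * enn2real (quadrant_prob A L z1 z2) * (1 / g u))"
        unfolding s_def by simp
      also have "\<dots> = (ennreal (entry_density e B u z1 z2) * ennreal (enn2real (quadrant_prob A L z1 z2))) * ennreal (1 / g u)"
        using g_pos[OF u] entry_density_nonneg by (simp only: ennreal_mult enn2real_nonneg mult_nonneg_nonneg divide_nonneg_pos zero_le_one)
      finally show "ennreal (s u (z1, z2)) = (ennreal (entry_density e B u z1 z2) * quadrant_prob A L z1 z2) * ennreal (1 / g u)"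
        by (simp only: Gfin[symmetric])
    qed
    also have "\<dots> = local_integral e B u A L * ennreal (1 / g u)"
      unfolding local_integral_def by (simp add: nn_integral_multc)
    finally show ?thesis .
  qed
  have f_int: "(\<integral>\<^sup>+ p. ennreal (f p) \<partial>?P) = (\<integral>\<^sup>+ z1. \<integral>\<^sup>+ z2. ennreal (exp (- (q * B / 2)) * exp (- V z1 z2)) * quadrant_prob A L z1 z2 \<partial>lborel \<partial>lborel)"
  proof -
    have "(\<integral>\<^sup>+ p. ennreal (f p) \<partial>?P) = (\<integral>\<^sup>+ z1. \<integral>\<^sup>+ z2. ennreal (f (z1, z2)) \<partial>lborel \<partial>lborel)"
      by (rule lborel.nn_integral_fst[symmetric]) measurable
    also have "\<dots> = (\<integral>\<^sup>+ z1. \<integral>\<^sup>+ z2. ennreal (exp (- (q * B / 2)) * exp (- V z1 z2)) * quadrant_prob A L z1 z2 \<partial>lborel \<partial>lborel)"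
    proof (intro nn_integral_cong)
      fix z1 z2
      have "ennreal (f (z1, z2)) = ennreal (exp (- (q * B / 2)) * exp (- V z1 z2)) * ennreal (enn2real (quadrant_prob A L z1 z2))"
        unfolding f_def fst_conv snd_conv by (rule ennreal_mult) simp_all
      then show "ennreal (f (z1, z2)) = ennreal (exp (- (q * B / 2)) * exp (- V z1 z2)) * quadrant_prob A L z1 z2"
        by (simp only: Gfin[symmetric])
    qed
    finally show ?thesis .
  qed
  have w_int: "(\<integral>\<^sup>+ p. ennreal (w p) \<partial>?P) < \<infinity>"
  proof -
    have "(\<integral>\<^sup>+ p. ennreal (w p) \<partial>?P) = (\<integral>\<^sup>+ z1. \<integral>\<^sup>+ z2. ennreal (w (z1, z2)) \<partial>lborel \<partial>lborel)"
      by (rule lborel.nn_integral_fst[symmetric]) measurable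
    also have "\<dots> = (\<integral>\<^sup>+ z1. \<integral>\<^sup>+ z2. ennreal (density_const e * exp (- (q * B / 2)) * exp (2 * tilt\<^sup>2 * A)) * ennreal (weight z1 z2) \<partial>lborel \<partial>lborel)"
      unfolding w_def fst_conv snd_conv using const_nonneg weight_nonneg by (intro nn_integral_cong ennreal_mult) auto
    also have "\<dots> = ennreal (density_const e * exp (- (q * B / 2)) * exp (2 * tilt\<^sup>2 * A)) * (\<integral>\<^sup>+ z1. \<integral>\<^sup>+ z2. ennreal (weight z1 z2) \<partial>lborel \<partial>lborel)"
      by (simp add: nn_integral_cmult)
    also have "\<dots> < \<infinity>" using weight_integral by (simp add: ennreal_mult_less_top)
    finally show ?thesis .
  qed
  have lim: "((\<lambda>u. s u p) \<longlongrightarrow> f p) at_top" for p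
  proof -
    obtain z1 z2 where p: "p = (z1, z2)" by (cases p)
    have e2: "(z2 + e / u - \<rho> * (z1 + e / u)) / \<sigma> = (z2 - \<rho> * z1) / \<sigma> + ((1 - \<rho>) * e / \<sigma>) / u" for u
      by (simp add: field_simps add_divide_distrib diff_divide_distrib)
    have "((\<lambda>u. dens 1 c1 B u (z1 + e / u) / rate 1 c1 u *
       (dens k d B u ((z2 - \<rho> * z1) / \<sigma> + ((1 - \<rho>) * e / \<sigma>) / u) / rate k d u) * ?G p) \<longlongrightarrow>
       exp (- (1\<^sup>2 * B / 2) - 1 * z1) * exp (- (k\<^sup>2 * B / 2) - k * ((z2 - \<rho> * z1) / \<sigma>)) * ?G p) at_top"
      by (intro tendsto_mult tendsto_const dens_over_rate_limit)
    moreover have "exp (- (1\<^sup>2 * B / 2) - 1 * z1) * exp (- (k\<^sup>2 * B / 2) - k * ((z2 - \<rho> * z1) / \<sigma>)) * ?G p = f p"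
    proof -
      have "- (1\<^sup>2 * B / 2) - 1 * z1 + (- (k\<^sup>2 * B / 2) - k * ((z2 - \<rho> * z1) / \<sigma>)) = - (q * B / 2) + - V z1 z2"
        using V_eq[of z1 z2] unfolding q_def by (simp add: algebra_simps add_divide_distrib)
      then have "exp (- (1\<^sup>2 * B / 2) - 1 * z1) * exp (- (k\<^sup>2 * B / 2) - k * ((z2 - \<rho> * z1) / \<sigma>)) = exp (- (q * B / 2)) * exp (- V z1 z2)"
        by (simp only: mult_exp_exp)
      then show ?thesis unfolding f_def p fst_conv snd_conv by (simp only:)
    qed
    moreover have "s u p = dens 1 c1 B u (z1 + e / u) / rate 1 c1 u *
       (dens k d B u ((z2 - \<rho> * z1) / \<sigma> + ((1 - \<rho>) * e / \<sigma>) / u) / rate k d u) * ?G p" for u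
      unfolding s_def entry_density_def g_def p fst_conv snd_conv e2 by (simp add: field_simps)
    ultimately show ?thesis by simp
  qed
  have "((\<lambda>u. \<integral>\<^sup>+ p. ennreal (s u p) \<partial>?P) \<longlongrightarrow> (\<integral>\<^sup>+ p. ennreal (f p) \<partial>?P)) at_top"
  proof (rule nn_integral_dominated_at_top[OF fm sm wm w_int])
    show "AE p in ?P. ((\<lambda>u. s u p) \<longlongrightarrow> f p) at_top" using lim by simp
    show "0 \<le> s u p" for u p unfolding s_def using entry_density_nonneg g_nonneg by (auto intro!: mult_nonneg_nonneg divide_nonneg_nonneg)
    show "0 \<le> w p" for p unfolding w_def using const_nonneg weight_nonneg by (auto intro!: mult_nonneg_nonneg)
    show "0 \<le> f p" for p unfolding f_def by simp
    have ev1: "\<forall>\<^sub>F u in at_top. u\<^sup>2 / 2 \<le> u\<^sup>2 - B" by real_asymp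
    have ev2: "\<forall>\<^sub>F u in at_top. - u\<^sup>2 \<le> B" by real_asymp
    show "\<forall>\<^sub>F u in at_top. AE p in ?P. s u p \<le> w p"
      using eventually_ge_at_top[of 1] ev1 ev2
    proof eventually_elim
      case (elim u)
      have g: "0 < g u" using elim(1) by (intro g_pos) simp
      have "s u p \<le> w p" for p
      proof -
        let ?S = "exp (- (V (fst p) (snd p) / 2)) + exp (- (2 * V (fst p) (snd p)))"
        have S0: "0 \<le> ?S" by (auto intro: add_nonneg_nonneg)
        have "entry_density e B u (fst p) (snd p) / g u \<le> density_const e * exp (- (q * B / 2)) * ?S"
          using entry_density_bound[OF elim, of e "fst p" "snd p"] g by (simp add: field_simps)
        then have "s u p \<le> density_const e * exp (- (q * B / 2)) * ?S * ?G p"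
          unfolding s_def by (intro mult_right_mono) auto
        also have "\<dots> = density_const e * exp (- (q * B / 2)) * (?S * ?G p)" by (simp only: mult.assoc)
        also have "\<dots> \<le> density_const e * exp (- (q * B / 2)) * (exp (2 * tilt\<^sup>2 * A) * weight (fst p) (snd p))"
        proof (rule mult_left_mono)
          have "ennreal (?S * ?G p) = ennreal ?S * quadrant_prob A L (fst p) (snd p)"
            by (subst ennreal_mult[OF S0]) (simp_all only: enn2real_nonneg Gfin[symmetric])
          also have "\<dots> \<le> ennreal (exp (2 * tilt\<^sup>2 * A) * weight (fst p) (snd p))" by (rule quadrant_prob_weight_bound[OF A])
          finally show "?S * ?G p \<le> exp (2 * tilt\<^sup>2 * A) * weight (fst p) (snd p)"
            using weight_nonneg by (simp add: ennreal_le_iff)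
        qed (use const_nonneg in simp)
        also have "\<dots> = w p" by (simp add: w_def mult.assoc)
        finally show ?thesis .
      qed
      then show ?case by simp
    qed
  qed
  then have "((\<lambda>u. \<integral>\<^sup>+ p. ennreal (s u p) \<partial>?P) \<longlongrightarrow>
     (\<integral>\<^sup>+ z1. \<integral>\<^sup>+ z2. ennreal (exp (- (q * B / 2)) * exp (- V z1 z2)) * quadrant_prob A L z1 z2 \<partial>lborel \<partial>lborel)) at_top"
    unfolding f_int .
  then show ?thesis
    by (rule Lim_transform_eventually[OF _ eventually_mono[OF eventually_gt_at_top[of 0] s_int]])
qed

text \<open>The limiting process inside the Parisian constant: the pair with drift \<open>(-1, -a)\<close> relative to the
level \<open>(z1, z2)\<close>.\<close>

definition R :: "real \<Rightarrow> real \<Rightarrow> real \<Rightarrow> 'a \<Rightarrow> real" where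
  "R z1 z2 r \<omega> = min (X r \<omega> - r - z1) (W r \<omega> - a * r - z2)"

lemma R_proc: "cont_proc M (R z1 z2)"
  unfolding R_def by (intro cont_proc_min cont_proc_minus cont_proc_const cont_proc_det X_proc W_proc) (auto intro!: continuous_intros)

lemma R_prob_measurable[measurable (raw)]:
  assumes [measurable]: "F \<in> borel_measurable N" "H \<in> borel_measurable N"
  shows "(\<lambda>p. occ_prob M A L (R (F p) (H p))) \<in> borel_measurable N"
  unfolding R_def
  by (intro occ_prob_measurable[OF _ prob_space_axioms] cont_proc_min cont_proc_minus cont_proc_const cont_proc_det
        cont_proc_snd[OF X_proc] cont_proc_snd[OF W_proc] continuous_intros) measurable

text \<open>Up to the factor \<open>l1 * l2\<close>, the two integrals below are the Parisian constant with the occupation time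
cut off at \<open>A\<close> and the full constant.\<close>

definition K_quadrant_upto :: "real \<Rightarrow> real \<Rightarrow> ennreal" where
  "K_quadrant_upto A L = (\<integral>\<^sup>+ z1. \<integral>\<^sup>+ z2. ennreal (exp (V z1 z2)) * occ_prob M A L (R z1 z2) \<partial>lborel \<partial>lborel)"

definition K_quadrant :: "real \<Rightarrow> ennreal" where
  "K_quadrant L = (\<integral>\<^sup>+ z1. \<integral>\<^sup>+ z2. ennreal (exp (V z1 z2)) *
     emeasure M {\<omega> \<in> space M. ennreal L < emeasure lborel {t \<in> {0..}. 0 < R z1 z2 t \<omega>}} \<partial>lborel \<partial>lborel)"

text \<open>The densities are taken \<open>A\<close> units of scaled time before \<open>u\<^sup>2 - x\<close>, which costs a factor
\<open>exp (- (q * A / 2))\<close>; it cancels against the factor in \<open>tilt_identity\<close>. What remains depends on \<open>A\<close> only through the cut-off in the constant.\<close>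

lemma local_limit:
  assumes A: "0 < A" and L: "0 \<le> L"
  shows "((\<lambda>u. occ_prob M A L (\<lambda>r. Z u (u\<^sup>2 - x - A + r)) * ennreal (1 / g u)) \<longlongrightarrow>
     ennreal (1 / \<sigma> * exp (- (q * x / 2))) * K_quadrant_upto A L) at_top"
proof -
  define B where "B = x + A"
  let ?l = "\<integral>\<^sup>+ z1. \<integral>\<^sup>+ z2. ennreal (exp (- (q * B / 2)) * exp (- V z1 z2)) * quadrant_prob A L z1 z2 \<partial>lborel \<partial>lborel"
  let ?C = "(\<bar>c1\<bar> + \<bar>c2\<bar>) * A"
  have "?l = (\<integral>\<^sup>+ z1. \<integral>\<^sup>+ z2. ennreal (exp (- (q * B / 2))) * (ennreal (exp (- V z1 z2)) * quadrant_prob A L z1 z2) \<partial>lborel \<partial>lborel)"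
    by (simp add: ennreal_mult mult.assoc)
  also have "\<dots> = ennreal (exp (- (q * B / 2))) * (\<integral>\<^sup>+ z1. \<integral>\<^sup>+ z2. ennreal (exp (- V z1 z2)) * quadrant_prob A L z1 z2 \<partial>lborel \<partial>lborel)"
    by (simp add: nn_integral_cmult)
  also have "(\<integral>\<^sup>+ z1. \<integral>\<^sup>+ z2. ennreal (exp (- V z1 z2)) * quadrant_prob A L z1 z2 \<partial>lborel \<partial>lborel) = ennreal (exp (q * A / 2)) * K_quadrant_upto A L"
    using tilt_identity[OF A L, of k] unfolding V_eq q_def[symmetric] a_eq[symmetric] K_quadrant_upto_def R_def .
  also have "ennreal (exp (- (q * B / 2))) * (ennreal (exp (q * A / 2)) * K_quadrant_upto A L) = ennreal (exp (- (q * x / 2))) * K_quadrant_upto A L"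
    unfolding mult.assoc[symmetric] B_def by (simp add: ennreal_mult[symmetric] mult_exp_exp) (simp add: field_simps)
  finally have l: "?l = ennreal (exp (- (q * x / 2))) * K_quadrant_upto A L" .
  have lim: "((\<lambda>u. ennreal (1 / \<sigma>) * (local_integral e B u A L * ennreal (1 / g u))) \<longlongrightarrow> ennreal (1 / \<sigma>) * ?l) at_top" for e
    by (intro tendsto_mult_ennreal tendsto_const local_integral_limit A) (use sigma_pos in \<open>auto simp: ennreal_eq_0_iff\<close>)
  have ev: "\<forall>\<^sub>F u in at_top. 0 < u \<and> B < u\<^sup>2"
    by (intro eventually_conj eventually_gt_at_top) real_asymp
  have "((\<lambda>u. occ_prob M A L (\<lambda>r. Z u (u\<^sup>2 - B + r)) * ennreal (1 / g u)) \<longlongrightarrow> ennreal (1 / \<sigma>) * ?l) at_top"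
  proof (rule tendsto_sandwich[OF _ _ lim[of ?C] lim[of "- ?C"]])
    show "\<forall>\<^sub>F u in at_top. ennreal (1 / \<sigma>) * (local_integral ?C B u A L * ennreal (1 / g u)) \<le> occ_prob M A L (\<lambda>r. Z u (u\<^sup>2 - B + r)) * ennreal (1 / g u)"
      using ev
    proof eventually_elim
      case (elim u)
      then show ?case unfolding mult.assoc[symmetric] by (intro mult_right_mono local_sandwich(2) A L) auto
    qed
    show "\<forall>\<^sub>F u in at_top. occ_prob M A L (\<lambda>r. Z u (u\<^sup>2 - B + r)) * ennreal (1 / g u) \<le> ennreal (1 / \<sigma>) * (local_integral (- ?C) B u A L * ennreal (1 / g u))"
      using ev
    proof eventually_elim
      case (elim u)
      then show ?case unfolding mult.assoc[symmetric] by (intro mult_right_mono local_sandwich(1) A L) auto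
    qed
  qed
  moreover have "ennreal (1 / \<sigma>) * ?l = ennreal (1 / \<sigma> * exp (- (q * x / 2))) * K_quadrant_upto A L"
    unfolding l by (subst ennreal_mult) (use sigma_pos in \<open>auto simp: mult.assoc\<close>)
  ultimately show ?thesis unfolding B_def by (simp add: algebra_simps)
qed

lemma K_quadrant_upto_incseq: "incseq (\<lambda>m. K_quadrant_upto (real m) L)"
proof (rule incseq_SucI)
  fix m
  have "occ_prob M (real m) L (R z1 z2) \<le> occ_prob M (real (Suc m)) L (R z1 z2)" for z1 z2
    using occ_prob_incseq[OF R_proc] by (rule incseq_SucD)
  then show "K_quadrant_upto (real m) L \<le> K_quadrant_upto (real (Suc m)) L"
    unfolding K_quadrant_upto_def by (intro nn_integral_mono mult_left_mono) auto
qed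

lemma K_quadrant_upto_SUP: "(SUP m. K_quadrant_upto (real m) L) = K_quadrant L"
proof -
  let ?f = "\<lambda>m z1 z2. ennreal (exp (V z1 z2)) * occ_prob M (real m) L (R z1 z2)"
  have inc: "?f m z1 z2 \<le> ?f (Suc m) z1 z2" for m z1 z2
    by (intro mult_left_mono incseq_SucD[OF occ_prob_incseq[OF R_proc]]) auto
  have "K_quadrant L = (\<integral>\<^sup>+ z1. \<integral>\<^sup>+ z2. (SUP m. ?f m z1 z2) \<partial>lborel \<partial>lborel)"
    unfolding K_quadrant_def occ_prob_SUP[OF R_proc, symmetric] SUP_mult_left_ennreal ..
  also have "\<dots> = (\<integral>\<^sup>+ z1. (SUP m. \<integral>\<^sup>+ z2. ?f m z1 z2 \<partial>lborel) \<partial>lborel)"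
    using inc by (intro nn_integral_cong nn_integral_monotone_convergence_SUP) (auto simp: incseq_Suc_iff le_fun_def)
  also have "\<dots> = (SUP m. \<integral>\<^sup>+ z1. \<integral>\<^sup>+ z2. ?f m z1 z2 \<partial>lborel \<partial>lborel)"
    using inc by (intro nn_integral_monotone_convergence_SUP) (auto simp: incseq_Suc_iff le_fun_def intro!: nn_integral_mono)
  finally show ?thesis unfolding K_quadrant_upto_def ..
qed

lemma quadrant_limit:
  assumes L: "0 \<le> L"
  shows "K_quadrant L < \<infinity>"
    and "((\<lambda>u. enn2real (occ_prob M (u\<^sup>2 - x) L (Z u)) / g u) \<longlongrightarrow> 1 / \<sigma> * exp (- (q * x / 2)) * enn2real (K_quadrant L)) at_top"
proof -
  let ?Lm = "\<lambda>x m. ennreal (1 / \<sigma> * exp (- (q * x / 2))) * K_quadrant_upto (real (Suc m)) L"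
  have inc: "incseq (?Lm x)" for x
  proof (rule incseq_SucI)
    show "?Lm x m \<le> ?Lm x (Suc m)" for m
      by (intro mult_left_mono incseq_SucD[OF K_quadrant_upto_incseq, of "Suc m"]) auto
  qed
  have sup: "(SUP m. ?Lm x m) = ennreal (1 / \<sigma> * exp (- (q * x / 2))) * K_quadrant L" for x
    using SUP_Suc_incseq[OF K_quadrant_upto_incseq[of L]] by (simp add: SUP_mult_left_ennreal[symmetric] K_quadrant_upto_SUP del: of_nat_Suc)
  note R = ruin_asymptotics[where Z=Z and g=g and e=early_rate and C=block_const and q=q and L=L and Lm="?Lm x" and x=x for x,
      OF Z_proc g_pos q_pos block_const_nonneg block_bound early_bound _ early_limit local_limit[OF _ L] inc]
  have e0: "0 \<le> early_rate u" for u by (simp add: early_rate_def)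
  have "ennreal (1 / \<sigma> * exp (- (q * 0 / 2))) * K_quadrant L < \<infinity>" using R(1)[of 0] e0 unfolding sup by simp
  then show fin: "K_quadrant L < \<infinity>" using sigma_pos by (auto simp: ennreal_mult_less_top)
  show "((\<lambda>u. enn2real (occ_prob M (u\<^sup>2 - x) L (Z u)) / g u) \<longlongrightarrow> 1 / \<sigma> * exp (- (q * x / 2)) * enn2real (K_quadrant L)) at_top"
    using R(2)[of x] e0 sigma_pos unfolding sup by (simp add: enn2real_mult)
qed

text \<open>All levels \<open>(z1, z2)\<close> that lie far enough below zero are exceeded for a sufficiently long time with
a common positive probability.\<close>

lemma K_quadrant_pos:
  assumes L: "0 \<le> L"
  shows "0 < K_quadrant L"
proof -
  obtain n :: nat where n: "0 < occ_prob M (L + 1) L (\<lambda>r \<omega>. R 0 0 r \<omega> + real n)"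
    using occ_prob_shift_pos[OF R_proc L, of "L + 1"] by auto
  define p where "p = occ_prob M (L + 1) L (\<lambda>r \<omega>. R 0 0 r \<omega> + real n)"
  obtain m :: nat where m: "L + 1 \<le> real m" using real_arch_simple by blast
  let ?I = "{- real n - 1 .. - real n}"
  define c where "c = exp ((l1 + l2) * (- real n - 1))"
  have lb: "ennreal c * p \<le> ennreal (exp (V z1 z2)) * occ_prob M (real m) L (R z1 z2)" if z: "z1 \<in> ?I" "z2 \<in> ?I" for z1 z2
  proof (rule mult_mono)
    have "l1 * (- real n - 1) \<le> l1 * z1" "l2 * (- real n - 1) \<le> l2 * z2" using z l_pos by (auto intro!: mult_left_mono)
    then have "(l1 + l2) * (- real n - 1) \<le> V z1 z2" unfolding V_def distrib_right by linarith
    then show "ennreal c \<le> ennreal (exp (V z1 z2))" unfolding c_def by (intro ennreal_leI) simp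
    have "p \<le> occ_prob M (L + 1) L (R z1 z2)" unfolding p_def
      by (rule occ_prob_mono[OF R_proc]) (use z in \<open>auto simp: R_def min_def split: if_splits\<close>)
    also have "\<dots> \<le> occ_prob M (real m) L (R z1 z2)"
      unfolding occ_prob_def
    proof (rule emeasure_mono[OF _ occ_set_measurable[OF R_proc]], rule subsetI)
      fix \<omega> assume "\<omega> \<in> {\<omega> \<in> space M. ennreal L < occ (L + 1) (\<lambda>t. R z1 z2 t \<omega>)}"
      then have w: "\<omega> \<in> space M" and l: "ennreal L < occ (L + 1) (\<lambda>t. R z1 z2 t \<omega>)" by auto
      note [measurable] = cont_proc_path_measurable[OF R_proc w]
      have "occ (L + 1) (\<lambda>t. R z1 z2 t \<omega>) \<le> occ (real m) (\<lambda>t. R z1 z2 t \<omega>)"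
        unfolding occ_def by (rule emeasure_mono) (use m in auto)
      then show "\<omega> \<in> {\<omega> \<in> space M. ennreal L < occ (real m) (\<lambda>t. R z1 z2 t \<omega>)}" using w l by auto
    qed
    finally show "p \<le> occ_prob M (real m) L (R z1 z2)" .
  qed auto
  have "0 < ennreal c * p" using n by (auto simp: c_def p_def ennreal_zero_less_mult_iff)
  also have "ennreal c * p = (\<integral>\<^sup>+ z1. (\<integral>\<^sup>+ z2. (ennreal c * p) * indicator ?I z2 \<partial>lborel) * indicator ?I z1 \<partial>lborel)"
    by (simp add: nn_integral_cmult_indicator)
  also have "\<dots> = (\<integral>\<^sup>+ z1. \<integral>\<^sup>+ z2. (ennreal c * p) * indicator ?I z2 * indicator ?I z1 \<partial>lborel \<partial>lborel)"
    by (intro nn_integral_cong nn_integral_multc[symmetric]) auto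
  also have "\<dots> \<le> K_quadrant_upto (real m) L"
    unfolding K_quadrant_upto_def using lb by (intro nn_integral_mono) (auto simp: indicator_def)
  also have "\<dots> \<le> K_quadrant L" unfolding K_quadrant_upto_SUP[symmetric] by (rule SUP_upper) simp
  finally show ?thesis .
qed

end

section \<open>One active barrier\<close>

text \<open>For \<open>a \<le> \<rho>\<close> a first coordinate at its barrier already carries the second one to its own, up to
lower order. If \<open>a < \<rho>\<close> the second barrier is exceeded automatically; if \<open>a = \<rho>\<close> it is exceeded
with a probability between 0 and 1 that does not depend on the occupation time. In both cases only
the first coordinate enters the limiting constant.\<close>

locale half_plane_ruin = ruin_pair +
  assumes a_le: "a \<le> \<rho>"
begin

definition g :: "real \<Rightarrow> real" where "g u = rate 1 c1 u"

lemma g_pos: "0 < u \<Longrightarrow> 0 < g u" by (simp add: g_def rate_pos)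

definition line_prob :: "real \<Rightarrow> real \<Rightarrow> real \<Rightarrow> ennreal" where
  "line_prob A L z = occ_prob M A L (\<lambda>r \<omega>. z + X r \<omega>)"

lemma line_proc:
  assumes "f \<in> borel_measurable N" "h \<in> measurable N M"
  shows "cont_proc N (\<lambda>r x. f x + X r (h x))"
  by (intro cont_proc_add cont_proc_const assms cont_proc_compose[OF X_proc])

lemma line_occ_measurable[measurable (raw)]:
  assumes "f \<in> borel_measurable N" "h \<in> measurable N M"
  shows "(\<lambda>x. occ A (\<lambda>r. f x + X r (h x))) \<in> borel_measurable N"
  by (rule occ_measurable[OF line_proc[OF assms]])

lemma line_prob_nn_integral: "line_prob A L z = (\<integral>\<^sup>+ \<omega>. indicator {ennreal L<..} (occ A (\<lambda>r. z + X r \<omega>)) \<partial>M)"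
  unfolding line_prob_def by (rule occ_prob_nn_integral[OF line_proc]) auto

lemma line_prob_measurable[measurable (raw)]:
  assumes [measurable]: "f \<in> borel_measurable N"
  shows "(\<lambda>x. line_prob A L (f x)) \<in> borel_measurable N"
  unfolding line_prob_nn_integral by measurable

text \<open>Chernoff bound with slope 3, chosen above the growth rate 2 of the density bound.\<close>

lemma line_prob_bound:
  assumes A: "0 < A"
  shows "line_prob A L z \<le> ennreal (exp (9 / 2 * A + 3 * min z 0))"
proof (cases "z < 0")
  case True
  have "line_prob A L z \<le> ennreal (exp ((3\<^sup>2 + 0\<^sup>2) / 2 * A - (- (3 * z))))"
    unfolding line_prob_def by (rule occ_prob_tail[OF A]) simp
  then show ?thesis using True by simp
next
  case False
  have "ennreal 1 \<le> ennreal (exp (9 / 2 * A + 3 * min z 0))" using False A by (intro ennreal_leI) simp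
  then show ?thesis unfolding line_prob_def ennreal_1 using occ_prob_le_1 by (rule order_trans[rotated])
qed

text \<open>The overshoot of the second coordinate divided by \<open>u\<close>, when the first coordinate starts with
overshoot \<open>z\<close> and the independent coordinate \<open>Y\<close> starts at \<open>u * y\<close>. Only its sign matters, and on
this scale everything random after the restart is of order \<open>1 / u\<close>.\<close>

definition second_margin :: "real \<Rightarrow> real \<Rightarrow> real \<Rightarrow> real \<Rightarrow> real \<Rightarrow> 'a \<Rightarrow> real" where
  "second_margin B u z y r \<omega> = (\<rho> - a) * u + (\<rho> * c1 - c2) * (u\<^sup>2 - B) / u\<^sup>2 + \<sigma> * y + (\<rho> * (z + X r \<omega>) + \<sigma> * Y r \<omega> - c2 * r / u) / u"

text \<open>Density of \<open>Y / u\<close> at the time \<open>u\<^sup>2 - B\<close>: \<open>Y\<close> is not pushed to an extreme value here, in contrast to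
the quadrant case.\<close>

definition side_density :: "real \<Rightarrow> real \<Rightarrow> real \<Rightarrow> real" where
  "side_density B u y = u * normal_density 0 (sqrt (u\<^sup>2 - B)) (u * y)"

lemma strip_proc:
  assumes u: "0 < u" and [measurable]: "F \<in> borel_measurable N" "F' \<in> borel_measurable N" "F'' \<in> borel_measurable N" "h \<in> measurable N M"
  shows "cont_proc N (\<lambda>r x. min (F x + X r (h x) - c * r / u) (second_margin B u (F' x) (F'' x) r (h x)))"
proof -
  note [measurable] = cont_proc_measurable[OF X_proc] cont_proc_measurable[OF Y_proc]
  have cX: "continuous_on UNIV (\<lambda>t. X t (h x))" "continuous_on UNIV (\<lambda>t. Y t (h x))" if "x \<in> space N" for x
    using measurable_space[OF assms(5) that] X_proc Y_proc by (auto simp: cont_proc_def)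
  show ?thesis
    unfolding cont_proc_def second_margin_def
  proof (intro conjI allI ballI)
    show "(\<lambda>x. min (F x + X t (h x) - c * t / u) ((\<rho> - a) * u + (\<rho> * c1 - c2) * (u\<^sup>2 - B) / u\<^sup>2 + \<sigma> * F'' x +
        (\<rho> * (F' x + X t (h x)) + \<sigma> * Y t (h x) - c2 * t / u) / u)) \<in> borel_measurable N" for t by measurable
    show "continuous_on UNIV (\<lambda>t. min (F x + X t (h x) - c * t / u) ((\<rho> - a) * u + (\<rho> * c1 - c2) * (u\<^sup>2 - B) / u\<^sup>2 + \<sigma> * F'' x +
        (\<rho> * (F' x + X t (h x)) + \<sigma> * Y t (h x) - c2 * t / u) / u))" if "x \<in> space N" for x
      by (intro continuous_intros cX that) (use u in auto)
  qed
qed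

text \<open>The analogue of \<open>local_formula\<close> with \<open>Y\<close> rescaled instead of being measured from the second barrier.\<close>

lemma local_formula_strip:
  assumes u: "0 < u" and B: "B < u\<^sup>2" and A: "0 < A" and L: "0 \<le> L"
  shows "occ_prob M A L (\<lambda>r. Z u (u\<^sup>2 - B + r)) =
    (\<integral>\<^sup>+ z. \<integral>\<^sup>+ y. ennreal (dens 1 c1 B u z * side_density B u y) *
      occ_prob M A L (\<lambda>r \<omega>. min (z + X r \<omega> - c1 * r / u) (second_margin B u z y r \<omega>)) \<partial>lborel \<partial>lborel)"
proof -
  define \<tau> where "\<tau> = u\<^sup>2 - B"
  have \<tau>: "0 < \<tau>" using B by (simp add: \<tau>_def)
  define f where "f = (\<lambda>r x y. min (x - u\<^sup>2 - c1 * (\<tau> + r) / u) (\<rho> * x + \<sigma> * y - a * u\<^sup>2 - c2 * (\<tau> + r) / u))"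
  have fc: "continuous_on UNIV (\<lambda>(r, x, y). f r x y)"
    unfolding f_def case_prod_beta' using u by (intro continuous_intros) auto
  let ?P = "\<lambda>x y. occ_prob M A L (\<lambda>r \<omega>. f r (x + X r \<omega>) (y + Y r \<omega>))"
  let ?\<phi> = "normal_density 0 (sqrt \<tau>)"
  have Pm[measurable (raw)]: "(\<lambda>p. ?P (F p) (F' p)) \<in> borel_measurable N"
    if [measurable]: "F \<in> borel_measurable N" "F' \<in> borel_measurable N" for F F' :: "'c \<Rightarrow> real" and N
  proof (rule occ_prob_measurable[OF _ prob_space_axioms])
    show "cont_proc (N \<Otimes>\<^sub>M M) (\<lambda>t p. f t (F (fst p) + X t (snd p)) (F' (fst p) + Y t (snd p)))"
      by (rule cont_proc_comp[OF cont_proc_add[OF cont_proc_const cont_proc_snd[OF X_proc]]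
          cont_proc_add[OF cont_proc_const cont_proc_snd[OF Y_proc]] fc]) measurable
  qed
  have "occ_prob M A L (\<lambda>r. Z u (\<tau> + r)) = (\<integral>\<^sup>+ x. \<integral>\<^sup>+ y. ennreal (?\<phi> x * ?\<phi> y) * ?P x y \<partial>lborel \<partial>lborel)"
    using restart[OF \<tau> A L fc] unfolding f_def W_def Z_def .
  also have "\<dots> = (\<integral>\<^sup>+ z. \<integral>\<^sup>+ y. ennreal (?\<phi> (u\<^sup>2 + c1 * \<tau> / u + 1 * z) * ?\<phi> y) * ?P (u\<^sup>2 + c1 * \<tau> / u + 1 * z) y \<partial>lborel \<partial>lborel)"
    by (subst nn_integral_real_affine[where c=1 and t="u\<^sup>2 + c1 * \<tau> / u"]) simp_all
  also have "\<dots> = (\<integral>\<^sup>+ z. (\<integral>\<^sup>+ y. ennreal u * (ennreal (?\<phi> (u\<^sup>2 + c1 * \<tau> / u + 1 * z) * ?\<phi> (0 + u * y)) *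
       ?P (u\<^sup>2 + c1 * \<tau> / u + 1 * z) (0 + u * y)) \<partial>lborel) \<partial>lborel)"
  proof (rule nn_integral_cong)
    fix z
    have "(\<lambda>y. ennreal (?\<phi> (u\<^sup>2 + c1 * \<tau> / u + 1 * z) * ?\<phi> y) * ?P (u\<^sup>2 + c1 * \<tau> / u + 1 * z) y) \<in> borel_measurable borel"
      by measurable
    from nn_integral_real_affine[OF this, of u 0] u
    show "(\<integral>\<^sup>+ y. ennreal (?\<phi> (u\<^sup>2 + c1 * \<tau> / u + 1 * z) * ?\<phi> y) * ?P (u\<^sup>2 + c1 * \<tau> / u + 1 * z) y \<partial>lborel) =
      (\<integral>\<^sup>+ y. ennreal u * (ennreal (?\<phi> (u\<^sup>2 + c1 * \<tau> / u + 1 * z) * ?\<phi> (0 + u * y)) *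
       ?P (u\<^sup>2 + c1 * \<tau> / u + 1 * z) (0 + u * y)) \<partial>lborel)" by (subst nn_integral_cmult) simp_all
  qed
  also have "\<dots> = (\<integral>\<^sup>+ z. \<integral>\<^sup>+ y. ennreal (dens 1 c1 B u z * side_density B u y) *
      occ_prob M A L (\<lambda>r \<omega>. min (z + X r \<omega> - c1 * r / u) (second_margin B u z y r \<omega>)) \<partial>lborel \<partial>lborel)"
  proof (intro nn_integral_cong)
    fix z y
    have e1: "?\<phi> (u\<^sup>2 + c1 * \<tau> / u + 1 * z) = dens 1 c1 B u z" by (simp add: dens_def \<tau>_def)
    have e2: "u * ?\<phi> (0 + u * y) = side_density B u y" by (simp add: side_density_def \<tau>_def)
    have "?P (u\<^sup>2 + c1 * \<tau> / u + 1 * z) (0 + u * y) = occ_prob M A L (\<lambda>r \<omega>. min (z + X r \<omega> - c1 * r / u) (second_margin B u z y r \<omega>))"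
    proof (rule occ_prob_cong_sign)
      fix r \<omega>
      have "u\<^sup>2 + c1 * \<tau> / u + 1 * z + X r \<omega> - u\<^sup>2 - c1 * (\<tau> + r) / u = z + X r \<omega> - c1 * r / u"
        using u by (simp add: field_simps)
      moreover have "\<rho> * (u\<^sup>2 + c1 * \<tau> / u + 1 * z + X r \<omega>) + \<sigma> * (0 + u * y + Y r \<omega>) - a * u\<^sup>2 - c2 * (\<tau> + r) / u = u * second_margin B u z y r \<omega>"
        unfolding second_margin_def \<tau>_def[symmetric] using u by (simp add: field_simps power2_eq_square)
      ultimately have "f r (u\<^sup>2 + c1 * \<tau> / u + 1 * z + X r \<omega>) (0 + u * y + Y r \<omega>) = min (z + X r \<omega> - c1 * r / u) (u * second_margin B u z y r \<omega>)"
        unfolding f_def by (simp only:)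
      then show "0 < f r (u\<^sup>2 + c1 * \<tau> / u + 1 * z + X r \<omega>) (0 + u * y + Y r \<omega>) \<longleftrightarrow> 0 < min (z + X r \<omega> - c1 * r / u) (second_margin B u z y r \<omega>)"
        using u by (simp add: zero_less_mult_iff)
    qed
    then show "ennreal u * (ennreal (?\<phi> (u\<^sup>2 + c1 * \<tau> / u + 1 * z) * ?\<phi> (0 + u * y)) * ?P (u\<^sup>2 + c1 * \<tau> / u + 1 * z) (0 + u * y)) =
       ennreal (dens 1 c1 B u z * side_density B u y) * occ_prob M A L (\<lambda>r \<omega>. min (z + X r \<omega> - c1 * r / u) (second_margin B u z y r \<omega>))"
      unfolding e1 e2[symmetric] using u by (simp add: ennreal_mult mult_ac dens_nonneg)
  qed
  finally show ?thesis unfolding \<tau>_def .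
qed

definition strip_prob :: "real \<Rightarrow> real \<Rightarrow> real \<Rightarrow> real \<Rightarrow> real \<Rightarrow> real \<Rightarrow> real \<Rightarrow> ennreal" where
  "strip_prob e B u A L z y = occ_prob M A L (\<lambda>r \<omega>. min (z + X r \<omega>) (second_margin B u (z + e / u) y r \<omega>))"

lemma strip_proc0:
  assumes u: "0 < u" and [measurable]: "F \<in> borel_measurable N" "F' \<in> borel_measurable N" "F'' \<in> borel_measurable N" "h \<in> measurable N M"
  shows "cont_proc N (\<lambda>r x. min (F x + X r (h x)) (second_margin B u (F' x) (F'' x) r (h x)))"
  using strip_proc[OF assms, of 0] by simp

lemma strip_prob_measurable[measurable (raw)]:
  assumes u: "0 < u" and [measurable]: "F \<in> borel_measurable N" "F' \<in> borel_measurable N"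
  shows "(\<lambda>x. strip_prob e B u A L (F x) (F' x)) \<in> borel_measurable N"
  unfolding strip_prob_def by (rule occ_prob_measurable[OF strip_proc0[OF u] prob_space_axioms]) measurable

lemma strip_prob_le_line_prob: "strip_prob e B u A L z y \<le> line_prob A L z"
  unfolding strip_prob_def line_prob_def by (rule occ_prob_mono[OF line_proc]) auto

lemma strip_prob_le_1: "strip_prob e B u A L z y \<le> 1"
  unfolding strip_prob_def by (rule occ_prob_le_1)

text \<open>As in the quadrant case the shift \<open>e / u\<close> absorbs the drift of the first coordinate; the drift of the
second one is kept in \<open>second_margin\<close>.\<close>

definition strip_integral :: "real \<Rightarrow> real \<Rightarrow> real \<Rightarrow> real \<Rightarrow> real \<Rightarrow> ennreal" where
  "strip_integral e B u A L = (\<integral>\<^sup>+ z. \<integral>\<^sup>+ y. ennreal (dens 1 c1 B u (z + e / u) * side_density B u y) * strip_prob e B u A L z y \<partial>lborel \<partial>lborel)"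

lemma side_density_nonneg: "0 < u \<Longrightarrow> 0 \<le> side_density B u y" by (simp add: side_density_def)

lemma side_density_measurable[measurable (raw)]: "F \<in> borel_measurable N \<Longrightarrow> (\<lambda>x. side_density B u (F x)) \<in> borel_measurable N"
  unfolding side_density_def by measurable

lemma dens_measurable_raw[measurable (raw)]: "F \<in> borel_measurable N \<Longrightarrow> (\<lambda>x. dens k d B u (F x)) \<in> borel_measurable N"
  unfolding dens_def by measurable

lemma strip_integral_shift:
  assumes u: "0 < u"
  shows "(\<integral>\<^sup>+ z. \<integral>\<^sup>+ y. ennreal (dens 1 c1 B u z * side_density B u y) *
      occ_prob M A L (\<lambda>r \<omega>. min (z + (- e) / u + X r \<omega>) (second_margin B u z y r \<omega>)) \<partial>lborel \<partial>lborel) = strip_integral e B u A L"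
proof -
  let ?F = "\<lambda>z y. ennreal (dens 1 c1 B u z * side_density B u y) * occ_prob M A L (\<lambda>r \<omega>. min (z + (- e) / u + X r \<omega>) (second_margin B u z y r \<omega>))"
  have [measurable (raw)]: "(\<lambda>x. occ_prob M A L (\<lambda>r \<omega>. min (F x + (- e) / u + X r \<omega>) (second_margin B u (F x) (F' x) r \<omega>))) \<in> borel_measurable N"
    if [measurable]: "F \<in> borel_measurable N" "F' \<in> borel_measurable N" for F F' :: "'c \<Rightarrow> real" and N
    by (rule occ_prob_measurable[OF strip_proc0[OF u] prob_space_axioms]) measurable
  have "(\<lambda>z. \<integral>\<^sup>+ y. ?F z y \<partial>lborel) \<in> borel_measurable borel" by measurable
  from nn_integral_real_affine[OF this, of 1 "e / u"]
  have "(\<integral>\<^sup>+ z. \<integral>\<^sup>+ y. ?F z y \<partial>lborel \<partial>lborel) = (\<integral>\<^sup>+ z. \<integral>\<^sup>+ y. ?F (e / u + 1 * z) y \<partial>lborel \<partial>lborel)"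
    by (simp only: abs_one ennreal_1 mult_1_left one_neq_zero not_False_eq_True simp_thms)
  also have "\<dots> = strip_integral e B u A L"
    unfolding strip_integral_def strip_prob_def by (intro nn_integral_cong) (simp add: add.commute)
  finally show ?thesis .
qed

lemma shift_bound:
  assumes u: "0 < u" and r: "0 \<le> r" "r \<le> A"
  shows "c1 * r / u \<le> (\<bar>c1\<bar> * A) / u" "- ((\<bar>c1\<bar> * A) / u) \<le> c1 * r / u"
proof -
  have "\<bar>c1\<bar> * r \<le> \<bar>c1\<bar> * A" using r by (intro mult_left_mono) auto
  then have "c1 * r \<le> \<bar>c1\<bar> * A" "- (\<bar>c1\<bar> * A) \<le> c1 * r"
    using abs_mult[of c1 r] r by (auto simp: abs_le_iff)
  then have "c1 * r / u \<le> (\<bar>c1\<bar> * A) / u" "(- (\<bar>c1\<bar> * A)) / u \<le> c1 * r / u"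
    using divide_right_mono[of "c1 * r" "\<bar>c1\<bar> * A" u] divide_right_mono[of "- (\<bar>c1\<bar> * A)" "c1 * r" u] u by (simp_all only: less_imp_le)
  then show "c1 * r / u \<le> (\<bar>c1\<bar> * A) / u" "- ((\<bar>c1\<bar> * A) / u) \<le> c1 * r / u" by simp_all
qed

lemma local_sandwich:
  assumes u: "0 < u" and B: "B < u\<^sup>2" and A: "0 < A" and L: "0 \<le> L"
  defines "C \<equiv> \<bar>c1\<bar> * A"
  shows "occ_prob M A L (\<lambda>r. Z u (u\<^sup>2 - B + r)) \<le> strip_integral (- C) B u A L"
    and "strip_integral C B u A L \<le> occ_prob M A L (\<lambda>r. Z u (u\<^sup>2 - B + r))"
proof -
  note loc = local_formula_strip[OF u B A L]
  note sb = shift_bound[OF u, of _ A, folded C_def]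
  show "occ_prob M A L (\<lambda>r. Z u (u\<^sup>2 - B + r)) \<le> strip_integral (- C) B u A L"
    unfolding loc strip_integral_shift[OF u, symmetric] minus_minus
  proof (intro mult_left_mono nn_integral_mono occ_prob_mono[OF strip_proc0[OF u]])
    fix z y t \<omega> assume "0 \<le> t" "t \<le> A" and p: "0 < min (z + X t \<omega> - c1 * t / u) (second_margin B u z y t \<omega>)"
    with sb[of t] show "0 < min (z + C / u + X t \<omega>) (second_margin B u z y t \<omega>)"
      unfolding min_less_iff_conj by linarith
  qed auto
  show "strip_integral C B u A L \<le> occ_prob M A L (\<lambda>r. Z u (u\<^sup>2 - B + r))"
    unfolding loc strip_integral_shift[OF u, symmetric]
  proof (intro mult_left_mono nn_integral_mono occ_prob_mono[OF strip_proc[OF u]])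
    fix z y t \<omega> assume "0 \<le> t" "t \<le> A" and p: "0 < min (z + (- C) / u + X t \<omega>) (second_margin B u z y t \<omega>)"
    with sb[of t] show "0 < min (z + X t \<omega> - c1 * t / u) (second_margin B u z y t \<omega>)"
      unfolding min_less_iff_conj minus_divide_left[symmetric] by linarith
  qed auto
qed

definition density_const :: "real \<Rightarrow> real" where "density_const e = 2 * exp (c1\<^sup>2 / 2) * exp (2 * \<bar>e\<bar>)"

lemma dens_shift_bound:
  assumes u: "1 \<le> u" and v: "u\<^sup>2 / 2 \<le> u\<^sup>2 - B" and B: "- u\<^sup>2 \<le> B"
  shows "dens 1 c1 B u (z + e / u) \<le> g u * (density_const e * exp (- (1 * B / 2)) * (exp (- (z / 2)) + exp (- (2 * z))))"
proof -
  define s where "s = u\<^sup>2 / (u\<^sup>2 - B)"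
  have u0: "0 < u" using u by simp
  have s: "1 / 2 \<le> s" "s \<le> 2" using time_ratio_bounds[OF u0 v B] by (auto simp: s_def)
  have "dens 1 c1 B u (z + e / u) \<le> g u * (2 * exp (c1\<^sup>2 / 2) * exp (- (1\<^sup>2 * B / 2)) * exp (- (s * (1 * (z + e / u)))))"
    unfolding g_def s_def by (rule dens_bound[OF u0 v])
  also have "exp (- (s * (1 * (z + e / u)))) = exp (- (s * z)) * exp (- (s * (e / u)))"
    unfolding mult_exp_exp by (simp add: algebra_simps)
  also have "g u * (2 * exp (c1\<^sup>2 / 2) * exp (- (1\<^sup>2 * B / 2)) * (exp (- (s * z)) * exp (- (s * (e / u))))) \<le>
    g u * (2 * exp (c1\<^sup>2 / 2) * exp (- (1\<^sup>2 * B / 2)) * ((exp (- (z / 2)) + exp (- (2 * z))) * exp (2 * \<bar>e\<bar>)))"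
  proof (intro mult_left_mono mult_mono exp_between[OF s])
    have "\<bar>e\<bar> / u \<le> \<bar>e\<bar> / 1" by (rule divide_left_mono) (use u in auto)
    moreover have "- (e / u) \<le> \<bar>e\<bar> / u" using u0 divide_right_mono[of "- e" "\<bar>e\<bar>" u] by simp
    ultimately have "- (e / u) \<le> \<bar>e\<bar>" by simp
    then have "s * - (e / u) \<le> s * \<bar>e\<bar>" using s by (intro mult_left_mono) auto
    also have "\<dots> \<le> 2 * \<bar>e\<bar>" using s by (intro mult_right_mono) auto
    finally show "exp (- (s * (e / u))) \<le> exp (2 * \<bar>e\<bar>)" by simp
  qed (use g_pos[OF u0] in \<open>auto simp: add_nonneg_nonneg less_imp_le\<close>)
  also have "\<dots> = g u * (density_const e * exp (- (1 * B / 2)) * (exp (- (z / 2)) + exp (- (2 * z))))"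
    unfolding density_const_def by (simp add: mult_ac)
  finally show ?thesis .
qed

lemma side_density_bound:
  assumes u: "0 < u" and v: "u\<^sup>2 / 2 \<le> u\<^sup>2 - B" and B: "- u\<^sup>2 \<le> B"
  shows "side_density B u y \<le> exp (- (y\<^sup>2 / 4))"
proof -
  define w where "w = u\<^sup>2 - B"
  have u2: "0 < u\<^sup>2" using u by simp
  have v': "u\<^sup>2 / 2 \<le> w" "B = u\<^sup>2 - w" using v by (simp_all add: w_def)
  have w: "0 < w" "u\<^sup>2 \<le> 2 * w" "w \<le> 2 * u\<^sup>2" using u2 v' B by linarith+
  have "u\<^sup>2 \<le> 2 * pi * w"
  proof -
    have "2 * w \<le> 2 * pi * w" using pi_gt3 w by (intro mult_right_mono) auto
    then show ?thesis using w by linarith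
  qed
  then have "u \<le> sqrt (2 * pi * w)" using u by (intro real_le_rsqrt)
  then have c: "u / sqrt (2 * pi * w) \<le> 1" using w pi_gt_zero by (simp add: field_simps)
  have "y\<^sup>2 / 4 \<le> (u * y)\<^sup>2 / (2 * w)"
  proof -
    have "w * y\<^sup>2 \<le> 2 * u\<^sup>2 * y\<^sup>2" using w by (intro mult_right_mono) auto
    then show ?thesis using w by (simp add: field_simps power_mult_distrib)
  qed
  then have "exp (- ((u * y)\<^sup>2 / (2 * w))) \<le> exp (- (y\<^sup>2 / 4))" by simp
  then have "u / sqrt (2 * pi * w) * exp (- ((u * y)\<^sup>2 / (2 * w))) \<le> 1 * exp (- (y\<^sup>2 / 4))"
    using c by (intro mult_mono) auto
  moreover have "side_density B u y = u / sqrt (2 * pi * w) * exp (- ((u * y)\<^sup>2 / (2 * w)))"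
    unfolding side_density_def normal_density_def w_def[symmetric] using w by simp
  ultimately show ?thesis by simp
qed

lemma side_density_limit: "((\<lambda>u. side_density B u y) \<longlongrightarrow> normal_density 0 1 y) at_top"
proof -
  have t1: "((\<lambda>u::real. u / sqrt (u\<^sup>2 - B)) \<longlongrightarrow> 1) at_top" by real_asymp
  have t2: "((\<lambda>u::real. u\<^sup>2 / (u\<^sup>2 - B)) \<longlongrightarrow> 1) at_top" by real_asymp
  have "((\<lambda>u. 1 / sqrt (2 * pi) * (u / sqrt (u\<^sup>2 - B)) * exp (- (y\<^sup>2 / 2 * (u\<^sup>2 / (u\<^sup>2 - B))))) \<longlongrightarrow>
     1 / sqrt (2 * pi) * 1 * exp (- (y\<^sup>2 / 2 * 1))) at_top"
    by (intro tendsto_intros t1 t2)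
  moreover have "1 / sqrt (2 * pi) * 1 * exp (- (y\<^sup>2 / 2 * 1)) = normal_density 0 1 y"
    by (simp add: normal_density_def)
  moreover have "\<forall>\<^sub>F u in at_top. 1 / sqrt (2 * pi) * (u / sqrt (u\<^sup>2 - B)) * exp (- (y\<^sup>2 / 2 * (u\<^sup>2 / (u\<^sup>2 - B)))) = side_density B u y"
  proof -
    have "\<forall>\<^sub>F u in at_top. B < u\<^sup>2" by real_asymp
    then show ?thesis
      by eventually_elim (simp add: side_density_def normal_density_def real_sqrt_mult power_mult_distrib)
  qed
  ultimately show ?thesis by (simp add: Lim_transform_eventually)
qed

definition side_indicator :: "real \<Rightarrow> real" where
  "side_indicator y = (if a < \<rho> \<or> (c2 - \<rho> * c1) / \<sigma> < y then 1 else 0)"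

lemma side_indicator_measurable[measurable]: "side_indicator \<in> borel_measurable borel"
  unfolding side_indicator_def by measurable

text \<open>Along each path \<open>second_margin\<close> is within \<open>K / u\<close> of a deterministic quantity. That quantity tends to
infinity if \<open>a < \<rho>\<close>, and to \<open>\<sigma> * (y - (c2 - \<rho> * c1) / \<sigma>)\<close> if \<open>a = \<rho>\<close>. So for large \<open>u\<close> the second
constraint is either satisfied on the whole interval or violated on the whole interval.\<close>

lemma strip_prob_limit:
  assumes A: "0 < A" and L: "0 \<le> L" and y: "y \<noteq> (c2 - \<rho> * c1) / \<sigma>"
  shows "((\<lambda>u. enn2real (strip_prob e B u A L z y)) \<longlongrightarrow> side_indicator y * enn2real (line_prob A L z)) at_top"
proof -
  let ?ZZ = "\<lambda>u \<omega>. occ A (\<lambda>r. min (z + X r \<omega>) (second_margin B u (z + e / u) y r \<omega>))"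
  \<comment> \<open>The default 0 for \<open>u < 1\<close> keeps \<open>s u\<close> measurable for every \<open>u\<close>; \<open>second_margin\<close> divides by \<open>u\<close>.\<close>
  define s where "s = (\<lambda>u \<omega>. if 1 \<le> u then indicat_real {ennreal L<..} (?ZZ u \<omega>) else 0)"
  define f where "f = (\<lambda>\<omega>. side_indicator y * indicat_real {ennreal L<..} (occ A (\<lambda>r. z + X r \<omega>)))"
  have fm[measurable]: "f \<in> borel_measurable M" unfolding f_def by measurable
  have sm[measurable]: "s u \<in> borel_measurable M" for u
  proof (cases "1 \<le> u")
    case True
    then have [measurable]: "(\<lambda>\<omega>. ?ZZ u \<omega>) \<in> borel_measurable M"
      by (intro occ_measurable strip_proc0) auto
    show ?thesis unfolding s_def by measurable
  qed (simp add: s_def)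
  have lim: "((\<lambda>u. s u \<omega>) \<longlongrightarrow> f \<omega>) at_top" if w: "\<omega> \<in> space M" for \<omega>
  proof -
    have "\<exists>b. \<forall>t\<in>{0..A}. \<bar>U t \<omega>\<bar> \<le> b" if "cont_proc M U" for U :: "real \<Rightarrow> 'a \<Rightarrow> real"
    proof -
      have "continuous_on {0..A} (\<lambda>t. U t \<omega>)" using that w by (auto simp: cont_proc_def intro: continuous_on_subset)
      then have "compact ((\<lambda>t. U t \<omega>) ` {0..A})" by (intro compact_continuous_image) auto
      then show ?thesis using compact_imp_bounded[of "(\<lambda>t. U t \<omega>) ` {0..A}"] unfolding bounded_iff real_norm_def by blast
    qed
    from this[OF X_proc] this[OF Y_proc] obtain bX bY where
      b': "\<forall>t\<in>{0..A}. \<bar>X t \<omega>\<bar> \<le> bX" "\<forall>t\<in>{0..A}. \<bar>Y t \<omega>\<bar> \<le> bY" by blast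
    note b = b'[THEN bspec]
    define K where "K = \<bar>\<rho>\<bar> * (\<bar>z\<bar> + \<bar>e\<bar> + bX) + \<sigma> * bY + \<bar>c2\<bar> * A"
    define base where "base = (\<lambda>u. (\<rho> - a) * u + (\<rho> * c1 - c2) * (u\<^sup>2 - B) / u\<^sup>2 + \<sigma> * y)"
    have near: "\<bar>second_margin B u (z + e / u) y r \<omega> - base u\<bar> \<le> K / u" if u: "1 \<le> u" and r: "r \<in> {0..A}" for u r
    proof -
      have "\<bar>e / u\<bar> \<le> \<bar>e\<bar> / 1" unfolding abs_divide by (rule divide_left_mono) (use u in auto)
      then have "\<bar>z + e / u + X r \<omega>\<bar> \<le> \<bar>z\<bar> + \<bar>e\<bar> + bX" using b(1)[OF r] by linarith
      then have 1: "\<bar>\<rho> * (z + e / u + X r \<omega>)\<bar> \<le> \<bar>\<rho>\<bar> * (\<bar>z\<bar> + \<bar>e\<bar> + bX)"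
        unfolding abs_mult by (rule mult_left_mono) simp
      have 2: "\<bar>\<sigma> * Y r \<omega>\<bar> \<le> \<sigma> * bY" unfolding abs_mult using b(2)[OF r] sigma_pos by (simp add: mult_left_mono)
      have "r / u \<le> r / 1" by (rule divide_left_mono) (use r u in auto)
      moreover have "0 \<le> r / u" "r \<le> A" using r u by auto
      ultimately have "\<bar>r / u\<bar> \<le> A" by linarith
      then have 3: "\<bar>c2 * r / u\<bar> \<le> \<bar>c2\<bar> * A"
        unfolding times_divide_eq_right[symmetric] abs_mult by (intro mult_left_mono) auto
      have "\<bar>\<rho> * (z + e / u + X r \<omega>) + \<sigma> * Y r \<omega> - c2 * r / u\<bar> \<le> K"
        unfolding K_def using 1 2 3 by linarith
      then have "\<bar>\<rho> * (z + e / u + X r \<omega>) + \<sigma> * Y r \<omega> - c2 * r / u\<bar> / u \<le> K / u" using u by (intro divide_right_mono) auto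
      moreover have "second_margin B u (z + e / u) y r \<omega> - base u = (\<rho> * (z + e / u + X r \<omega>) + \<sigma> * Y r \<omega> - c2 * r / u) / u"
        unfolding second_margin_def base_def by simp
      ultimately show ?thesis using u by (simp add: abs_divide)
    qed
    have K_vanishes: "((\<lambda>u. K / u) \<longlongrightarrow> 0) at_top"
      using tendsto_mult[OF tendsto_const[of K] tendsto_inverse_0_at_top[OF filterlim_ident]] by (simp add: divide_inverse)
    have ratio: "((\<lambda>u::real. (u\<^sup>2 - B) / u\<^sup>2) \<longlongrightarrow> 1) at_top" by real_asymp
    have drift: "((\<lambda>u. (\<rho> * c1 - c2) * ((u\<^sup>2 - B) / u\<^sup>2) + \<sigma> * y) \<longlongrightarrow> (\<rho> * c1 - c2) * 1 + \<sigma> * y) at_top"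
      by (intro tendsto_intros ratio)
    have lim0: "(\<rho> * c1 - c2) * 1 + \<sigma> * y = \<sigma> * (y - (c2 - \<rho> * c1) / \<sigma>)" using sigma_pos by (simp add: field_simps)
    show ?thesis
    proof (cases "side_indicator y = 1")
      case True
      have "\<forall>\<^sub>F u in at_top. K / u < base u"
      proof (cases "a < \<rho>")
        case True
        have "filterlim (\<lambda>u. (\<rho> - a) * u) at_top at_top"
          by (rule filterlim_tendsto_pos_mult_at_top[OF tendsto_const]) (use True in \<open>auto simp: filterlim_ident\<close>)
        from filterlim_tendsto_add_at_top[OF drift this]
        have "filterlim base at_top at_top" unfolding base_def by (simp add: add_ac)
        then have "\<forall>\<^sub>F u in at_top. 1 \<le> base u" by (simp add: filterlim_at_top)
        moreover have "\<forall>\<^sub>F u in at_top. K / u < 1" using order_tendstoD(2)[OF K_vanishes, of 1] by simp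
        ultimately show ?thesis by eventually_elim simp
      next
        case False
        then have ar: "a = \<rho>" using a_le by simp
        have "(c2 - \<rho> * c1) / \<sigma> < y" using \<open>side_indicator y = 1\<close> False by (simp add: side_indicator_def split: if_splits)
        then have p: "0 < (\<rho> * c1 - c2) * 1 + \<sigma> * y" unfolding lim0 using sigma_pos by simp
        have "((\<lambda>u. base u - K / u) \<longlongrightarrow> (\<rho> * c1 - c2) * 1 + \<sigma> * y - 0) at_top"
          unfolding base_def using tendsto_diff[OF drift K_vanishes] by (simp add: ar)
        from order_tendstoD(1)[OF this, of 0] p show ?thesis by (auto elim: eventually_mono)
      qed
      then have "\<forall>\<^sub>F u in at_top. f \<omega> = s u \<omega>" using eventually_ge_at_top[of 1]
      proof eventually_elim
        case (elim u)
        have "{t \<in> {0..A}. 0 < min (z + X t \<omega>) (second_margin B u (z + e / u) y t \<omega>)} = {t \<in> {0..A}. 0 < z + X t \<omega>}"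
        proof (intro Collect_cong conj_cong refl)
          fix t assume t: "t \<in> {0..A}"
          have "0 < second_margin B u (z + e / u) y t \<omega>" using near[OF elim(2) t] elim(1) by (simp add: abs_le_iff)
          then show "(0 < min (z + X t \<omega>) (second_margin B u (z + e / u) y t \<omega>)) = (0 < z + X t \<omega>)" by simp
        qed
        then have "?ZZ u \<omega> = occ A (\<lambda>r. z + X r \<omega>)" unfolding occ_def by (simp only:)
        then show ?case using elim(2) True unfolding f_def s_def by simp
      qed
      then show ?thesis by (rule tendsto_eventually[OF eventually_mono]) simp
    next
      case False
      then have inactive: "side_indicator y = 0" and ar: "a = \<rho>" and "y < (c2 - \<rho> * c1) / \<sigma>"
        using y a_le by (auto simp: side_indicator_def split: if_splits)
      then have p: "(\<rho> * c1 - c2) * 1 + \<sigma> * y < 0" unfolding lim0 using sigma_pos by (simp add: mult_pos_neg)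
      have "((\<lambda>u. base u + K / u) \<longlongrightarrow> (\<rho> * c1 - c2) * 1 + \<sigma> * y + 0) at_top"
        unfolding base_def using tendsto_add[OF drift K_vanishes] by (simp add: ar)
      from order_tendstoD(2)[OF this, of 0] p have "\<forall>\<^sub>F u in at_top. base u + K / u < 0" by simp
      then have "\<forall>\<^sub>F u in at_top. f \<omega> = s u \<omega>" using eventually_ge_at_top[of 1]
      proof eventually_elim
        case (elim u)
        have "{t \<in> {0..A}. 0 < min (z + X t \<omega>) (second_margin B u (z + e / u) y t \<omega>)} = {}"
        proof (rule ccontr)
          assume "\<not> ?thesis"
          then obtain t where t: "t \<in> {0..A}" and p: "0 < second_margin B u (z + e / u) y t \<omega>" by auto
          show False using near[OF elim(2) t] elim(1) p by (simp add: abs_le_iff)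
        qed
        then have "?ZZ u \<omega> = 0" unfolding occ_def by (simp only: emeasure_empty)
        then show ?case using elim(2) inactive unfolding f_def s_def by simp
      qed
      then show ?thesis by (rule tendsto_eventually[OF eventually_mono]) simp
    qed
  qed
  have "((\<lambda>u. \<integral>\<^sup>+ \<omega>. ennreal (s u \<omega>) \<partial>M) \<longlongrightarrow> (\<integral>\<^sup>+ \<omega>. ennreal (f \<omega>) \<partial>M)) at_top"
  proof (rule nn_integral_dominated_at_top[OF fm sm, of "\<lambda>_. 1"])
    show "AE \<omega> in M. ((\<lambda>u. s u \<omega>) \<longlongrightarrow> f \<omega>) at_top" using lim by (intro AE_I2)
  qed (auto simp: s_def f_def side_indicator_def emeasure_space_1)
  moreover have "(\<integral>\<^sup>+ \<omega>. ennreal (f \<omega>) \<partial>M) = ennreal (side_indicator y) * line_prob A L z"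
    unfolding f_def line_prob_nn_integral
    by (subst nn_integral_cmult[symmetric]) (auto simp: ennreal_mult side_indicator_def ennreal_indicator intro!: nn_integral_cong)
  ultimately have l: "((\<lambda>u. \<integral>\<^sup>+ \<omega>. ennreal (s u \<omega>) \<partial>M) \<longlongrightarrow> ennreal (side_indicator y) * line_prob A L z) at_top" by simp
  have "\<forall>\<^sub>F u in at_top. (\<integral>\<^sup>+ \<omega>. ennreal (s u \<omega>) \<partial>M) = strip_prob e B u A L z y"
    using eventually_ge_at_top[of 1]
  proof eventually_elim
    case (elim u)
    then have "0 < u" by simp
    then have "strip_prob e B u A L z y = (\<integral>\<^sup>+ \<omega>. indicator {ennreal L<..} (?ZZ u \<omega>) \<partial>M)"
      unfolding strip_prob_def by (intro occ_prob_nn_integral strip_proc0) auto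
    then show ?case unfolding s_def using elim by (simp add: ennreal_indicator)
  qed
  from Lim_transform_eventually[OF l this]
  have "((\<lambda>u. strip_prob e B u A L z y) \<longlongrightarrow> ennreal (side_indicator y) * line_prob A L z) at_top" .
  moreover have "ennreal (side_indicator y) * line_prob A L z < \<infinity>"
  proof -
    have "line_prob A L z \<le> 1" unfolding line_prob_def by (rule occ_prob_le_1)
    then have "line_prob A L z < \<infinity>" by (rule le_less_trans) simp
    then show ?thesis by (simp add: ennreal_mult_less_top)
  qed
  ultimately have "((\<lambda>u. enn2real (strip_prob e B u A L z y)) \<longlongrightarrow> enn2real (ennreal (side_indicator y) * line_prob A L z)) at_top"
    by (rule tendsto_enn2real_finite)
  then show ?thesis by (simp add: enn2real_mult side_indicator_def split: if_splits)
qed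

text \<open>The rate 3 matches \<open>line_prob_bound\<close> and exceeds the growth rate 2.\<close>

definition weight :: "real \<Rightarrow> real" where
  "weight z = (exp (- (z / 2)) + exp (- (2 * z))) * exp (3 * min z 0)"

lemma weight_nonneg: "0 \<le> weight z" by (auto simp: weight_def intro!: mult_nonneg_nonneg add_nonneg_nonneg)

lemma weight_measurable[measurable (raw)]:
  assumes [measurable]: "F \<in> borel_measurable N"
  shows "(\<lambda>x. weight (F x)) \<in> borel_measurable N"
  unfolding weight_def by measurable

lemma weight_integral: "(\<integral>\<^sup>+ z. ennreal (weight z) \<partial>lborel) < \<infinity>"
proof -
  let ?E = "\<lambda>al z. ennreal (exp (- (al * z) + 3 * min z 0))"
  have split: "ennreal (weight z) = ?E (1 / 2) z + ?E 2 z" for z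
    unfolding weight_def distrib_right mult_exp_exp by simp
  have "(\<integral>\<^sup>+ z. ennreal (weight z) \<partial>lborel) = (\<integral>\<^sup>+ z. ?E (1 / 2) z \<partial>lborel) + (\<integral>\<^sup>+ z. ?E 2 z \<partial>lborel)"
    unfolding split by (rule nn_integral_add) auto
  moreover have "(\<integral>\<^sup>+ z. ?E (1 / 2) z \<partial>lborel) < \<infinity>" by (rule nn_integral_two_sided_exponential) auto
  moreover have "(\<integral>\<^sup>+ z. ?E 2 z \<partial>lborel) < \<infinity>" by (rule nn_integral_two_sided_exponential) auto
  ultimately show ?thesis by simp
qed

lemma line_prob_weight_bound:
  assumes A: "0 < A"
  shows "ennreal (exp (- (z / 2)) + exp (- (2 * z))) * line_prob A L z \<le> ennreal (exp (9 / 2 * A) * weight z)"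
proof -
  have "ennreal (exp (- (z / 2)) + exp (- (2 * z))) * line_prob A L z \<le>
     ennreal (exp (- (z / 2)) + exp (- (2 * z))) * ennreal (exp (9 / 2 * A + 3 * min z 0))"
    by (intro mult_left_mono line_prob_bound[OF A]) auto
  also have "\<dots> = ennreal ((exp (- (z / 2)) + exp (- (2 * z))) * exp (9 / 2 * A + 3 * min z 0))"
    by (rule ennreal_mult[symmetric]) (auto intro!: add_nonneg_nonneg)
  also have "(exp (- (z / 2)) + exp (- (2 * z))) * exp (9 / 2 * A + 3 * min z 0) = exp (9 / 2 * A) * weight z"
    unfolding weight_def by (simp add: exp_add mult_ac)
  finally show ?thesis .
qed

lemma gaussian_integral_finite: "(\<integral>\<^sup>+ y. ennreal (exp (- (y\<^sup>2 / 4))) \<partial>lborel) < \<infinity>"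
proof -
  interpret g2: prob_space "gauss 2" by (rule prob_space_gauss) simp
  have "exp (- (y\<^sup>2 / 4)) = sqrt (4 * pi) * normal_density 0 (sqrt 2) y" for y :: real
    by (simp add: normal_density_def)
  then have "(\<integral>\<^sup>+ y. ennreal (exp (- (y\<^sup>2 / 4))) \<partial>lborel) = (\<integral>\<^sup>+ y. ennreal (sqrt (4 * pi)) * ennreal (normal_density 0 (sqrt 2) y) \<partial>lborel)"
    by (simp add: ennreal_mult)
  also have "\<dots> = ennreal (sqrt (4 * pi)) * (\<integral>\<^sup>+ y. ennreal (normal_density 0 (sqrt 2) y) \<partial>lborel)"
    by (rule nn_integral_cmult) auto
  also have "(\<integral>\<^sup>+ y. ennreal (normal_density 0 (sqrt 2) y) \<partial>lborel) = 1"
    using nn_integral_gauss[of "\<lambda>_. 1" 2] g2.emeasure_space_1 by simp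
  finally show ?thesis by simp
qed

text \<open>The limiting probability that the second constraint holds.\<close>

definition side_prob :: ennreal where "side_prob = (\<integral>\<^sup>+ y. ennreal (normal_density 0 1 y * side_indicator y) \<partial>lborel)"

text \<open>The limit factorises because in the limit the second constraint depends on \<open>y\<close> alone and the
occupation time on \<open>z\<close> alone. The pointwise limit fails only for the single critical value of \<open>y\<close>,
which is a null set.\<close>

lemma strip_integral_limit:
  assumes A: "0 < A" and L: "0 \<le> L"
  shows "((\<lambda>u. strip_integral e B u A L * ennreal (1 / g u)) \<longlongrightarrow>
    ennreal (exp (- (B / 2))) * side_prob * (\<integral>\<^sup>+ z. ennreal (exp (- z)) * line_prob A L z \<partial>lborel)) at_top"
proof -
  let ?P = "lborel \<Otimes>\<^sub>M lborel :: (real \<times> real) measure"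
  let ?H = "\<lambda>p::real \<times> real. enn2real (line_prob A L (fst p))"
  \<comment> \<open>The default 0 for \<open>u < 1\<close> serves measurability, as in \<open>strip_prob_limit\<close>.\<close>
  define s where "s = (\<lambda>u p. if 1 \<le> u then dens 1 c1 B u (fst p + e / u) / g u * side_density B u (snd p) * enn2real (strip_prob e B u A L (fst p) (snd p)) else 0)"
  define f where "f = (\<lambda>p. exp (- (B / 2)) * exp (- fst p) * (normal_density 0 1 (snd p) * side_indicator (snd p)) * ?H p)"
  define w where "w = (\<lambda>p. density_const e * exp (- (1 * B / 2)) * exp (9 / 2 * A) * weight (fst p) * exp (- ((snd p)\<^sup>2 / 4)))"
  have fin: "Q' = ennreal (enn2real Q')" if "Q' \<le> 1" for Q' :: ennreal
    using that by (metis ennreal_enn2real ennreal_one_less_top le_less_trans)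
  have H1: "line_prob A L z \<le> 1" for z unfolding line_prob_def by (rule occ_prob_le_1)
  have sm[measurable]: "s u \<in> borel_measurable ?P" for u
  proof (cases "1 \<le> u")
    case True
    then have [measurable]: "(\<lambda>p. strip_prob e B u A L (fst p) (snd p)) \<in> borel_measurable ?P" by (intro strip_prob_measurable) auto
    show ?thesis unfolding s_def by measurable
  qed (simp add: s_def)
  have fm[measurable]: "f \<in> borel_measurable ?P" unfolding f_def by measurable
  have wm[measurable]: "w \<in> borel_measurable ?P" unfolding w_def by measurable
  have const_nonneg: "0 \<le> density_const e" by (simp add: density_const_def)
  have s_int: "(\<integral>\<^sup>+ p. ennreal (s u p) \<partial>?P) = strip_integral e B u A L * ennreal (1 / g u)" if u: "1 \<le> u" for u
  proof -
    have u0: "0 < u" using u by simp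
    have [measurable (raw)]: "(\<lambda>x. strip_prob e B u A L (F x) (F' x)) \<in> borel_measurable N"
      if "F \<in> borel_measurable N" "F' \<in> borel_measurable N" for F F' :: "'c \<Rightarrow> real" and N
      by (rule strip_prob_measurable[OF u0 that])
    have "(\<integral>\<^sup>+ p. ennreal (s u p) \<partial>?P) = (\<integral>\<^sup>+ z. \<integral>\<^sup>+ y. ennreal (s u (z, y)) \<partial>lborel \<partial>lborel)"
      by (rule lborel.nn_integral_fst[symmetric]) measurable
    also have "\<dots> = (\<integral>\<^sup>+ z. \<integral>\<^sup>+ y. (ennreal (dens 1 c1 B u (z + e / u) * side_density B u y) * strip_prob e B u A L z y) * ennreal (1 / g u) \<partial>lborel \<partial>lborel)"
    proof (intro nn_integral_cong)
      fix z y
      have "ennreal (s u (z, y)) = ennreal (dens 1 c1 B u (z + e / u) * side_density B u y * enn2real (strip_prob e B u A L z y) * (1 / g u))"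
        unfolding s_def using u by simp
      also have "\<dots> = (ennreal (dens 1 c1 B u (z + e / u) * side_density B u y) * ennreal (enn2real (strip_prob e B u A L z y))) * ennreal (1 / g u)"
        using g_pos[OF u0] dens_nonneg side_density_nonneg[OF u0] by (simp only: ennreal_mult enn2real_nonneg mult_nonneg_nonneg divide_nonneg_pos zero_le_one)
      finally show "ennreal (s u (z, y)) = (ennreal (dens 1 c1 B u (z + e / u) * side_density B u y) * strip_prob e B u A L z y) * ennreal (1 / g u)"
        by (simp only: fin[OF strip_prob_le_1, symmetric])
    qed
    also have "\<dots> = strip_integral e B u A L * ennreal (1 / g u)"
      unfolding strip_integral_def by (simp add: nn_integral_multc)
    finally show ?thesis .
  qed
  have f_int: "(\<integral>\<^sup>+ p. ennreal (f p) \<partial>?P) = ennreal (exp (- (B / 2))) * side_prob * (\<integral>\<^sup>+ z. ennreal (exp (- z)) * line_prob A L z \<partial>lborel)"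
  proof -
    have chi0: "0 \<le> side_indicator y" for y by (simp add: side_indicator_def)
    have "(\<integral>\<^sup>+ p. ennreal (f p) \<partial>?P) = (\<integral>\<^sup>+ z. \<integral>\<^sup>+ y. ennreal (f (z, y)) \<partial>lborel \<partial>lborel)"
      by (rule lborel.nn_integral_fst[symmetric]) measurable
    also have "\<dots> = (\<integral>\<^sup>+ z. \<integral>\<^sup>+ y. ennreal (normal_density 0 1 y * side_indicator y) * (ennreal (exp (- (B / 2))) * (ennreal (exp (- z)) * line_prob A L z)) \<partial>lborel \<partial>lborel)"
    proof (intro nn_integral_cong)
      fix z y
      have "f (z, y) = normal_density 0 1 y * side_indicator y * (exp (- (B / 2)) * (exp (- z) * enn2real (line_prob A L z)))"
        unfolding f_def by (simp add: mult_ac)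
      then have "ennreal (f (z, y)) = ennreal (normal_density 0 1 y * side_indicator y) * (ennreal (exp (- (B / 2))) * (ennreal (exp (- z)) * ennreal (enn2real (line_prob A L z))))"
        using chi0 by (simp only: ennreal_mult enn2real_nonneg mult_nonneg_nonneg normal_density_nonneg exp_ge_zero)
      then show "ennreal (f (z, y)) = ennreal (normal_density 0 1 y * side_indicator y) * (ennreal (exp (- (B / 2))) * (ennreal (exp (- z)) * line_prob A L z))"
        by (simp only: fin[OF H1, symmetric])
    qed
    also have "\<dots> = (\<integral>\<^sup>+ z. side_prob * (ennreal (exp (- (B / 2))) * (ennreal (exp (- z)) * line_prob A L z)) \<partial>lborel)"
      unfolding side_prob_def by (intro nn_integral_cong nn_integral_multc) measurable
    also have "\<dots> = side_prob * (ennreal (exp (- (B / 2))) * (\<integral>\<^sup>+ z. ennreal (exp (- z)) * line_prob A L z \<partial>lborel))"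
      by (simp add: nn_integral_cmult)
    finally show ?thesis by (simp only: mult_ac)
  qed
  have w_int: "(\<integral>\<^sup>+ p. ennreal (w p) \<partial>?P) < \<infinity>"
  proof -
    have "(\<integral>\<^sup>+ p. ennreal (w p) \<partial>?P) = (\<integral>\<^sup>+ z. \<integral>\<^sup>+ y. ennreal (w (z, y)) \<partial>lborel \<partial>lborel)"
      by (rule lborel.nn_integral_fst[symmetric]) measurable
    also have "\<dots> = (\<integral>\<^sup>+ z. \<integral>\<^sup>+ y. ennreal (density_const e * exp (- (1 * B / 2)) * exp (9 / 2 * A)) * ennreal (weight z) * ennreal (exp (- (y\<^sup>2 / 4))) \<partial>lborel \<partial>lborel)"
      unfolding w_def fst_conv snd_conv using const_nonneg weight_nonneg
      by (intro nn_integral_cong) (simp only: ennreal_mult mult_nonneg_nonneg exp_ge_zero)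
    also have "\<dots> = ennreal (density_const e * exp (- (1 * B / 2)) * exp (9 / 2 * A)) * (\<integral>\<^sup>+ z. ennreal (weight z) \<partial>lborel) * (\<integral>\<^sup>+ y. ennreal (exp (- (y\<^sup>2 / 4))) \<partial>lborel)"
      by (simp add: nn_integral_cmult nn_integral_multc)
    also have "\<dots> < \<infinity>" using weight_integral gaussian_integral_finite by (simp add: ennreal_mult_less_top)
    finally show ?thesis .
  qed
  have lim: "((\<lambda>u. s u p) \<longlongrightarrow> f p) at_top" if y: "snd p \<noteq> (c2 - \<rho> * c1) / \<sigma>" for p
  proof -
    obtain z y where p: "p = (z, y)" by (cases p)
    have "((\<lambda>u. dens 1 c1 B u (z + e / u) / rate 1 c1 u * side_density B u y * enn2real (strip_prob e B u A L z y)) \<longlongrightarrow>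
       exp (- (1\<^sup>2 * B / 2) - 1 * z) * normal_density 0 1 y * (side_indicator y * enn2real (line_prob A L z))) at_top"
      by (intro tendsto_mult dens_over_rate_limit side_density_limit strip_prob_limit A L) (use y p in simp)
    moreover have "exp (- (1\<^sup>2 * B / 2) - 1 * z) * normal_density 0 1 y * (side_indicator y * enn2real (line_prob A L z)) = f p"
      unfolding f_def p fst_conv snd_conv mult_exp_exp by simp
    moreover have "\<forall>\<^sub>F u in at_top. dens 1 c1 B u (z + e / u) / rate 1 c1 u * side_density B u y * enn2real (strip_prob e B u A L z y) = s u p"
      using eventually_ge_at_top[of 1] by eventually_elim (simp add: s_def g_def p)
    ultimately show ?thesis by (simp add: Lim_transform_eventually)
  qed
  have "((\<lambda>u. \<integral>\<^sup>+ p. ennreal (s u p) \<partial>?P) \<longlongrightarrow> (\<integral>\<^sup>+ p. ennreal (f p) \<partial>?P)) at_top"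
  proof (rule nn_integral_dominated_at_top[OF fm sm wm w_int])
    show "AE p in ?P. ((\<lambda>u. s u p) \<longlongrightarrow> f p) at_top"
    proof (rule AE_I'[where N="UNIV \<times> {(c2 - \<rho> * c1) / \<sigma>}"])
      have "UNIV \<times> {(c2 - \<rho> * c1) / \<sigma>} \<in> sets ?P" by (rule pair_measureI) auto
      moreover have "emeasure ?P (UNIV \<times> {(c2 - \<rho> * c1) / \<sigma>}) = 0"
        by (subst lborel.emeasure_pair_measure_Times) auto
      ultimately show "UNIV \<times> {(c2 - \<rho> * c1) / \<sigma>} \<in> null_sets ?P" by (rule null_setsI[rotated])
      show "{p \<in> space ?P. \<not> ((\<lambda>u. s u p) \<longlongrightarrow> f p) at_top} \<subseteq> UNIV \<times> {(c2 - \<rho> * c1) / \<sigma>}"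
      proof (rule subsetI)
        fix p assume "p \<in> {p \<in> space ?P. \<not> ((\<lambda>u. s u p) \<longlongrightarrow> f p) at_top}"
        then have "snd p = (c2 - \<rho> * c1) / \<sigma>" using lim[of p] by blast
        then show "p \<in> UNIV \<times> {(c2 - \<rho> * c1) / \<sigma>}" by (cases p) simp
      qed
    qed
    show "0 \<le> s u p" for u p
      unfolding s_def using dens_nonneg side_density_nonneg g_pos by (auto intro!: mult_nonneg_nonneg divide_nonneg_nonneg simp: less_imp_le)
    show "0 \<le> w p" for p unfolding w_def using const_nonneg weight_nonneg by (auto intro!: mult_nonneg_nonneg)
    show "0 \<le> f p" for p unfolding f_def by (simp add: side_indicator_def)
    have ev1: "\<forall>\<^sub>F u in at_top. u\<^sup>2 / 2 \<le> u\<^sup>2 - B" by real_asymp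
    have ev2: "\<forall>\<^sub>F u in at_top. - u\<^sup>2 \<le> B" by real_asymp
    show "\<forall>\<^sub>F u in at_top. AE p in ?P. s u p \<le> w p"
      using eventually_ge_at_top[of 1] ev1 ev2
    proof eventually_elim
      case (elim u)
      have u0: "0 < u" using elim(1) by simp
      have g: "0 < g u" using u0 by (rule g_pos)
      have "s u p \<le> w p" for p
      proof -
        let ?S = "exp (- (fst p / 2)) + exp (- (2 * fst p))"
        have S0: "0 \<le> ?S" by (auto intro: add_nonneg_nonneg)
        have 1: "dens 1 c1 B u (fst p + e / u) / g u \<le> density_const e * exp (- (1 * B / 2)) * ?S"
          using dens_shift_bound[OF elim, of "fst p" e] g by (simp add: field_simps)
        have QH: "enn2real (strip_prob e B u A L (fst p) (snd p)) \<le> ?H p"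
        proof (rule enn2real_mono[OF strip_prob_le_line_prob])
          show "line_prob A L (fst p) < \<top>" using H1[of "fst p"] by (rule le_less_trans) simp
        qed
        have "s u p \<le> (density_const e * exp (- (1 * B / 2)) * ?S) * exp (- ((snd p)\<^sup>2 / 4)) * ?H p"
          unfolding s_def using elim(1) const_nonneg S0 dens_nonneg side_density_nonneg[OF u0] g
          by (simp only: if_True, intro mult_mono 1 side_density_bound[OF u0 elim(2,3)] QH)
            (auto intro!: mult_nonneg_nonneg divide_nonneg_nonneg simp: less_imp_le)
        also have "\<dots> = density_const e * exp (- (1 * B / 2)) * exp (- ((snd p)\<^sup>2 / 4)) * (?S * ?H p)" by (simp only: mult_ac)
        also have "\<dots> \<le> density_const e * exp (- (1 * B / 2)) * exp (- ((snd p)\<^sup>2 / 4)) * (exp (9 / 2 * A) * weight (fst p))"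
        proof (rule mult_left_mono)
          have "ennreal (?S * ?H p) = ennreal ?S * line_prob A L (fst p)"
            by (subst ennreal_mult[OF S0]) (simp_all only: enn2real_nonneg fin[OF H1, symmetric])
          also have "\<dots> \<le> ennreal (exp (9 / 2 * A) * weight (fst p))" by (rule line_prob_weight_bound[OF A])
          finally show "?S * ?H p \<le> exp (9 / 2 * A) * weight (fst p)"
            using weight_nonneg by (simp add: ennreal_le_iff)
        qed (use const_nonneg in simp)
        also have "\<dots> = w p" unfolding w_def by (simp only: mult_ac)
        finally show ?thesis .
      qed
      then show ?case by simp
    qed
  qed
  then have "((\<lambda>u. \<integral>\<^sup>+ p. ennreal (s u p) \<partial>?P) \<longlongrightarrow>
     ennreal (exp (- (B / 2))) * side_prob * (\<integral>\<^sup>+ z. ennreal (exp (- z)) * line_prob A L z \<partial>lborel)) at_top"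
    unfolding f_int .
  then show ?thesis
    by (rule Lim_transform_eventually[OF _ eventually_mono[OF eventually_ge_at_top[of 1] s_int]])
qed

definition R :: "real \<Rightarrow> real \<Rightarrow> 'a \<Rightarrow> real" where
  "R z r \<omega> = X r \<omega> - r - z"

lemma R_proc: "cont_proc M (R z)"
  unfolding R_def by (intro cont_proc_minus cont_proc_const cont_proc_det X_proc) (auto intro!: continuous_intros)

lemma R_prob_measurable[measurable (raw)]:
  assumes [measurable]: "F \<in> borel_measurable N"
  shows "(\<lambda>p. occ_prob M A L (R (F p))) \<in> borel_measurable N"
  unfolding R_def
  by (intro occ_prob_measurable[OF _ prob_space_axioms] cont_proc_minus cont_proc_const cont_proc_det
        cont_proc_snd[OF X_proc] continuous_intros) measurable

definition K_line_upto :: "real \<Rightarrow> real \<Rightarrow> ennreal" where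
  "K_line_upto A L = (\<integral>\<^sup>+ z. ennreal (exp z) * occ_prob M A L (R z) \<partial>lborel)"

definition K_line :: "real \<Rightarrow> ennreal" where
  "K_line L = (\<integral>\<^sup>+ z. ennreal (exp z) * emeasure M {\<omega> \<in> space M. ennreal L < emeasure lborel {t \<in> {0..}. 0 < R z t \<omega>}} \<partial>lborel)"

text \<open>The one-dimensional version of \<open>tilt_identity\<close>.\<close>

lemma tilt_identity_line:
  assumes A: "0 < A" and L: "0 \<le> L"
  shows "(\<integral>\<^sup>+ z. ennreal (exp (- z)) * line_prob A L z \<partial>lborel) = ennreal (exp (A / 2)) * K_line_upto A L"
proof -
  interpret pm: pair_sigma_finite lborel M ..
  let ?I = "\<lambda>z \<omega>. indicator {ennreal L<..} (occ A (\<lambda>r. z + X r \<omega>)) :: ennreal"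
  let ?J = "\<lambda>z \<omega>. ?I (- X A \<omega> + 1 * z) \<omega>"
  have "(\<integral>\<^sup>+ z. ennreal (exp (- z)) * line_prob A L z \<partial>lborel) = (\<integral>\<^sup>+ z. \<integral>\<^sup>+ \<omega>. ennreal (exp (- z)) * ?I z \<omega> \<partial>M \<partial>lborel)"
    unfolding line_prob_nn_integral by (intro nn_integral_cong nn_integral_cmult[symmetric]) measurable
  also have "\<dots> = (\<integral>\<^sup>+ \<omega>. \<integral>\<^sup>+ z. ennreal (exp (- z)) * ?I z \<omega> \<partial>lborel \<partial>M)"
    by (intro pm.Fubini'[symmetric]) measurable
  also have "\<dots> = (\<integral>\<^sup>+ \<omega>. \<integral>\<^sup>+ z. ennreal (exp (- z)) * (ennreal (exp (X A \<omega>)) * ?J z \<omega>) \<partial>lborel \<partial>M)"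
  proof (rule nn_integral_cong)
    fix \<omega> assume w[measurable]: "\<omega> \<in> space M"
    have "(\<lambda>z. ennreal (exp (- z)) * ?I z \<omega>) \<in> borel_measurable borel" by measurable
    from nn_integral_real_affine[OF this, of 1 "- X A \<omega>"]
    have "(\<integral>\<^sup>+ z. ennreal (exp (- z)) * ?I z \<omega> \<partial>lborel) = (\<integral>\<^sup>+ z. ennreal (exp (- (- X A \<omega> + 1 * z))) * ?J z \<omega> \<partial>lborel)"
      by simp
    also have "\<dots> = (\<integral>\<^sup>+ z. ennreal (exp (- z)) * (ennreal (exp (X A \<omega>)) * ?J z \<omega>) \<partial>lborel)"
    proof (rule nn_integral_cong)
      fix z
      have "- (- X A \<omega> + 1 * z) = - z + X A \<omega>" by simp
      then have "ennreal (exp (- (- X A \<omega> + 1 * z))) = ennreal (exp (- z)) * ennreal (exp (X A \<omega>))"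
        by (simp only: exp_add ennreal_mult exp_ge_zero)
      then show "ennreal (exp (- (- X A \<omega> + 1 * z))) * ?J z \<omega> = ennreal (exp (- z)) * (ennreal (exp (X A \<omega>)) * ?J z \<omega>)"
        by (simp only: mult.assoc)
    qed
    finally show "(\<integral>\<^sup>+ z. ennreal (exp (- z)) * ?I z \<omega> \<partial>lborel) =
       (\<integral>\<^sup>+ z. ennreal (exp (- z)) * (ennreal (exp (X A \<omega>)) * ?J z \<omega>) \<partial>lborel)" .
  qed
  also have "\<dots> = (\<integral>\<^sup>+ z. \<integral>\<^sup>+ \<omega>. ennreal (exp (- z)) * (ennreal (exp (X A \<omega>)) * ?J z \<omega>) \<partial>M \<partial>lborel)"
    by (intro pm.Fubini') measurable
  also have "\<dots> = (\<integral>\<^sup>+ z. ennreal (exp (- z)) * (\<integral>\<^sup>+ \<omega>. ennreal (exp (X A \<omega>)) * ?J z \<omega> \<partial>M) \<partial>lborel)"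
    by (intro nn_integral_cong nn_integral_cmult) measurable
  also have "\<dots> = (\<integral>\<^sup>+ z. ennreal (exp (A / 2)) * (ennreal (exp (- z)) * occ_prob M A L (R (- z))) \<partial>lborel)"
  proof (rule nn_integral_cong)
    fix z :: real
    define f where "f = (\<lambda>r::real. \<lambda>x y::real. z - x)"
    have fc: "continuous_on UNIV (\<lambda>(r, x, y). f r x y)"
      unfolding f_def case_prod_beta' by (intro continuous_intros)
    let ?Z = "\<lambda>r \<omega>. f r (X A \<omega> - X (A - r) \<omega>) (Y A \<omega> - Y (A - r) \<omega>)"
    have "(\<integral>\<^sup>+ \<omega>. ennreal (exp (X A \<omega>)) * ?J z \<omega> \<partial>M) =
      (\<integral>\<^sup>+ \<omega>. ennreal (exp (A / 2)) * (ennreal (exp (1 * X A \<omega> + 0 * Y A \<omega> - (1\<^sup>2 + 0\<^sup>2) * A / 2)) *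
         indicator {\<omega> \<in> space M. occ A (\<lambda>r. ?Z r \<omega>) > ennreal L} \<omega>) \<partial>M)"
    proof (rule nn_integral_cong)
      fix \<omega> assume w[measurable]: "\<omega> \<in> space M"
      have "occ A (\<lambda>r. - X A \<omega> + 1 * z + X r \<omega>) = occ A (\<lambda>r. - X A \<omega> + 1 * z + X (A - r) \<omega>)"
        by (rule occ_reverse) measurable
      also have "\<dots> = occ A (\<lambda>r. ?Z r \<omega>)"
        unfolding f_def by (rule arg_cong[where f="occ A"]) (simp add: algebra_simps)
      finally have "?J z \<omega> = indicator {\<omega> \<in> space M. occ A (\<lambda>r. ?Z r \<omega>) > ennreal L} \<omega>"
        using w by (simp add: indicator_def)
      moreover have "ennreal (exp (X A \<omega>)) = ennreal (exp (A / 2)) * ennreal (exp (1 * X A \<omega> + 0 * Y A \<omega> - (1\<^sup>2 + 0\<^sup>2) * A / 2))"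
        by (simp add: ennreal_mult[symmetric] mult_exp_exp)
      ultimately show "ennreal (exp (X A \<omega>)) * ?J z \<omega> =
          ennreal (exp (A / 2)) * (ennreal (exp (1 * X A \<omega> + 0 * Y A \<omega> - (1\<^sup>2 + 0\<^sup>2) * A / 2)) *
         indicator {\<omega> \<in> space M. occ A (\<lambda>r. ?Z r \<omega>) > ennreal L} \<omega>)"
        by (simp only: mult.assoc)
    qed
    also have "\<dots> = ennreal (exp (A / 2)) * (\<integral>\<^sup>+ \<omega>. ennreal (exp (1 * X A \<omega> + 0 * Y A \<omega> - (1\<^sup>2 + 0\<^sup>2) * A / 2)) *
         indicator {\<omega> \<in> space M. occ A (\<lambda>r. ?Z r \<omega>) > ennreal L} \<omega> \<partial>M)"
    proof (rule nn_integral_cmult)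
      have cr: "continuous_on UNIV (\<lambda>r. A - r)" by (intro continuous_intros)
      have "cont_proc M ?Z"
        by (intro cont_proc_comp[OF _ _ fc] cont_proc_minus cont_proc_const cont_proc_reindex[OF X_proc cr] cont_proc_reindex[OF Y_proc cr])
          measurable
      note ind = borel_measurable_indicator[OF occ_set_measurable[OF this, of L A]]
      have "(\<lambda>\<omega>. ennreal (exp (1 * X A \<omega> + 0 * Y A \<omega> - (1\<^sup>2 + 0\<^sup>2) * A / 2))) \<in> borel_measurable M"
        by measurable
      from borel_measurable_times_ennreal[OF this ind]
      show "(\<lambda>\<omega>. ennreal (exp (1 * X A \<omega> + 0 * Y A \<omega> - (1\<^sup>2 + 0\<^sup>2) * A / 2)) *
         indicator {\<omega> \<in> space M. occ A (\<lambda>r. ?Z r \<omega>) > ennreal L} \<omega>) \<in> borel_measurable M" .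
    qed
    also have "\<dots> = ennreal (exp (A / 2)) * occ_prob M A L (\<lambda>r \<omega>. f r (1 * r - X r \<omega>) (0 * r - Y r \<omega>))"
      unfolding reversal_tilt[OF A L fc] ..
    also have "(\<lambda>r \<omega>. f r (1 * r - X r \<omega>) (0 * r - Y r \<omega>)) = R (- z)"
      unfolding f_def R_def by (simp add: algebra_simps)
    finally show "ennreal (exp (- z)) * (\<integral>\<^sup>+ \<omega>. ennreal (exp (X A \<omega>)) * ?J z \<omega> \<partial>M) =
       ennreal (exp (A / 2)) * (ennreal (exp (- z)) * occ_prob M A L (R (- z)))"
      by (simp only: mult.left_commute)
  qed
  also have "\<dots> = ennreal (exp (A / 2)) * (\<integral>\<^sup>+ z. ennreal (exp (- z)) * occ_prob M A L (R (- z)) \<partial>lborel)"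
    by (rule nn_integral_cmult) measurable
  also have "(\<integral>\<^sup>+ z. ennreal (exp (- z)) * occ_prob M A L (R (- z)) \<partial>lborel) = K_line_upto A L"
  proof -
    have "(\<lambda>z. ennreal (exp z) * occ_prob M A L (R z)) \<in> borel_measurable borel" by measurable
    from nn_integral_real_affine[OF this, of "-1" 0] show ?thesis unfolding K_line_upto_def by simp
  qed
  finally show ?thesis .
qed

lemma local_limit:
  assumes A: "0 < A" and L: "0 \<le> L"
  shows "((\<lambda>u. occ_prob M A L (\<lambda>r. Z u (u\<^sup>2 - x - A + r)) * ennreal (1 / g u)) \<longlongrightarrow>
     ennreal (exp (- (x / 2))) * side_prob * K_line_upto A L) at_top"
proof -
  define B where "B = x + A"
  let ?l = "ennreal (exp (- (B / 2))) * side_prob * (\<integral>\<^sup>+ z. ennreal (exp (- z)) * line_prob A L z \<partial>lborel)"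
  let ?C = "\<bar>c1\<bar> * A"
  have "?l = (ennreal (exp (- (B / 2))) * ennreal (exp (A / 2))) * side_prob * K_line_upto A L"
    unfolding tilt_identity_line[OF A L] by (simp only: mult_ac)
  also have "ennreal (exp (- (B / 2))) * ennreal (exp (A / 2)) = ennreal (exp (- (x / 2)))"
    unfolding B_def by (simp add: ennreal_mult[symmetric] mult_exp_exp) (simp add: field_simps)
  finally have l: "?l = ennreal (exp (- (x / 2))) * side_prob * K_line_upto A L" .
  have ev: "\<forall>\<^sub>F u in at_top. 0 < u \<and> B < u\<^sup>2"
    by (intro eventually_conj eventually_gt_at_top) real_asymp
  have "((\<lambda>u. occ_prob M A L (\<lambda>r. Z u (u\<^sup>2 - B + r)) * ennreal (1 / g u)) \<longlongrightarrow> ?l) at_top"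
  proof (rule tendsto_sandwich[OF _ _ strip_integral_limit[OF A L, of ?C] strip_integral_limit[OF A L, of "- ?C"]])
    show "\<forall>\<^sub>F u in at_top. strip_integral ?C B u A L * ennreal (1 / g u) \<le> occ_prob M A L (\<lambda>r. Z u (u\<^sup>2 - B + r)) * ennreal (1 / g u)"
      using ev by eventually_elim (intro mult_right_mono local_sandwich(2) A L, auto)
    show "\<forall>\<^sub>F u in at_top. occ_prob M A L (\<lambda>r. Z u (u\<^sup>2 - B + r)) * ennreal (1 / g u) \<le> strip_integral (- ?C) B u A L * ennreal (1 / g u)"
      using ev by eventually_elim (intro mult_right_mono local_sandwich(1) A L, auto)
  qed
  then show ?thesis unfolding l unfolding B_def by (simp add: algebra_simps)
qed

definition block_const :: real where
  "block_const = density_const (- (\<bar>c1\<bar> * 1)) * exp (9 / 2 * 1) * enn2real (\<integral>\<^sup>+ z. ennreal (weight z) \<partial>lborel) * enn2real (\<integral>\<^sup>+ y. ennreal (exp (- (y\<^sup>2 / 4))) \<partial>lborel)"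

lemma block_const_nonneg: "0 \<le> block_const" by (simp add: block_const_def density_const_def)

lemma block_bound:
  assumes u: "1 \<le> u" and v: "u\<^sup>2 / 2 \<le> u\<^sup>2 - B" and B: "- u\<^sup>2 \<le> B"
  shows "occ_prob M 1 0 (\<lambda>r. Z u (u\<^sup>2 - B + r)) \<le> ennreal (g u * (block_const * exp (- (1 * B / 2))))"
proof -
  let ?e = "- (\<bar>c1\<bar> * 1)" and ?w = "\<integral>\<^sup>+ z. ennreal (weight z) \<partial>lborel" and ?v = "\<integral>\<^sup>+ y. ennreal (exp (- (y\<^sup>2 / 4))) \<partial>lborel"
  have u0: "0 < u" and Bu: "B < u\<^sup>2" using u v by (auto, smt (verit) divide_pos_pos zero_less_power)
  have g: "0 \<le> g u" using g_pos[OF u0] by simp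
  have const_nonneg: "0 \<le> density_const e" for e by (simp add: density_const_def)
  let ?k = "g u * (density_const ?e * exp (- (1 * B / 2))) * exp (9 / 2 * 1)"
  have k: "0 \<le> ?k" using g const_nonneg by simp
  have "strip_integral ?e B u 1 0 \<le> (\<integral>\<^sup>+ z. \<integral>\<^sup>+ y. ennreal ?k * ennreal (weight z) * ennreal (exp (- (y\<^sup>2 / 4))) \<partial>lborel \<partial>lborel)"
    unfolding strip_integral_def
  proof (intro nn_integral_mono)
    fix z y :: real
    let ?S = "exp (- (z / 2)) + exp (- (2 * z))"
    have S0: "0 \<le> ?S" by (auto intro: add_nonneg_nonneg)
    have "ennreal (dens 1 c1 B u (z + ?e / u) * side_density B u y) * strip_prob ?e B u 1 0 z y \<le>
       ennreal ((g u * (density_const ?e * exp (- (1 * B / 2)) * ?S)) * exp (- (y\<^sup>2 / 4))) * line_prob 1 0 z"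
      using g const_nonneg S0 side_density_nonneg[OF u0]
      by (intro mult_mono ennreal_leI dens_shift_bound[OF u v B] side_density_bound[OF u0 v B] strip_prob_le_line_prob) auto
    also have "(g u * (density_const ?e * exp (- (1 * B / 2)) * ?S)) * exp (- (y\<^sup>2 / 4)) = (g u * (density_const ?e * exp (- (1 * B / 2)))) * exp (- (y\<^sup>2 / 4)) * ?S"
      by (simp only: mult_ac)
    also have "ennreal ((g u * (density_const ?e * exp (- (1 * B / 2)))) * exp (- (y\<^sup>2 / 4)) * ?S) * line_prob 1 0 z =
       ennreal ((g u * (density_const ?e * exp (- (1 * B / 2)))) * exp (- (y\<^sup>2 / 4))) * (ennreal ?S * line_prob 1 0 z)"
      using g const_nonneg S0 by (subst ennreal_mult) (auto simp: mult.assoc)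
    also have "\<dots> \<le> ennreal ((g u * (density_const ?e * exp (- (1 * B / 2)))) * exp (- (y\<^sup>2 / 4))) * ennreal (exp (9 / 2 * 1) * weight z)"
      by (intro mult_left_mono line_prob_weight_bound) auto
    also have "\<dots> = ennreal (?k * weight z * exp (- (y\<^sup>2 / 4)))"
      using g const_nonneg weight_nonneg by (subst ennreal_mult[symmetric]) (auto simp: mult_ac)
    also have "\<dots> = ennreal ?k * ennreal (weight z) * ennreal (exp (- (y\<^sup>2 / 4)))"
      using k weight_nonneg by (simp only: ennreal_mult mult_nonneg_nonneg exp_ge_zero)
    finally show "ennreal (dens 1 c1 B u (z + ?e / u) * side_density B u y) * strip_prob ?e B u 1 0 z y \<le> ennreal ?k * ennreal (weight z) * ennreal (exp (- (y\<^sup>2 / 4)))" .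
  qed
  also have "\<dots> = ennreal ?k * ?w * ?v"
    by (simp add: nn_integral_cmult nn_integral_multc)
  finally have integral_bound: "strip_integral ?e B u 1 0 \<le> ennreal ?k * ?w * ?v" .
  have "occ_prob M 1 0 (\<lambda>r. Z u (u\<^sup>2 - B + r)) \<le> strip_integral ?e B u 1 0"
    by (rule local_sandwich(1)[OF u0 Bu]) auto
  also note integral_bound
  also have "?w = ennreal (enn2real ?w)" using weight_integral by (simp add: less_top)
  also have "?v = ennreal (enn2real ?v)" using gaussian_integral_finite by (simp add: less_top)
  also have "ennreal ?k * ennreal (enn2real ?w) * ennreal (enn2real ?v) = ennreal (?k * enn2real ?w * enn2real ?v)"
    using k by (simp only: ennreal_mult mult_nonneg_nonneg enn2real_nonneg)
  also have "?k * enn2real ?w * enn2real ?v = g u * (block_const * exp (- (1 * B / 2)))"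
    unfolding block_const_def by (simp only: mult_ac)
  finally show ?thesis .
qed

text \<open>As in the quadrant case, with the tilt 4/3 along the first coordinate only.\<close>

definition early_rate :: "real \<Rightarrow> real" where
  "early_rate u = exp (2 / 3 * u\<^sup>2 - 4 / 3 * (u\<^sup>2 - \<bar>c1\<bar> * u))"

lemma early_bound:
  assumes u: "1 \<le> u"
  shows "occ_prob M (3 / 4 * u\<^sup>2) 0 (Z u) \<le> ennreal (early_rate u)"
proof -
  have u0: "0 < u" using u by simp
  have "occ_prob M (3 / 4 * u\<^sup>2) 0 (Z u) \<le> ennreal (exp (((4 / 3)\<^sup>2 + 0\<^sup>2) / 2 * (3 / 4 * u\<^sup>2) - 4 / 3 * (u\<^sup>2 - \<bar>c1\<bar> * u)))"
  proof (rule occ_prob_tail)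
    show "0 < 3 / 4 * u\<^sup>2" using u0 by simp
    fix t \<omega> assume t: "0 \<le> t" "t \<le> 3 / 4 * u\<^sup>2" and "0 < Z u t \<omega>"
    then have p: "u\<^sup>2 + c1 * t / u < X t \<omega>" by (auto simp: Z_def)
    have "t \<le> u * u" using t(2) zero_le_power2[of u] unfolding power2_eq_square by linarith
    then have "t / u \<le> u" using u0 by (simp add: field_simps)
    moreover have "0 \<le> t / u" using t u0 by simp
    ultimately have "\<bar>c1 * (t / u)\<bar> \<le> \<bar>c1\<bar> * u" by (simp add: abs_mult mult_left_mono del: times_divide_eq_right)
    then have "- (c1 * (t / u)) \<le> \<bar>c1\<bar> * u" by linarith
    then have "u\<^sup>2 - \<bar>c1\<bar> * u < X t \<omega>" using p by simp
    then show "4 / 3 * (u\<^sup>2 - \<bar>c1\<bar> * u) < 4 / 3 * X t \<omega> + 0 * Y t \<omega>" by simp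
  qed
  also have "((4 / 3)\<^sup>2 + 0\<^sup>2) / 2 * (3 / 4 * u\<^sup>2) = 2 / 3 * u\<^sup>2"
    by (simp add: power2_eq_square field_simps)
  finally show ?thesis unfolding early_rate_def .
qed

lemma early_limit: "((\<lambda>u. early_rate u / g u) \<longlongrightarrow> 0) at_top"
proof -
  let ?b = "4 / 3 * \<bar>c1\<bar> + c1" and ?c = "c1\<^sup>2 / 2"
  have "((\<lambda>u. sqrt (2 * pi) * (exp (- (1 / 6 * u\<^sup>2) + ?b * u + ?c) * u ^ 1)) \<longlongrightarrow> sqrt (2 * pi) * 0) at_top"
    by (intro tendsto_mult tendsto_const exp_quadratic_limit) simp
  moreover have "\<forall>\<^sub>F u in at_top. sqrt (2 * pi) * (exp (- (1 / 6 * u\<^sup>2) + ?b * u + ?c) * u ^ 1) = early_rate u / g u"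
    using eventually_gt_at_top[of 0]
  proof eventually_elim
    case (elim u)
    have e: "- (1 / 6 * u\<^sup>2) + ?b * u + ?c = (2 / 3 * u\<^sup>2 - 4 / 3 * (u\<^sup>2 - \<bar>c1\<bar> * u)) + (1\<^sup>2 * u\<^sup>2 / 2 + 1 * c1 * u + c1\<^sup>2 / 2)"
      by (simp add: field_simps)
    have "1 / g u = sqrt (2 * pi) * u * exp (1\<^sup>2 * u\<^sup>2 / 2 + 1 * c1 * u + c1\<^sup>2 / 2)"
      using elim unfolding g_def rate_def exp_minus by (simp add: field_simps)
    then have "early_rate u / g u = early_rate u * (sqrt (2 * pi) * u * exp (1\<^sup>2 * u\<^sup>2 / 2 + 1 * c1 * u + c1\<^sup>2 / 2))"
      by (metis divide_inverse inverse_eq_divide)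
    also have "\<dots> = sqrt (2 * pi) * (exp (- (1 / 6 * u\<^sup>2) + ?b * u + ?c) * u ^ 1)"
      unfolding early_rate_def e exp_add power_one_right by (simp only: mult_ac)
    finally show ?case by simp
  qed
  ultimately show ?thesis by (simp add: tendsto_cong)
qed

lemma K_line_upto_incseq: "incseq (\<lambda>m. K_line_upto (real m) L)"
proof (rule incseq_SucI)
  fix m
  have "occ_prob M (real m) L (R z) \<le> occ_prob M (real (Suc m)) L (R z)" for z
    using occ_prob_incseq[OF R_proc] by (rule incseq_SucD)
  then show "K_line_upto (real m) L \<le> K_line_upto (real (Suc m)) L"
    unfolding K_line_upto_def by (intro nn_integral_mono mult_left_mono) auto
qed

lemma K_line_upto_SUP: "(SUP m. K_line_upto (real m) L) = K_line L"
proof -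
  let ?f = "\<lambda>m z. ennreal (exp z) * occ_prob M (real m) L (R z)"
  have inc: "?f m z \<le> ?f (Suc m) z" for m z
    by (intro mult_left_mono incseq_SucD[OF occ_prob_incseq[OF R_proc]]) auto
  have "K_line L = (\<integral>\<^sup>+ z. (SUP m. ?f m z) \<partial>lborel)"
    unfolding K_line_def occ_prob_SUP[OF R_proc, symmetric] SUP_mult_left_ennreal ..
  also have "\<dots> = (SUP m. \<integral>\<^sup>+ z. ?f m z \<partial>lborel)"
    using inc by (intro nn_integral_monotone_convergence_SUP) (auto simp: incseq_Suc_iff le_fun_def)
  finally show ?thesis unfolding K_line_upto_def ..
qed

lemma side_prob_bounds: "0 < side_prob" "side_prob < \<infinity>"
proof -
  define y0 where "y0 = (c2 - \<rho> * c1) / \<sigma>"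
  let ?m = "normal_density 0 1 (\<bar>y0\<bar> + 1)"
  have "0 < ?m" by (rule normal_density_pos) simp
  then have "0 < ennreal ?m * emeasure lborel {y0<..y0 + 1}" by (simp add: ennreal_zero_less_mult_iff)
  also have "\<dots> = (\<integral>\<^sup>+ y. ennreal ?m * indicator {y0<..y0 + 1} y \<partial>lborel)"
    by (simp add: nn_integral_cmult_indicator)
  also have "\<dots> \<le> side_prob"
    unfolding side_prob_def
  proof (intro nn_integral_mono)
    fix y
    show "ennreal ?m * indicator {y0<..y0 + 1} y \<le> ennreal (normal_density 0 1 y * side_indicator y)"
    proof (cases "y \<in> {y0<..y0 + 1}")
      case True
      then have "\<bar>y\<bar> \<le> \<bar>y0\<bar> + 1" by auto
      then have "y\<^sup>2 \<le> (\<bar>y0\<bar> + 1)\<^sup>2" by (metis abs_ge_zero power2_abs power_mono)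
      then have "?m \<le> normal_density 0 1 y" unfolding normal_density_def by (intro mult_left_mono) auto
      moreover have "side_indicator y = 1" using True by (simp add: side_indicator_def y0_def)
      ultimately show ?thesis using True by (simp add: ennreal_leI)
    qed simp
  qed
  finally show "0 < side_prob" .
  interpret g1: prob_space "gauss 1" by (rule prob_space_gauss) simp
  have "side_prob \<le> (\<integral>\<^sup>+ y. ennreal (normal_density 0 1 y) \<partial>lborel)"
    unfolding side_prob_def by (intro nn_integral_mono ennreal_leI) (simp add: side_indicator_def)
  also have "\<dots> = 1" using nn_integral_gauss[of "\<lambda>_. 1" 1] g1.emeasure_space_1 by simp
  finally show "side_prob < \<infinity>" by (rule le_less_trans) simp
qed

lemma half_plane_limit:
  assumes L: "0 \<le> L"
  shows "K_line L < \<infinity>"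
    and "((\<lambda>u. enn2real (occ_prob M (u\<^sup>2 - x) L (Z u)) / g u) \<longlongrightarrow> exp (- (x / 2)) * enn2real side_prob * enn2real (K_line L)) at_top"
proof -
  let ?Lm = "\<lambda>x m. ennreal (exp (- (x / 2))) * side_prob * K_line_upto (real (Suc m)) L"
  have inc: "incseq (?Lm x)" for x
  proof (rule incseq_SucI)
    show "?Lm x m \<le> ?Lm x (Suc m)" for m
      by (intro mult_left_mono incseq_SucD[OF K_line_upto_incseq, of "Suc m"]) auto
  qed
  have sup: "(SUP m. ?Lm x m) = ennreal (exp (- (x / 2))) * side_prob * K_line L" for x
    using SUP_Suc_incseq[OF K_line_upto_incseq[of L]] by (simp add: SUP_mult_left_ennreal[symmetric] K_line_upto_SUP del: of_nat_Suc)
  note R = ruin_asymptotics[where Z=Z and g=g and e=early_rate and C=block_const and q=1 and L=L and Lm="?Lm x" and x=x for x,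
      OF Z_proc g_pos zero_less_one block_const_nonneg block_bound early_bound _ early_limit local_limit[OF _ L] inc]
  have e0: "0 \<le> early_rate u" for u by (simp add: early_rate_def)
  have "ennreal (exp (- (0 / 2))) * side_prob * K_line L < \<infinity>" using R(1)[of 0] e0 unfolding sup by simp
  then show fin: "K_line L < \<infinity>" using side_prob_bounds by (auto simp: ennreal_mult_less_top)
  show "((\<lambda>u. enn2real (occ_prob M (u\<^sup>2 - x) L (Z u)) / g u) \<longlongrightarrow> exp (- (x / 2)) * enn2real side_prob * enn2real (K_line L)) at_top"
    using R(2)[of x] e0 unfolding sup by (simp add: enn2real_mult)
qed

text \<open>As for \<open>K_quadrant_pos\<close>: all levels far enough below zero are exceeded long enough with a common
positive probability.\<close>

lemma K_line_pos:
  assumes L: "0 \<le> L"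
  shows "0 < K_line L"
proof -
  obtain n :: nat where n: "0 < occ_prob M (L + 1) L (\<lambda>r \<omega>. R 0 r \<omega> + real n)"
    using occ_prob_shift_pos[OF R_proc L, of "L + 1"] by auto
  define p where "p = occ_prob M (L + 1) L (\<lambda>r \<omega>. R 0 r \<omega> + real n)"
  obtain m :: nat where m: "L + 1 \<le> real m" using real_arch_simple by blast
  let ?I = "{- real n - 1 .. - real n}"
  define c where "c = exp (- real n - 1)"
  have lb: "ennreal c * p \<le> ennreal (exp z) * occ_prob M (real m) L (R z)" if z: "z \<in> ?I" for z
  proof (rule mult_mono)
    show "ennreal c \<le> ennreal (exp z)" unfolding c_def using z by (intro ennreal_leI) simp
    have "p \<le> occ_prob M (L + 1) L (R z)" unfolding p_def
      by (rule occ_prob_mono[OF R_proc]) (use z in \<open>auto simp: R_def\<close>)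
    also have "\<dots> \<le> occ_prob M (real m) L (R z)"
      unfolding occ_prob_def
    proof (rule emeasure_mono[OF _ occ_set_measurable[OF R_proc]], rule subsetI)
      fix \<omega> assume "\<omega> \<in> {\<omega> \<in> space M. ennreal L < occ (L + 1) (\<lambda>t. R z t \<omega>)}"
      then have w: "\<omega> \<in> space M" and l: "ennreal L < occ (L + 1) (\<lambda>t. R z t \<omega>)" by auto
      note [measurable] = cont_proc_path_measurable[OF R_proc w]
      have "occ (L + 1) (\<lambda>t. R z t \<omega>) \<le> occ (real m) (\<lambda>t. R z t \<omega>)"
        unfolding occ_def by (rule emeasure_mono) (use m in auto)
      then show "\<omega> \<in> {\<omega> \<in> space M. ennreal L < occ (real m) (\<lambda>t. R z t \<omega>)}" using w l by auto
    qed
    finally show "p \<le> occ_prob M (real m) L (R z)" .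
  qed auto
  have "0 < ennreal c * p" using n by (auto simp: c_def p_def ennreal_zero_less_mult_iff)
  also have "ennreal c * p = (\<integral>\<^sup>+ z. (ennreal c * p) * indicator ?I z \<partial>lborel)"
    by (simp add: nn_integral_cmult_indicator)
  also have "\<dots> \<le> K_line_upto (real m) L"
    unfolding K_line_upto_def using lb by (intro nn_integral_mono) (auto simp: indicator_def)
  also have "\<dots> \<le> K_line L" unfolding K_line_upto_SUP[symmetric] by (rule SUP_upper) simp
  finally show ?thesis .
qed

end

section \<open>Ruin times and their conditional limit\<close>

lemma occ_mono_horizon:
  assumes "z \<in> borel_measurable borel" "S \<le> T"
  shows "occ S z \<le> occ T z"
  unfolding occ_def using assms by (intro emeasure_mono) auto

text \<open>The first exceedance time need not itself belong to the set of exceedance times, hence the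
approximation from the right. This gives measurability of the ruin time.\<close>

lemma first_exceedance_le_iff:
  fixes z :: "real \<Rightarrow> real"
  assumes z: "z \<in> borel_measurable borel" and T: "0 < T"
  shows "Inf (ereal ` {T. 0 < T \<and> l < occ T z}) \<le> ereal T \<longleftrightarrow> (\<forall>n::nat. l < occ (T + 1 / real (Suc n)) z)"
    (is "Inf ?A \<le> _ \<longleftrightarrow> _")
proof
  assume le: "Inf ?A \<le> ereal T"
  show "\<forall>n::nat. l < occ (T + 1 / real (Suc n)) z"
  proof
    fix n :: nat
    have "Inf ?A < ereal (T + 1 / real (Suc n))" by (rule le_less_trans[OF le]) simp
    then obtain S where S: "l < occ S z" "S < T + 1 / real (Suc n)" by (auto simp: Inf_less_iff)
    then show "l < occ (T + 1 / real (Suc n)) z"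
      using occ_mono_horizon[OF z less_imp_le[OF S(2)]] by (rule_tac less_le_trans)
  qed
next
  assume all: "\<forall>n::nat. l < occ (T + 1 / real (Suc n)) z"
  have le: "Inf ?A \<le> ereal (T + 1 / real (Suc n))" for n
    using all T by (intro Inf_lower imageI) (simp add: add_pos_pos)
  have "(\<lambda>n. ereal (T + 1 / real (Suc n))) \<longlonglongrightarrow> ereal T"
    by (rule tendsto_ereal) real_asymp
  then show "Inf ?A \<le> ereal T" by (rule LIMSEQ_le_const) (use le in auto)
qed

text \<open>The event that ruin occurs by time \<open>T\<close> lies between the exceedance events at \<open>T\<close> and at any later
\<open>T'\<close>; this replaces an exact identity.\<close>

lemma first_exceedance_event:
  assumes z: "z \<in> borel_measurable borel" and T: "0 < T"
  shows "l < occ T z \<Longrightarrow> Inf (ereal ` {T. 0 < T \<and> l < occ T z}) \<le> ereal T"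
    and "Inf (ereal ` {T. 0 < T \<and> l < occ T z}) \<le> ereal T \<Longrightarrow> T < T' \<Longrightarrow> l < occ T' z"
proof -
  show "Inf (ereal ` {T. 0 < T \<and> l < occ T z}) \<le> ereal T" if "l < occ T z"
    using that T by (intro Inf_lower imageI) auto
  assume le: "Inf (ereal ` {T. 0 < T \<and> l < occ T z}) \<le> ereal T" and T': "T < T'"
  have "Inf (ereal ` {T. 0 < T \<and> l < occ T z}) < ereal T'" by (rule le_less_trans[OF le]) (use T' in simp)
  then obtain S where S: "l < occ S z" "S < T'" by (auto simp: Inf_less_iff)
  then show "l < occ T' z"
    using occ_mono_horizon[OF z less_imp_le[OF S(2)]] by (rule_tac less_le_trans)
qed

lemma scaled_time_le_iff:
  fixes t :: ereal
  assumes u: "0 < (u::real)"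
  shows "ereal x \<le> ereal (u\<^sup>2) * (1 - t) \<longleftrightarrow> t \<le> ereal (1 - x / u\<^sup>2)"
proof (cases t)
  case (real r)
  have u2: "0 < u\<^sup>2" using u by simp
  have "ereal (u\<^sup>2) * (1 - t) = ereal (u\<^sup>2 * (1 - r))" using real by (simp add: one_ereal_def)
  moreover have "x \<le> u\<^sup>2 * (1 - r) \<longleftrightarrow> r \<le> 1 - x / u\<^sup>2"
  proof -
    have "x \<le> u\<^sup>2 * (1 - r) \<longleftrightarrow> x / u\<^sup>2 \<le> 1 - r" using u2 by (simp add: field_simps)
    then show ?thesis by auto
  qed
  ultimately show ?thesis using real by simp
next
  case PInf
  have "(1::ereal) - \<infinity> = - \<infinity>" by (simp add: one_ereal_def)
  then show ?thesis using PInf u by simp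
next
  case MInf
  have "(1::ereal) - (- \<infinity>) = \<infinity>" by (simp add: one_ereal_def)
  then show ?thesis using MInf u by simp
qed

lemma tendsto_between_shifts:
  fixes p :: "real \<Rightarrow> real \<Rightarrow> real" and b g F :: "real \<Rightarrow> real"
  assumes lim: "\<And>y. ((\<lambda>u. p y u / g u) \<longlongrightarrow> F y) at_top"
    and F: "isCont F x"
    and g: "\<forall>\<^sub>F u in at_top. 0 < g u"
    and lower: "\<forall>\<^sub>F u in at_top. p x u \<le> b u"
    and upper: "\<And>\<epsilon>. 0 < \<epsilon> \<Longrightarrow> \<forall>\<^sub>F u in at_top. b u \<le> p (x - \<epsilon>) u"
  shows "((\<lambda>u. b u / g u) \<longlongrightarrow> F x) at_top"
proof (rule tendstoI)
  fix e :: real assume "0 < e"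
  then have e2: "0 < e / 2" by simp
  from F[unfolded continuous_at_eps_delta, rule_format, OF e2]
  obtain \<delta> where \<delta>: "0 < \<delta>" "\<And>y. \<bar>y - x\<bar> < \<delta> \<Longrightarrow> \<bar>F y - F x\<bar> < e / 2"
    by (auto simp: dist_real_def)
  have F\<delta>: "\<bar>F (x - \<delta> / 2) - F x\<bar> < e / 2" by (rule \<delta>(2)) (use \<delta>(1) in simp)
  have \<delta>2: "0 < \<delta> / 2" using \<delta> by simp
  show "\<forall>\<^sub>F u in at_top. dist (b u / g u) (F x) < e"
    using g lower upper[OF \<delta>2] tendstoD[OF lim[of x] e2] tendstoD[OF lim[of "x - \<delta> / 2"] e2]
  proof eventually_elim
    case (elim u)
    have "p x u / g u \<le> b u / g u" "b u / g u \<le> p (x - \<delta> / 2) u / g u"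
      using elim by (auto intro: divide_right_mono)
    then show ?case using elim(4,5) F\<delta> unfolding dist_real_def by linarith
  qed
qed

text \<open>In the conditional probability both events are of the form that a ruin time is at most
\<open>1 - y / u\<^sup>2\<close>, and for \<open>L2 \<le> L1\<close> the first one implies the second. So the conditional probability is
a quotient of two probabilities with known asymptotics, where the error of
\<open>first_exceedance_event\<close> is a shift of \<open>y\<close> and disappears by continuity in \<open>y\<close>.\<close>

lemma (in prob_space) parisian_ratio_limit:
  fixes Z :: "real \<Rightarrow> real \<Rightarrow> 'a \<Rightarrow> real" and g k :: "real \<Rightarrow> real"
  defines "\<tau> \<equiv> \<lambda>L u \<omega>. Inf (ereal ` {T. 0 < T \<and> ennreal (L / u\<^sup>2) < occ T (\<lambda>t. Z u t \<omega>)})"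
  assumes Z: "\<And>u. cont_proc M (Z u)"
    and lim: "\<And>L y. 0 \<le> L \<Longrightarrow> ((\<lambda>u. enn2real (occ_prob M (1 - y / u\<^sup>2) (L / u\<^sup>2) (Z u)) / g u) \<longlongrightarrow> c * exp (- (q * y / 2)) * k L) at_top"
    and g: "\<And>u. 0 < u \<Longrightarrow> 0 < g u" and c: "0 < c" and k: "0 < k L2"
    and L: "0 \<le> L2" "L2 \<le> L1" and x: "0 < x"
  shows "((\<lambda>u. \<P>(\<omega> in M. ereal x \<le> ereal (u\<^sup>2) * (1 - \<tau> L1 u \<omega>) \<bar> \<tau> L2 u \<omega> \<le> 1)) \<longlongrightarrow> k L1 / k L2 * exp (- (q * x / 2))) at_top"
proof -
  define b where "b = (\<lambda>L y u. prob {\<omega> \<in> space M. \<tau> L u \<omega> \<le> ereal (1 - y / u\<^sup>2)})"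
  define p where "p = (\<lambda>L y u. enn2real (occ_prob M (1 - y / u\<^sup>2) (L / u\<^sup>2) (Z u)))"
  have path: "(\<lambda>t. Z u t \<omega>) \<in> borel_measurable borel" if "\<omega> \<in> space M" for u \<omega>
    by (rule cont_proc_path_measurable[OF Z that])
  have p_prob: "p L y u = prob {\<omega> \<in> space M. ennreal (L / u\<^sup>2) < occ (1 - y / u\<^sup>2) (\<lambda>t. Z u t \<omega>)}" for L y u
    unfolding p_def occ_prob_def measure_def ..
  have horizon: "\<forall>\<^sub>F u in at_top. 0 < 1 - y / u\<^sup>2" for y :: real by real_asymp
  have tau_sets: "{\<omega> \<in> space M. \<tau> L u \<omega> \<le> ereal T} \<in> sets M" if T: "0 < T" for L u T
  proof -
    have "{\<omega> \<in> space M. \<tau> L u \<omega> \<le> ereal T} = (\<Inter>n. {\<omega> \<in> space M. ennreal (L / u\<^sup>2) < occ (T + 1 / real (Suc n)) (\<lambda>t. Z u t \<omega>)})"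
      unfolding \<tau>_def using first_exceedance_le_iff[OF path T] by auto
    also have "\<dots> \<in> sets M" using occ_set_measurable[OF Z] by auto
    finally show ?thesis .
  qed
  have blim: "((\<lambda>u. b L y u / g u) \<longlongrightarrow> c * exp (- (q * y / 2)) * k L) at_top" if L: "0 \<le> L" for L y
  proof (rule tendsto_between_shifts[where p="p L" and F="\<lambda>y. c * exp (- (q * y / 2)) * k L"])
    show "((\<lambda>u. p L y u / g u) \<longlongrightarrow> c * exp (- (q * y / 2)) * k L) at_top" for y
      unfolding p_def by (rule lim[OF L])
    show "isCont (\<lambda>y. c * exp (- (q * y / 2)) * k L) y" by (intro continuous_intros) auto
    show "\<forall>\<^sub>F u in at_top. 0 < g u" using eventually_gt_at_top[of 0] by eventually_elim (rule g)
    show "\<forall>\<^sub>F u in at_top. p L y u \<le> b L y u"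
      using horizon[of y]
    proof eventually_elim
      case (elim u)
      show ?case unfolding p_prob b_def
      proof (rule finite_measure_mono[OF _ tau_sets[OF elim]], rule subsetI)
        fix \<omega> assume "\<omega> \<in> {\<omega> \<in> space M. ennreal (L / u\<^sup>2) < occ (1 - y / u\<^sup>2) (\<lambda>t. Z u t \<omega>)}"
        then show "\<omega> \<in> {\<omega> \<in> space M. \<tau> L u \<omega> \<le> ereal (1 - y / u\<^sup>2)}"
          unfolding \<tau>_def using first_exceedance_event(1)[OF path elim] by blast
      qed
    qed
    show "\<forall>\<^sub>F u in at_top. b L y u \<le> p L (y - \<epsilon>) u" if \<epsilon>: "0 < \<epsilon>" for \<epsilon>
      using horizon[of y] eventually_gt_at_top[of 0]
    proof eventually_elim
      case (elim u)
      have lt: "1 - y / u\<^sup>2 < 1 - (y - \<epsilon>) / u\<^sup>2" using elim \<epsilon> by (simp add: divide_strict_right_mono)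
      show ?case unfolding p_prob b_def
      proof (rule finite_measure_mono[OF _ occ_set_measurable[OF Z]], rule subsetI)
        fix \<omega> assume "\<omega> \<in> {\<omega> \<in> space M. \<tau> L u \<omega> \<le> ereal (1 - y / u\<^sup>2)}"
        then show "\<omega> \<in> {\<omega> \<in> space M. ennreal (L / u\<^sup>2) < occ (1 - (y - \<epsilon>) / u\<^sup>2) (\<lambda>t. Z u t \<omega>)}"
          unfolding \<tau>_def using first_exceedance_event(2)[OF path elim(1) _ lt] by blast
      qed
    qed
  qed
  have L1: "0 \<le> L1" using L by simp
  have "((\<lambda>u. (b L1 x u / g u) / (b L2 0 u / g u)) \<longlongrightarrow> (c * exp (- (q * x / 2)) * k L1) / (c * exp (- (q * 0 / 2)) * k L2)) at_top"
    using c k by (intro tendsto_divide blim L L1) simp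
  moreover have "(c * exp (- (q * x / 2)) * k L1) / (c * exp (- (q * 0 / 2)) * k L2) = k L1 / k L2 * exp (- (q * x / 2))"
    using c by (simp add: field_simps)
  moreover have "\<forall>\<^sub>F u in at_top. (b L1 x u / g u) / (b L2 0 u / g u) =
      \<P>(\<omega> in M. ereal x \<le> ereal (u\<^sup>2) * (1 - \<tau> L1 u \<omega>) \<bar> \<tau> L2 u \<omega> \<le> 1)"
    using eventually_gt_at_top[of 0]
  proof eventually_elim
    case (elim u)
    have anti: "\<tau> L2 u \<omega> \<le> \<tau> L1 u \<omega>" for \<omega>
    proof -
      have "ennreal (L2 / u\<^sup>2) \<le> ennreal (L1 / u\<^sup>2)" using L by (intro ennreal_leI divide_right_mono) auto
      then show ?thesis unfolding \<tau>_def by (intro Inf_superset_mono image_mono) (auto intro: le_less_trans)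
    qed
    have "{\<omega> \<in> space M. ereal x \<le> ereal (u\<^sup>2) * (1 - \<tau> L1 u \<omega>) \<and> \<tau> L2 u \<omega> \<le> 1} = {\<omega> \<in> space M. \<tau> L1 u \<omega> \<le> ereal (1 - x / u\<^sup>2)}"
    proof (intro Collect_cong conj_cong refl)
      fix \<omega>
      have "ereal (1 - x / u\<^sup>2) \<le> 1" using x by (simp add: one_ereal_def)
      then have "\<tau> L2 u \<omega> \<le> 1" if "\<tau> L1 u \<omega> \<le> ereal (1 - x / u\<^sup>2)"
        using anti[of \<omega>] that by (meson order_trans)
      then show "(ereal x \<le> ereal (u\<^sup>2) * (1 - \<tau> L1 u \<omega>) \<and> \<tau> L2 u \<omega> \<le> 1) = (\<tau> L1 u \<omega> \<le> ereal (1 - x / u\<^sup>2))"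
        unfolding scaled_time_le_iff[OF elim] by blast
    qed
    then have num: "prob {\<omega> \<in> space M. ereal x \<le> ereal (u\<^sup>2) * (1 - \<tau> L1 u \<omega>) \<and> \<tau> L2 u \<omega> \<le> 1} = b L1 x u"
      unfolding b_def by (simp only:)
    have den: "prob {\<omega> \<in> space M. \<tau> L2 u \<omega> \<le> 1} = b L2 0 u"
      unfolding b_def by (simp add: one_ereal_def)
    show ?case unfolding cond_prob_def num den using g[OF elim] by simp
  qed
  ultimately show ?thesis by (simp add: tendsto_cong)
qed

lemma occ_scale:
  assumes [measurable]: "z \<in> borel_measurable borel" and c: "0 < c"
  shows "occ (c * A) (\<lambda>s. z (s / c)) = ennreal c * occ A z"
proof -
  have "occ (c * A) (\<lambda>s. z (s / c)) = (\<integral>\<^sup>+ s. indicator {0..c * A} s * indicator {0<..} (z (s / c)) \<partial>lborel)"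
    by (rule occ_nn_integral) measurable
  also have "\<dots> = ennreal \<bar>c\<bar> * (\<integral>\<^sup>+ t. indicator {0..c * A} (0 + c * t) * indicator {0<..} (z ((0 + c * t) / c)) \<partial>lborel)"
    by (rule nn_integral_real_affine) (use c in auto)
  also have "(\<integral>\<^sup>+ t. indicator {0..c * A} (0 + c * t) * indicator {0<..} (z ((0 + c * t) / c)) \<partial>lborel) = occ A z"
    unfolding occ_nn_integral[OF assms(1)] using c
    by (intro nn_integral_cong) (auto simp: indicator_def zero_le_mult_iff)
  finally show ?thesis using c by simp
qed

text \<open>Brownian scaling: \<open>u * X (s / u\<^sup>2)\<close> is again a Brownian motion, and occupation times are multiplied
by \<open>u\<^sup>2\<close>.\<close>

lemma (in ruin_pair) ruin_scaling:
  assumes u: "0 < u" and T: "0 < T" and L: "0 \<le> L"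
  shows "occ_prob M T (L / u\<^sup>2) (\<lambda>t \<omega>. min (X t \<omega> - u - c1 * t) (W t \<omega> - a * u - c2 * t)) = occ_prob M (u\<^sup>2 * T) L (Z u)"
proof -
  let ?z = "\<lambda>t \<omega>. min (X t \<omega> - u - c1 * t) (W t \<omega> - a * u - c2 * t)"
  have u2: "0 < u\<^sup>2" using u by simp
  have zc: "cont_proc M ?z"
    by (intro cont_proc_min cont_proc_minus cont_proc_const cont_proc_det X_proc W_proc continuous_intros) auto
  have iff: "ennreal (L / u\<^sup>2) < occ T (\<lambda>t. ?z t \<omega>) \<longleftrightarrow> ennreal L < occ (u\<^sup>2 * T) (\<lambda>s. ?z (s / u\<^sup>2) \<omega>)" if w: "\<omega> \<in> space M" for \<omega>
  proof -
    have "occ (u\<^sup>2 * T) (\<lambda>s. ?z (s / u\<^sup>2) \<omega>) = ennreal (u\<^sup>2) * occ T (\<lambda>t. ?z t \<omega>)"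
      by (rule occ_scale[OF cont_proc_path_measurable[OF zc w] u2])
    moreover have "ennreal L = ennreal (u\<^sup>2) * ennreal (L / u\<^sup>2)" using u2 L by (simp flip: ennreal_mult)
    moreover have "b * l < b * v \<longleftrightarrow> l < v" if b: "0 < b" "b < top" for b l v :: ennreal
    proof
      assume less: "b * l < b * v"
      show "l < v"
      proof (rule ccontr)
        assume "\<not> l < v"
        then have "b * v \<le> b * l" by (intro mult_left_mono) (auto simp: not_less)
        with less show False by simp
      qed
    qed (rule ennreal_mult_strict_left_mono[OF _ b])
    moreover have "0 < ennreal (u\<^sup>2)" "ennreal (u\<^sup>2) < top" using u2 by simp_all
    ultimately show ?thesis by (simp only:)
  qed
  have "occ_prob M T (L / u\<^sup>2) ?z = occ_prob M (u\<^sup>2 * T) L (\<lambda>s. ?z (s / u\<^sup>2))"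
    unfolding occ_prob_def using iff by (intro arg_cong[where f="emeasure M"] Collect_cong conj_cong refl) auto
  also have "\<dots> = occ_prob M (u\<^sup>2 * T) L (\<lambda>s \<omega>. min (u * X (s / u\<^sup>2) \<omega> - u\<^sup>2 - c1 * s / u)
      (\<rho> * (u * X (s / u\<^sup>2) \<omega>) + \<sigma> * (u * Y (s / u\<^sup>2) \<omega>) - a * u\<^sup>2 - c2 * s / u))"
  proof (rule occ_prob_cong_sign)
    fix s \<omega>
    have "u * X (s / u\<^sup>2) \<omega> - u\<^sup>2 - c1 * s / u = u * (X (s / u\<^sup>2) \<omega> - u - c1 * (s / u\<^sup>2))"
      using u by (simp add: field_simps power2_eq_square)
    moreover have "\<rho> * (u * X (s / u\<^sup>2) \<omega>) + \<sigma> * (u * Y (s / u\<^sup>2) \<omega>) - a * u\<^sup>2 - c2 * s / u =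
       u * (W (s / u\<^sup>2) \<omega> - a * u - c2 * (s / u\<^sup>2))"
      unfolding W_def using u by (simp add: field_simps power2_eq_square)
    ultimately show "(0 < ?z (s / u\<^sup>2) \<omega>) = (0 < min (u * X (s / u\<^sup>2) \<omega> - u\<^sup>2 - c1 * s / u)
      (\<rho> * (u * X (s / u\<^sup>2) \<omega>) + \<sigma> * (u * Y (s / u\<^sup>2) \<omega>) - a * u\<^sup>2 - c2 * s / u))"
      unfolding min_less_iff_conj using u by (simp only: zero_less_mult_iff) auto
  qed
  also have "\<dots> = occ_prob M (u\<^sup>2 * T) L (Z u)"
  proof -
    let ?f = "\<lambda>s x y. min (x - u\<^sup>2 - c1 * s / u) (\<rho> * x + \<sigma> * y - a * u\<^sup>2 - c2 * s / u)"
    have fc: "continuous_on UNIV (\<lambda>(s, x, y). ?f s x y)"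
      unfolding case_prod_beta' using u by (intro continuous_intros) auto
    have "0 < u\<^sup>2 * T" using u2 T by simp
    from brownian_pair_occ_prob_cong[OF scaled[OF u] brownian_pair_axioms this L fc]
    show ?thesis unfolding Z_def W_def .
  qed
  finally show ?thesis .
qed

section \<open>The Brownian pair behind a process of given law\<close>

lemma brownian_increment_law:
  assumes B: "standard_brownian_motion N B" and st: "0 \<le> s" "s < t"
  shows "distr N borel (\<lambda>\<omega>. B t \<omega> - B s \<omega>) = gauss (t - s)"
proof -
  have "distributed N lborel (\<lambda>\<omega>. B t \<omega> - B s \<omega>) (normal_density 0 (sqrt (t - s)))"
    using B st unfolding standard_brownian_motion_def by blast
  then have "distr N lborel (\<lambda>\<omega>. B t \<omega> - B s \<omega>) = gauss (t - s)"
    unfolding distributed_def gauss_def by simp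
  then show ?thesis by (metis distr_cong sets_lborel)
qed

text \<open>All \<open>2 * n\<close> increments are collected in a single independent family indexed by \<open>bool \<times> {..<n}\<close>
and then regrouped into pairs.\<close>

lemma independent_pair_increments:
  fixes t :: "nat \<Rightarrow> real"
  assumes B1: "standard_brownian_motion N B1" and B2: "standard_brownian_motion N B2"
    and ind: "independent_processes N B1 B2"
    and t: "0 \<le> t 0" "\<And>i. i < n \<Longrightarrow> t i < t (Suc i)" and n: "0 < n"
  shows "distr N (PiM {..<n} (\<lambda>_. borel \<Otimes>\<^sub>M borel))
      (\<lambda>\<omega>. \<lambda>i\<in>{..<n}. (B1 (t (Suc i)) \<omega> - B1 (t i) \<omega>, B2 (t (Suc i)) \<omega> - B2 (t i) \<omega>)) =
    PiM {..<n} (\<lambda>i. gauss2 (t (Suc i) - t i))"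
proof -
  interpret prob_space N using B1 by (simp add: standard_brownian_motion_def)
  have tpos: "0 \<le> t i" if "i \<le> n" for i
    using that
  proof (induction i)
    case (Suc i)
    then have "0 \<le> t i" "t i < t (Suc i)" using t(2)[of i] by simp_all
    then show ?case by simp
  qed (simp add: t(1))
  have meas: "B1 s \<in> borel_measurable N" "B2 s \<in> borel_measurable N" if "0 \<le> s" for s
    using B1 B2 that by (auto simp: standard_brownian_motion_def continuous_process_def)
  define D where "D = (\<lambda>b i \<omega>. if b then B1 (t (Suc i)) \<omega> - B1 (t i) \<omega> else B2 (t (Suc i)) \<omega> - B2 (t i) \<omega>)"
  have Dm: "D b i \<in> borel_measurable N" if "i < n" for b i
    using that tpos[of i] tpos[of "Suc i"] meas unfolding D_def by (cases b) auto
  have Dlaw: "distr N borel (D b i) = gauss (t (Suc i) - t i)" if "i < n" for b i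
    using brownian_increment_law[OF B1 tpos t(2), of i] brownian_increment_law[OF B2 tpos t(2), of i] that
    unfolding D_def by (cases b) simp_all
  have DI: "indep_vars (\<lambda>_. borel) (D b) {..<n}" for b
    using B1 B2 t unfolding standard_brownian_motion_def D_def by (cases b) auto
  let ?P = "PiM {..<n} (\<lambda>_. borel :: real measure)"
  let ?U = "\<lambda>b \<omega>. \<lambda>i\<in>{..<n}. D b i \<omega>"
  have U: "indep_var ?P (?U True) ?P (?U False)"
  proof -
    let ?F = "\<lambda>w :: real \<Rightarrow> real. \<lambda>i\<in>{..<n}. w (t (Suc i)) - w (t i)"
    have F: "?F \<in> measurable (PiM {0..} (\<lambda>_. borel)) ?P"
    proof (rule measurable_restrict)
      fix i assume "i \<in> {..<n}"
      then have "t (Suc i) \<in> {0..}" "t i \<in> {0..}" using tpos[of i] tpos[of "Suc i"] by auto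
      then show "(\<lambda>w. w (t (Suc i)) - w (t i)) \<in> measurable (PiM {0..} (\<lambda>_. borel :: real measure)) borel"
        by (intro borel_measurable_diff measurable_component_singleton)
    qed
    have "indep_var ?P (?F \<circ> path_map B1) ?P (?F \<circ> path_map B2)"
      by (rule indep_var_compose[OF ind[unfolded independent_processes_def] F F])
    moreover have "?F \<circ> path_map B1 = ?U True" "?F \<circ> path_map B2 = ?U False"
      unfolding D_def path_map_def using tpos by (auto simp: fun_eq_iff Suc_leI less_imp_le restrict_def)
    ultimately show ?thesis by simp
  qed
  define V where "V = (\<lambda>k. D (fst k) (snd k))"
  let ?I = "(UNIV :: bool set) \<times> {..<n}"
  have Vm: "V k \<in> borel_measurable N" if "k \<in> ?I" for k using that Dm unfolding V_def by auto
  let ?G = "\<lambda>k. gauss (if snd k < n then t (Suc (snd k)) - t (snd k) else 1)"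
  interpret G: product_sigma_finite ?G
    using t by (intro product_sigma_finite.intro prob_space_imp_sigma_finite prob_space_gauss) auto
  have "distr N (PiM ?I (\<lambda>_. borel)) (\<lambda>\<omega>. \<lambda>k\<in>?I. V k \<omega>) = PiM ?I ?G"
  proof (rule G.PiM_eqI)
    show "sets (distr N (PiM ?I (\<lambda>_. borel)) (\<lambda>\<omega>. \<lambda>k\<in>?I. V k \<omega>)) = sets (PiM ?I ?G)"
      by (simp cong: sets_PiM_cong)
    fix A assume "\<And>k. k \<in> ?I \<Longrightarrow> A k \<in> sets (?G k)"
    then have A: "A (b, i) \<in> sets borel" if "i < n" for b i using that by auto
    have Vmm: "(\<lambda>\<omega>. \<lambda>k\<in>?I. V k \<omega>) \<in> measurable N (PiM ?I (\<lambda>_. borel))"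
      by (intro measurable_restrict Vm)
    have Am: "Pi\<^sub>E ?I A \<in> sets (PiM ?I (\<lambda>_. borel))" using A by (intro sets_PiM_I_finite) auto
    let ?F = "\<lambda>b d. \<Prod>i<n. indicator (A (b, i)) (d i) :: ennreal"
    have Fm: "?F b \<in> borel_measurable ?P" for b
      using A by (intro borel_measurable_prod_ennreal) (auto intro!: measurable_compose[OF measurable_component_singleton] borel_measurable_indicator)
    have Fint: "(\<integral>\<^sup>+ \<omega>. ?F b (?U b \<omega>) \<partial>N) = (\<Prod>i<n. emeasure (gauss (t (Suc i) - t i)) (A (b, i)))" for b
    proof -
      have "(\<integral>\<^sup>+ \<omega>. ?F b (?U b \<omega>) \<partial>N) = (\<integral>\<^sup>+ \<omega>. (\<Prod>i\<in>{..<n}. indicator (A (b, i)) (D b i \<omega>)) \<partial>N)"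
        by (intro nn_integral_cong) simp
      also have "\<dots> = (\<Prod>i\<in>{..<n}. \<integral>\<^sup>+ \<omega>. indicator (A (b, i)) (D b i \<omega>) \<partial>N)"
        by (rule indep_vars_nn_integral[OF finite_lessThan indep_vars_compose2[OF DI]]) (use A in auto)
      also have "\<dots> = (\<Prod>i<n. emeasure (gauss (t (Suc i) - t i)) (A (b, i)))"
      proof (rule prod.cong[OF refl])
        fix i assume "i \<in> {..<n}"
        then have i: "i < n" by simp
        have "(\<integral>\<^sup>+ \<omega>. indicator (A (b, i)) (D b i \<omega>) \<partial>N) = (\<integral>\<^sup>+ x. indicator (A (b, i)) x \<partial>distr N borel (D b i))"
          by (rule nn_integral_distr[symmetric]) (use A[OF i] Dm[OF i] in auto)
        then show "(\<integral>\<^sup>+ \<omega>. indicator (A (b, i)) (D b i \<omega>) \<partial>N) = emeasure (gauss (t (Suc i) - t i)) (A (b, i))"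
          unfolding Dlaw[OF i] using A[OF i] by simp
      qed
      finally show ?thesis .
    qed
    have "emeasure (distr N (PiM ?I (\<lambda>_. borel)) (\<lambda>\<omega>. \<lambda>k\<in>?I. V k \<omega>)) (Pi\<^sub>E ?I A) =
       (\<integral>\<^sup>+ \<omega>. indicator (Pi\<^sub>E ?I A) (\<lambda>k\<in>?I. V k \<omega>) \<partial>N)"
      (is "emeasure ?D _ = _")
    proof -
      have "emeasure ?D (Pi\<^sub>E ?I A) = (\<integral>\<^sup>+ w. indicator (Pi\<^sub>E ?I A) w \<partial>?D)"
        by (rule nn_integral_indicator[symmetric]) (use Am in simp)
      also have "\<dots> = (\<integral>\<^sup>+ \<omega>. indicator (Pi\<^sub>E ?I A) (\<lambda>k\<in>?I. V k \<omega>) \<partial>N)"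
        by (rule nn_integral_distr[OF Vmm]) (simp add: borel_measurable_indicator[OF Am])
      finally show ?thesis .
    qed
    also have "\<dots> = (\<integral>\<^sup>+ \<omega>. ?F True (?U True \<omega>) * ?F False (?U False \<omega>) \<partial>N)"
    proof (intro nn_integral_cong)
      fix \<omega>
      have "(\<lambda>k\<in>?I. V k \<omega>) \<in> Pi\<^sub>E ?I A \<longleftrightarrow> (\<forall>i<n. D True i \<omega> \<in> A (True, i)) \<and> (\<forall>i<n. D False i \<omega> \<in> A (False, i))"
        unfolding PiE_iff V_def by (auto simp: extensional_def) (metis (full_types))
      moreover have "?F b (?U b \<omega>) = (if \<forall>i<n. D b i \<omega> \<in> A (b, i) then 1 else 0)" for b
        unfolding prod_indicator_all by (simp add: indicator_def)
      ultimately show "indicator (Pi\<^sub>E ?I A) (\<lambda>k\<in>?I. V k \<omega>) = ?F True (?U True \<omega>) * ?F False (?U False \<omega>)"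
        by (simp add: indicator_def)
    qed
    also have "\<dots> = (\<integral>\<^sup>+ \<omega>. ?F True (?U True \<omega>) \<partial>N) * (\<integral>\<^sup>+ \<omega>. ?F False (?U False \<omega>) \<partial>N)"
      by (rule indep_var_nn_integral_mult[OF U Fm Fm])
    also have "\<dots> = (\<Prod>b\<in>UNIV. \<Prod>i<n. emeasure (?G (b, i)) (A (b, i)))"
      unfolding Fint by (simp add: UNIV_bool mult.commute)
    also have "\<dots> = (\<Prod>k\<in>?I. emeasure (?G k) (A k))"
      unfolding prod.cartesian_product unfolding case_prod_beta' by (simp only: fst_conv snd_conv prod.collapse)
    finally show "emeasure (distr N (PiM ?I (\<lambda>_. borel)) (\<lambda>\<omega>. \<lambda>k\<in>?I. V k \<omega>)) (Pi\<^sub>E ?I A) = (\<Prod>k\<in>?I. emeasure (?G k) (A k))" .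
  qed simp
  also have "\<dots> = PiM ?I (\<lambda>k. distr N borel (V k))"
    by (rule PiM_cong) (auto simp: V_def Dlaw)
  finally have VI: "indep_vars (\<lambda>_. borel) V ?I"
    by (subst indep_vars_iff_distr_eq_PiM') (use n Vm in auto)
  let ?K = "\<lambda>i. {(True, i), (False, i)}"
  have "indep_vars (\<lambda>i. PiM (?K i) (\<lambda>_. borel)) (\<lambda>i \<omega>. \<lambda>k\<in>?K i. V k \<omega>) {..<n}"
    by (rule indep_vars_restrict[OF VI]) (auto simp: disjoint_family_on_def)
  then have "indep_vars (\<lambda>_. borel \<Otimes>\<^sub>M borel) (\<lambda>i \<omega>. (\<lambda>d. (d (True, i), d (False, i))) (\<lambda>k\<in>?K i. V k \<omega>)) {..<n}"
    by (rule indep_vars_compose2) (intro measurable_Pair measurable_component_singleton, auto)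
  then have pairs: "indep_vars (\<lambda>_. borel \<Otimes>\<^sub>M borel) (\<lambda>i \<omega>. (D True i \<omega>, D False i \<omega>)) {..<n}"
    by (simp add: V_def)
  have plaw: "distr N (borel \<Otimes>\<^sub>M borel) (\<lambda>\<omega>. (D True i \<omega>, D False i \<omega>)) = gauss2 (t (Suc i) - t i)" if i: "i < n" for i
  proof -
    have c: "(\<lambda>d. d i) \<in> measurable ?P borel" using i by (intro measurable_component_singleton) auto
    have "indep_var borel ((\<lambda>d. d i) \<circ> ?U True) borel ((\<lambda>d. d i) \<circ> ?U False)" by (rule indep_var_compose[OF U c c])
    moreover have "(\<lambda>d. d i) \<circ> ?U b = D b i" for b using i by auto
    ultimately have "indep_var borel (D True i) borel (D False i)" by simp
    then have "distr N borel (D True i) \<Otimes>\<^sub>M distr N borel (D False i) = distr N (borel \<Otimes>\<^sub>M borel) (\<lambda>\<omega>. (D True i \<omega>, D False i \<omega>))"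
      unfolding indep_var_distribution_eq by blast
    then show ?thesis unfolding Dlaw[OF i] gauss2_def by simp
  qed
  have "distr N (PiM {..<n} (\<lambda>_. borel \<Otimes>\<^sub>M borel)) (\<lambda>\<omega>. \<lambda>i\<in>{..<n}. (D True i \<omega>, D False i \<omega>)) =
     PiM {..<n} (\<lambda>i. distr N (borel \<Otimes>\<^sub>M borel) (\<lambda>\<omega>. (D True i \<omega>, D False i \<omega>)))"
    using pairs by (subst (asm) indep_vars_iff_distr_eq_PiM') (use n Dm in \<open>auto intro!: measurable_Pair\<close>)
  also have "\<dots> = PiM {..<n} (\<lambda>i. gauss2 (t (Suc i) - t i))"
    by (rule PiM_cong) (auto simp: plaw)
  finally show ?thesis unfolding D_def by simp
qed

lemma cont_proc_stopped_at_zero: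
  assumes "continuous_process M X"
  shows "cont_proc M (\<lambda>t. X (max 0 t))"
  unfolding cont_proc_def
proof (intro conjI allI ballI)
  show "X (max 0 t) \<in> borel_measurable M" for t using assms by (simp add: continuous_process_def)
  fix \<omega> assume "\<omega> \<in> space M"
  then have "continuous_on {0..} (\<lambda>t. X t \<omega>)" using assms by (simp add: continuous_process_def)
  then show "continuous_on UNIV (\<lambda>t. X (max 0 t) \<omega>)"
    by (rule continuous_on_compose2) (auto intro!: continuous_intros)
qed

lemma gauss2_component:
  assumes eq: "distr M (PiM {..<1::nat} (\<lambda>_. borel \<Otimes>\<^sub>M borel)) (\<lambda>\<omega>. \<lambda>i\<in>{..<1}. D i \<omega>) = PiM {..<1} (\<lambda>_. gauss2 v)"
    and D: "D 0 \<in> measurable M (borel \<Otimes>\<^sub>M borel)" and v: "0 < v"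
  shows "distr M (borel \<Otimes>\<^sub>M borel) (D 0) = gauss2 v"
proof -
  interpret p: product_prob_space "\<lambda>_::nat. gauss2 v" "{..<1}"
    by (intro product_prob_space.intro product_prob_space_axioms.intro product_sigma_finite.intro
        prob_space_imp_sigma_finite prob_space_gauss2 v)
  have U: "(\<lambda>\<omega>. \<lambda>i\<in>{..<1}. D i \<omega>) \<in> measurable M (PiM {..<1::nat} (\<lambda>_. borel \<Otimes>\<^sub>M borel))"
    using D by (intro measurable_restrict) simp
  have "distr M (borel \<Otimes>\<^sub>M borel) (D 0) = distr (distr M (PiM {..<1::nat} (\<lambda>_. borel \<Otimes>\<^sub>M borel)) (\<lambda>\<omega>. \<lambda>i\<in>{..<1}. D i \<omega>)) (borel \<Otimes>\<^sub>M borel) (\<lambda>d. d 0)"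
    by (subst distr_distr[OF _ U]) (auto simp: o_def intro!: measurable_component_singleton)
  also have "\<dots> = distr (PiM {..<1} (\<lambda>_::nat. gauss2 v)) (gauss2 v) (\<lambda>d. d 0)"
    unfolding eq by (rule distr_cong) (auto simp: sets_gauss2)
  also have "\<dots> = gauss2 v" by (rule p.PiM_component) simp
  finally show ?thesis .
qed

text \<open>Equality of the path laws turns \<open>X\<close> and \<open>Y\<close>, recovered linearly from \<open>(W1, W2)\<close>, into independent
Brownian motions on \<open>M\<close>. Subtracting the values at time 0, which vanish only almost surely, makes
them start at 0 for every sample point; evaluating at \<open>max 0 t\<close> extends the paths continuously to
negative times.\<close>

lemma corr_pair_of_process_law:
  fixes N :: "'b measure" and M :: "'a measure"
  assumes \<rho>: "-1 < \<rho>" "\<rho> < 1"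
    and B1: "standard_brownian_motion N B1" and B2: "standard_brownian_motion N B2"
    and ind: "independent_processes N B1 B2"
    and M: "prob_space M"
    and W1: "continuous_process M W1" and W2: "continuous_process M W2"
    and law: "process_law M (\<lambda>t \<omega>. (W1 t \<omega>, W2 t \<omega>)) =
         process_law N (\<lambda>t \<omega>. (B1 t \<omega>, \<rho> * B1 t \<omega> + sqrt (1 - \<rho>\<^sup>2) * B2 t \<omega>))"
  defines "\<sigma> \<equiv> sqrt (1 - \<rho>\<^sup>2)"
  defines "X \<equiv> \<lambda>t \<omega>. W1 (max 0 t) \<omega> - W1 0 \<omega>"
  defines "Y \<equiv> \<lambda>t \<omega>. ((W2 (max 0 t) \<omega> - \<rho> * W1 (max 0 t) \<omega>) - (W2 0 \<omega> - \<rho> * W1 0 \<omega>)) / \<sigma>"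
  shows "corr_pair M X Y \<rho> \<sigma>"
    and "AE \<omega> in M. W1 0 \<omega> = 0 \<and> W2 0 \<omega> = 0"
proof -
  interpret M: prob_space M by fact
  interpret N: prob_space N using B1 by (simp add: standard_brownian_motion_def)
  have \<rho>2: "\<rho>\<^sup>2 < 1" using \<rho> by (simp add: abs_square_less_1 abs_less_iff)
  then have \<sigma>: "0 < \<sigma>" "\<rho>\<^sup>2 + \<sigma>\<^sup>2 = 1" by (auto simp: \<sigma>_def)
  let ?WW = "\<lambda>t \<omega>. (W1 t \<omega>, W2 t \<omega>)" and ?BB = "\<lambda>t \<omega>. (B1 t \<omega>, \<rho> * B1 t \<omega> + \<sigma> * B2 t \<omega>)"
  let ?Pth = "PiM {0::real..} (\<lambda>_. borel :: (real \<times> real) measure)"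
  have BBm: "?BB t \<in> borel_measurable N" and WWm: "?WW t \<in> borel_measurable M" if "0 \<le> t" for t
    using B1 B2 W1 W2 that unfolding standard_brownian_motion_def continuous_process_def
    by (auto intro!: borel_measurable_Pair borel_measurable_add borel_measurable_times)
  have pW: "path_map ?WW \<in> measurable M ?Pth" and pB: "path_map ?BB \<in> measurable N ?Pth"
    unfolding path_map_def using BBm WWm by (auto intro!: measurable_restrict)
  have lawD: "distr M ?Pth (path_map ?WW) = distr N ?Pth (path_map ?BB)"
    using law unfolding process_law_def \<sigma>_def .
  have comp: "(\<lambda>w. fst (w s)) \<in> borel_measurable ?Pth" "(\<lambda>w. snd (w s)) \<in> borel_measurable ?Pth" if "0 \<le> s" for s
  proof -
    have c: "(\<lambda>w. w s) \<in> measurable ?Pth borel" using that by (intro measurable_component_singleton) auto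
    have "fst \<in> borel_measurable (borel :: (real \<times> real) measure)" "snd \<in> borel_measurable (borel :: (real \<times> real) measure)"
      by (auto intro!: borel_measurable_continuous_onI continuous_intros)
    from measurable_compose[OF c this(1)] measurable_compose[OF c this(2)]
    show "(\<lambda>w. fst (w s)) \<in> borel_measurable ?Pth" "(\<lambda>w. snd (w s)) \<in> borel_measurable ?Pth" .
  qed
  show "AE \<omega> in M. W1 0 \<omega> = 0 \<and> W2 0 \<omega> = 0"
  proof -
    have S: "{w \<in> space ?Pth. fst (w 0) = 0 \<and> snd (w 0) = 0} \<in> sets ?Pth"
      using comp[of 0] by measurable
    have "AE \<omega> in N. B1 0 \<omega> = 0" "AE \<omega> in N. B2 0 \<omega> = 0"
      using B1 B2 by (auto simp: standard_brownian_motion_def)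
    then have "AE \<omega> in N. fst (path_map ?BB \<omega> 0) = 0 \<and> snd (path_map ?BB \<omega> 0) = 0"
      by eventually_elim (simp add: path_map_def)
    then have "AE w in distr N ?Pth (path_map ?BB). fst (w 0) = 0 \<and> snd (w 0) = 0"
      by (subst AE_distr_iff[OF pB S])
    then have "AE \<omega> in M. fst (path_map ?WW \<omega> 0) = 0 \<and> snd (path_map ?WW \<omega> 0) = 0"
      unfolding lawD[symmetric] by (subst (asm) AE_distr_iff[OF pW S])
    then show ?thesis by (simp add: path_map_def)
  qed
  have X: "cont_proc M X" and Y: "cont_proc M Y"
  proof -
    have m: "W1 0 \<in> borel_measurable M" "W2 0 \<in> borel_measurable M" using W1 W2 by (auto simp: continuous_process_def)
    note c1 = cont_proc_stopped_at_zero[OF W1] and c2 = cont_proc_stopped_at_zero[OF W2]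
    show "cont_proc M X" unfolding X_def by (intro cont_proc_minus c1 cont_proc_const m)
    have "cont_proc M (\<lambda>t \<omega>. 1 / \<sigma> * ((W2 (max 0 t) \<omega> - \<rho> * W1 (max 0 t) \<omega>) - (W2 0 \<omega> - \<rho> * W1 0 \<omega>)))"
      by (intro cont_proc_cmult cont_proc_minus c1 c2 cont_proc_const) (use m in measurable)
    then show "cont_proc M Y" unfolding Y_def by simp
  qed
  have Xm: "X s \<in> borel_measurable M" and Ym: "Y s \<in> borel_measurable M" for s
    using X Y by (auto simp: cont_proc_def)
  have incr: "distr M (PiM {..<n} (\<lambda>_. borel \<Otimes>\<^sub>M borel))
      (\<lambda>\<omega>. \<lambda>i\<in>{..<n}. (X (t (Suc i)) \<omega> - X (t i) \<omega>, Y (t (Suc i)) \<omega> - Y (t i) \<omega>)) =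
    PiM {..<n} (\<lambda>i. gauss2 (t (Suc i) - t i))"
    if t: "0 \<le> t 0" "\<And>i. i < n \<Longrightarrow> t i < t (Suc i)" and n: "0 < n" for n and t :: "nat \<Rightarrow> real"
  proof -
    have tpos: "0 \<le> t i" if "i \<le> n" for i
      using that
    proof (induction i)
      case (Suc i)
      then have "0 \<le> t i" "t i < t (Suc i)" using t(2)[of i] by simp_all
      then show ?case by simp
    qed (simp add: t(1))
    let ?y = "\<lambda>w s. (snd (w s) - \<rho> * fst (w s)) / \<sigma>"
    let ?F = "\<lambda>w. \<lambda>i\<in>{..<n}. (fst (w (t (Suc i))) - fst (w (t i)), ?y w (t (Suc i)) - ?y w (t i))"
    have F: "?F \<in> measurable ?Pth (PiM {..<n} (\<lambda>_. borel \<Otimes>\<^sub>M borel))"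
    proof (rule measurable_restrict)
      fix i assume "i \<in> {..<n}"
      then have "0 \<le> t i" "0 \<le> t (Suc i)" using tpos[of i] tpos[of "Suc i"] by auto
      note [measurable] = comp[OF this(1)] comp[OF this(2)]
      show "(\<lambda>w. (fst (w (t (Suc i))) - fst (w (t i)), ?y w (t (Suc i)) - ?y w (t i))) \<in> measurable ?Pth (borel \<Otimes>\<^sub>M borel)"
        by measurable
    qed
    have "distr M (PiM {..<n} (\<lambda>_. borel \<Otimes>\<^sub>M borel))
      (\<lambda>\<omega>. \<lambda>i\<in>{..<n}. (X (t (Suc i)) \<omega> - X (t i) \<omega>, Y (t (Suc i)) \<omega> - Y (t i) \<omega>)) =
      distr M (PiM {..<n} (\<lambda>_. borel \<Otimes>\<^sub>M borel)) (?F \<circ> path_map ?WW)"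
    proof (rule distr_cong[OF refl refl], rule ext)
      fix \<omega> i
      show "(\<lambda>i\<in>{..<n}. (X (t (Suc i)) \<omega> - X (t i) \<omega>, Y (t (Suc i)) \<omega> - Y (t i) \<omega>)) i = (?F \<circ> path_map ?WW) \<omega> i"
      proof (cases "i < n")
        case True
        then have "0 \<le> t i" "0 \<le> t (Suc i)" using tpos[of i] tpos[of "Suc i"] by auto
        then show ?thesis using True unfolding X_def Y_def path_map_def
          by (simp add: max_def diff_divide_distrib)
      qed simp
    qed
    also have "\<dots> = distr (distr M ?Pth (path_map ?WW)) (PiM {..<n} (\<lambda>_. borel \<Otimes>\<^sub>M borel)) ?F"
      by (rule distr_distr[symmetric, OF F pW])
    also have "\<dots> = distr (distr N ?Pth (path_map ?BB)) (PiM {..<n} (\<lambda>_. borel \<Otimes>\<^sub>M borel)) ?F"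
      by (simp only: lawD)
    also have "\<dots> = distr N (PiM {..<n} (\<lambda>_. borel \<Otimes>\<^sub>M borel)) (?F \<circ> path_map ?BB)"
      by (rule distr_distr[OF F pB])
    also have "\<dots> = distr N (PiM {..<n} (\<lambda>_. borel \<Otimes>\<^sub>M borel))
      (\<lambda>\<omega>. \<lambda>i\<in>{..<n}. (B1 (t (Suc i)) \<omega> - B1 (t i) \<omega>, B2 (t (Suc i)) \<omega> - B2 (t i) \<omega>))"
    proof (rule distr_cong[OF refl refl], rule ext)
      fix \<omega> i
      show "(?F \<circ> path_map ?BB) \<omega> i = (\<lambda>i\<in>{..<n}. (B1 (t (Suc i)) \<omega> - B1 (t i) \<omega>, B2 (t (Suc i)) \<omega> - B2 (t i) \<omega>)) i"
      proof (cases "i < n")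
        case True
        then have "0 \<le> t i" "0 \<le> t (Suc i)" using tpos[of i] tpos[of "Suc i"] by auto
        then show ?thesis using True \<sigma>(1) unfolding path_map_def by simp
      qed simp
    qed
    also have "\<dots> = PiM {..<n} (\<lambda>i. gauss2 (t (Suc i) - t i))"
      by (rule independent_pair_increments[OF B1 B2 ind t n])
    finally show ?thesis .
  qed
  have ilaw: "distr M (borel \<Otimes>\<^sub>M borel) (\<lambda>\<omega>. (X t \<omega> - X s \<omega>, Y t \<omega> - Y s \<omega>)) = gauss2 (t - s)"
    if "0 \<le> s" "s < t" for s t
  proof -
    let ?t = "\<lambda>i::nat. if i = 0 then s else t"
    have "distr M (PiM {..<1} (\<lambda>_. borel \<Otimes>\<^sub>M borel))
      (\<lambda>\<omega>. \<lambda>i\<in>{..<1}. (X (?t (Suc i)) \<omega> - X (?t i) \<omega>, Y (?t (Suc i)) \<omega> - Y (?t i) \<omega>)) =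
      PiM {..<1} (\<lambda>i. gauss2 (?t (Suc i) - ?t i))"
      by (rule incr) (use that in auto)
    also have "\<dots> = PiM {..<1} (\<lambda>i. gauss2 (t - s))" by (rule PiM_cong) auto
    finally have "distr M (borel \<Otimes>\<^sub>M borel) (\<lambda>\<omega>. (X (?t (Suc 0)) \<omega> - X (?t 0) \<omega>, Y (?t (Suc 0)) \<omega> - Y (?t 0) \<omega>)) = gauss2 (t - s)"
      by (rule gauss2_component[where D="\<lambda>i \<omega>. (X (?t (Suc i)) \<omega> - X (?t i) \<omega>, Y (?t (Suc i)) \<omega> - Y (?t i) \<omega>)"])
        (use that Xm Ym in \<open>auto intro!: measurable_Pair borel_measurable_diff\<close>)
    then show ?thesis by simp
  qed
  show "corr_pair M X Y \<rho> \<sigma>"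
  proof (unfold_locales, goal_cases)
    case (6 n t)
    have tpos: "0 \<le> t i" if "i \<le> n" for i
      using that
    proof (induction i)
      case (Suc i)
      then have "0 \<le> t i" "t i < t (Suc i)" using 6(2)[of i] by simp_all
      then show ?case by simp
    qed (simp add: 6(1))
    show ?case
    proof (cases "n = 0")
      case True
      then show ?thesis by (simp add: M.indep_vars_def M.indep_sets_def)
    next
      case False
      then have n: "0 < n" by simp
      have "PiM {..<n} (\<lambda>i. gauss2 (t (Suc i) - t i)) = PiM {..<n} (\<lambda>i. distr M (borel \<Otimes>\<^sub>M borel)
         (\<lambda>\<omega>. (X (t (Suc i)) \<omega> - X (t i) \<omega>, Y (t (Suc i)) \<omega> - Y (t i) \<omega>)))"
        by (intro PiM_cong refl ilaw[symmetric]) (use 6 tpos in auto)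
      then show ?thesis
        using incr[of t n, OF 6 n] n Xm Ym
        by (subst M.indep_vars_iff_distr_eq_PiM') (auto intro!: measurable_Pair borel_measurable_diff)
    qed
  qed (use X Y ilaw \<sigma> in \<open>auto simp: X_def Y_def\<close>)
qed

section \<open>The risk processes and the Parisian constants\<close>

lemma occ_prob_AE_cong:
  assumes Z: "cont_proc M Z" and Z': "cont_proc M Z'" and eq: "AE \<omega> in M. \<forall>t\<ge>0. Z t \<omega> = Z' t \<omega>"
  shows "occ_prob M A L Z = occ_prob M A L Z'"
  unfolding occ_prob_def
proof (rule emeasure_eq_AE[OF _ occ_set_measurable[OF Z] occ_set_measurable[OF Z']])
  show "AE \<omega> in M. \<omega> \<in> {\<omega> \<in> space M. ennreal L < occ A (\<lambda>t. Z t \<omega>)} \<longleftrightarrow> \<omega> \<in> {\<omega> \<in> space M. ennreal L < occ A (\<lambda>t. Z' t \<omega>)}"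
    using eq
  proof eventually_elim
    case (elim \<omega>)
    then have "{t \<in> {0..A}. 0 < Z t \<omega>} = {t \<in> {0..A}. 0 < Z' t \<omega>}" by auto
    then have "occ A (\<lambda>t. Z t \<omega>) = occ A (\<lambda>t. Z' t \<omega>)" unfolding occ_def by (rule arg_cong)
    then show ?case by simp
  qed
qed

lemma sojourn_emeasure:
  fixes z :: "real \<Rightarrow> real"
  assumes z: "z \<in> borel_measurable borel" and I: "I \<subseteq> {0..}" "I \<in> sets borel"
    and P: "\<And>t. 0 \<le> t \<Longrightarrow> t \<in> P \<longleftrightarrow> 0 < z t"
  shows "(\<integral>\<^sup>+ t\<in>I. indicator P t \<partial>lborel) = emeasure lborel {t \<in> I. 0 < z t}"
proof -
  note [measurable] = z I(2)
  have m: "{t \<in> I. 0 < z t} \<in> sets borel" by measurable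
  have "(\<integral>\<^sup>+ t\<in>I. indicator P t \<partial>lborel) = (\<integral>\<^sup>+ t. indicator {t \<in> I. 0 < z t} t \<partial>lborel)"
    using I(1) P by (intro nn_integral_cong) (auto simp: indicator_def)
  also have "\<dots> = emeasure lborel {t \<in> I. 0 < z t}"
    by (rule nn_integral_indicator) (use m in simp)
  finally show ?thesis .
qed

text \<open>Links the given processes to the Brownian pair: they agree almost surely at all nonnegative times.\<close>

locale risk_pair = ruin_pair +
  fixes W1 W2 :: "real \<Rightarrow> 'a \<Rightarrow> real"
  assumes W1_proc: "continuous_process M W1" and W2_proc: "continuous_process M W2"
    and W_agree: "AE \<omega> in M. \<forall>t\<ge>0. W1 t \<omega> = X t \<omega> \<and> W2 t \<omega> = W t \<omega>"
begin

text \<open>Positive exactly when both coordinates exceed their linear barriers. It covers the risk processes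
and the processes in the constants at once.\<close>

definition margin :: "real \<Rightarrow> real \<Rightarrow> real \<Rightarrow> real \<Rightarrow> real \<Rightarrow> 'a \<Rightarrow> real" where
  "margin z1 m1 z2 m2 t \<omega> = min (W1 (max 0 t) \<omega> - z1 - m1 * t) (W2 (max 0 t) \<omega> - z2 - m2 * t)"

lemma margin_proc: "cont_proc M (margin z1 m1 z2 m2)"
  unfolding margin_def
  by (intro cont_proc_min cont_proc_minus cont_proc_const cont_proc_det cont_proc_stopped_at_zero[OF W1_proc]
      cont_proc_stopped_at_zero[OF W2_proc]) (auto intro!: continuous_intros)

lemma margin_occ_prob:
  "occ_prob M A L (margin z1 m1 z2 m2) = occ_prob M A L (\<lambda>t \<omega>. min (X t \<omega> - z1 - m1 * t) (W t \<omega> - z2 - m2 * t))"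
proof (rule occ_prob_AE_cong[OF margin_proc])
  show "cont_proc M (\<lambda>t \<omega>. min (X t \<omega> - z1 - m1 * t) (W t \<omega> - z2 - m2 * t))"
    by (intro cont_proc_min cont_proc_minus cont_proc_const cont_proc_det X_proc W_proc) (auto intro!: continuous_intros)
  show "AE \<omega> in M. \<forall>t\<ge>0. margin z1 m1 z2 m2 t \<omega> = min (X t \<omega> - z1 - m1 * t) (W t \<omega> - z2 - m2 * t)"
    using W_agree by eventually_elim (simp add: margin_def)
qed

lemma ruin_time_eq:
  assumes w: "\<omega> \<in> space M"
  shows "parisian_ruin_time a c1 c2 W1 W2 L u \<omega> =
    Inf (ereal ` {T. 0 < T \<and> ennreal (L / u\<^sup>2) < occ T (\<lambda>t. margin u c1 (a * u) c2 t \<omega>)})"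
proof -
  have "(\<integral>\<^sup>+ t\<in>{0..T}. indicator {s. risk_process u c1 W1 s \<omega> < 0 \<and> risk_process (a * u) c2 W2 s \<omega> < 0} t \<partial>lborel) =
    occ T (\<lambda>t. margin u c1 (a * u) c2 t \<omega>)" for T
    unfolding occ_def by (rule sojourn_emeasure[OF cont_proc_path_measurable[OF margin_proc w]]) (auto simp: risk_process_def margin_def)
  then show ?thesis unfolding parisian_ruin_time_def by simp
qed

text \<open>Reduces the conditional limit theorem to the asymptotics of occupation probabilities of \<open>Z\<close>; the
factor \<open>c\<close> that does not depend on \<open>L\<close> and the scale \<open>g\<close> cancel.\<close>

lemma ruin_ratio_limit:
  assumes lim: "\<And>L y. 0 \<le> L \<Longrightarrow> ((\<lambda>u. enn2real (occ_prob M (u\<^sup>2 - y) L (Z u)) / g u) \<longlongrightarrow> c * exp (- (q * y / 2)) * k L) at_top"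
    and g: "\<And>u. 0 < u \<Longrightarrow> 0 < g u" and c: "0 < c" and k: "0 < k L2"
    and L: "0 \<le> L2" "L2 \<le> L1" and x: "0 < x"
  shows "((\<lambda>u. \<P>(\<omega> in M. ereal x \<le> ereal (u\<^sup>2) * (1 - parisian_ruin_time a c1 c2 W1 W2 L1 u \<omega>) \<bar>
       parisian_ruin_time a c1 c2 W1 W2 L2 u \<omega> \<le> 1)) \<longlongrightarrow> k L1 / k L2 * exp (- (q * x / 2))) at_top"
proof -
  have lim': "((\<lambda>u. enn2real (occ_prob M (1 - y / u\<^sup>2) (L / u\<^sup>2) (margin u c1 (a * u) c2)) / g u) \<longlongrightarrow> c * exp (- (q * y / 2)) * k L) at_top"
    if L: "0 \<le> L" for L y
  proof (rule Lim_transform_eventually[OF lim[OF L]])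
    have "\<forall>\<^sub>F u in at_top. 0 < u \<and> 0 < 1 - y / u\<^sup>2"
      by (intro eventually_conj eventually_gt_at_top) real_asymp
    then show "\<forall>\<^sub>F u in at_top. enn2real (occ_prob M (u\<^sup>2 - y) L (Z u)) / g u =
        enn2real (occ_prob M (1 - y / u\<^sup>2) (L / u\<^sup>2) (margin u c1 (a * u) c2)) / g u"
    proof eventually_elim
      case (elim u)
      then have e: "u\<^sup>2 * (1 - y / u\<^sup>2) = u\<^sup>2 - y" by (simp add: field_simps)
      have "occ_prob M (1 - y / u\<^sup>2) (L / u\<^sup>2) (margin u c1 (a * u) c2) = occ_prob M (u\<^sup>2 - y) L (Z u)"
        unfolding margin_occ_prob e[symmetric] by (rule ruin_scaling) (use elim L in auto)
      then show ?case by simp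
    qed
  qed
  have "cond_prob M (\<lambda>\<omega>. ereal x \<le> ereal (u\<^sup>2) * (1 - parisian_ruin_time a c1 c2 W1 W2 L1 u \<omega>))
      (\<lambda>\<omega>. parisian_ruin_time a c1 c2 W1 W2 L2 u \<omega> \<le> 1) =
    cond_prob M (\<lambda>\<omega>. ereal x \<le> ereal (u\<^sup>2) * (1 - Inf (ereal ` {T. 0 < T \<and> ennreal (L1 / u\<^sup>2) < occ T (\<lambda>t. margin u c1 (a * u) c2 t \<omega>)})))
      (\<lambda>\<omega>. Inf (ereal ` {T. 0 < T \<and> ennreal (L2 / u\<^sup>2) < occ T (\<lambda>t. margin u c1 (a * u) c2 t \<omega>)}) \<le> 1)" for u
    unfolding cond_prob_def by (simp add: ruin_time_eq cong: conj_cong)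
  then show ?thesis
    using parisian_ratio_limit[OF margin_proc lim' g c k L x] by simp
qed

lemma K_biv_prob:
  "emeasure M {\<omega> \<in> space M. ennreal L < (\<integral>\<^sup>+ t\<in>{0..}. indicator {s. W1 s \<omega> - s > x \<and> W2 s \<omega> - b * s > y} t \<partial>lborel)} =
   emeasure M {\<omega> \<in> space M. ennreal L < emeasure lborel {t \<in> {0..}. 0 < min (X t \<omega> - t - x) (W t \<omega> - b * t - y)}}"
proof -
  have R: "cont_proc M (\<lambda>t \<omega>. min (X t \<omega> - t - x) (W t \<omega> - b * t - y))"
    by (intro cont_proc_min cont_proc_minus cont_proc_const cont_proc_det X_proc W_proc) (auto intro!: continuous_intros)
  have "(\<integral>\<^sup>+ t\<in>{0..}. indicator {s. W1 s \<omega> - s > x \<and> W2 s \<omega> - b * s > y} t \<partial>lborel) =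
      emeasure lborel {t \<in> {0..}. 0 < margin x 1 y b t \<omega>}" if w: "\<omega> \<in> space M" for \<omega>
    by (rule sojourn_emeasure[OF cont_proc_path_measurable[OF margin_proc w]]) (auto simp: margin_def)
  then have "emeasure M {\<omega> \<in> space M. ennreal L < (\<integral>\<^sup>+ t\<in>{0..}. indicator {s. W1 s \<omega> - s > x \<and> W2 s \<omega> - b * s > y} t \<partial>lborel)} =
      emeasure M {\<omega> \<in> space M. ennreal L < emeasure lborel {t \<in> {0..}. 0 < margin x 1 y b t \<omega>}}"
    by (simp cong: conj_cong)
  also have "\<dots> = (SUP m. occ_prob M (real m) L (margin x 1 y b))" by (rule occ_prob_SUP[OF margin_proc, symmetric])
  also have "\<dots> = (SUP m. occ_prob M (real m) L (\<lambda>t \<omega>. min (X t \<omega> - t - x) (W t \<omega> - b * t - y)))"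
    unfolding margin_occ_prob by (intro SUP_cong refl occ_prob_cong_sign) (auto simp: diff_right_commute)
  also have "\<dots> = emeasure M {\<omega> \<in> space M. ennreal L < emeasure lborel {t \<in> {0..}. 0 < min (X t \<omega> - t - x) (W t \<omega> - b * t - y)}}"
    by (rule occ_prob_SUP[OF R])
  finally show ?thesis .
qed

lemma K_uni_prob:
  "emeasure M {\<omega> \<in> space M. ennreal L < (\<integral>\<^sup>+ t\<in>{0..}. indicator {s. W1 s \<omega> - s > x} t \<partial>lborel)} =
   emeasure M {\<omega> \<in> space M. ennreal L < emeasure lborel {t \<in> {0..}. 0 < X t \<omega> - t - x}}"
proof -
  have R: "cont_proc M (\<lambda>t \<omega>. X t \<omega> - t - x)"
    by (intro cont_proc_minus cont_proc_const cont_proc_det X_proc) (auto intro!: continuous_intros)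
  have R': "cont_proc M (\<lambda>t \<omega>. W1 (max 0 t) \<omega> - t - x)"
    by (intro cont_proc_minus cont_proc_const cont_proc_det cont_proc_stopped_at_zero[OF W1_proc]) (auto intro!: continuous_intros)
  have "(\<integral>\<^sup>+ t\<in>{0..}. indicator {s. W1 s \<omega> - s > x} t \<partial>lborel) =
      emeasure lborel {t \<in> {0..}. 0 < W1 (max 0 t) \<omega> - t - x}" if w: "\<omega> \<in> space M" for \<omega>
    by (rule sojourn_emeasure[OF cont_proc_path_measurable[OF R' w]]) auto
  then have "emeasure M {\<omega> \<in> space M. ennreal L < (\<integral>\<^sup>+ t\<in>{0..}. indicator {s. W1 s \<omega> - s > x} t \<partial>lborel)} =
      emeasure M {\<omega> \<in> space M. ennreal L < emeasure lborel {t \<in> {0..}. 0 < W1 (max 0 t) \<omega> - t - x}}"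
    by (simp cong: conj_cong)
  also have "\<dots> = (SUP m. occ_prob M (real m) L (\<lambda>t \<omega>. W1 (max 0 t) \<omega> - t - x))" by (rule occ_prob_SUP[OF R', symmetric])
  also have "\<dots> = (SUP m. occ_prob M (real m) L (\<lambda>t \<omega>. X t \<omega> - t - x))"
  proof (intro SUP_cong refl occ_prob_AE_cong[OF R' R])
    show "AE \<omega> in M. \<forall>t\<ge>0. W1 (max 0 t) \<omega> - t - x = X t \<omega> - t - x" using W_agree by eventually_elim simp
  qed
  also have "\<dots> = emeasure M {\<omega> \<in> space M. ennreal L < emeasure lborel {t \<in> {0..}. 0 < X t \<omega> - t - x}}"
    by (rule occ_prob_SUP[OF R])
  finally show ?thesis .
qed

end

locale quadrant_risk = quadrant_ruin + risk_pair
begin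

lemma lambda_eq: "lambda1 a \<rho> = l1" "lambda2 a \<rho> = l2"
proof -
  have "1 - \<rho>\<^sup>2 = \<sigma>\<^sup>2" using unit by simp
  then show "lambda1 a \<rho> = l1" "lambda2 a \<rho> = l2" unfolding lambda1_def lambda2_def l1_def l2_def by simp_all
qed

lemma K_biv_eq: "K_biv M W1 W2 a \<rho> L = l1 * l2 * enn2real (K_quadrant L)"
proof -
  let ?E = "\<lambda>x y. emeasure M {\<omega> \<in> space M. ennreal L < emeasure lborel {t \<in> {0..}. 0 < R x y t \<omega>}}"
  let ?F = "\<lambda>x y. ennreal (exp (V x y)) * ?E x y"
  have E_SUP: "?E x y = (SUP m. occ_prob M (real m) L (R x y))" for x y by (rule occ_prob_SUP[OF R_proc, symmetric])
  have Fm[measurable]: "(\<lambda>p. ?F (fst p) (snd p)) \<in> borel_measurable (lborel \<Otimes>\<^sub>M lborel)"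
    unfolding E_SUP by measurable
  have fin: "?F x y < \<infinity>" for x y
    by (simp add: ennreal_mult_eq_top_iff less_top[symmetric])
  have integrand: "(\<lambda>(x, y). \<P>(\<omega> in M. (\<integral>\<^sup>+ t\<in>{0..}. indicator {s. W1 s \<omega> - s > x \<and> W2 s \<omega> - a * s > y} t \<partial>lborel) > ennreal L)
        * exp (lambda1 a \<rho> * x + lambda2 a \<rho> * y)) = (\<lambda>p. enn2real (?F (fst p) (snd p)))"
    unfolding lambda_eq measure_def K_biv_prob
    by (rule ext) (simp add: case_prod_beta enn2real_mult V_def R_def mult.commute)
  have "K_biv M W1 W2 a \<rho> L = l1 * l2 * (LINT p|(lborel \<Otimes>\<^sub>M lborel). enn2real (?F (fst p) (snd p)))"
    unfolding K_biv_def integrand unfolding lambda_eq lborel_prod ..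
  also have "(LINT p|(lborel \<Otimes>\<^sub>M lborel). enn2real (?F (fst p) (snd p))) =
      enn2real (\<integral>\<^sup>+ p. ennreal (enn2real (?F (fst p) (snd p))) \<partial>(lborel \<Otimes>\<^sub>M lborel))"
    by (rule integral_eq_nn_integral[OF borel_measurable_enn2real[OF Fm]]) simp
  also have "(\<integral>\<^sup>+ p. ennreal (enn2real (?F (fst p) (snd p))) \<partial>(lborel \<Otimes>\<^sub>M lborel)) =
      (\<integral>\<^sup>+ p. ?F (fst p) (snd p) \<partial>(lborel \<Otimes>\<^sub>M lborel))"
    by (rule nn_integral_cong) (rule ennreal_enn2real[OF fin[unfolded infinity_ennreal_def]])
  also have "\<dots> = (\<integral>\<^sup>+ x. \<integral>\<^sup>+ y. ?F (fst (x, y)) (snd (x, y)) \<partial>lborel \<partial>lborel)"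
    by (rule lborel.nn_integral_fst[symmetric]) measurable
  also have "\<dots> = K_quadrant L" unfolding K_quadrant_def by simp
  finally show ?thesis .
qed

text \<open>The factors \<open>1 / \<sigma>\<close> and \<open>l1 * l2\<close> cancel in the quotient, and \<open>q\<close> equals
\<open>(1 - 2 * a * \<rho> + a\<^sup>2) / (1 - \<rho>\<^sup>2)\<close>.\<close>

lemma quadrant_ratio:
  assumes L: "0 \<le> L2" "L2 \<le> L1" and x: "0 < x"
  shows "((\<lambda>u. \<P>(\<omega> in M. ereal x \<le> ereal (u\<^sup>2) * (1 - parisian_ruin_time a c1 c2 W1 W2 L1 u \<omega>) \<bar>
       parisian_ruin_time a c1 c2 W1 W2 L2 u \<omega> \<le> 1)) \<longlongrightarrow>
     K_biv M W1 W2 a \<rho> L1 / K_biv M W1 W2 a \<rho> L2 * exp (- x * ((1 - 2 * a * \<rho> + a\<^sup>2) / (2 - 2 * \<rho>\<^sup>2)))) at_top"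
proof -
  have pos: "0 < enn2real (K_quadrant L2)"
    using K_quadrant_pos[OF L(1)] quadrant_limit(1)[OF L(1)] by (simp add: enn2real_positive_iff)
  have "((\<lambda>u. \<P>(\<omega> in M. ereal x \<le> ereal (u\<^sup>2) * (1 - parisian_ruin_time a c1 c2 W1 W2 L1 u \<omega>) \<bar>
       parisian_ruin_time a c1 c2 W1 W2 L2 u \<omega> \<le> 1)) \<longlongrightarrow> enn2real (K_quadrant L1) / enn2real (K_quadrant L2) * exp (- (q * x / 2))) at_top"
    by (rule ruin_ratio_limit[where k="\<lambda>L. enn2real (K_quadrant L)", OF quadrant_limit(2) g_pos _ pos L x]) (use sigma_pos in auto)
  moreover have "enn2real (K_quadrant L1) / enn2real (K_quadrant L2) = K_biv M W1 W2 a \<rho> L1 / K_biv M W1 W2 a \<rho> L2"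
    using l_pos unfolding K_biv_eq by simp
  moreover have "- (q * x / 2) = - x * ((1 - 2 * a * \<rho> + a\<^sup>2) / (2 - 2 * \<rho>\<^sup>2))"
  proof -
    have r: "\<rho>\<^sup>2 = 1 - \<sigma>\<^sup>2" using unit by simp
    have "q * \<sigma>\<^sup>2 = \<sigma>\<^sup>2 + (a - \<rho>)\<^sup>2" using sigma_pos unfolding q_def k_def by (simp add: field_simps)
    also have "\<dots> = 1 - 2 * a * \<rho> + a\<^sup>2" using unit by (simp add: power2_eq_square algebra_simps)
    finally have "(1 - 2 * a * \<rho> + a\<^sup>2) / (2 - 2 * \<rho>\<^sup>2) = q * \<sigma>\<^sup>2 / (2 * \<sigma>\<^sup>2)" unfolding r by simp
    also have "\<dots> = q / 2" using sigma_pos by simp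
    finally show ?thesis by (simp only: times_divide_eq_right mult_minus_left mult.commute[of q])
  qed
  ultimately show ?thesis by (simp only:)
qed

end

locale half_plane_risk = half_plane_ruin + risk_pair
begin

lemma K_uni_eq: "K_uni M W1 L = enn2real (K_line L)"
proof -
  let ?E = "\<lambda>x. emeasure M {\<omega> \<in> space M. ennreal L < emeasure lborel {t \<in> {0..}. 0 < R x t \<omega>}}"
  let ?F = "\<lambda>x. ennreal (exp x) * ?E x"
  have E_SUP: "?E x = (SUP m. occ_prob M (real m) L (R x))" for x by (rule occ_prob_SUP[OF R_proc, symmetric])
  have Fm: "?F \<in> borel_measurable lborel" unfolding E_SUP by measurable
  have fin: "?F x < \<infinity>" for x by (simp add: ennreal_mult_eq_top_iff less_top[symmetric])
  have integrand: "exp x * \<P>(\<omega> in M. (\<integral>\<^sup>+ t\<in>{0..}. indicator {s. W1 s \<omega> - s > x} t \<partial>lborel) > ennreal L) = enn2real (?F x)" for x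
    unfolding measure_def K_uni_prob by (simp add: enn2real_mult R_def)
  have "K_uni M W1 L = (LINT x|lborel. enn2real (?F x))" unfolding K_uni_def integrand ..
  also have "\<dots> = enn2real (\<integral>\<^sup>+ x. ennreal (enn2real (?F x)) \<partial>lborel)"
    by (rule integral_eq_nn_integral[OF borel_measurable_enn2real[OF Fm]]) simp
  also have "(\<integral>\<^sup>+ x. ennreal (enn2real (?F x)) \<partial>lborel) = K_line L"
    unfolding K_line_def by (rule nn_integral_cong) (rule ennreal_enn2real[OF fin[unfolded infinity_ennreal_def]])
  finally show ?thesis .
qed

lemma half_plane_ratio:
  assumes L: "0 \<le> L2" "L2 \<le> L1" and x: "0 < x"
  shows "((\<lambda>u. \<P>(\<omega> in M. ereal x \<le> ereal (u\<^sup>2) * (1 - parisian_ruin_time a c1 c2 W1 W2 L1 u \<omega>) \<bar>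
       parisian_ruin_time a c1 c2 W1 W2 L2 u \<omega> \<le> 1)) \<longlongrightarrow> K_uni M W1 L1 / K_uni M W1 L2 * exp (- x / 2)) at_top"
proof -
  have pos: "0 < enn2real (K_line L2)"
    using K_line_pos[OF L(1)] half_plane_limit(1)[OF L(1)] by (simp add: enn2real_positive_iff)
  have c: "0 < enn2real side_prob" using side_prob_bounds by (simp add: enn2real_positive_iff)
  have lim: "((\<lambda>u. enn2real (occ_prob M (u\<^sup>2 - y) L (Z u)) / g u) \<longlongrightarrow> enn2real side_prob * exp (- (1 * y / 2)) * enn2real (K_line L)) at_top"
    if "0 \<le> L" for L y
    using half_plane_limit(2)[OF that, of y] by (simp only: mult.commute[of "enn2real side_prob"] mult_1)
  show ?thesis
    using ruin_ratio_limit[where k="\<lambda>L. enn2real (K_line L)", OF lim g_pos c pos L x] by (simp add: K_uni_eq)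
qed

end

section \<open>The conditional limit theorem\<close>

theorem proposition2p4:
  fixes N :: "'b measure" and B1 B2 :: "real \<Rightarrow> 'b \<Rightarrow> real"
    and M :: "'a measure" and W1 W2 :: "real \<Rightarrow> 'a \<Rightarrow> real"
    and \<rho> c1 c2 a :: real
  assumes "-1 < \<rho>" and "\<rho> < 1"
    and "standard_brownian_motion N B1"
    and "standard_brownian_motion N B2"
    and "independent_processes N B1 B2"
    and "prob_space M"
    and "continuous_process M W1"
    and "continuous_process M W2"
    and "process_law M (\<lambda>t \<omega>. (W1 t \<omega>, W2 t \<omega>)) =
         process_law N (\<lambda>t \<omega>. (B1 t \<omega>, \<rho> * B1 t \<omega> + sqrt (1 - \<rho>\<^sup>2) * B2 t \<omega>))"
  defines "\<tau> \<equiv> parisian_ruin_time a c1 c2 W1 W2"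
  shows "(\<rho> < a \<and> a \<le> 1 \<longrightarrow>
           (\<forall>x L1 L2. 0 < x \<and> 0 \<le> L2 \<and> L2 \<le> L1 \<and> L1 \<le> 1 \<longrightarrow>
              ((\<lambda>u. \<P>(\<omega> in M. ereal (u\<^sup>2) * (1 - \<tau> L1 u \<omega>) \<ge> ereal x \<bar> \<tau> L2 u \<omega> \<le> 1))
                \<longlongrightarrow> K_biv M W1 W2 a \<rho> L1 / K_biv M W1 W2 a \<rho> L2
                    * exp (- x * ((1 - 2 * a * \<rho> + a\<^sup>2) / (2 - 2 * \<rho>\<^sup>2)))) at_top)) \<and>
         (a \<le> \<rho> \<longrightarrow>
           (\<forall>x L1 L2. 0 < x \<and> 0 \<le> L2 \<and> L2 \<le> L1 \<and> L1 \<le> 1 \<longrightarrow>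
              ((\<lambda>u. \<P>(\<omega> in M. ereal (u\<^sup>2) * (1 - \<tau> L1 u \<omega>) \<ge> ereal x \<bar> \<tau> L2 u \<omega> \<le> 1))
                \<longlongrightarrow> K_uni M W1 L1 / K_uni M W1 L2 * exp (- x / 2)) at_top))"
proof (intro conjI impI allI)
  define \<sigma> where "\<sigma> = sqrt (1 - \<rho>\<^sup>2)"
  define X where "X = (\<lambda>t \<omega>. W1 (max 0 t) \<omega> - W1 0 \<omega>)"
  define Y where "Y = (\<lambda>t \<omega>. ((W2 (max 0 t) \<omega> - \<rho> * W1 (max 0 t) \<omega>) - (W2 0 \<omega> - \<rho> * W1 0 \<omega>)) / \<sigma>)"
  interpret corr_pair M X Y \<rho> \<sigma>
    unfolding X_def Y_def \<sigma>_def by (rule corr_pair_of_process_law(1)[OF assms(1-9)])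
  have zero: "AE \<omega> in M. W1 0 \<omega> = 0 \<and> W2 0 \<omega> = 0"
    by (rule corr_pair_of_process_law(2)[OF assms(1-9)])
  have agree: "AE \<omega> in M. \<forall>t\<ge>0. W1 t \<omega> = X t \<omega> \<and> W2 t \<omega> = W t \<omega>"
    unfolding W_def unfolding X_def Y_def using zero by eventually_elim (use sigma_pos in simp)
  fix x L1 L2 :: real
  assume "0 < x \<and> 0 \<le> L2 \<and> L2 \<le> L1 \<and> L1 \<le> 1"
  then have x: "0 < x" and L: "0 \<le> L2" "L2 \<le> L1" by auto
  {
    assume a: "\<rho> < a \<and> a \<le> 1"
    \<comment> \<open>For negative \<open>a\<close> the hypothesis \<open>\<rho> < a\<close> gives \<open>\<bar>a\<bar> < \<bar>\<rho>\<bar> < 1\<close>.\<close>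
    have "a * \<rho> < 1"
    proof (cases "0 \<le> a")
      case True
      then have "a * \<rho> \<le> a * \<bar>\<rho>\<bar>" by (intro mult_left_mono) auto
      also have "\<dots> \<le> 1 * \<bar>\<rho>\<bar>" using a by (intro mult_right_mono) auto
      finally have "a * \<rho> \<le> 1 * \<bar>\<rho>\<bar>" .
      then show ?thesis using assms(1,2) by auto
    next
      case False
      then have "- a * - \<rho> < 1 * 1" using a assms(1) by (intro mult_strict_mono) auto
      then show ?thesis by simp
    qed
    then interpret quadrant_risk M X Y \<rho> \<sigma> a c1 c2 W1 W2
      using a agree assms(7,8) by unfold_locales auto
    show "((\<lambda>u. \<P>(\<omega> in M. ereal (u\<^sup>2) * (1 - \<tau> L1 u \<omega>) \<ge> ereal x \<bar> \<tau> L2 u \<omega> \<le> 1))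
                \<longlongrightarrow> K_biv M W1 W2 a \<rho> L1 / K_biv M W1 W2 a \<rho> L2
                    * exp (- x * ((1 - 2 * a * \<rho> + a\<^sup>2) / (2 - 2 * \<rho>\<^sup>2)))) at_top"
      unfolding \<tau>_def by (rule quadrant_ratio[OF L x])
  next
    assume a: "a \<le> \<rho>"
    interpret half_plane_risk M X Y \<rho> \<sigma> a c1 c2 W1 W2
      using a agree assms(7,8) by unfold_locales auto
    show "((\<lambda>u. \<P>(\<omega> in M. ereal (u\<^sup>2) * (1 - \<tau> L1 u \<omega>) \<ge> ereal x \<bar> \<tau> L2 u \<omega> \<le> 1))
                \<longlongrightarrow> K_uni M W1 L1 / K_uni M W1 L2 * exp (- x / 2)) at_top"
      unfolding \<tau>_def by (rule half_plane_ratio[OF L x])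
  }
qed

end
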